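(* Let $f\in C^2(\mathbb{R})$ satisfy $f(0)=0$, $f'(0)=1$, $f''(u)u<0$ for all $u\neq 0$, and $\limsup_{|u|\to+\infty} f(u)/u<0$. Let $0<m\le M$, let $a:[0,+\infty)\to[m,M]$ be continuously differentiable, and let $\nu>0$. Suppose that $\psi$ is an equilibrium of $$w_\tau=w_{xx}+\frac{\nu f(w)}{a(\|w_x\|^2)},\quad x\in(0,\pi),\qquad w(0,\tau)=w(\pi,\tau)=0,$$ with exactly $k-1$ zeros in $(0,\pi)$ for some positive integer $k$. Let $c=c_k^+$ if $\psi_x(0)>0$ and $c=c_k^-$ if $\psi_x(0)<0$, where $c_k^\pm$ are the functions defined in the context. Then: (i) If $a'(\|\psi_x\|^2)>\nu c'(\|\psi_x\|^2)$, then $\psi$ is hyperbolic and its Morse index is $k-1$. (ii) If $a'(\|\psi_x\|^2)<\nu c'(\|\psi_x\|^2)$, then $\psi$ is hyperbolic and its Morse index is $k$.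
   Context: $\|\cdot\|$ denotes the norm of $L^2(0,\pi)$. An equilibrium is a solution $\psi$ of $\psi_{xx}+\nu f(\psi)/a(\|\psi_x\|^2)=0$ in $(0,\pi)$, $\psi(0)=\psi(\pi)=0$. The functions $c_j^\pm$. For each positive integer $j$ and $\lambda>j^2$ it is known (Chafee–Infante) that the problem $\phi_{xx}+\lambda f(\phi)=0$ in $(0,\pi)$, $\phi(0)=\phi(\pi)=0$, has exactly two solutions $\phi_{j,\lambda}^+$, $\phi_{j,\lambda}^-$ with exactly $j-1$ zeros in $(0,\pi)$, where $(\phi_{j,\lambda}^+)_x(0)>0$ and $(\phi_{j,\lambda}^-)_x(0)<0$; put $\phi_{j,j^2}^\pm=0$. The maps $[j^2,+\infty)\ni\lambda\mapsto\|(\phi_{j,\lambda}^\pm)_x\|^2\in[0,+\infty)$ are strictly increasing continuous bijections, continuously differentiable on $(j^2,+\infty)$. For $r\ge0$ let $\lambda_{j,r}^\pm\in[j^2,+\infty)$ be the unique $\lambda$ with $\|(\phi_{j,\lambda}^\pm)_x\|^2=r$, and define $c_j^\pm:[0,+\infty)\to(0,\frac1{j^2}]$ by $c_j^\pm(r)=1/\lambda_{j,r}^\pm$. These functions are continuous, strictly decreasing, and continuously differentiable for $r>0$. Linearization. The linearization at an equilibrium $\psi$ is the self-adjoint operator with compact resolvent $L:H^2(0,\pi)\cap H^1_0(0,\pi)\subset L^2(0,\pi)\to L^2(0,\pi)$, $$Lv=v''+\frac{\nu f'(\psi)}{a(\|\psi_x\|^2)}v-\frac{2\nu^2a'(\|\psi_x\|^2)}{a(\|\psi_x\|^2)^3}\,f(\psi)\int_0^\pi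 f(\psi(s))v(s)\,ds .$$ The equilibrium $\psi$ is hyperbolic if $0\notin\sigma(L)$; its Morse index is the number of positive eigenvalues of $L$, counted with multiplicity. *)

theory Defs
  imports "HOL-Analysis.Analysis" "HOL-Library.Function_Algebras"
begin

section \<open>Functions on \<open>[0, \<pi>]\<close> and the space \<open>L\<^sup>2(0, \<pi>)\<close>\<close>

text \<open>Elements of \<open>L\<^sup>2(0, \<pi>)\<close> are represented by functions on the real line, of which only
  the values in \<open>(0, \<pi>)\<close> matter; equality in \<open>L\<^sup>2(0, \<pi>)\<close> is \<open>eq_ae\<close>.\<close>

abbreviation leb_I :: "real measure" where
  "leb_I \<equiv> lebesgue_on {0<..<pi}"

definition L2 :: "(real \<Rightarrow> real) set" where
  "L2 = {u. u \<in> borel_measurable leb_I \<and> integrable leb_I (\<lambda>x. (u x)\<^sup>2)}"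

definition L2norm :: "(real \<Rightarrow> real) \<Rightarrow> real" where
  "L2norm u = sqrt (\<integral>x. (u x)\<^sup>2 \<partial>leb_I)"

definition eq_ae :: "(real \<Rightarrow> real) \<Rightarrow> (real \<Rightarrow> real) \<Rightarrow> bool" where
  "eq_ae u v \<longleftrightarrow> (AE x in leb_I. u x = v x)"

text \<open>The classical derivative on \<open>[0, \<pi>]\<close>, one-sided at the end points.\<close>

definition dx :: "(real \<Rightarrow> real) \<Rightarrow> real \<Rightarrow> real" where
  "dx u x = vector_derivative u (at x within {0..pi})"

definition C2_on_I :: "(real \<Rightarrow> real) \<Rightarrow> bool" where
  "C2_on_I u \<longleftrightarrow> u differentiable_on {0..pi} \<and> dx u differentiable_on {0..pi}
      \<and> continuous_on {0..pi} (dx (dx u))"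


section \<open>Dirichlet problems, equilibria and the functions \<open>c\<^sub>j\<^sup>\<plusminus>\<close>\<close>

definition dirichlet_solution :: "(real \<Rightarrow> real) \<Rightarrow> (real \<Rightarrow> real) \<Rightarrow> bool" where
  "dirichlet_solution h u \<longleftrightarrow> C2_on_I u \<and> (\<forall>x\<in>{0<..<pi}. dx (dx u) x + h (u x) = 0)
      \<and> u 0 = 0 \<and> u pi = 0"

definition equilibrium :: "real \<Rightarrow> (real \<Rightarrow> real) \<Rightarrow> (real \<Rightarrow> real) \<Rightarrow> (real \<Rightarrow> real) \<Rightarrow> bool" where
  "equilibrium \<nu> f a \<psi> \<longleftrightarrow> dirichlet_solution (\<lambda>s. \<nu> * f s / a ((L2norm (dx \<psi>))\<^sup>2)) \<psi>"

definition has_n_zeros :: "nat \<Rightarrow> (real \<Rightarrow> real) \<Rightarrow> bool" where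
  "has_n_zeros n u \<longleftrightarrow> finite {x\<in>{0<..<pi}. u x = 0} \<and> card {x\<in>{0<..<pi}. u x = 0} = n"

text \<open>The parameter \<open>s\<close> is the sign: \<open>s = 1\<close> gives \<open>\<phi>\<^sub>j\<^sub>,\<^sub>\<lambda>\<^sup>+\<close> and \<open>s = -1\<close> gives
  \<open>\<phi>\<^sub>j\<^sub>,\<^sub>\<lambda>\<^sup>-\<close>. Since functions are total, uniqueness requires fixing the value outside
  \<open>[0, \<pi>]\<close>; it is taken to be 0.\<close>

definition phi :: "(real \<Rightarrow> real) \<Rightarrow> nat \<Rightarrow> real \<Rightarrow> real \<Rightarrow> real \<Rightarrow> real" where
  "phi f j s lam =
     (if lam = (real j)\<^sup>2 then (\<lambda>_. 0)
      else (THE \<phi>. dirichlet_solution (\<lambda>u. lam * f u) \<phi> \<and> has_n_zeros (j - 1) \<phi>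
                  \<and> s * dx \<phi> 0 > 0 \<and> (\<forall>x. x \<notin> {0..pi} \<longrightarrow> \<phi> x = 0)))"

definition lam_of :: "(real \<Rightarrow> real) \<Rightarrow> nat \<Rightarrow> real \<Rightarrow> real \<Rightarrow> real" where
  "lam_of f j s r = (THE lam. lam \<ge> (real j)\<^sup>2 \<and> (L2norm (dx (phi f j s lam)))\<^sup>2 = r)"

definition c_plus :: "(real \<Rightarrow> real) \<Rightarrow> nat \<Rightarrow> real \<Rightarrow> real" where
  "c_plus f j r = 1 / lam_of f j 1 r"

definition c_minus :: "(real \<Rightarrow> real) \<Rightarrow> nat \<Rightarrow> real \<Rightarrow> real" where
  "c_minus f j r = 1 / lam_of f j (- 1) r"


section \<open>The domain \<open>H\<^sup>2(0, \<pi>) \<inter> H\<^sup>1\<^sub>0(0, \<pi>)\<close> and the linearization\<close>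

text \<open>On an interval, \<open>u \<in> H\<^sup>1\<close> with weak derivative \<open>g\<close> means that (the continuous representative
  of) \<open>u\<close> is absolutely continuous with \<open>u' = g \<in> L\<^sup>2\<close> almost everywhere, that is, \<open>u\<close> is an
  indefinite integral of \<open>g\<close>; and \<open>H\<^sup>1\<^sub>0\<close> is the subspace of those vanishing at both end points.\<close>

definition has_weak_deriv :: "(real \<Rightarrow> real) \<Rightarrow> (real \<Rightarrow> real) \<Rightarrow> bool" where
  "has_weak_deriv u g \<longleftrightarrow> g \<in> L2 \<and> (\<forall>x\<in>{0..pi}. u x = u 0 + (LINT t:{0<..<x}|lebesgue. g t))"

definition has_weak_deriv2 :: "(real \<Rightarrow> real) \<Rightarrow> (real \<Rightarrow> real) \<Rightarrow> bool" where
  "has_weak_deriv2 u w \<longleftrightarrow> (\<exists>p. has_weak_deriv u p \<and> has_weak_deriv p w)"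

text \<open>The weak second derivative; it is determined up to equality almost everywhere.\<close>

definition weak_dxx :: "(real \<Rightarrow> real) \<Rightarrow> real \<Rightarrow> real" where
  "weak_dxx u = (SOME w. has_weak_deriv2 u w)"

text \<open>Each element of \<open>H\<^sup>2 \<inter> H\<^sup>1\<^sub>0\<close> is represented by exactly one function: its continuous
  representative on \<open>[0, \<pi>]\<close>, extended by 0. So linear dimensions of sets of such functions are
  the dimensions of the corresponding sets of equivalence classes.\<close>

definition H2_H10 :: "(real \<Rightarrow> real) set" where
  "H2_H10 = {v. (\<exists>w. has_weak_deriv2 v w) \<and> v 0 = 0 \<and> v pi = 0 \<and> (\<forall>x. x \<notin> {0..pi} \<longrightarrow> v x = 0)}"

text \<open>The arguments \<open>f'\<close> and \<open>a'\<close> are meant to be the derivatives of \<open>f\<close> and \<open>a\<close>.\<close>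

definition linearization ::
  "real \<Rightarrow> (real \<Rightarrow> real) \<Rightarrow> (real \<Rightarrow> real) \<Rightarrow> (real \<Rightarrow> real) \<Rightarrow> (real \<Rightarrow> real) \<Rightarrow> (real \<Rightarrow> real)
     \<Rightarrow> (real \<Rightarrow> real) \<Rightarrow> real \<Rightarrow> real" where
  "linearization \<nu> f f' a a' \<psi> v =
     (let r = (L2norm (dx \<psi>))\<^sup>2 in
      (\<lambda>x. weak_dxx v x + \<nu> * f' (\<psi> x) / a r * v x
           - 2 * \<nu>\<^sup>2 * a' r / (a r) ^ 3 * f (\<psi> x) * (\<integral>s. f (\<psi> s) * v s \<partial>leb_I)))"


section \<open>Spectrum, hyperbolicity and Morse index\<close>

text \<open>\<open>T\<close> is an operator in the real Hilbert space \<open>L\<^sup>2(0, \<pi>)\<close> with domain \<open>D\<close>, whose elements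
  are unique representatives of their classes. The real number \<open>\<mu>\<close> is in the resolvent set if
  \<open>T - \<mu>\<close> is a bijection from \<open>D\<close> onto \<open>L\<^sup>2(0, \<pi>)\<close> with bounded inverse. For a self-adjoint
  operator with real coefficients this real spectrum is the spectrum of the complexification.\<close>

definition spectrum :: "(real \<Rightarrow> real) set \<Rightarrow> ((real \<Rightarrow> real) \<Rightarrow> real \<Rightarrow> real) \<Rightarrow> real set" where
  "spectrum D T = - {\<mu>. (\<forall>h\<in>L2. \<exists>!v. v \<in> D \<and> eq_ae (\<lambda>x. T v x - \<mu> * v x) h)
                      \<and> (\<exists>C. \<forall>v\<in>D. L2norm v \<le> C * L2norm (\<lambda>x. T v x - \<mu> * v x))}"

definition eigenspace ::
  "(real \<Rightarrow> real) set \<Rightarrow> ((real \<Rightarrow> real) \<Rightarrow> real \<Rightarrow> real) \<Rightarrow> real \<Rightarrow> (real \<Rightarrow> real) set" where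
  "eigenspace D T \<mu> = {v\<in>D. eq_ae (T v) (\<lambda>x. \<mu> * v x)}"

definition fscale :: "real \<Rightarrow> (real \<Rightarrow> real) \<Rightarrow> real \<Rightarrow> real" where
  "fscale c v = (\<lambda>x. c * v x)"

interpretation fun_space: vector_space fscale
  by unfold_locales (auto simp: fscale_def fun_eq_iff algebra_simps)

text \<open>The finiteness conditions are needed because the dimension of an infinite-dimensional space,
  and a sum over an infinite set, are 0 by convention.\<close>

definition has_morse_index ::
  "(real \<Rightarrow> real) set \<Rightarrow> ((real \<Rightarrow> real) \<Rightarrow> real \<Rightarrow> real) \<Rightarrow> nat \<Rightarrow> bool" where
  "has_morse_index D T n \<longleftrightarrow>
     (let P = {\<mu>. 0 < \<mu> \<and> (\<exists>v\<in>eigenspace D T \<mu>. v \<noteq> (\<lambda>_. 0))} in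
      finite P
      \<and> (\<forall>\<mu>\<in>P. \<exists>B. finite B \<and> eigenspace D T \<mu> \<subseteq> fun_space.span B)
      \<and> (\<Sum>\<mu>\<in>P. fun_space.dim (eigenspace D T \<mu>)) = n)"

definition hyperbolic ::
  "real \<Rightarrow> (real \<Rightarrow> real) \<Rightarrow> (real \<Rightarrow> real) \<Rightarrow> (real \<Rightarrow> real) \<Rightarrow> (real \<Rightarrow> real) \<Rightarrow> (real \<Rightarrow> real)
     \<Rightarrow> bool" where
  "hyperbolic \<nu> f f' a a' \<psi> \<longleftrightarrow> 0 \<notin> spectrum H2_H10 (linearization \<nu> f f' a a' \<psi>)"

definition morse_index_is ::
  "real \<Rightarrow> (real \<Rightarrow> real) \<Rightarrow> (real \<Rightarrow> real) \<Rightarrow> (real \<Rightarrow> real) \<Rightarrow> (real \<Rightarrow> real) \<Rightarrow> (real \<Rightarrow> real)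
     \<Rightarrow> nat \<Rightarrow> bool" where
  "morse_index_is \<nu> f f' a a' \<psi> n \<longleftrightarrow> has_morse_index H2_H10 (linearization \<nu> f f' a a' \<psi>) n"

end

theory Submission
  imports Defs "HOL-Complex_Analysis.Great_Picard"
begin

text \<open>Solutions of \<open>u'' + lam f u = 0\<close> move on circles in the coordinates \<open>(Y u, u' / sqrt lam)\<close>, where \<open>Y\<^sup>2 / 2\<close> is the
  primitive of \<open>f\<close>. With \<open>h = Y\<^sup>-\<^sup>1\<close> this means \<open>u = h (\<rho> sin \<theta>)\<close>, \<open>u' = sqrt lam \<rho> cos \<theta>\<close> and
  \<open>\<theta>' = sqrt lam / h' (\<rho> sin \<theta>)\<close>, so along a branch both \<open>lam\<close> and \<open>R\<close>, the square of the norm of \<open>u'\<close>, are explicit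
  integrals that increase with the amplitude \<open>\<rho>\<close>.

  The linearization is \<open>L w = L0 w - \<beta> (g, w) g\<close> with \<open>L0 w = w'' + lam f' \<psi> w\<close> and \<open>g = f \<psi>\<close>. The derivative \<open>z\<close> of the
  branch with respect to \<open>lam\<close> satisfies \<open>L0 z = - g\<close> and \<open>(g, z) = (dR / dlam) / (2 lam) > 0\<close>. Hence \<open>L z = - D g\<close> with
  \<open>D = 1 + \<beta> (g, z)\<close>, which equals \<open>1 - a' / (\<nu> c')\<close>. The form of \<open>L\<close> splits along \<open>z\<close>, where its sign is
  that of \<open>- D\<close>, and the orthogonal complement of \<open>g\<close>, where it agrees with the form of \<open>L0\<close>. Jacobi's identity makes
  the latter negative on functions vanishing at the \<open>k - 1\<close> interior zeros of \<open>\<psi>\<close>. Conversely, the restrictions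
  of \<open>\<psi>'\<close> to the \<open>k - 1\<close> intervals between consecutive critical points are orthogonal to \<open>g\<close> and span a space on
  which the form of \<open>L0\<close> is zero, so that it has \<open>k - 1\<close> positive directions as \<open>0\<close> is not an eigenvalue.\<close>

text \<open>Two obstacles shape the development. The functions \<open>c_plus\<close> and
  \<open>c_minus\<close> are given by definite descriptions, so existence, uniqueness and
  monotonicity along the branches all have to be proved. In the usual time map the integrand is
  singular at the turning points; in polar coordinates the angle runs over a fixed interval and the
  integrand is continuously differentiable in \<rho>, so one may differentiate under the integral.
  The spectral part works with continuous functions and the inverse \<open>M\<close>, without a
  spectral theorem in the Hilbert space. The Morse index is found as the largest size of an
  orthogonal family of eigenfunctions with positive eigenvalues: too large a family contains a
  combination with nonpositive form, and too small a family leaves a direction in which the form of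
  \<open>M\<close> is positive, hence a further eigenfunction. The truncations of \<psi>' have
  corners and lie outside the domain, and the form is merely zero on them. They are therefore
  approximated by products of \<psi>' with smooth cut-offs, and a small multiple of
  \<open>M k\<close> is added to obtain a strict sign.\<close>

section \<open>The inner product on continuous functions\<close>

definition ip :: "(real \<Rightarrow> real) \<Rightarrow> (real \<Rightarrow> real) \<Rightarrow> real" where
  "ip u v = integral {0..pi} (\<lambda>x. u x * v x)"

abbreviation cts :: "(real \<Rightarrow> real) \<Rightarrow> bool" where
  "cts u \<equiv> continuous_on {0..pi} u"

lemma ip_integrable: "cts u \<Longrightarrow> cts v \<Longrightarrow> (\<lambda>x. u x * v x) integrable_on {0..pi}"
  by (intro integrable_continuous_real continuous_intros)

lemma ip_commute: "ip u v = ip v u"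
  by (simp add: ip_def mult.commute)

lemma ip_add_left: "cts u \<Longrightarrow> cts v \<Longrightarrow> cts w \<Longrightarrow> ip (\<lambda>x. u x + v x) w = ip u w + ip v w"
  by (simp add: ip_def distrib_right integral_add ip_integrable)

lemma ip_diff_left: "cts u \<Longrightarrow> cts v \<Longrightarrow> cts w \<Longrightarrow> ip (\<lambda>x. u x - v x) w = ip u w - ip v w"
  by (simp add: ip_def left_diff_distrib integral_diff ip_integrable)

lemma ip_scale_left: "ip (\<lambda>x. c * u x) w = c * ip u w"
  by (simp add: ip_def mult.assoc)

lemma ip_add_right: "cts u \<Longrightarrow> cts v \<Longrightarrow> cts w \<Longrightarrow> ip w (\<lambda>x. u x + v x) = ip w u + ip w v"
  unfolding ip_commute[of w] by (rule ip_add_left)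

lemma ip_diff_right: "cts u \<Longrightarrow> cts v \<Longrightarrow> cts w \<Longrightarrow> ip w (\<lambda>x. u x - v x) = ip w u - ip w v"
  unfolding ip_commute[of w] by (rule ip_diff_left)

lemma ip_scale_right: "ip w (\<lambda>x. c * u x) = c * ip w u"
  unfolding ip_commute[of w] by (rule ip_scale_left)

lemma ip_zero [simp]: "ip (\<lambda>x. 0) w = 0" "ip w (\<lambda>x. 0) = 0"
  by (simp_all add: ip_def)

lemma cts_sum: "(\<And>i. i \<in> I \<Longrightarrow> cts (u i)) \<Longrightarrow> cts (\<lambda>x. \<Sum>i\<in>I. c i * u i x)"
  by (intro continuous_intros) auto

lemma ip_sum_left:
  assumes "finite I" "\<And>i. i \<in> I \<Longrightarrow> cts (u i)" "cts w"
  shows "ip (\<lambda>x. \<Sum>i\<in>I. c i * u i x) w = (\<Sum>i\<in>I. c i * ip (u i) w)"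
  using assms
proof (induction I rule: finite_induct)
  case empty
  then show ?case by simp
next
  case (insert i I)
  have "ip (\<lambda>x. c i * u i x + (\<Sum>j\<in>I. c j * u j x)) w
      = ip (\<lambda>x. c i * u i x) w + ip (\<lambda>x. \<Sum>j\<in>I. c j * u j x) w"
    using insert.prems by (intro ip_add_left continuous_intros cts_sum) auto
  with insert show ?case by (simp add: ip_scale_left)
qed

lemma ip_cong: "(\<And>x. x \<in> {0..pi} \<Longrightarrow> u x = u' x) \<Longrightarrow> (\<And>x. x \<in> {0..pi} \<Longrightarrow> v x = v' x) \<Longrightarrow> ip u v = ip u' v'"
  unfolding ip_def by (rule integral_cong) auto

lemma ip_self_nonneg: "0 \<le> ip u u"
proof (cases "(\<lambda>x. u x * u x) integrable_on {0..pi}")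
  case True
  then show ?thesis unfolding ip_def by (rule integral_nonneg) simp
next
  case False
  then show ?thesis by (simp add: ip_def not_integrable_integral)
qed

lemma ip_self_eq_0_iff: "cts u \<Longrightarrow> ip u u = 0 \<longleftrightarrow> (\<forall>x\<in>{0..pi}. u x = 0)"
  unfolding ip_def by (subst integral_eq_0_iff) (auto intro!: continuous_intros)

lemma ip_self_pos: "cts u \<Longrightarrow> x \<in> {0..pi} \<Longrightarrow> u x \<noteq> 0 \<Longrightarrow> 0 < ip u u"
  using ip_self_eq_0_iff ip_self_nonneg by (metis less_eq_real_def)

lemma ip_Cauchy_Schwarz:
  assumes "cts u" "cts v"
  shows "(ip u v)\<^sup>2 \<le> ip u u * ip v v"
proof (cases "ip v v = 0")
  case True
  then have "\<forall>x\<in>{0..pi}. v x = 0" using assms ip_self_eq_0_iff by auto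
  then have "ip u v = ip u (\<lambda>x. 0)" by (intro ip_cong) auto
  with True show ?thesis by simp
next
  case False
  define t where "t = ip u v / ip v v"
  have pos: "ip v v > 0" using False ip_self_nonneg[of v] by simp
  have "0 \<le> ip (\<lambda>x. u x - t * v x) (\<lambda>x. u x - t * v x)" by (rule ip_self_nonneg)
  also have "\<dots> = ip u u - 2 * t * ip u v + t\<^sup>2 * ip v v"
    using assms by (simp add: ip_diff_left ip_diff_right ip_scale_left ip_scale_right
        continuous_intros ip_commute[of v u] power2_eq_square algebra_simps)
  also have "\<dots> = ip u u - (ip u v)\<^sup>2 / ip v v"
    using False by (simp add: t_def power2_eq_square field_simps)
  finally show ?thesis using pos by (simp add: field_simps)
qed

lemma ip_bound:
  assumes "cts u" "cts v"
  shows "\<bar>ip u v\<bar> \<le> sqrt (ip u u) * sqrt (ip v v)"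
  using ip_Cauchy_Schwarz[OF assms] by (metis real_sqrt_abs real_sqrt_le_iff real_sqrt_mult)

lemma sup_bound_imp_ip:
  assumes "cts u" "\<And>x. x \<in> {0..pi} \<Longrightarrow> \<bar>u x\<bar> \<le> B" "0 \<le> B"
  shows "sqrt (ip u u) \<le> sqrt pi * B"
proof -
  have "ip u u \<le> integral {0..pi} (\<lambda>x. B\<^sup>2)"
    unfolding ip_def power2_eq_square[symmetric]
    by (intro integral_le integrable_continuous_real continuous_intros assms)
      (use assms in \<open>auto simp: abs_le_square_iff[symmetric]\<close>)
  also have "\<dots> = pi * B\<^sup>2" by simp
  finally show ?thesis using assms(3)
    by (metis real_sqrt_abs real_sqrt_le_iff real_sqrt_mult abs_of_nonneg)
qed

lemma continuous_on_Icc_bounded: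
  fixes g :: "real \<Rightarrow> real"
  assumes "continuous_on {a..b} g"
  obtains C where "0 \<le> C" "\<And>x. x \<in> {a..b} \<Longrightarrow> \<bar>g x\<bar> \<le> C"
proof -
  have "bounded (g ` {a..b})"
    using assms by (intro compact_imp_bounded compact_continuous_image) auto
  then obtain C where "0 < C" "\<And>y. y \<in> g ` {a..b} \<Longrightarrow> norm y \<le> C"
    by (auto simp: bounded_pos)
  then show ?thesis by (intro that[of C]) auto
qed

subsection \<open>Linear algebra\<close>

text \<open>One equation is solved for one unknown, which is then eliminated from the others. Both
  dimension counts for the Morse index rest on this lemma. The index types are arbitrary because
  equations and unknowns are indexed by eigenfunctions in one place and by option values in
  another.\<close>

lemma homogeneous_system_nontrivial:
  fixes A :: "'j \<Rightarrow> 'i \<Rightarrow> real"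
  assumes "finite J" "finite I" "card J < card I"
  shows "\<exists>c. (\<forall>j\<in>J. (\<Sum>i\<in>I. c i * A j i) = 0) \<and> (\<exists>i\<in>I. c i \<noteq> 0)"
  using assms
proof (induction J arbitrary: I A rule: finite_induct)
  case empty
  then obtain i where "i \<in> I" by (metis card.empty card_gt_0_iff equals0I)
  then show ?case by (intro exI[of _ "\<lambda>_. 1"]) auto
next
  case (insert j J)
  show ?case
  proof (cases "\<forall>i\<in>I. A j i = 0")
    case True
    have "card J < card I" using insert by auto
    then obtain c where c: "\<forall>j\<in>J. (\<Sum>i\<in>I. c i * A j i) = 0" "\<exists>i\<in>I. c i \<noteq> 0"
      using insert.IH[OF insert.prems(1)] by blast
    then show ?thesis using True by (intro exI[of _ c]) auto
  next
    case False
    then obtain i0 where i0: "i0 \<in> I" "A j i0 \<noteq> 0" by auto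
    \<comment> \<open>\<open>A'\<close> is the system that remains after \<open>i0\<close> has been
      eliminated by means of equation \<open>j\<close>; \<open>d\<close> below restores this
      unknown.\<close>
    define I' where "I' = I - {i0}"
    define A' where "A' l i = A l i - A l i0 * A j i / A j i0" for l i
    have "card J < card I'" "finite I'"
      using insert i0 by (auto simp: I'_def)
    then obtain c where c: "\<forall>l\<in>J. (\<Sum>i\<in>I'. c i * A' l i) = 0" "\<exists>i\<in>I'. c i \<noteq> 0"
      using insert.IH[of I' A'] by blast
    define d where "d i = (if i = i0 then - (\<Sum>i\<in>I'. c i * A j i) / A j i0 else c i)" for i
    have I: "I = insert i0 I'" "i0 \<notin> I'" using i0 by (auto simp: I'_def)
    have eq: "(\<Sum>i\<in>I. d i * A l i) = - (\<Sum>i\<in>I'. c i * A j i) / A j i0 * A l i0 + (\<Sum>i\<in>I'. c i * A l i)" for l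
    proof -
      have "(\<Sum>i\<in>I'. d i * A l i) = (\<Sum>i\<in>I'. c i * A l i)"
        by (rule sum.cong) (use I in \<open>auto simp: d_def\<close>)
      then show ?thesis using \<open>finite I'\<close> by (subst I(1), subst sum.insert) (use I in \<open>auto simp: d_def\<close>)
    qed
    have "(\<Sum>i\<in>I. d i * A l i) = 0" if "l \<in> J" for l
    proof -
      have "0 = (\<Sum>i\<in>I'. c i * A' l i)" using c that by simp
      also have "\<dots> = (\<Sum>i\<in>I'. c i * A l i) - (\<Sum>i\<in>I'. (A l i0 / A j i0) * (c i * A j i))"
        unfolding A'_def sum_subtractf[symmetric] by (rule sum.cong) (auto simp: field_simps)
      also have "\<dots> = (\<Sum>i\<in>I'. c i * A l i) - (A l i0 / A j i0) * (\<Sum>i\<in>I'. c i * A j i)"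
        by (simp add: sum_distrib_left)
      finally show ?thesis unfolding eq by simp
    qed
    moreover have "(\<Sum>i\<in>I. d i * A j i) = 0" unfolding eq using i0 by simp
    moreover have "\<exists>i\<in>I. d i \<noteq> 0" using c(2) I by (auto simp: d_def)
    ultimately show ?thesis by (intro exI[of _ d]) auto
  qed
qed

subsection \<open>Initial value problems\<close>

text \<open>Gronwall: the derivative of w^2 + w1^2 is bounded by a multiple of this function. An
  inequality for \<open>w2\<close> instead of an equation covers linear equations as well as
  differences of solutions of a nonlinear one.\<close>

lemma linear_second_order_unique:
  fixes w w1 w2 :: "real \<Rightarrow> real"
  assumes d: "\<And>x. x \<in> {a..b} \<Longrightarrow> (w has_real_derivative w1 x) (at x within {a..b})"
    "\<And>x. x \<in> {a..b} \<Longrightarrow> (w1 has_real_derivative w2 x) (at x within {a..b})"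
    and bnd: "\<And>x. x \<in> {a..b} \<Longrightarrow> \<bar>w2 x\<bar> \<le> C * \<bar>w x\<bar>"
    and x0: "x0 \<in> {a..b}" "w x0 = 0" "w1 x0 = 0"
    and x: "x \<in> {a..b}"
  shows "w x = 0 \<and> w1 x = 0"
proof -
  define C' where "C' = max C 0"
  define e where "e x = (w x)\<^sup>2 + (w1 x)\<^sup>2" for x
  define e1 where "e1 x = 2 * w x * w1 x + 2 * w1 x * w2 x" for x
  have de: "(e has_real_derivative e1 x) (at x within {a..b})" if "x \<in> {a..b}" for x
    unfolding e_def e1_def using that
    by (auto intro!: derivative_eq_intros d simp: algebra_simps)
  have e1: "\<bar>e1 x\<bar> \<le> (1 + C') * e x" if "x \<in> {a..b}" for x
  proof -
    have "\<bar>w2 x\<bar> \<le> C' * \<bar>w x\<bar>"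
      using bnd[OF that] by (smt (verit) C'_def abs_ge_zero max.cobounded1 mult_right_mono)
    then have "\<bar>w1 x\<bar> * \<bar>w2 x\<bar> \<le> \<bar>w1 x\<bar> * (C' * \<bar>w x\<bar>)" by (intro mult_left_mono) auto
    moreover have "\<bar>e1 x\<bar> \<le> 2 * (\<bar>w x\<bar> * \<bar>w1 x\<bar>) + 2 * (\<bar>w1 x\<bar> * \<bar>w2 x\<bar>)"
      unfolding e1_def by (rule order_trans[OF abs_triangle_ineq]) (simp add: abs_mult)
    ultimately have "\<bar>e1 x\<bar> \<le> (1 + C') * (2 * (\<bar>w x\<bar> * \<bar>w1 x\<bar>))" by (simp add: algebra_simps)
    also have "\<dots> \<le> (1 + C') * e x"
    proof (rule mult_left_mono)
      have "0 \<le> (\<bar>w x\<bar> - \<bar>w1 x\<bar>)\<^sup>2" by simp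
      then show "2 * (\<bar>w x\<bar> * \<bar>w1 x\<bar>) \<le> e x" by (simp add: e_def power2_eq_square algebra_simps)
    qed (simp add: C'_def)
    finally show ?thesis .
  qed
  have e0: "e x0 = 0" "\<And>x. e x \<ge> 0" using x0 by (auto simp: e_def)
  have "e x \<le> 0"
  \<comment> \<open>The exponential weight has to decay to the right of \<open>x0\<close> and to
    grow to the left of it.\<close>
  proof (cases "x0 \<le> x")
    case True
    have "e x * exp (- (1 + C') * x) \<le> e x0 * exp (- (1 + C') * x0)"
    proof (rule DERIV_nonpos_imp_decreasing_open[OF True])
      fix y assume y: "x0 < y" "y < x"
      then have yi: "y \<in> {a..b}" "at y within {a..b} = at y" using x0 x
        by (auto intro!: at_within_Icc_at)
      have "((\<lambda>x. e x * exp (- (1 + C') * x)) has_real_derivative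
          (e1 y - (1 + C') * e y) * exp (- (1 + C') * y)) (at y)"
        using de[OF yi(1)] unfolding yi(2) by (auto intro!: derivative_eq_intros simp: algebra_simps)
      moreover have "(e1 y - (1 + C') * e y) * exp (- (1 + C') * y) \<le> 0"
        using e1[OF yi(1)] by (intro mult_nonpos_nonneg) auto
      ultimately show "\<exists>d. ((\<lambda>x. e x * exp (- (1 + C') * x)) has_real_derivative d) (at y) \<and> d \<le> 0" by blast
    next
      have "continuous_on {a..b} e" using de by (meson DERIV_continuous_on)
      then show "continuous_on {x0..x} (\<lambda>x. e x * exp (- (1 + C') * x))"
        using x0 x by (auto intro!: continuous_intros elim: continuous_on_subset)
    qed
    then show ?thesis using e0 by (simp add: mult_le_0_iff)
  next
    case False
    then have le: "x \<le> x0" by simp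
    have "e x * exp ((1 + C') * x) \<le> e x0 * exp ((1 + C') * x0)"
    proof (rule DERIV_nonneg_imp_increasing_open[OF le])
      fix y assume y: "x < y" "y < x0"
      then have yi: "y \<in> {a..b}" "at y within {a..b} = at y" using x0 x
        by (auto intro!: at_within_Icc_at)
      have "((\<lambda>x. e x * exp ((1 + C') * x)) has_real_derivative
          (e1 y + (1 + C') * e y) * exp ((1 + C') * y)) (at y)"
        using de[OF yi(1)] unfolding yi(2) by (auto intro!: derivative_eq_intros simp: algebra_simps)
      moreover have "(e1 y + (1 + C') * e y) * exp ((1 + C') * y) \<ge> 0"
        using e1[OF yi(1)] by (intro mult_nonneg_nonneg) auto
      ultimately show "\<exists>d. ((\<lambda>x. e x * exp ((1 + C') * x)) has_real_derivative d) (at y) \<and> d \<ge> 0" by blast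
    next
      have "continuous_on {a..b} e" using de by (meson DERIV_continuous_on)
      then show "continuous_on {x..x0} (\<lambda>x. e x * exp ((1 + C') * x))"
        using x0 x by (auto intro!: continuous_intros elim: continuous_on_subset)
    qed
    then show ?thesis using e0 by (simp add: mult_le_0_iff)
  qed
  with e0(2)[of x] have "e x = 0" by simp
  then show ?thesis by (simp add: e_def sum_power2_eq_zero_iff)
qed

text \<open>Both solutions stay in a compact interval, where \<open>g\<close> is Lipschitz, so their
  difference satisfies the inequality of \<open>linear_second_order_unique\<close>.\<close>

lemma second_order_unique:
  fixes u v :: "real \<Rightarrow> real"
  assumes g: "\<And>s. (g has_real_derivative g' s) (at s)" "continuous_on UNIV g'"
    and u: "\<And>x. x \<in> {a..b} \<Longrightarrow> (u has_real_derivative u1 x) (at x within {a..b})"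
    "\<And>x. x \<in> {a..b} \<Longrightarrow> (u1 has_real_derivative g (u x)) (at x within {a..b})"
    and v: "\<And>x. x \<in> {a..b} \<Longrightarrow> (v has_real_derivative v1 x) (at x within {a..b})"
    "\<And>x. x \<in> {a..b} \<Longrightarrow> (v1 has_real_derivative g (v x)) (at x within {a..b})"
    and x0: "x0 \<in> {a..b}" "u x0 = v x0" "u1 x0 = v1 x0"
    and x: "x \<in> {a..b}"
  shows "u x = v x \<and> u1 x = v1 x"
proof -
  have "continuous_on {a..b} u" "continuous_on {a..b} v"
    using u v by (meson DERIV_continuous_on)+
  then have "bounded (u ` {a..b} \<union> v ` {a..b})"
    by (auto intro!: compact_imp_bounded compact_continuous_image)
  then obtain K where K: "\<And>y. y \<in> u ` {a..b} \<union> v ` {a..b} \<Longrightarrow> \<bar>y\<bar> \<le> K"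
    unfolding bounded_iff by auto
  have "continuous_on {-K..K} g'" using g(2) continuous_on_subset by blast
  then obtain C where C: "\<And>y. y \<in> {-K..K} \<Longrightarrow> \<bar>g' y\<bar> \<le> C"
    using continuous_on_Icc_bounded by metis
  have lip: "\<bar>g s - g t\<bar> \<le> C * \<bar>s - t\<bar>" if "s \<in> {-K..K}" "t \<in> {-K..K}" for s t
  proof -
    have "norm (g s - g t) \<le> C * norm (s - t)"
      by (rule field_differentiable_bound[of "{-K..K}" g g'])
        (use that C g(1) in \<open>auto intro: has_field_derivative_at_within\<close>)
    then show ?thesis by simp
  qed
  have inK: "u y \<in> {-K..K}" "v y \<in> {-K..K}" if "y \<in> {a..b}" for y
    using K[of "u y"] K[of "v y"] that by (auto simp: abs_le_iff)
  have "u x - v x = 0 \<and> u1 x - v1 x = 0"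
    by (rule linear_second_order_unique[of a b _ _ "\<lambda>x. g (u x) - g (v x)" C x0])
      (use u v x0 x lip inK in \<open>auto intro!: DERIV_diff\<close>)
  then show ?thesis by simp
qed

subsection \<open>Compact symmetric operators on continuous functions\<close>

text \<open>The supremum \<open>\<Lambda>\<close> of the form \<open>ip (M u) u\<close> over the unit ball is an eigenvalue: for a maximizing
  sequence \<open>\<Lambda> u\<^sub>n - M u\<^sub>n\<close> tends to 0, because \<open>\<Lambda> - M\<close> is nonnegative, and \<open>M u\<^sub>n\<close> has
  a uniformly convergent subsequence.\<close>

lemma compact_symmetric_eigenvector:
  fixes M :: "(real \<Rightarrow> real) \<Rightarrow> real \<Rightarrow> real" and E :: "(real \<Rightarrow> real) set"
  assumes lin: "\<And>u v a b x. cts u \<Longrightarrow> cts v \<Longrightarrow> x \<in> {0..pi} \<Longrightarrow>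
      M (\<lambda>x. a * u x + b * v x) x = a * M u x + b * M v x"
    and ctsM: "\<And>u. cts u \<Longrightarrow> cts (M u)"
    and sym: "\<And>u v. cts u \<Longrightarrow> cts v \<Longrightarrow> ip (M u) v = ip u (M v)"
    and bnd: "\<And>u x. cts u \<Longrightarrow> x \<in> {0..pi} \<Longrightarrow> \<bar>M u x\<bar> \<le> C * sqrt (ip u u)"
    and lip: "\<And>u x y. cts u \<Longrightarrow> x \<in> {0..pi} \<Longrightarrow> y \<in> {0..pi} \<Longrightarrow>
      \<bar>M u x - M u y\<bar> \<le> C * sqrt (ip u u) * \<bar>x - y\<bar>"
    and C: "0 < C"
    and E: "\<And>e. e \<in> E \<Longrightarrow> cts e"
    and inv: "\<And>u e. cts u \<Longrightarrow> (\<And>e. e \<in> E \<Longrightarrow> ip u e = 0) \<Longrightarrow> e \<in> E \<Longrightarrow> ip (M u) e = 0"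
    and u0: "cts u0" "\<And>e. e \<in> E \<Longrightarrow> ip u0 e = 0" "0 < ip (M u0) u0"
  shows "\<exists>\<Lambda> w. 0 < \<Lambda> \<and> cts w \<and> (\<forall>e\<in>E. ip w e = 0) \<and> (\<exists>x\<in>{0..pi}. w x \<noteq> 0)
    \<and> (\<forall>x\<in>{0..pi}. M w x = \<Lambda> * w x)"
proof -
  \<comment> \<open>The form is maximized over the orthogonal complement of \<open>E\<close> only.
    By \<open>inv\<close> this space is invariant, so the eigenvector found is new relative to
    \<open>E\<close>.\<close>
  define X where "X = {u. cts u \<and> (\<forall>e\<in>E. ip u e = 0)}"
  define B where "B = {ip (M u) u |u. u \<in> X \<and> ip u u \<le> 1}"
  define \<Lambda> where "\<Lambda> = Sup B"
  define C' where "C' = sqrt pi * C"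
  have C': "0 < C'" using C by (simp add: C'_def)
  have normM: "sqrt (ip (M u) (M u)) \<le> C' * sqrt (ip u u)" if "cts u" for u
    using sup_bound_imp_ip[OF ctsM[OF that] bnd[OF that]] C ip_self_nonneg[of u]
    by (simp add: C'_def mult.assoc)
  have form_bnd: "\<bar>ip (M u) u\<bar> \<le> C' * ip u u" if "cts u" for u
  proof -
    have "\<bar>ip (M u) u\<bar> \<le> sqrt (ip (M u) (M u)) * sqrt (ip u u)"
      by (rule ip_bound[OF ctsM[OF that] that])
    also have "\<dots> \<le> (C' * sqrt (ip u u)) * sqrt (ip u u)"
      by (rule mult_right_mono[OF normM[OF that]]) (simp add: ip_self_nonneg)
    finally show ?thesis using ip_self_nonneg[of u] by (simp add: mult.assoc)
  qed
  have Mscale: "ip (M (\<lambda>x. a * u x)) v = a * ip (M u) v" if "cts u" for a u v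
  proof -
    have "ip (M (\<lambda>x. a * u x)) v = ip (\<lambda>x. a * M u x) v"
      using lin[OF that that, where a=a and b=0] by (intro ip_cong) auto
    then show ?thesis by (simp add: ip_scale_left)
  qed
  have scaleX: "(\<lambda>x. a * u x) \<in> X" if "u \<in> X" for a u
    using that by (auto simp: X_def ip_scale_left intro!: continuous_intros)
  have bddB: "bdd_above B"
  proof (rule bdd_aboveI)
    fix y assume "y \<in> B"
    then obtain u where u: "y = ip (M u) u" "cts u" "ip u u \<le> 1" by (auto simp: B_def X_def)
    then have "y \<le> C' * ip u u" using form_bnd[of u] by auto
    also have "\<dots> \<le> C' * 1" using u C' by (intro mult_left_mono) auto
    finally show "y \<le> C'" by simp
  qed
  have formle: "ip (M u) u \<le> \<Lambda> * ip u u" if u: "u \<in> X" for u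
  proof (cases "ip u u = 0")
    case True
    then show ?thesis using form_bnd[of u] u by (auto simp: X_def)
  next
    case False
    then have pos: "0 < ip u u" using ip_self_nonneg[of u] by simp
    define a where "a = 1 / sqrt (ip u u)"
    have a2: "a * a * ip u u = 1" using pos by (simp add: a_def field_simps)
    have "ip (M (\<lambda>x. a * u x)) (\<lambda>x. a * u x) \<in> B"
      unfolding B_def using scaleX[OF u, of a] a2
      by (auto simp: ip_scale_left ip_scale_right intro!: exI[of _ "\<lambda>x. a * u x"])
    then have "ip (M (\<lambda>x. a * u x)) (\<lambda>x. a * u x) \<le> \<Lambda>"
      unfolding \<Lambda>_def using bddB by (intro cSup_upper)
    then have "a * a * ip (M u) u \<le> \<Lambda>" using u by (simp add: Mscale ip_scale_right X_def)
    then have "a * a * ip (M u) u * ip u u \<le> \<Lambda> * ip u u" using pos by (intro mult_right_mono) auto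
    then show ?thesis using a2 by (metis (no_types, lifting) mult.assoc mult.commute mult.right_neutral)
  qed
  have u0X: "u0 \<in> X" using u0 by (auto simp: X_def)
  have pos0: "0 < ip u0 u0"
    using form_bnd[OF u0(1)] u0(3) C' ip_self_nonneg[of u0] by (cases "ip u0 u0 = 0") auto
  have \<Lambda>: "0 < \<Lambda>" using formle[OF u0X] u0(3) pos0 by (smt (verit) mult_nonpos_nonneg)
  have "\<exists>u. u \<in> X \<and> ip u u \<le> 1 \<and> \<Lambda> - 1 / Suc n < ip (M u) u" for n
  proof -
    have "ip (M (\<lambda>x. 0)) (\<lambda>x. 0) \<in> B" unfolding B_def X_def by (auto intro!: exI[of _ "\<lambda>x. 0"])
    then have "B \<noteq> {}" by auto
    moreover have "\<Lambda> - 1 / Suc n < Sup B" by (simp add: \<Lambda>_def)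
    ultimately obtain y where "y \<in> B" "\<Lambda> - 1 / Suc n < y" using less_cSup_iff[OF _ bddB] by blast
    then show ?thesis by (auto simp: B_def)
  qed
  then obtain U where U: "\<And>n. U n \<in> X" "\<And>n. ip (U n) (U n) \<le> 1" "\<And>n. \<Lambda> - 1 / Suc n < ip (M (U n)) (U n)"
    by metis
  have cU: "cts (U n)" for n using U(1) by (auto simp: X_def)
  define d where "d n = (\<lambda>x. \<Lambda> * U n x + (- 1) * M (U n) x)" for n
  have cd: "cts (d n)" for n unfolding d_def by (intro continuous_intros cU ctsM)
  have dX: "d n \<in> X" for n
  proof -
    have "ip (d n) e = 0" if "e \<in> E" for e
    proof -
      have "ip (d n) e = ip (\<lambda>x. \<Lambda> * U n x) e + ip (\<lambda>x. (- 1) * M (U n) x) e"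
        unfolding d_def by (intro ip_add_left continuous_intros cU ctsM E that)
      also have "\<dots> = 0" using U(1)[of n] inv[OF cU[of n] _ that] that
        unfolding ip_scale_left by (auto simp: X_def)
      finally show ?thesis .
    qed
    with cd show ?thesis by (auto simp: X_def)
  qed
  have small: "ip (d n) (d n) \<le> (\<Lambda> + C') * (1 / Suc n)" for n
  proof -
    \<comment> \<open>This \<open>t\<close> minimizes the quadratic bound - 2 t D + t^2 (\<Lambda> +
      C') D obtained below. Testing the nonnegative form of \<Lambda> - M on
      \<open>U n - t d n\<close> is the Cauchy-Schwarz inequality for that form, which need not be
      definite.\<close>
    define t where "t = 1 / (\<Lambda> + C')"
    have t: "0 < t" "t * (\<Lambda> + C') = 1" using \<Lambda> C' by (auto simp: t_def)
    define y where "y = (\<lambda>x. 1 * U n x + (- t) * d n x)"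
    have cy: "cts y" unfolding y_def by (intro continuous_intros cU cd)
    have yX: "y \<in> X"
    proof -
      have "ip y e = 0" if "e \<in> E" for e
      proof -
        have "ip y e = ip (\<lambda>x. 1 * U n x) e + ip (\<lambda>x. (- t) * d n x) e"
          unfolding y_def by (intro ip_add_left continuous_intros cU cd E that)
        then show ?thesis unfolding ip_scale_left using U(1)[of n] dX[of n] that by (auto simp: X_def)
      qed
      with cy show ?thesis by (auto simp: X_def)
    qed
    define D where "D = ip (d n) (d n)"
    have My: "ip (M y) v = ip (M (U n)) v - t * ip (M (d n)) v" if "cts v" for v
    proof -
      have "ip (M y) v = ip (\<lambda>x. M (U n) x - t * M (d n) x) v"
        unfolding y_def by (intro ip_cong) (use lin[OF cU[of n] cd[of n], where a=1 and b="-t"] in auto)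
      also have "\<dots> = ip (M (U n)) v - ip (\<lambda>x. t * M (d n) x) v"
        by (intro ip_diff_left continuous_intros ctsM cU cd that)
      finally show ?thesis by (simp add: ip_scale_left)
    qed
    have y_ip: "ip v y = ip v (U n) - t * ip v (d n)" if "cts v" for v
    proof -
      have "ip v y = ip v (\<lambda>x. U n x - t * d n x)" unfolding y_def by simp
      also have "\<dots> = ip v (U n) - ip v (\<lambda>x. t * d n x)"
        by (intro ip_diff_right continuous_intros cU cd that)
      finally show ?thesis by (simp add: ip_scale_right)
    qed
    have Dd: "D = \<Lambda> * ip (U n) (d n) - ip (M (U n)) (d n)"
    proof -
      have "D = ip (\<lambda>x. \<Lambda> * U n x) (d n) + ip (\<lambda>x. (- 1) * M (U n) x) (d n)"
        unfolding D_def by (subst (1) d_def) (intro ip_add_left continuous_intros cU ctsM cd)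
      then show ?thesis unfolding ip_scale_left by simp
    qed
    have "0 \<le> \<Lambda> * ip y y - ip (M y) y" using formle[OF yX] by simp
    also have "\<dots> = (\<Lambda> * ip (U n) (U n) - ip (M (U n)) (U n)) - 2 * t * D + t\<^sup>2 * (\<Lambda> * D - ip (M (d n)) (d n))"
    proof -
      have "ip (M (d n)) (U n) = ip (M (U n)) (d n)"
        by (simp add: sym cU cd ip_commute[of "M (U n)"])
      moreover have "ip y y = ip (U n) (U n) - 2 * t * ip (U n) (d n) + t\<^sup>2 * D"
        using y_ip[OF cy] y_ip[OF cU, of n] y_ip[OF cd, of n] ip_commute[of y "U n"] ip_commute[of y "d n"]
          ip_commute[of "U n" "d n"]
        by (simp add: D_def power2_eq_square algebra_simps)
      moreover have "\<Lambda> * (A - 2 * t * B + t\<^sup>2 * D) - (F - t * G - t * (G - t * H))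
          = (\<Lambda> * A - F) - 2 * t * D + t\<^sup>2 * (\<Lambda> * D - H)" if "D = \<Lambda> * B - G" for A B F G H
        unfolding that by (simp add: power2_eq_square algebra_simps)
      moreover have "ip (M y) y = ip (M (U n)) (U n) - t * ip (M (U n)) (d n)
          - t * (ip (M (d n)) (U n) - t * ip (M (d n)) (d n))"
        unfolding My[OF cy] y_ip[OF ctsM[OF cU]] y_ip[OF ctsM[OF cd]] ..
      ultimately show ?thesis using Dd by presburger
    qed
    also have "\<dots> \<le> 1 / Suc n - 2 * t * D + t\<^sup>2 * ((\<Lambda> + C') * D)"
    proof (intro add_mono diff_mono mult_left_mono order_refl)
      have "\<Lambda> * ip (U n) (U n) \<le> \<Lambda> * 1" using U(2)[of n] \<Lambda> by (intro mult_left_mono) auto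
      then show "\<Lambda> * ip (U n) (U n) - ip (M (U n)) (U n) \<le> 1 / Suc n" using U(3)[of n] by simp
      show "\<Lambda> * D - ip (M (d n)) (d n) \<le> (\<Lambda> + C') * D"
        using form_bnd[OF cd[of n]] unfolding D_def by (auto simp: algebra_simps)
    qed (use t in auto)
    also have "\<dots> = 1 / Suc n - t * D"
    proof -
      have "t\<^sup>2 * ((\<Lambda> + C') * D) = t * (t * (\<Lambda> + C')) * D" by (simp add: power2_eq_square)
      then show ?thesis using t(2) by simp
    qed
    finally have "t * D \<le> 1 / Suc n" by simp
    then have "(\<Lambda> + C') * (t * D) \<le> (\<Lambda> + C') * (1 / Suc n)" using \<Lambda> C' by (intro mult_left_mono) auto
    then show ?thesis using t(2) by (simp add: D_def mult.assoc[symmetric] mult.commute)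
  qed
  have nU: "sqrt (ip (U n) (U n)) \<le> 1" for n using U(2)[of n] by simp
  obtain w k where w: "cts w" "strict_mono (k :: nat \<Rightarrow> nat)"
    and conv: "\<And>\<epsilon>. 0 < \<epsilon> \<Longrightarrow> \<exists>N. \<forall>n x. n \<ge> N \<and> x \<in> {0..pi} \<longrightarrow> norm (M (U (k n)) x - w x) < \<epsilon>"
  proof (rule Arzela_Ascoli[of "{0..pi}" "\<lambda>n. M (U n)" C])
    fix n x assume "x \<in> {0..pi}"
    then have "\<bar>M (U n) x\<bar> \<le> C * sqrt (ip (U n) (U n))" by (rule bnd[OF cU])
    also have "\<dots> \<le> C * 1" using nU[of n] C by (intro mult_left_mono) auto
    finally show "norm (M (U n) x) \<le> C" by simp
  next
    fix x e :: real assume xe: "x \<in> {0..pi}" "0 < e"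
    have "norm (M (U n) x - M (U n) y) < e" if y: "y \<in> {0..pi} \<and> norm (x - y) < e / C" for n y
    proof -
      have "\<bar>M (U n) x - M (U n) y\<bar> \<le> C * sqrt (ip (U n) (U n)) * \<bar>x - y\<bar>"
        using lip[OF cU xe(1)] y by blast
      also have "\<dots> \<le> C * 1 * \<bar>x - y\<bar>" using nU[of n] C by (intro mult_left_mono mult_right_mono) auto
      also have "\<dots> < e" using y C by (simp add: field_simps)
      finally show ?thesis by simp
    qed
    then show "\<exists>d>0. \<forall>n y. y \<in> {0..pi} \<and> norm (x - y) < d \<longrightarrow> norm (M (U n) x - M (U n) y) < e"
      using xe C by (intro exI[of _ "e / C"]) auto
  qed auto
  have MUX: "ip (M (U n)) e = 0" if "e \<in> E" for n e
    using inv[OF cU[of n] _ that] U(1)[of n] by (auto simp: X_def)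
  define r where "r n = (\<lambda>x. M (U (k n)) x - w x)" for n
  have cr: "cts (r n)" for n unfolding r_def by (intro continuous_intros ctsM cU w)
  have r0: "(\<lambda>n. sqrt (ip (r n) (r n))) \<longlonglongrightarrow> 0"
  proof (rule LIMSEQ_I)
    fix e :: real assume e: "0 < e"
    then have "0 < e / (2 * sqrt pi)" by simp
    from conv[OF this] obtain N where N: "\<And>n x. n \<ge> N \<Longrightarrow> x \<in> {0..pi} \<Longrightarrow> \<bar>r n x\<bar> < e / (2 * sqrt pi)"
      by (auto simp: r_def)
    have "norm (sqrt (ip (r n) (r n)) - 0) < e" if "n \<ge> N" for n
    proof -
      have "sqrt (ip (r n) (r n)) \<le> sqrt pi * (e / (2 * sqrt pi))"
        using N[OF that] e by (intro sup_bound_imp_ip cr) (auto intro: less_imp_le)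
      also have "\<dots> < e" using e by simp
      finally show ?thesis using ip_self_nonneg[of "r n"] by simp
    qed
    then show "\<exists>no. \<forall>n\<ge>no. norm (sqrt (ip (r n) (r n)) - 0) < e" by blast
  qed
  have ip_w: "(\<lambda>n. ip (M (U (k n))) v) \<longlonglongrightarrow> ip w v" if v: "cts v" for v
  proof -
    have "(\<lambda>n. ip (r n) v) \<longlonglongrightarrow> 0"
    proof (rule tendsto_rabs_zero_cancel, rule tendsto_sandwich[OF always_eventually always_eventually tendsto_const])
      show "(\<lambda>n. sqrt (ip (r n) (r n)) * sqrt (ip v v)) \<longlonglongrightarrow> 0"
        by (rule tendsto_mult_left_zero[OF r0])
    qed (use ip_bound[OF cr v] in auto)
    moreover have "ip (r n) v = ip (M (U (k n))) v - ip w v" for n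
      unfolding r_def by (intro ip_diff_left ctsM cU w v)
    ultimately show ?thesis by (simp add: LIM_zero_iff)
  qed
  have wE: "ip w e = 0" if "e \<in> E" for e
    using ip_w[OF E[OF that]] MUX[OF that] by (simp add: LIMSEQ_const_iff)
  have d0: "(\<lambda>n. sqrt (ip (d (k n)) (d (k n)))) \<longlonglongrightarrow> 0"
  proof -
    have "(\<lambda>n. ip (d n) (d n)) \<longlonglongrightarrow> 0"
    proof (rule tendsto_sandwich[OF always_eventually always_eventually tendsto_const])
      show "(\<lambda>n. (\<Lambda> + C') * (1 / Suc n)) \<longlonglongrightarrow> 0"
        by (intro tendsto_mult_right_zero lim_1_over_n[THEN LIMSEQ_Suc])
    qed (use small ip_self_nonneg in auto)
    then have "(\<lambda>n. sqrt (ip (d n) (d n))) \<longlonglongrightarrow> sqrt 0" by (rule tendsto_real_sqrt)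
    then show ?thesis using LIMSEQ_subseq_LIMSEQ[OF _ w(2)] by (auto simp: o_def)
  qed
  have eig: "M w x = \<Lambda> * w x" if x: "x \<in> {0..pi}" for x
  proof -
    \<comment> \<open>Apply \<open>M\<close> to \<open>w = M (U (k n)) - r n\<close> and to the
      residual \<open>d (k n)\<close>. The left side does not depend on \<open>n\<close>, and each
      term on the right tends to 0 pointwise.\<close>
    have eq: "M w x - \<Lambda> * w x = \<Lambda> * r n x - M (r n) x - M (d (k n)) x" for n
    proof -
      have "M (r n) x = M (M (U (k n))) x - M w x"
        using lin[OF ctsM[OF cU[of "k n"]] w(1) x, where a=1 and b="-1"] by (simp add: r_def)
      moreover have "M (d (k n)) x = \<Lambda> * M (U (k n)) x - M (M (U (k n))) x"
        using lin[OF cU[of "k n"] ctsM[OF cU[of "k n"]] x, where a=\<Lambda> and b="-1"] by (simp add: d_def)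
      ultimately show ?thesis by (simp add: r_def algebra_simps)
    qed
    have "(\<lambda>n. r n x) \<longlonglongrightarrow> 0"
      using conv x by (intro LIMSEQ_I) (fastforce simp: r_def)
    moreover have "(\<lambda>n. M (r n) x) \<longlonglongrightarrow> 0"
    proof (rule tendsto_rabs_zero_cancel, rule tendsto_sandwich[OF always_eventually always_eventually tendsto_const])
      show "(\<lambda>n. C * sqrt (ip (r n) (r n))) \<longlonglongrightarrow> 0" by (rule tendsto_mult_right_zero[OF r0])
    qed (use bnd[OF cr x] in auto)
    moreover have "(\<lambda>n. M (d (k n)) x) \<longlonglongrightarrow> 0"
    proof (rule tendsto_rabs_zero_cancel, rule tendsto_sandwich[OF always_eventually always_eventually tendsto_const])
      show "(\<lambda>n. C * sqrt (ip (d (k n)) (d (k n)))) \<longlonglongrightarrow> 0" by (rule tendsto_mult_right_zero[OF d0])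
    qed (use bnd[OF cd x] in auto)
    ultimately have "(\<lambda>n. \<Lambda> * r n x - M (r n) x - M (d (k n)) x) \<longlonglongrightarrow> \<Lambda> * 0 - 0 - 0"
      by (intro tendsto_intros)
    then show ?thesis unfolding eq[symmetric] by (simp add: LIMSEQ_const_iff)
  qed
  \<comment> \<open>If \<open>w\<close> vanished, then \<open>M (U (k n))\<close> and hence the
    values of the form would tend to 0, but these values exceed \<Lambda> - 1 / Suc (k n).\<close>
  have "\<exists>x\<in>{0..pi}. w x \<noteq> 0"
  proof (rule ccontr)
    assume "\<not> ?thesis"
    then have r: "\<And>n x. x \<in> {0..pi} \<Longrightarrow> r n x = M (U (k n)) x" by (auto simp: r_def)
    have "\<Lambda> - 1 / Suc (k n) \<le> sqrt (ip (r n) (r n))" for n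
    proof -
      have "\<Lambda> - 1 / Suc (k n) \<le> ip (M (U (k n))) (U (k n))" using U(3)[of "k n"] by simp
      also have "\<dots> = ip (r n) (U (k n))" using r by (intro ip_cong) auto
      also have "\<dots> \<le> sqrt (ip (r n) (r n)) * sqrt (ip (U (k n)) (U (k n)))"
        using ip_bound[OF cr cU, of n "k n"] by simp
      also have "\<dots> \<le> sqrt (ip (r n) (r n)) * 1"
        by (intro mult_left_mono nU) (simp add: ip_self_nonneg)
      finally show ?thesis by simp
    qed
    moreover have "(\<lambda>n. \<Lambda> - 1 / Suc (k n)) \<longlonglongrightarrow> \<Lambda> - 0"
      using LIMSEQ_subseq_LIMSEQ[OF lim_1_over_n[THEN LIMSEQ_Suc] w(2)]
      by (intro tendsto_diff tendsto_const) (auto simp: o_def)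
    ultimately have "\<Lambda> - 0 \<le> 0" using r0 by (meson LIMSEQ_le)
    with \<Lambda> show False by simp
  qed
  with \<Lambda> w(1) wE eig show ?thesis by blast
qed

subsection \<open>Lebesgue integrals over \<open>(0, \<pi>)\<close>\<close>

lemma sets_I [simp]: "{0<..<pi} \<in> sets lebesgue"
  by (simp add: fmeasurableD)

lemma leb_I_finite_measure: "finite_measure leb_I"
  by (rule finite_measureI) (simp add: emeasure_restrict_space)

lemma integrable_leb_I_set: "integrable leb_I d \<longleftrightarrow> set_integrable lebesgue {0<..<pi} d"
  for d :: "real \<Rightarrow> real"
  unfolding set_integrable_def by (rule integrable_restrict_space) simp

lemma cts_integrable_leb_I:
  assumes "cts u"
  shows "integrable leb_I u"
proof -
  have "u absolutely_integrable_on {0..pi}" using assms by (rule absolutely_integrable_continuous_real)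
  then have "set_integrable lebesgue {0<..<pi} u" by (rule set_integrable_subset) auto
  then show ?thesis by (simp add: integrable_leb_I_set)
qed

lemma integral_leb_I: "integrable leb_I d \<Longrightarrow> (\<integral>x. d x \<partial>leb_I) = integral {0..pi} d"
  for d :: "real \<Rightarrow> real"
  by (metis lebesgue_integral_eq_integral integral_open_interval_real sets_I)

lemma integral_leb_I_ip: "cts u \<Longrightarrow> cts v \<Longrightarrow> (\<integral>x. u x * v x \<partial>leb_I) = ip u v"
  unfolding ip_def by (rule integral_leb_I) (intro cts_integrable_leb_I continuous_intros)

lemma cts_imp_L2:
  assumes "cts u"
  shows "u \<in> L2"
proof -
  have "cts (\<lambda>x. (u x)\<^sup>2)" using assms by (intro continuous_intros)
  then show ?thesis
    unfolding L2_def using assms by (simp add: cts_integrable_leb_I borel_measurable_integrable)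
qed

lemma L2norm_sq: "(L2norm u)\<^sup>2 = (\<integral>x. (u x)\<^sup>2 \<partial>leb_I)"
  by (simp add: L2norm_def)

lemma L2norm_cts: "cts u \<Longrightarrow> L2norm u = sqrt (ip u u)"
  using integral_leb_I_ip[of u u] by (simp add: L2norm_def power2_eq_square)

lemma L2_add:
  assumes "u \<in> L2" "v \<in> L2"
  shows "(\<lambda>x. u x + v x) \<in> L2"
proof -
  have m: "u \<in> borel_measurable leb_I" "v \<in> borel_measurable leb_I" using assms by (auto simp: L2_def)
  have "integrable leb_I (\<lambda>x. (u x + v x)\<^sup>2)"
  proof (rule Bochner_Integration.integrable_bound)
    show "integrable leb_I (\<lambda>x. 2 * (u x)\<^sup>2 + 2 * (v x)\<^sup>2)" using assms by (auto simp: L2_def)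
    show "(\<lambda>x. (u x + v x)\<^sup>2) \<in> borel_measurable leb_I" using m by measurable
    have "(u x + v x)\<^sup>2 \<le> 2 * (u x)\<^sup>2 + 2 * (v x)\<^sup>2" for x
      using zero_le_power2[of "u x - v x"] by (simp add: power2_eq_square algebra_simps)
    then show "AE x in leb_I. norm ((u x + v x)\<^sup>2) \<le> norm (2 * (u x)\<^sup>2 + 2 * (v x)\<^sup>2)" by simp
  qed
  with m show ?thesis by (auto simp: L2_def)
qed

lemma L2_scale: "u \<in> L2 \<Longrightarrow> (\<lambda>x. c * u x) \<in> L2"
  by (auto simp: L2_def power_mult_distrib)

text \<open>Young's inequality, applied pointwise with a free parameter \<open>t\<close>, gives
  integrability and the bound at once.\<close>

lemma L2_abs_bound: assumes "h \<in> L2" "0 < t"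
  shows "integrable leb_I h" "(\<integral>x. \<bar>h x\<bar> \<partial>leb_I) \<le> t * pi / 2 + (L2norm h)\<^sup>2 / (2 * t)"
proof -
  interpret finite_measure leb_I by (rule leb_I_finite_measure)
  have le: "\<bar>h x\<bar> \<le> t / 2 + (h x)\<^sup>2 / (2 * t)" for x
  proof -
    have "0 \<le> (\<bar>h x\<bar> - t)\<^sup>2" by simp
    then show ?thesis using assms(2) by (simp add: power2_eq_square field_simps)
  qed
  have i: "integrable leb_I (\<lambda>x. t / 2 + (h x)\<^sup>2 / (2 * t))" using assms by (auto simp: L2_def)
  show ih: "integrable leb_I h"
    by (rule Bochner_Integration.integrable_bound[OF i]) (use assms le in \<open>auto simp: L2_def intro!: AE_I2 order_trans[OF le]\<close>)
  have "(\<integral>x. \<bar>h x\<bar> \<partial>leb_I) \<le> (\<integral>x. t / 2 + (h x)\<^sup>2 / (2 * t) \<partial>leb_I)"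
    by (intro integral_mono i integrable_abs ih le)
  also have "\<dots> = t * pi / 2 + (L2norm h)\<^sup>2 / (2 * t)"
    using assms by (simp add: L2norm_sq L2_def measure_restrict_space)
  finally show "(\<integral>x. \<bar>h x\<bar> \<partial>leb_I) \<le> t * pi / 2 + (L2norm h)\<^sup>2 / (2 * t)" .
qed

lemma L2norm_nonneg: "0 \<le> L2norm h"
  by (simp add: L2norm_def)

lemma L2_imp_integrable: "h \<in> L2 \<Longrightarrow> integrable leb_I h"
  by (rule L2_abs_bound(1)[of _ 1]) auto

text \<open>Take \<open>t = L2norm h\<close>, or let \<open>t\<close> tend to 0 if this norm is 0.
  The computation gives the factor (pi + 1) / 2, which is rounded up to 4.\<close>

lemma L1_le_L2norm:
  assumes "h \<in> L2"
  shows "(\<integral>x. \<bar>h x\<bar> \<partial>leb_I) \<le> 4 * L2norm h"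
proof (cases "L2norm h = 0")
  case True
  have "(\<integral>x. \<bar>h x\<bar> \<partial>leb_I) \<le> 0 + e" if "0 < e" for e
  proof -
    have "4 * (\<integral>x. \<bar>h x\<bar> \<partial>leb_I) \<le> pi * e"
      using L2_abs_bound(2)[OF assms, of "e / 2"] that True by (simp add: mult.commute)
    moreover have "pi * e \<le> 4 * e" using that pi_less_4 by simp
    ultimately show ?thesis by linarith
  qed
  then have "(\<integral>x. \<bar>h x\<bar> \<partial>leb_I) \<le> 0" by (rule field_le_epsilon)
  then show ?thesis using True by simp
next
  case False
  then have pos: "0 < L2norm h" using L2norm_nonneg[of h] by simp
  have "(\<integral>x. \<bar>h x\<bar> \<partial>leb_I) \<le> L2norm h * pi / 2 + L2norm h / 2"
    using L2_abs_bound(2)[OF assms pos] pos by (simp add: power2_eq_square)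
  also have "\<dots> \<le> L2norm h * 4 / 2 + L2norm h / 2"
    using pos pi_less_4 by (intro add_mono divide_right_mono mult_left_mono) auto
  finally show ?thesis using pos by simp
qed

section \<open>Primitives of integrable functions\<close>

definition prim :: "(real \<Rightarrow> real) \<Rightarrow> real \<Rightarrow> real" where
  "prim h x = (LINT t:{0<..<x}|lebesgue. h t)"

lemma prim_eq:
  assumes "integrable leb_I h" "x \<in> {0..pi}"
  shows "h integrable_on {0..x}" "prim h x = integral {0..x} h"
proof -
  have "set_integrable lebesgue {0<..<x} h"
    by (rule set_integrable_subset[of _ "{0<..<pi}"]) (use assms in \<open>auto simp: integrable_leb_I_set\<close>)
  from set_lebesgue_integral_eq_integral[OF this]
  show "h integrable_on {0..x}" "prim h x = integral {0..x} h"
    by (simp_all add: prim_def integral_open_interval_real integrable_on_open_interval_real)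
qed

lemma prim_continuous: "integrable leb_I h \<Longrightarrow> cts (prim h)"
  using indefinite_integral_continuous_1[OF prim_eq(1)[of h pi]]
  by (subst continuous_on_cong[OF refl prim_eq(2)]) auto

lemma prim_bound:
  assumes "integrable leb_I h" "x \<in> {0..pi}"
  shows "\<bar>prim h x\<bar> \<le> (\<integral>x. \<bar>h x\<bar> \<partial>leb_I)"
proof -
  have i: "integrable leb_I (\<lambda>x. \<bar>h x\<bar>)" using assms by auto
  have "\<bar>prim h x\<bar> \<le> integral {0..x} (\<lambda>x. \<bar>h x\<bar>)"
    using integral_norm_bound_integral[OF prim_eq(1)[OF assms] prim_eq(1)[OF i assms(2)]]
    by (simp add: prim_eq(2)[OF assms])
  also have "\<dots> \<le> integral {0..pi} (\<lambda>x. \<bar>h x\<bar>)"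
    by (rule integral_subset_le) (use assms prim_eq(1)[OF i] in auto)
  also have "\<dots> = (\<integral>x. \<bar>h x\<bar> \<partial>leb_I)" using integral_leb_I[OF i] by simp
  finally show ?thesis .
qed

text \<open>By Lebesgue differentiation the averages of \<open>d\<close> over short intervals to the
  right of almost every point converge to the value of \<open>d\<close> there, and all these
  averages are 0. The function is first extended by 0 to the whole line, and the intervals are kept
  inside (0, pi).\<close>

lemma prim_zero_imp_AE_zero:
  assumes d: "integrable leb_I d" and z: "\<And>x. x \<in> {0..pi} \<Longrightarrow> prim d x = 0"
  shows "AE x in leb_I. d x = 0"
proof -
  define d0 where "d0 x = indicator {0<..<pi} x *\<^sub>R d x" for x
  have "integrable lebesgue d0"
    using d unfolding d0_def by (subst (asm) integrable_restrict_space) auto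
  then have "d0 integrable_on UNIV" by (rule integrable_on_lebesgue)
  then have "d0 integrable_on cbox a b" for a b by (rule integrable_on_subcbox) simp
  then obtain N where N: "negligible N"
    "\<And>x e. x \<notin> N \<Longrightarrow> 0 < e \<Longrightarrow> \<exists>r>0. \<forall>h. 0 < h \<and> h < r \<longrightarrow>
        norm (integral (cbox x (x + h *\<^sub>R One)) d0 /\<^sub>R h ^ DIM(real) - d0 x) < e"
    using integrable_ccontinuous_explicit[of d0] by metis
  have "d x = 0" if xN: "x \<notin> N" "0 < x" "x < pi" for x
  proof (rule ccontr)
    assume "d x \<noteq> 0"
    then obtain r where r: "r > 0" "\<And>h. 0 < h \<Longrightarrow> h < r \<Longrightarrow>
        norm (integral (cbox x (x + h *\<^sub>R One)) d0 /\<^sub>R h ^ DIM(real) - d0 x) < \<bar>d x\<bar>"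
      using N(2)[OF xN(1), of "\<bar>d x\<bar>"] by auto
    define h where "h = min r (pi - x) / 2"
    have h: "0 < h" "h < r" "x + h < pi" using r(1) that by (auto simp: h_def min_def field_simps)
    have "integral {x..x+h} d0 = integral {x..x+h} d"
      by (rule integral_cong) (use that h in \<open>auto simp: d0_def\<close>)
    moreover have "integral {0..x} d + integral {x..x+h} d = integral {0..x+h} d"
      by (rule Henstock_Kurzweil_Integration.integral_combine) (use that h prim_eq(1)[OF d, of "x+h"] in auto)
    moreover have "integral {0..x} d = 0" "integral {0..x+h} d = 0"
      using z[of x] z[of "x+h"] prim_eq(2)[OF d, of x] prim_eq(2)[OF d, of "x+h"] that h by auto
    ultimately have "integral (cbox x (x + h *\<^sub>R One)) d0 = 0" by simp
    then show False using r(2)[OF h(1,2)] that by (simp add: d0_def)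
  qed
  then have "{x. \<not> (x \<in> {0<..<pi} \<longrightarrow> d x = 0)} \<subseteq> N" by auto
  moreover have "N \<in> null_sets lebesgue" using N(1) by (simp add: negligible_iff_null_sets)
  ultimately have "AE x in lebesgue. x \<in> {0<..<pi} \<longrightarrow> d x = 0" by (intro AE_I'[of N]) auto
  then show ?thesis by (simp add: AE_restrict_space_iff)
qed

lemma prim_diff:
  assumes "integrable leb_I g" "integrable leb_I h" "x \<in> {0..pi}"
  shows "prim (\<lambda>x. g x - h x) x = prim g x - prim h x"
  using assms by (simp add: prim_eq integral_diff)

lemma prim_AE_cong:
  assumes "integrable leb_I g" "integrable leb_I h" "eq_ae g h" "x \<in> {0..pi}"
  shows "prim g x = prim h x"
proof -
  have "AE t in lebesgue. t \<in> {0<..<pi} \<longrightarrow> g t = h t"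
    using assms(3) by (simp add: eq_ae_def AE_restrict_space_iff)
  then have "AE t in lebesgue. t \<in> {0<..<x} \<longrightarrow> g t = h t"
    by eventually_elim (use assms(4) in auto)
  moreover have "set_integrable lebesgue {0<..<x} g" "set_integrable lebesgue {0<..<x} h"
    by (rule set_integrable_subset[of _ "{0<..<pi}"]; use assms in \<open>auto simp: integrable_leb_I_set\<close>)+
  ultimately show ?thesis
    unfolding prim_def set_lebesgue_integral_def set_integrable_def
    by (intro integral_cong_AE) (auto intro: borel_measurable_integrable elim!: eventually_mono split: split_indicator)
qed

lemma prim_has_derivative:
  assumes "cts g" "x \<in> {0..pi}"
  shows "(prim g has_real_derivative g x) (at x within {0..pi})"
  by (rule has_field_derivative_transform_within[OF integral_has_real_derivative[OF assms] zero_less_one assms(2)])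
    (simp add: prim_eq(2)[OF cts_integrable_leb_I[OF assms(1)]])

subsection \<open>Weak and classical second derivatives\<close>

lemma has_weak_deriv_alt:
  "has_weak_deriv u g \<longleftrightarrow> g \<in> L2 \<and> (\<forall>x\<in>{0..pi}. u x = u 0 + prim g x)"
  by (simp add: has_weak_deriv_def prim_def)

lemma has_weak_derivD:
  assumes "has_weak_deriv u g"
  shows "g \<in> L2" "integrable leb_I g" "\<And>x. x \<in> {0..pi} \<Longrightarrow> u x = u 0 + prim g x"
  using assms L2_imp_integrable unfolding has_weak_deriv_alt by blast+

text \<open>The derivatives are explicit arguments, so that computations need not pass through
  \<open>dx\<close>; at the end points they are one-sided, as in \<open>dx\<close>.\<close>

definition has_C2_deriv :: "(real \<Rightarrow> real) \<Rightarrow> (real \<Rightarrow> real) \<Rightarrow> (real \<Rightarrow> real) \<Rightarrow> bool" where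
  "has_C2_deriv v v1 v2 \<longleftrightarrow> cts v2 \<and> (\<forall>x\<in>{0..pi}. (v has_real_derivative v1 x) (at x within {0..pi})
      \<and> (v1 has_real_derivative v2 x) (at x within {0..pi}))"

lemma has_C2_derivD:
  assumes "has_C2_deriv v v1 v2"
  shows "x \<in> {0..pi} \<Longrightarrow> (v has_real_derivative v1 x) (at x within {0..pi})"
    "x \<in> {0..pi} \<Longrightarrow> (v1 has_real_derivative v2 x) (at x within {0..pi})"
    "cts v" "cts v1" "cts v2"
  using assms unfolding has_C2_deriv_def by (auto intro: DERIV_continuous_on)

lemma FTC_prim:
  assumes "\<And>x. x \<in> {0..pi} \<Longrightarrow> (v has_real_derivative v1 x) (at x within {0..pi})" "cts v1" "x \<in> {0..pi}"
  shows "v x = v 0 + prim v1 x"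
proof -
  have "(v1 has_integral (v x - v 0)) {0..x}"
    using assms(3) by (intro fundamental_theorem_of_calculus)
      (auto simp: has_real_derivative_iff_has_vector_derivative[symmetric]
        intro: DERIV_subset[OF assms(1)])
  then show ?thesis using prim_eq(2)[OF cts_integrable_leb_I[OF assms(2)] assms(3)]
    by (simp add: integral_unique)
qed

lemma has_weak_deriv_classical:
  assumes "\<And>x. x \<in> {0..pi} \<Longrightarrow> (v has_real_derivative v1 x) (at x within {0..pi})" "cts v1"
  shows "has_weak_deriv v v1"
  unfolding has_weak_deriv_alt using cts_imp_L2[OF assms(2)] FTC_prim[OF assms] by blast

lemma C2_imp_weak_deriv2: "has_C2_deriv v v1 v2 \<Longrightarrow> has_weak_deriv2 v v2"
  unfolding has_weak_deriv2_def
  by (intro exI[of _ v1] conjI has_weak_deriv_classical) (auto dest: has_C2_derivD)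

lemma weak_deriv_add:
  assumes "has_weak_deriv u g" "has_weak_deriv v h"
  shows "has_weak_deriv (\<lambda>x. u x + c * v x) (\<lambda>x. g x + c * h x)"
  unfolding has_weak_deriv_alt
proof (intro conjI ballI)
  show "(\<lambda>x. g x + c * h x) \<in> L2" by (intro L2_add L2_scale has_weak_derivD(1)[OF assms(1)] has_weak_derivD(1)[OF assms(2)])
  fix x assume x: "x \<in> {0..pi}"
  note i = has_weak_derivD(2)[OF assms(1)] has_weak_derivD(2)[OF assms(2)]
  have "prim (\<lambda>x. g x + c * h x) x = prim g x + c * prim h x"
  proof -
    have j: "integrable leb_I (\<lambda>x. g x + c * h x)" using i by auto
    have k: "(\<lambda>x. c * h x) integrable_on {0..x}"
      using integrable_on_cmult_left[OF prim_eq(1)[OF i(2) x], of c] by simp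
    show ?thesis
      unfolding prim_eq(2)[OF j x] prim_eq(2)[OF i(1) x] prim_eq(2)[OF i(2) x]
        integral_add[OF prim_eq(1)[OF i(1) x] k] by simp
  qed
  then show "u x + c * v x = u 0 + c * v 0 + prim (\<lambda>x. g x + c * h x) x"
    using has_weak_derivD(3)[OF assms(1) x] has_weak_derivD(3)[OF assms(2) x] by (simp add: distrib_left)
qed

lemma weak_deriv2_add:
  assumes "has_weak_deriv2 u g" "has_weak_deriv2 v h"
  shows "has_weak_deriv2 (\<lambda>x. u x + c * v x) (\<lambda>x. g x + c * h x)"
  using assms weak_deriv_add unfolding has_weak_deriv2_def by blast

lemma weak_deriv_cong:
  assumes "has_weak_deriv u g" "\<And>x. x \<in> {0..pi} \<Longrightarrow> v x = u x"
  shows "has_weak_deriv v g"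
  unfolding has_weak_deriv_alt
proof (intro conjI ballI has_weak_derivD(1)[OF assms(1)])
  fix x assume x: "x \<in> {0..pi}"
  show "v x = v 0 + prim g x"
    using has_weak_derivD(3)[OF assms(1) x] assms(2)[OF x] assms(2)[of 0] by simp
qed

lemma weak_deriv2_cong:
  assumes "has_weak_deriv2 u g" "\<And>x. x \<in> {0..pi} \<Longrightarrow> v x = u x"
  shows "has_weak_deriv2 v g"
proof -
  obtain p where "has_weak_deriv u p" "has_weak_deriv p g" using assms(1) by (auto simp: has_weak_deriv2_def)
  moreover from this(1) have "has_weak_deriv v p" by (rule weak_deriv_cong) (rule assms(2))
  ultimately show ?thesis by (auto simp: has_weak_deriv2_def)
qed

text \<open>Regularity: once the weak second derivative has a continuous representative, integrating
  twice gives classical derivatives. This turns eigenfunctions in \<open>H2_H10\<close> into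
  solutions of a differential equation.\<close>

lemma weak_deriv2_classical:
  assumes v: "has_weak_deriv2 v w" and g: "eq_ae w g" "cts g"
  shows "\<exists>v1. has_C2_deriv v v1 g"
proof -
  obtain p where p: "has_weak_deriv v p" "has_weak_deriv p w"
    using v by (auto simp: has_weak_deriv2_def)
  note w = has_weak_derivD(2)[OF p(2)]
  have peq: "p x = p 0 + prim g x" if "x \<in> {0..pi}" for x
    using has_weak_derivD(3)[OF p(2) that] prim_AE_cong[OF w cts_integrable_leb_I[OF g(2)] g(1) that]
    by simp
  have dp: "(p has_real_derivative g x) (at x within {0..pi})" if x: "x \<in> {0..pi}" for x
  proof -
    have "((\<lambda>x. p 0 + prim g x) has_real_derivative g x) (at x within {0..pi})"
      using prim_has_derivative[OF g(2) x] by (auto intro!: derivative_eq_intros)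
    then show ?thesis
      by (rule has_field_derivative_transform_within[OF _ zero_less_one x]) (rule peq[symmetric])
  qed
  then have cp: "cts p" by (meson DERIV_continuous_on)
  have "(v has_real_derivative p x) (at x within {0..pi})" if x: "x \<in> {0..pi}" for x
  proof -
    have "((\<lambda>x. v 0 + prim p x) has_real_derivative p x) (at x within {0..pi})"
      using prim_has_derivative[OF cp x] by (auto intro!: derivative_eq_intros)
    then show ?thesis
      by (rule has_field_derivative_transform_within[OF _ zero_less_one x])
        (rule has_weak_derivD(3)[OF p(1), symmetric])
  qed
  with dp g(2) have "has_C2_deriv v p g" by (auto simp: has_C2_deriv_def)
  then show ?thesis by blast
qed

lemma dx_eq:
  assumes "(u has_real_derivative d) (at x within {0..pi})" "x \<in> {0..pi}"
  shows "dx u x = d"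
  unfolding dx_def
  using vector_derivative_within_cbox[of 0 pi x u d] assms
  by (simp add: has_real_derivative_iff_has_vector_derivative)

text \<open>The value of \<open>weak_dxx\<close> is a choice, so facts about it have to hold for
  every weak second derivative. Two first derivatives are continuous with equal primitives, hence
  equal everywhere; for the second derivatives equality of primitives gives equality almost
  everywhere.\<close>

lemma weak_deriv2_unique:
  assumes "has_weak_deriv2 v w" "has_weak_deriv2 v w'"
  shows "eq_ae w w'"
proof -
  obtain p where p: "has_weak_deriv v p" "has_weak_deriv p w"
    using assms by (auto simp: has_weak_deriv2_def)
  obtain p' where p': "has_weak_deriv v p'" "has_weak_deriv p' w'"
    using assms by (auto simp: has_weak_deriv2_def)
  note i = p[THEN has_weak_derivD(2)] p'[THEN has_weak_derivD(2)]
  have c: "cts (\<lambda>x. p 0 + prim w x)" "cts (\<lambda>x. p' 0 + prim w' x)"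
    by (intro continuous_intros prim_continuous i)+
  have "cts p" by (rule continuous_on_eq[OF c(1)]) (rule has_weak_derivD(3)[OF p(2), symmetric])
  moreover have "cts p'" by (rule continuous_on_eq[OF c(2)]) (rule has_weak_derivD(3)[OF p'(2), symmetric])
  ultimately have cd: "cts (\<lambda>x. p x - p' x)" by (intro continuous_intros)
  have pd: "prim (\<lambda>x. p x - p' x) x = 0" if "x \<in> {0..pi}" for x
    using has_weak_derivD(3)[OF p(1) that] has_weak_derivD(3)[OF p'(1) that]
    unfolding prim_diff[OF i(1) i(3) that] by simp
  have pp: "p x = p' x" if x: "x \<in> {0..pi}" for x
  proof -
    have "((\<lambda>_. 0) has_real_derivative p x - p' x) (at x within {0..pi})"
      by (rule has_field_derivative_transform_within[OF prim_has_derivative[OF cd x] zero_less_one x]) (use pd in auto)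
    then have "p x - p' x = dx (\<lambda>_. 0) x" using dx_eq x by metis
    also have "\<dots> = 0" by (rule dx_eq[OF _ x]) simp
    finally have "p x - p' x = 0" .
    then show ?thesis by simp
  qed
  have "prim (\<lambda>x. w x - w' x) x = 0" if x: "x \<in> {0..pi}" for x
    using has_weak_derivD(3)[OF p(2) x] has_weak_derivD(3)[OF p'(2) x] pp[OF x] pp[of 0] x
    unfolding prim_diff[OF i(2) i(4) x] by simp
  from prim_zero_imp_AE_zero[OF _ this] i have "AE x in leb_I. w x - w' x = 0" by auto
  then show ?thesis by (simp add: eq_ae_def)
qed

lemma weak_dxx_ae:
  assumes "has_weak_deriv2 v w"
  shows "has_weak_deriv2 v (weak_dxx v)" "eq_ae (weak_dxx v) w"
proof -
  show "has_weak_deriv2 v (weak_dxx v)" unfolding weak_dxx_def by (rule someI[where P = "has_weak_deriv2 v", OF assms])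
  then show "eq_ae (weak_dxx v) w" using weak_deriv2_unique assms by blast
qed

lemma C2_on_I_iff: "C2_on_I u \<longleftrightarrow> (\<exists>u1 u2. has_C2_deriv u u1 u2)"
proof
  assume C: "C2_on_I u"
  have d: "(u has_real_derivative dx u x) (at x within {0..pi})"
    if "x \<in> {0..pi}" "u differentiable_on {0..pi}" for u x
    using that unfolding dx_def differentiable_on_def
    by (simp add: has_real_derivative_iff_has_vector_derivative vector_derivative_works)
  have "has_C2_deriv u (dx u) (dx (dx u))"
    using C d by (auto simp: has_C2_deriv_def C2_on_I_def)
  then show "\<exists>u1 u2. has_C2_deriv u u1 u2" by blast
next
  assume "\<exists>u1 u2. has_C2_deriv u u1 u2"
  then obtain u1 u2 where u: "has_C2_deriv u u1 u2" by blast
  have e1: "dx u x = u1 x" if "x \<in> {0..pi}" for x using dx_eq has_C2_derivD(1)[OF u that] that by blast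
  have d1: "(dx u has_real_derivative u2 x) (at x within {0..pi})" if "x \<in> {0..pi}" for x
    by (rule has_field_derivative_transform_within[OF has_C2_derivD(2)[OF u that] zero_less_one that]) (use e1 in auto)
  have e2: "dx (dx u) x = u2 x" if "x \<in> {0..pi}" for x using dx_eq d1 that by blast
  have "cts (dx (dx u))" by (rule continuous_on_eq[OF has_C2_derivD(5)[OF u]]) (use e2 in auto)
  moreover have "u differentiable at x within {0..pi}" "dx u differentiable at x within {0..pi}"
    if "x \<in> {0..pi}" for x
    using has_C2_derivD(1)[OF u that] d1[OF that]
    by (blast intro: differentiableI has_field_derivative_imp_has_derivative)+
  ultimately show "C2_on_I u" by (simp add: C2_on_I_def differentiable_on_def)
qed

lemma has_C2_deriv_dx:
  assumes "has_C2_deriv u u1 u2" "x \<in> {0..pi}"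
  shows "dx u x = u1 x" "dx (dx u) x = u2 x"
proof -
  have e1: "dx u x = u1 x" if "x \<in> {0..pi}" for x using dx_eq has_C2_derivD(1)[OF assms(1) that] that by blast
  have "(dx u has_real_derivative u2 x) (at x within {0..pi})"
    by (rule has_field_derivative_transform_within[OF has_C2_derivD(2)[OF assms] zero_less_one assms(2)]) (use e1 in auto)
  with e1[OF assms(2)] assms(2) show "dx u x = u1 x" "dx (dx u) x = u2 x" using dx_eq by auto
qed

lemma eq_on_interior_imp_eq:
  fixes u v :: "real \<Rightarrow> real"
  assumes "cts u" "cts v" "\<And>x. x \<in> {0<..<pi} \<Longrightarrow> u x = v x" "x \<in> {0..pi}"
  shows "u x = v x"
proof -
  have "closure {0<..<pi} = {0..pi}" by simp
  then show ?thesis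
    using continuous_constant_on_closure[of "{0<..<pi}" "\<lambda>x. u x - v x" 0 x] assms
    by (auto intro!: continuous_intros)
qed

text \<open>The equation is imposed in the open interval; both sides are continuous, so it extends
  to the end points.\<close>

lemma dirichlet_solution_iff:
  assumes "continuous_on UNIV h"
  shows "dirichlet_solution h u \<longleftrightarrow> (\<exists>u1. has_C2_deriv u u1 (\<lambda>x. - h (u x))) \<and> u 0 = 0 \<and> u pi = 0"
proof
  assume D: "dirichlet_solution h u"
  then obtain u1 u2 where u: "has_C2_deriv u u1 u2" by (auto simp: dirichlet_solution_def C2_on_I_iff)
  have ch: "cts (\<lambda>x. - h (u x))"
    by (intro continuous_intros continuous_on_compose2[OF assms] has_C2_derivD(3)[OF u]) auto
  have "u2 x = - h (u x)" if "x \<in> {0..pi}" for x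
  proof (rule eq_on_interior_imp_eq[OF has_C2_derivD(5)[OF u] ch _ that])
    fix x assume x: "x \<in> {0<..<pi}"
    then have "dx (dx u) x + h (u x) = 0" using D unfolding dirichlet_solution_def by blast
    moreover have "dx (dx u) x = u2 x" using has_C2_deriv_dx(2)[OF u, of x] x by simp
    ultimately show "u2 x = - h (u x)" by linarith
  qed
  then have "has_C2_deriv u u1 (\<lambda>x. - h (u x))" using u ch by (auto simp: has_C2_deriv_def)
  then show "(\<exists>u1. has_C2_deriv u u1 (\<lambda>x. - h (u x))) \<and> u 0 = 0 \<and> u pi = 0"
    using D by (auto simp: dirichlet_solution_def)
next
  assume "(\<exists>u1. has_C2_deriv u u1 (\<lambda>x. - h (u x))) \<and> u 0 = 0 \<and> u pi = 0"
  then show "dirichlet_solution h u"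
    using has_C2_deriv_dx(2) by (auto simp: dirichlet_solution_def C2_on_I_iff)
qed

subsection \<open>Polar coordinates for \<open>u'' + f u = 0\<close>\<close>

text \<open>L'Hospital's rule for the difference quotient. It supplies the derivative of
  \<open>h1\<close> at 0, where the quotient defining \<open>h1\<close> degenerates.\<close>

lemma DERIV_at_from_limit:
  fixes g :: "real \<Rightarrow> real"
  assumes "isCont g a" "\<forall>\<^sub>F y in at a. (g has_real_derivative g' y) (at y)" "(g' \<longlongrightarrow> L) (at a)"
  shows "(g has_real_derivative L) (at a)"
proof -
  have "((\<lambda>y. (g y - g a) / (y - a)) \<longlongrightarrow> L) (at a)"
  proof (rule lhopital[where f' = g' and g' = "\<lambda>_. 1"])
    show "((\<lambda>y. g y - g a) \<longlongrightarrow> 0) (at a)" using assms(1) by (simp add: isCont_def LIM_zero)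
    show "((\<lambda>y. y - a) \<longlongrightarrow> 0) (at a)" by (rule LIM_zero) simp
    show "\<forall>\<^sub>F y in at a. ((\<lambda>y. g y - g a) has_real_derivative g' y) (at y)"
      using assms(2) by eventually_elim (auto intro!: derivative_eq_intros)
    show "\<forall>\<^sub>F y in at a. ((\<lambda>y. y - a) has_real_derivative 1) (at y)"
      by (rule always_eventually) (auto intro!: derivative_eq_intros)
    show "\<forall>\<^sub>F y in at a. y - a \<noteq> 0" by (simp add: eventually_at_filter)
  qed (use assms(3) in auto)
  then show ?thesis by (simp add: has_field_derivative_iff)
qed

text \<open>The behaviour of \<open>f\<close> at infinity is represented by a zero on either side of
  0. These zeros are the barriers that enclose every solution of the Dirichlet problem.\<close>

locale nonlinearity =
  fixes f f' f'' :: "real \<Rightarrow> real" and bm bp :: real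
  assumes f_deriv: "\<And>u. (f has_real_derivative f' u) (at u)"
    and f'_deriv: "\<And>u. (f' has_real_derivative f'' u) (at u)"
    and f''_cont: "continuous_on UNIV f''"
    and f_0: "f 0 = 0"
    and f'_0: "f' 0 = 1"
    and f''_sign: "\<And>u. u \<noteq> 0 \<Longrightarrow> f'' u * u < 0"
    and bm: "bm < 0" "f bm = 0" and bp: "0 < bp" "f bp = 0"
begin

lemma f_cont: "continuous_on S f" and f'_cont: "continuous_on S f'"
  by (rule DERIV_continuous_on, rule has_field_derivative_at_within, rule f_deriv f'_deriv)+

lemma f''_0: "f'' 0 = 0"
proof -
  have lim: "(f'' \<longlongrightarrow> f'' 0) (at 0)"
    using f''_cont by (simp add: continuous_on_eq_continuous_at isCont_def)
  have "f'' 0 \<le> 0"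
  proof (rule tendsto_upperbound)
    show "(f'' \<longlongrightarrow> f'' 0) (at_right 0)" using lim by (rule filterlim_mono) (auto simp: at_le)
    have "f'' u \<le> 0" if "u > 0" for u using f''_sign[of u] that by (simp add: mult_less_0_iff)
    then show "\<forall>\<^sub>F u in at_right 0. f'' u \<le> 0" by (auto simp: eventually_at_filter)
  qed auto
  moreover have "f'' 0 \<ge> 0"
  proof (rule tendsto_lowerbound)
    show "(f'' \<longlongrightarrow> f'' 0) (at_left 0)" using lim by (rule filterlim_mono) (auto simp: at_le)
    have "f'' u \<ge> 0" if "u < 0" for u using f''_sign[of u] that by (simp add: mult_less_0_iff)
    then show "\<forall>\<^sub>F u in at_left 0. f'' u \<ge> 0" by (auto simp: eventually_at_filter)
  qed auto
  ultimately show ?thesis by simp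
qed

text \<open>u f'(u) - f(u) vanishes at 0 and has derivative u f''(u), which is negative for u
  different from 0. The strict inequality gives the monotonicity of f(u) / u and, later, the
  definiteness in Jacobi's identity.\<close>

lemma f'_less_slope:
  assumes "u \<noteq> 0"
  shows "f' u < f u / u"
proof -
  define k where "k u = u * f' u - f u" for u
  have dk: "(k has_real_derivative u * f'' u) (at u)" for u
    unfolding k_def by (auto intro!: derivative_eq_intros f_deriv f'_deriv)
  have ck: "continuous_on S k" for S
    by (rule DERIV_continuous_on[of _ _ "\<lambda>u. u * f'' u"]) (rule has_field_derivative_at_within[OF dk])
  have neg: "u * f'' u < 0" if "u \<noteq> 0" for u using f''_sign[OF that] by (simp add: mult.commute)
  have k0: "k 0 = 0" by (simp add: k_def f_0)
  show ?thesis
  proof (cases "u > 0")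
    case True
    have "k 0 > k u"
    proof (rule DERIV_neg_imp_decreasing_open[OF True _ ck])
      fix x :: real assume "0 < x" "x < u"
      then show "\<exists>y. (k has_real_derivative y) (at x) \<and> y < 0" using dk[of x] neg[of x] by blast
    qed
    then show ?thesis using True k0 by (simp add: k_def field_simps)
  next
    case False
    with assms have "u < 0" by simp
    have "k u > k 0"
    proof (rule DERIV_neg_imp_decreasing_open[OF \<open>u < 0\<close> _ ck])
      fix x :: real assume "u < x" "x < 0"
      then show "\<exists>y. (k has_real_derivative y) (at x) \<and> y < 0" using dk[of x] neg[of x] by blast
    qed
    then show ?thesis using \<open>u < 0\<close> k0 by (simp add: k_def field_simps)
  qed
qed

lemma slope_deriv: "u \<noteq> 0 \<Longrightarrow> ((\<lambda>u. f u / u) has_real_derivative (f' u - f u / u) / u) (at u)"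
  by (auto intro!: derivative_eq_intros f_deriv simp: field_simps)

lemma slope_decreasing:
  assumes "0 < u" "u < v"
  shows "f v / v < f u / u"
proof (rule DERIV_neg_imp_decreasing[OF assms(2)])
  fix x assume x: "u \<le> x" "x \<le> v"
  then have "(f' x - f x / x) / x < 0" using f'_less_slope[of x] assms by (simp add: divide_neg_pos)
  with x assms slope_deriv[of x] show "\<exists>y. ((\<lambda>u. f u / u) has_real_derivative y) (at x) \<and> y < 0" by force
qed

lemma slope_increasing:
  assumes "u < v" "v < 0"
  shows "f u / u < f v / v"
proof (rule DERIV_pos_imp_increasing[OF assms(1)])
  fix x assume x: "u \<le> x" "x \<le> v"
  then have "(f' x - f x / x) / x > 0" using f'_less_slope[of x] assms by (simp add: divide_neg_neg)
  with x assms slope_deriv[of x] show "\<exists>y. ((\<lambda>u. f u / u) has_real_derivative y) (at x) \<and> y > 0" by force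
qed

lemma f_pos: "0 < u \<Longrightarrow> u < bp \<Longrightarrow> 0 < f u"
  using slope_decreasing[of u bp] bp by (simp add: zero_less_divide_iff)

lemma f_neg_above: "bp < u \<Longrightarrow> f u < 0"
  using slope_decreasing[of bp u] bp by (auto simp: divide_less_0_iff)

lemma f_neg: "bm < u \<Longrightarrow> u < 0 \<Longrightarrow> f u < 0"
  using slope_increasing[of bm u] bm by (simp add: zero_less_divide_iff)

lemma f_pos_below: "u < bm \<Longrightarrow> 0 < f u"
  using slope_increasing[of u bm] bm by (auto simp: divide_less_0_iff)

text \<open>The primitive of \<open>f\<close> that vanishes at 0. The base point lies to the left of
  \<open>bm\<close> so that the derivative is two-sided on all of [bm, bp].\<close>

definition F :: "real \<Rightarrow> real" where
  "F u = integral {bm - 1..u} f - integral {bm - 1..0} f"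

lemma F_0: "F 0 = 0"
  by (simp add: F_def)

lemma F_deriv:
  assumes "bm \<le> u" "u \<le> bp"
  shows "(F has_real_derivative f u) (at u)"
proof -
  have "((\<lambda>x. integral {bm - 1..x} f) has_real_derivative f u) (at u within {bm - 1..bp + 1})"
    by (rule integral_has_real_derivative) (use assms f_cont in auto)
  moreover have "at u within {bm - 1..bp + 1} = at u"
    by (rule at_within_Icc_at) (use assms in auto)
  ultimately show ?thesis unfolding F_def by (auto intro!: derivative_eq_intros)
qed

lemma F_cont: "continuous_on {bm..bp} F"
  by (rule DERIV_continuous_on[of _ _ f]) (auto intro: has_field_derivative_at_within F_deriv)

lemma F_increasing:
  assumes "0 \<le> u" "u < v" "v \<le> bp" shows "F u < F v"
proof (rule DERIV_pos_imp_increasing_open[OF assms(2)])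
  fix x assume "u < x" "x < v"
  then show "\<exists>y. (F has_real_derivative y) (at x) \<and> 0 < y"
    using F_deriv[of x] f_pos[of x] assms bm by auto
qed (use assms bm in \<open>auto intro: continuous_on_subset[OF F_cont]\<close>)

lemma F_decreasing:
  assumes "bm \<le> u" "u < v" "v \<le> 0" shows "F v < F u"
proof (rule DERIV_neg_imp_decreasing_open[OF assms(2)])
  fix x assume "u < x" "x < v"
  then show "\<exists>y. (F has_real_derivative y) (at x) \<and> y < 0"
    using F_deriv[of x] f_neg[of x] assms bp by auto
qed (use assms bp in \<open>auto intro: continuous_on_subset[OF F_cont]\<close>)

lemma F_pos: "bm \<le> u \<Longrightarrow> u \<le> bp \<Longrightarrow> u \<noteq> 0 \<Longrightarrow> 0 < F u"
  using F_increasing[of 0 u] F_decreasing[of u 0] F_0 by (cases "u > 0") auto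

lemma F_nonneg: "bm \<le> u \<Longrightarrow> u \<le> bp \<Longrightarrow> 0 \<le> F u"
  using F_pos[of u] F_0 by (cases "u = 0") auto

text \<open>The energy of \<open>u'' + f u = 0\<close> is \<open>(u'\<^sup>2 + Y(u)\<^sup>2) / 2\<close>, so that \<open>(Y u, u')\<close> moves on a circle.\<close>

definition Y :: "real \<Rightarrow> real" where
  "Y u = sgn u * sqrt (2 * F u)"

definition yp :: real where "yp = Y bp"
definition ym :: real where "ym = Y bm"

lemma Y_0: "Y 0 = 0"
  by (simp add: Y_def)

lemma Y_sq: "bm \<le> u \<Longrightarrow> u \<le> bp \<Longrightarrow> (Y u)\<^sup>2 = 2 * F u"
  using F_nonneg[of u] F_0 by (auto simp: Y_def power_mult_distrib sgn_if)

lemma Y_pos: "0 < u \<Longrightarrow> u \<le> bp \<Longrightarrow> 0 < Y u"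
  using F_pos[of u] bm by (simp add: Y_def)

lemma Y_neg: "bm \<le> u \<Longrightarrow> u < 0 \<Longrightarrow> Y u < 0"
  using F_pos[of u] bp by (simp add: Y_def)

lemma yp_pos: "0 < yp" and ym_neg: "ym < 0"
  using Y_pos[of bp] Y_neg[of bm] bm bp by (auto simp: yp_def ym_def)

lemma Y_strict_mono:
  assumes "bm \<le> u" "u < v" "v \<le> bp" shows "Y u < Y v"
proof -
  consider "0 \<le> u" | "v \<le> 0" | "u < 0" "0 < v" by linarith
  then show ?thesis
  proof cases
    case 1
    then show ?thesis using F_increasing[OF 1 assms(2,3)] assms Y_pos[of v] by (cases "u = 0") (auto simp: Y_def)
  next
    case 2
    then show ?thesis using F_decreasing[OF assms(1,2) 2] assms Y_neg[of u] by (cases "v = 0") (auto simp: Y_def)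
  next
    case 3
    then show ?thesis using Y_pos[of v] Y_neg[of u] assms by simp
  qed
qed

lemma Y_inj: "inj_on Y {bm..bp}"
  by (rule strict_mono_on_imp_inj_on) (auto simp: strict_mono_on_def Y_strict_mono)

lemma F_quotient_limit: "((\<lambda>u. 2 * F u / u\<^sup>2) \<longlongrightarrow> 1) (at 0)"
proof (rule lhopital[where f' = "\<lambda>u. 2 * f u" and g' = "\<lambda>u. 2 * u"])
  have ev: "\<forall>\<^sub>F u in at 0. bm < u \<and> u < bp"
    using bm bp by (intro eventually_at_in_open'[of "{bm<..<bp}" 0, simplified]) auto
  have "isCont F 0" using F_deriv[of 0] bm bp by (intro DERIV_isCont) auto
  then show "((\<lambda>u. 2 * F u) \<longlongrightarrow> 0) (at 0)" by (auto simp: isCont_def F_0 intro!: tendsto_eq_intros)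
  show "\<forall>\<^sub>F u in at 0. ((\<lambda>u. 2 * F u) has_real_derivative 2 * f u) (at u)"
    using ev by eventually_elim (auto intro!: derivative_eq_intros F_deriv)
  have "((\<lambda>u. f u / u) \<longlongrightarrow> 1) (at 0)"
    using f_deriv[of 0] by (simp add: has_field_derivative_iff f_0 f'_0)
  then show "((\<lambda>u. 2 * f u / (2 * u)) \<longlongrightarrow> 1) (at 0)" by simp
  show "\<forall>\<^sub>F u in at 0. (power2 has_real_derivative 2 * u) (at (u::real))"
    by (rule always_eventually) (auto intro!: derivative_eq_intros)
qed (auto simp: eventually_at_filter intro!: tendsto_eq_intros)

lemma slope_limit: "((\<lambda>u. f u / u) \<longlongrightarrow> 1) (at 0)"
  using f_deriv[of 0] by (simp add: has_field_derivative_iff f_0 f'_0)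

lemma Y_quotient_limit: "((\<lambda>u. Y u / u) \<longlongrightarrow> 1) (at 0)"
proof -
  have "((\<lambda>u. sqrt (2 * F u / u\<^sup>2)) \<longlongrightarrow> sqrt 1) (at 0)"
    by (rule tendsto_real_sqrt[OF F_quotient_limit])
  moreover have "sqrt (2 * F u / u\<^sup>2) = Y u / u" if "u \<noteq> 0" for u
    using that by (auto simp: Y_def real_sqrt_divide sgn_if)
  ultimately show ?thesis
    by (auto elim!: Lim_transform_eventually simp: eventually_at_filter)
qed

lemma Y_deriv_0: "(Y has_real_derivative 1) (at 0)"
  using Y_quotient_limit by (simp add: has_field_derivative_iff Y_0)

lemma Y_deriv:
  assumes "bm \<le> u" "u \<le> bp" "u \<noteq> 0"
  shows "(Y has_real_derivative f u / Y u) (at u)"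
proof (cases "u > 0")
  case True
  have "((\<lambda>u. sqrt (2 * F u)) has_real_derivative f u / Y u) (at u)"
    using F_pos[OF assms] True by (auto intro!: derivative_eq_intros F_deriv assms simp: Y_def field_simps)
  then show ?thesis
    by (rule has_field_derivative_transform_within_open[of _ _ _ "{0<..}"]) (use True in \<open>auto simp: Y_def\<close>)
next
  case False
  then have "u < 0" using assms by simp
  have "((\<lambda>u. - sqrt (2 * F u)) has_real_derivative f u / Y u) (at u)"
    using F_pos[OF assms] \<open>u < 0\<close> by (auto intro!: derivative_eq_intros F_deriv assms simp: Y_def field_simps)
  then show ?thesis
    by (rule has_field_derivative_transform_within_open[of _ _ _ "{..<0}"]) (use \<open>u < 0\<close> in \<open>auto simp: Y_def\<close>)
qed

lemma Y_isCont: "bm \<le> u \<Longrightarrow> u \<le> bp \<Longrightarrow> isCont Y u"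
  using Y_deriv[of u] Y_deriv_0 by (cases "u = 0") (auto intro: DERIV_isCont)

section \<open>The inverse of the energy coordinate and its derivatives\<close>

definition h :: "real \<Rightarrow> real" where
  "h = inv_into {bm..bp} Y"

lemma h_Y: "bm \<le> u \<Longrightarrow> u \<le> bp \<Longrightarrow> h (Y u) = u"
  unfolding h_def by (rule inv_into_f_f[OF Y_inj]) auto

lemma Y_h:
  assumes "ym < y" "y < yp"
  shows "Y (h y) = y" "bm < h y" "h y < bp"
proof -
  have "\<exists>x\<ge>bm. x \<le> bp \<and> Y x = y"
    by (rule IVT) (use assms Y_isCont bm bp in \<open>auto simp: ym_def yp_def\<close>)
  then obtain x where x: "bm \<le> x" "x \<le> bp" "Y x = y" by auto
  then show e: "Y (h y) = y" using h_Y by auto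
  have "h y = x" using x h_Y by auto
  moreover have "x \<noteq> bm" "x \<noteq> bp" using x assms by (auto simp: ym_def yp_def)
  ultimately show "bm < h y" "h y < bp" using x by auto
qed

lemma Y_in: "bm < u \<Longrightarrow> u < bp \<Longrightarrow> ym < Y u \<and> Y u < yp"
  using Y_strict_mono[of bm u] Y_strict_mono[of u bp] by (auto simp: ym_def yp_def)

lemma h_0: "h 0 = 0"
  using h_Y[of 0] bm bp by (simp add: Y_0)

lemma h_eq_0_iff: "ym < y \<Longrightarrow> y < yp \<Longrightarrow> h y = 0 \<longleftrightarrow> y = 0"
  using Y_h(1)[of y] Y_0 h_0 by auto

text \<open>The derivative of \<open>h\<close>: since Y^2 / 2 is the primitive of \<open>f\<close>,
  the derivative of \<open>Y\<close> is f / Y. The value at 0 is the limit.\<close>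

definition h1 :: "real \<Rightarrow> real" where
  "h1 y = (if y = 0 then 1 else y / f (h y))"

text \<open>The second derivative of \<open>h\<close>, from differentiating the identity f(h(y))
  h1(y) = y. At 0 the division by 0 yields 0, which is the true value by
  \<open>h2_tendsto_0\<close>.\<close>

definition h2 :: "real \<Rightarrow> real" where
  "h2 y = (1 - f' (h y) * (h1 y)\<^sup>2) / f (h y)"

lemma f_h_nz: "ym < y \<Longrightarrow> y < yp \<Longrightarrow> y \<noteq> 0 \<Longrightarrow> f (h y) \<noteq> 0"
  using f_pos[of "h y"] f_neg[of "h y"] Y_h[of y] h_eq_0_iff[of y] by (cases "h y > 0") auto

lemma f_h_h1: "ym < y \<Longrightarrow> y < yp \<Longrightarrow> f (h y) * h1 y = y"
  using f_h_nz[of y] by (auto simp: h1_def h_0 f_0)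

lemma h1_h2: "ym < y \<Longrightarrow> y < yp \<Longrightarrow> f' (h y) * (h1 y)\<^sup>2 + f (h y) * h2 y = 1"
  using f_h_nz[of y] by (cases "y = 0") (auto simp: h2_def h1_def h_0 f_0 f'_0)

lemma h_isCont:
  assumes "ym < y" "y < yp"
  shows "isCont h y"
proof -
  define u where "u = h y"
  have u: "bm < u" "u < bp" "Y u = y" using Y_h[OF assms] by (auto simp: u_def)
  define d where "d = min (u - bm) (bp - u) / 2"
  have d: "0 < d" "bm \<le> u - d" "u + d \<le> bp" using u by (auto simp: d_def field_simps min_def)
  have "isCont h (Y u)"
  proof (rule isCont_inverse_function[where f = Y and g = h and x = u, OF d(1)])
    fix z assume "\<bar>z - u\<bar> \<le> d"
    then show "h (Y z) = z" "isCont Y z" using d by (auto intro!: h_Y Y_isCont)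
  qed
  then show ?thesis by (simp add: u)
qed

lemma h_deriv:
  assumes "ym < y" "y < yp"
  shows "(h has_real_derivative h1 y) (at y)"
proof -
  define D where "D = (if y = 0 then 1 else f (h y) / y)"
  have D: "(Y has_real_derivative D) (at (h y))"
    using Y_deriv_0 Y_deriv[of "h y"] Y_h[OF assms] h_eq_0_iff[OF assms] by (auto simp: D_def h_0)
  have "D \<noteq> 0" using f_h_nz[OF assms] by (auto simp: D_def)
  have "(h has_real_derivative inverse D) (at y)"
    by (rule DERIV_inverse_function[where f = Y and g = h and a = ym and b = yp and x = y, OF D \<open>D \<noteq> 0\<close> assms])
      (use Y_h h_isCont assms in auto)
  then show ?thesis by (auto simp: D_def h1_def split: if_splits)
qed

lemma near_0: "\<forall>\<^sub>F y in at 0. ym < y \<and> y < yp \<and> y \<noteq> 0"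
proof -
  have "\<forall>\<^sub>F y in at 0. y \<in> {ym<..<yp} - {0}"
    using ym_neg yp_pos by (intro eventually_at_in_open) auto
  then show ?thesis by eventually_elim auto
qed

lemma h_tendsto_0: "filterlim h (at 0) (at 0)"
proof -
  have "(h \<longlongrightarrow> 0) (at 0)" using h_isCont[of 0] ym_neg yp_pos by (simp add: isCont_def h_0)
  moreover have "\<forall>\<^sub>F y in at 0. h y \<noteq> 0"
    using near_0 by eventually_elim (use h_eq_0_iff in auto)
  ultimately show ?thesis by (simp add: filterlim_at)
qed

lemma h1_tendsto_0: "(h1 \<longlongrightarrow> 1) (at 0)"
proof -
  have "((\<lambda>u. (Y u / u) / (f u / u)) \<longlongrightarrow> 1 / 1) (at 0)"
    by (intro tendsto_divide Y_quotient_limit slope_limit) simp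
  then have "((\<lambda>y. (Y (h y) / h y) / (f (h y) / h y)) \<longlongrightarrow> 1) (at 0)"
    using filterlim_compose[OF _ h_tendsto_0] by simp
  moreover have "\<forall>\<^sub>F y in at 0. (Y (h y) / h y) / (f (h y) / h y) = h1 y"
    using near_0 by eventually_elim (use Y_h(1) h_eq_0_iff in \<open>auto simp: h1_def\<close>)
  ultimately show ?thesis by (rule Lim_transform_eventually)
qed

text \<open>The numerator of \<open>h2\<close> when the denominator is f^3. In its derivative the
  terms f f' cancel and only F f'' is left, so the sign condition on \<open>f''\<close> makes
  \<open>N\<close> positive away from 0. This is the source of all monotonicity in the
  amplitude.\<close>

definition N :: "real \<Rightarrow> real" where
  "N u = (f u)\<^sup>2 - 2 * F u * f' u"

lemma N_0: "N 0 = 0"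
  by (simp add: N_def f_0 F_0)

lemma N_deriv: "bm \<le> u \<Longrightarrow> u \<le> bp \<Longrightarrow> (N has_real_derivative - 2 * F u * f'' u) (at u)"
  unfolding N_def by (auto intro!: derivative_eq_intros f_deriv f'_deriv F_deriv simp: power2_eq_square)

lemma N_cont: "continuous_on {bm..bp} N"
  by (rule DERIV_continuous_on, rule has_field_derivative_at_within, rule N_deriv) auto

lemma N_pos:
  assumes "bm \<le> u" "u \<le> bp" "u \<noteq> 0"
  shows "0 < N u"
proof (cases "u > 0")
  case True
  have "N 0 < N u"
  proof (rule DERIV_pos_imp_increasing_open[OF True])
    fix x assume x: "0 < x" "x < u"
    then have "F x > 0" "f'' x < 0" using F_pos[of x] f''_sign[of x] assms bm by (auto simp: mult_less_0_iff)
    then have "- 2 * F x * f'' x > 0" by (simp add: mult_pos_neg)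
    then show "\<exists>y. (N has_real_derivative y) (at x) \<and> 0 < y"
      using N_deriv[of x] x assms bm by auto
  next
    show "continuous_on {0..u} N"
      by (rule continuous_on_subset[OF N_cont]) (use assms bm in auto)
  qed
  then show ?thesis by (simp add: N_0)
next
  case False
  then have u: "u < 0" using assms by simp
  have "N u > N 0"
  proof (rule DERIV_neg_imp_decreasing_open[OF u])
    fix x assume x: "u < x" "x < 0"
    then have "F x > 0" "f'' x > 0" using F_pos[of x] f''_sign[of x] assms bp by (auto simp: mult_less_0_iff)
    then have "- 2 * F x * f'' x < 0" by simp
    then show "\<exists>y. (N has_real_derivative y) (at x) \<and> y < 0"
      using N_deriv[of x] x assms bp by auto
  next
    show "continuous_on {u..0} N"
      by (rule continuous_on_subset[OF N_cont]) (use assms bp in auto)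
  qed
  then show ?thesis by (simp add: N_0)
qed

lemma h2_N:
  assumes "ym < y" "y < yp" "y \<noteq> 0"
  shows "h2 y = N (h y) / (f (h y)) ^ 3"
proof -
  have "y\<^sup>2 = 2 * F (h y)" using Y_sq[of "h y"] Y_h[OF assms(1,2)] by simp
  then show ?thesis using f_h_nz[OF assms] assms(3)
    by (simp add: h2_def h1_def N_def power_divide field_simps power2_eq_square power3_eq_cube)
qed

lemma h2_sign:
  assumes "ym < y" "y < yp" "y \<noteq> 0"
  shows "0 < y * h2 y"
proof -
  define u where "u = h y"
  have u: "bm < u" "u < bp" "u \<noteq> 0" using Y_h[OF assms(1,2)] h_eq_0_iff[OF assms(1,2)] assms by (auto simp: u_def)
  have "y = Y u" using Y_h[OF assms(1,2)] by (simp add: u_def)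
  have "0 < Y u * f u"
    using u Y_pos[of u] Y_neg[of u] f_pos[of u] f_neg[of u] by (cases "u > 0") (auto simp: mult_neg_neg)
  moreover have "h2 y = N u / (f u) ^ 3" using h2_N[OF assms] by (simp add: u_def)
  moreover have "0 < N u" using N_pos u by auto
  moreover have "y * (N u / (f u) ^ 3) = N u * (Y u * f u) / (f u) ^ 4"
    using \<open>y = Y u\<close> by (simp add: power_def field_simps)
  ultimately show ?thesis using f_h_nz[OF assms] by (simp add: u_def)
qed

lemma h2_0: "h2 0 = 0"
  by (simp add: h2_def h_0 f_0)

text \<open>N(u) is of smaller order than u^3: by L'Hospital the quotient behaves like -(1/3) (2 F /
  u^2) f'', where 2 F / u^2 tends to 1 and f''(0) = 0.\<close>

lemma h2_tendsto_0: "(h2 \<longlongrightarrow> 0) (at 0)"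
proof -
  have near: "\<forall>\<^sub>F u in at 0. bm < u \<and> u < bp"
    using bm bp by (intro eventually_at_in_open'[of "{bm<..<bp}" 0, simplified]) auto
  have "((\<lambda>u. N u / u ^ 3) \<longlongrightarrow> 0) (at 0)"
  proof (rule lhopital[where f' = "\<lambda>u. - 2 * F u * f'' u" and g' = "\<lambda>u. 3 * u\<^sup>2"])
    show "(N \<longlongrightarrow> 0) (at 0)" using DERIV_isCont[OF N_deriv[of 0]] bm bp by (simp add: isCont_def N_0)
    show "\<forall>\<^sub>F u in at 0. (N has_real_derivative - 2 * F u * f'' u) (at u)"
      using near by eventually_elim (rule N_deriv; simp)
    have "((\<lambda>u. - (1 / 3) * (2 * F u / u\<^sup>2) * f'' u) \<longlongrightarrow> - (1 / 3) * 1 * f'' 0) (at 0)"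
      using f''_cont by (intro tendsto_intros F_quotient_limit) (auto simp: continuous_on_eq_continuous_at isCont_def)
    then show "((\<lambda>u. - 2 * F u * f'' u / (3 * u\<^sup>2)) \<longlongrightarrow> 0) (at 0)" by (simp add: f''_0 mult_ac)
    show "\<forall>\<^sub>F u in at 0. ((\<lambda>u. u ^ 3) has_real_derivative 3 * u\<^sup>2) (at (u::real))"
      by (rule always_eventually) (auto intro!: derivative_eq_intros)
  qed (auto simp: eventually_at_filter intro!: tendsto_eq_intros)
  then have "((\<lambda>u. (N u / u ^ 3) / (f u / u) ^ 3) \<longlongrightarrow> 0 / 1 ^ 3) (at 0)"
    by (intro tendsto_divide tendsto_power slope_limit) auto
  then have "((\<lambda>y. (N (h y) / h y ^ 3) / (f (h y) / h y) ^ 3) \<longlongrightarrow> 0) (at 0)"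
    using filterlim_compose[OF _ h_tendsto_0] by simp
  moreover have "\<forall>\<^sub>F y in at 0. (N (h y) / h y ^ 3) / (f (h y) / h y) ^ 3 = h2 y"
    using near_0 by eventually_elim (use h2_N h_eq_0_iff in \<open>auto simp: power_divide\<close>)
  ultimately show ?thesis by (rule Lim_transform_eventually)
qed

lemma h1_deriv:
  assumes "ym < y" "y < yp"
  shows "(h1 has_real_derivative h2 y) (at y)"
proof -
  have gen: "(h1 has_real_derivative h2 y) (at y)" if "ym < y" "y < yp" "y \<noteq> 0" for y
  proof -
    have "((\<lambda>y. y / f (h y)) has_real_derivative h2 y) (at y)"
      using that f_h_nz[OF that]
      by (auto intro!: derivative_eq_intros DERIV_chain2[OF f_deriv] h_deriv
          simp: h2_def h1_def field_simps power2_eq_square)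
    then show ?thesis
      by (rule has_field_derivative_transform_within_open[of _ _ _ "- {0}"]) (use that in \<open>auto simp: h1_def\<close>)
  qed
  show ?thesis
  proof (cases "y = 0")
    case True
    have "(h1 has_real_derivative 0) (at 0)"
    proof (rule DERIV_at_from_limit[OF _ _ h2_tendsto_0])
      show "isCont h1 0" using h1_tendsto_0 by (simp add: isCont_def h1_def)
      show "\<forall>\<^sub>F y in at 0. (h1 has_real_derivative h2 y) (at y)"
        using near_0 by eventually_elim (auto intro: gen)
    qed
    then show ?thesis using True by (simp add: h2_0)
  qed (use gen assms in auto)
qed

lemma h1_cont: "continuous_on {ym<..<yp} h1"
  by (rule DERIV_continuous_on, rule has_field_derivative_at_within, rule h1_deriv) auto

lemma h2_cont: "continuous_on {ym<..<yp} h2"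
proof (intro continuous_at_imp_continuous_on ballI)
  fix y assume y: "y \<in> {ym<..<yp}"
  show "isCont h2 y"
  proof (cases "y = 0")
    case True
    then show ?thesis using h2_tendsto_0 by (simp add: isCont_def h2_0)
  next
    case False
    have "isCont (\<lambda>y. f' (h y)) y" "isCont (\<lambda>y. f (h y)) y" "isCont h1 y"
      using y by (auto intro!: isCont_o2[of y h] h_isCont DERIV_isCont[OF f_deriv] DERIV_isCont[OF f'_deriv]
          DERIV_isCont[OF h1_deriv])
    then show ?thesis unfolding h2_def using f_h_nz y False by (intro continuous_intros) auto
  qed
qed

lemma h1_mono_pos:
  assumes "0 \<le> y" "y < z" "z < yp" shows "h1 y < h1 z"
proof (rule DERIV_pos_imp_increasing_open[OF assms(2)])
  fix x assume "y < x" "x < z"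
  then show "\<exists>d. (h1 has_real_derivative d) (at x) \<and> 0 < d"
    using h1_deriv[of x] h2_sign[of x] assms ym_neg by (auto simp: zero_less_mult_iff)
qed (use assms ym_neg in \<open>auto intro: continuous_on_subset[OF h1_cont]\<close>)

lemma h1_mono_neg:
  assumes "z < y" "y \<le> 0" "ym < z" shows "h1 y < h1 z"
proof (rule DERIV_neg_imp_decreasing_open[OF assms(1)])
  fix x assume "z < x" "x < y"
  then show "\<exists>d. (h1 has_real_derivative d) (at x) \<and> d < 0"
    using h1_deriv[of x] h2_sign[of x] assms yp_pos by (auto simp: zero_less_mult_iff)
qed (use assms yp_pos in \<open>auto intro: continuous_on_subset[OF h1_cont]\<close>)

lemma h1_ge_1: "ym < y \<Longrightarrow> y < yp \<Longrightarrow> 1 \<le> h1 y"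
  using h1_mono_pos[of 0 y] h1_mono_neg[of y 0] by (cases "y = 0"; cases "y > 0") (auto simp: h1_def)

end

text \<open>Near 0 the function has the sign of its argument because f'(0) = 1, and far out it has
  the opposite sign; the intermediate value theorem gives a zero on each side.\<close>

lemma sublinear_zeros:
  fixes f f' :: "real \<Rightarrow> real"
  assumes f_deriv: "\<And>u. (f has_real_derivative f' u) (at u)"
    and f_0: "f 0 = 0" and f'_0: "f' 0 = 1"
    and limsup: "Limsup at_infinity (\<lambda>u. ereal (f u / u)) < 0"
  obtains bm bp where "bm < 0" "f bm = 0" "0 < bp" "f bp = 0"
proof -
  have "\<forall>\<^sub>F u in at_infinity. ereal (f u / u) < 0" by (rule Limsup_lessD[OF limsup])
  then obtain B where B: "\<And>u. B \<le> \<bar>u\<bar> \<Longrightarrow> f u / u < 0" by (auto simp: eventually_at_infinity)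
  have c: "isCont f u" for u using f_deriv by (rule DERIV_isCont)
  obtain d where d: "0 < d" "\<And>e. 0 < e \<Longrightarrow> e < d \<Longrightarrow> f 0 < f (0 + e)"
    using DERIV_pos_inc_right[OF f_deriv[of 0]] f'_0 by auto
  obtain d' where d': "0 < d'" "\<And>e. 0 < e \<Longrightarrow> e < d' \<Longrightarrow> f (0 - e) < f 0"
    using DERIV_pos_inc_left[OF f_deriv[of 0]] f'_0 by auto
  define K where "K = max 1 B"
  have K: "0 < K" "f K < 0" "f (- K) > 0"
  proof -
    have K: "0 < K" "B \<le> \<bar>K\<bar>" "B \<le> \<bar>- K\<bar>" by (auto simp: K_def)
    from B[OF K(2)] B[OF K(3)] K(1) show "0 < K" "f K < 0" "f (- K) > 0"
      by (auto simp: divide_less_0_iff zero_less_divide_iff)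
  qed
  define e where "e = min (min d d') K / 2"
  have e: "0 < e" "e < d" "e < d'" "e < K" using d d' K by (auto simp: e_def min_def)
  have "\<exists>x\<ge>e. x \<le> K \<and> f x = 0"
    by (rule IVT2) (use c e d(2)[of e] K f_0 in auto)
  moreover have "\<exists>x\<ge>-K. x \<le> -e \<and> f x = 0"
    by (rule IVT2) (use c e d'(2)[of e] K f_0 in auto)
  ultimately obtain x y where "e \<le> x" "f x = 0" "y \<le> - e" "f y = 0" by blast
  then show ?thesis using e(1) by (intro that[of y x]) auto
qed

subsection \<open>The phase of a solution\<close>

lemma strict_mono_from_deriv:
  fixes \<theta> :: "real \<Rightarrow> real"
  assumes "\<And>x. x \<in> {a..b} \<Longrightarrow> (\<theta> has_real_derivative d x) (at x within {a..b})"
    "\<And>x. x \<in> {a..b} \<Longrightarrow> 0 < d x" "a \<le> x" "x < y" "y \<le> b"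
  shows "\<theta> x < \<theta> y"
proof (rule DERIV_pos_imp_increasing_open[OF assms(4)])
  fix z assume z: "x < z" "z < y"
  then have "at z within {a..b} = at z" by (intro at_within_Icc_at) (use assms in auto)
  then show "\<exists>d. (\<theta> has_real_derivative d) (at z) \<and> 0 < d"
    using assms(1)[of z] assms(2)[of z] z assms(3,5) by auto
next
  have "continuous_on {a..b} \<theta>" by (rule DERIV_continuous_on[OF assms(1)])
  then show "continuous_on {x..y} \<theta>" by (rule continuous_on_subset) (use assms in auto)
qed

text \<open>Separation of variables: \<theta> is the inverse function of the primitive of
  \<open>g\<close>, evaluated at \<omega> x. This applies to the phase equation, whose right-hand
  side depends on \<theta> alone.\<close>

lemma autonomous_ode_solution:
  fixes g :: "real \<Rightarrow> real"
  assumes g: "continuous_on {0..L} g" "\<And>\<theta>. \<theta> \<in> {0..L} \<Longrightarrow> 0 < g \<theta>" and L: "0 \<le> L" and \<omega>: "0 < \<omega>"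
    and X: "X = integral {0..L} g / \<omega>"
  obtains \<theta> where "\<And>x. x \<in> {0..X} \<Longrightarrow> (\<theta> has_real_derivative \<omega> / g (\<theta> x)) (at x within {0..X})"
    "\<And>x. x \<in> {0..X} \<Longrightarrow> \<theta> x \<in> {0..L}" "\<theta> 0 = 0" "\<theta> X = L"
proof -
  \<comment> \<open>\<open>g\<close> is continued by constants beyond [0, L], so that the inverse
    function theorem applies at the end points too.\<close>
  define gc where "gc t = g (max 0 (min L t))" for t
  have gc: "continuous_on S gc" for S
    unfolding gc_def by (rule continuous_on_compose2[OF g(1)]) (use L in \<open>auto intro!: continuous_intros\<close>)
  have gc_pos: "0 < gc t" for t unfolding gc_def using g(2)[of "max 0 (min L t)"] L by auto
  define G where "G t = integral {-1..t} gc - integral {-1..0} gc" for t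
  have dG: "(G has_real_derivative gc t) (at t)" if "- 1 < t" "t < L + 1" for t
  proof -
    have "((\<lambda>x. integral {-1..x} gc) has_real_derivative gc t) (at t within {-1..L+1})"
      by (rule integral_has_real_derivative) (use that gc in auto)
    moreover have "at t within {-1..L+1} = at t" by (rule at_within_Icc_at) (use that in auto)
    ultimately show ?thesis unfolding G_def by (auto intro!: derivative_eq_intros)
  qed
  have contG: "isCont G t" if "- 1 < t" "t < L + 1" for t using dG[OF that] by (rule DERIV_isCont)
  have monoG: "G x < G y" if "- 1 < x" "x < y" "y < L + 1" for x y
  proof (rule DERIV_pos_imp_increasing[OF that(2)])
    fix z assume "x \<le> z" "z \<le> y"
    then show "\<exists>d. (G has_real_derivative d) (at z) \<and> 0 < d" using dG[of z] gc_pos that by auto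
  qed
  define a b where "a = - (1/2::real)" and "b = L + 1/2"
  have ab: "- 1 < a" "a < 0" "L < b" "b < L + 1" by (auto simp: a_def b_def)
  have G0: "G 0 = 0" by (simp add: G_def)
  have GL: "G L = \<omega> * X"
  proof -
    have "integral {-1..0} gc + integral {0..L} gc = integral {-1..L} gc"
      by (rule Henstock_Kurzweil_Integration.integral_combine) (use L gc in \<open>auto intro!: integrable_continuous_real\<close>)
    moreover have "integral {0..L} gc = integral {0..L} g"
      by (rule integral_cong) (auto simp: gc_def)
    ultimately show ?thesis using \<omega> by (simp add: G_def X)
  qed
  have injG: "inj_on G {a..b}"
    by (rule strict_mono_on_imp_inj_on) (use ab in \<open>auto simp: strict_mono_on_def intro!: monoG\<close>)
  define H where "H = inv_into {a..b} G"
  have HG: "H (G t) = t" if "a \<le> t" "t \<le> b" for t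
    unfolding H_def by (rule inv_into_f_f[OF injG]) (use that in auto)
  have GH: "G (H y) = y \<and> a \<le> H y \<and> H y \<le> b" if "G a < y" "y < G b" for y
  proof -
    have "\<exists>x\<ge>a. x \<le> b \<and> G x = y"
      by (rule IVT) (use that contG ab L in auto)
    then show ?thesis using HG by auto
  qed
  have rng: "G a < \<omega> * x \<and> \<omega> * x < G b" if "x \<in> {0..X}" for x
  proof -
    have "G a < 0" "\<omega> * X < G b" using monoG[of a 0] monoG[of L b] ab L G0 GL by auto
    moreover have "0 \<le> \<omega> * x" "\<omega> * x \<le> \<omega> * X" using that \<omega> by auto
    ultimately show ?thesis by linarith
  qed
  define \<theta> where "\<theta> x = H (\<omega> * x)" for x
  have \<theta>0: "\<theta> 0 = 0" using HG[of 0] ab L by (simp add: \<theta>_def G0)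
  have \<theta>X: "\<theta> X = L" using HG[of L] ab L by (simp add: \<theta>_def GL[symmetric])
  have \<theta>in: "\<theta> x \<in> {0..L}" if x: "x \<in> {0..X}" for x
  proof -
    have GHx: "G (\<theta> x) = \<omega> * x" "a \<le> \<theta> x" "\<theta> x \<le> b" using GH[of "\<omega> * x"] rng[OF x] by (auto simp: \<theta>_def)
    have "\<not> \<theta> x < 0"
      using monoG[of "\<theta> x" 0] GHx ab G0 x \<omega> L by (auto simp: mult_less_0_iff)
    moreover have "\<not> L < \<theta> x"
    proof
      assume "L < \<theta> x"
      then have "\<omega> * X < \<omega> * x" using monoG[of L "\<theta> x"] GHx ab GL L by auto
      then show False using x \<omega> by auto
    qed
    ultimately show ?thesis by auto
  qed
  have "(\<theta> has_real_derivative \<omega> / g (\<theta> x)) (at x within {0..X})" if x: "x \<in> {0..X}" for x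
  proof -
    define y where "y = \<omega> * x"
    have y: "G a < y" "y < G b" using rng[OF x] by (auto simp: y_def)
    have Hy: "H y \<in> {0..L}" using \<theta>in[OF x] by (simp add: \<theta>_def y_def)
    have "isCont H (G (H y))"
    proof (rule isCont_inverse_function[where f = G and g = H and x = "H y" and d = "1/2"])
      fix z assume z: "\<bar>z - H y\<bar> \<le> 1/2"
      then have "z - H y \<le> 1/2" "H y - z \<le> 1/2"
        using abs_ge_self[of "z - H y"] abs_ge_minus_self[of "z - H y"] by linarith+
      then have "a \<le> z" "z \<le> b" using Hy unfolding a_def b_def atLeastAtMost_iff by linarith+
      then show "H (G z) = z" "isCont G z" using HG contG ab by auto
    qed simp
    then have cH: "isCont H y" using GH[OF y] by simp
    have "(H has_real_derivative inverse (gc (H y))) (at y)"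
      by (rule DERIV_inverse_function[where f = G and g = H and a = "G a" and b = "G b" and x = y, OF dG _ y _ cH])
        (use Hy GH gc_pos[of "H y"] in auto)
    then have "(\<theta> has_real_derivative inverse (gc (H y)) * \<omega>) (at x)"
      unfolding \<theta>_def y_def by (rule DERIV_chain2) (auto intro!: derivative_eq_intros)
    moreover have "gc (H y) = g (\<theta> x)" using Hy by (auto simp: gc_def \<theta>_def y_def)
    ultimately show ?thesis by (simp add: field_simps has_field_derivative_at_within)
  qed
  with \<theta>in \<theta>0 \<theta>X show ?thesis using that by blast
qed

text \<open>The increasing phase maps the interior zeros bijectively onto the multiples of pi
  strictly between 0 and n pi.\<close>

lemma card_phase_zeros:
  fixes \<theta> :: "real \<Rightarrow> real"
  assumes mono: "\<And>x y. 0 \<le> x \<Longrightarrow> x < y \<Longrightarrow> y \<le> X \<Longrightarrow> \<theta> x < \<theta> y" and "continuous_on {0..X} \<theta>"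
    and "\<theta> 0 = 0" "\<theta> X = real n * pi" and X: "0 < X"
  shows "finite {x \<in> {0<..<X}. sin (\<theta> x) = 0}" "card {x \<in> {0<..<X}. sin (\<theta> x) = 0} = n - 1"
proof -
  define Z where "Z = {x \<in> {0<..<X}. sin (\<theta> x) = 0}"
  have inj: "inj_on \<theta> Z"
    by (rule strict_mono_on_imp_inj_on) (auto simp: strict_mono_on_def Z_def intro!: mono)
  have "\<theta> ` Z = (\<lambda>i. real i * pi) ` {1..<n}"
  proof (intro equalityI subsetI)
    fix y assume "y \<in> \<theta> ` Z"
    then obtain x where x: "y = \<theta> x" "0 < x" "x < X" "sin y = 0" by (auto simp: Z_def)
    then obtain i :: int where i: "y = of_int i * pi" by (auto simp: sin_zero_iff_int2)
    have "0 < y" "y < real n * pi" using mono[of 0 x] mono[of x X] x assms by auto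
    then have "0 < i" "i < int n" using i by (auto simp: zero_less_mult_iff of_int_less_iff[symmetric] simp del: of_int_less_iff)
    then show "y \<in> (\<lambda>i. real i * pi) ` {1..<n}" using i by (intro image_eqI[of _ _ "nat i"]) auto
  next
    fix y assume "y \<in> (\<lambda>i. real i * pi) ` {1..<n}"
    then obtain i where i: "y = real i * pi" "1 \<le> i" "i < n" by auto
    have "\<exists>x\<ge>0. x \<le> X \<and> \<theta> x = y"
      by (rule IVT') (use assms i X in auto)
    then obtain x where x: "0 \<le> x" "x \<le> X" "\<theta> x = y" by auto
    moreover have "x \<noteq> 0" "x \<noteq> X" using x i assms by auto
    moreover have "sin y = 0" unfolding i(1) by (simp add: sin_zero_iff_int2)
    ultimately show "y \<in> \<theta> ` Z" by (auto simp: Z_def)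
  qed
  moreover have "inj_on (\<lambda>i. real i * pi) {1..<n}" by (auto simp: inj_on_def)
  ultimately have "finite (\<theta> ` Z)" "card (\<theta> ` Z) = n - 1" by (auto simp: card_image)
  then show "finite {x \<in> {0<..<X}. sin (\<theta> x) = 0}" "card {x \<in> {0<..<X}. sin (\<theta> x) = 0} = n - 1"
    unfolding Z_def[symmetric] using inj by (simp_all add: card_image finite_image_iff)
qed

text \<open>At a positive maximum above \<open>b\<close> the second derivative would be positive, so
  the function would increase further to the right. A maximum equal to \<open>b\<close> is excluded
  by uniqueness, as the constant \<open>b\<close> is a solution that violates the boundary
  condition. The second claim provides a turning point at which the energy can be evaluated.\<close>

lemma solution_below:
  fixes g g' :: "real \<Rightarrow> real"
  assumes g: "\<And>s. (g has_real_derivative g' s) (at s)" "continuous_on UNIV g'"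
    and b: "0 < b" "g b = 0" "\<And>s. b < s \<Longrightarrow> g s > 0"
    and u: "\<And>x. x \<in> {0..pi} \<Longrightarrow> (u has_real_derivative u1 x) (at x within {0..pi})"
    "\<And>x. x \<in> {0..pi} \<Longrightarrow> (u1 has_real_derivative g (u x)) (at x within {0..pi})"
    and bc: "u 0 = 0" "u pi = 0"
  shows "\<And>x. x \<in> {0..pi} \<Longrightarrow> u x < b"
    and "x1 \<in> {0..pi} \<Longrightarrow> 0 < u x1 \<Longrightarrow> \<exists>x\<in>{0..pi}. u1 x = 0 \<and> 0 < u x"
proof -
  have cu: "continuous_on {0..pi} u" by (rule DERIV_continuous_on[OF u(1)])
  obtain x0 where x0: "x0 \<in> {0..pi}" "\<And>x. x \<in> {0..pi} \<Longrightarrow> u x \<le> u x0"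
    using continuous_attains_sup[OF _ _ cu] by auto
  have int: "x0 \<in> {0<..<pi}" "at x0 within {0..pi} = at x0" if "0 < u x0"
  proof -
    have "x0 \<noteq> 0" "x0 \<noteq> pi" using that bc by auto
    then show "x0 \<in> {0<..<pi}" using x0 by auto
    then show "at x0 within {0..pi} = at x0" by (intro at_within_Icc_at) auto
  qed
  have crit: "u1 x0 = 0" if pos: "0 < u x0"
  proof (rule DERIV_local_max[of u "u1 x0" x0 "min x0 (pi - x0)"])
    show "(u has_real_derivative u1 x0) (at x0)" using u(1)[OF x0(1)] int[OF pos] by simp
    show "0 < min x0 (pi - x0)" using int(1)[OF pos] by auto
    show "\<forall>y. \<bar>x0 - y\<bar> < min x0 (pi - x0) \<longrightarrow> u y \<le> u x0"
      by (auto intro!: x0(2))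
  qed
  show "\<exists>x\<in>{0..pi}. u1 x = 0 \<and> 0 < u x" if "x1 \<in> {0..pi}" "0 < u x1"
    using crit x0(1) x0(2)[OF that(1)] that(2) by (intro bexI[of _ x0]) auto
  have "u x0 < b"
  proof (rule ccontr)
    assume "\<not> ?thesis"
    then have ge: "b \<le> u x0" by simp
    then have pos: "0 < u x0" using b by simp
    note i = int[OF pos] and c = crit[OF pos]
    show False
    proof (cases "u x0 = b")
      case True
      have "u 0 = b \<and> u1 0 = 0"
        by (rule second_order_unique[of g g' 0 pi u u1 "\<lambda>_. b" "\<lambda>_. 0" x0 0, OF g u])
          (use True c x0 b in auto)
      then show False using bc b by simp
    next
      case False
      then have "g (u x0) > 0" using b ge by auto
      then obtain d where d: "0 < d" "\<And>e. 0 < e \<Longrightarrow> e < d \<Longrightarrow> u1 x0 < u1 (x0 + e)"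
        using DERIV_pos_inc_right[of u1 "g (u x0)" x0] u(2)[OF x0(1)] i(2) by auto
      define e where "e = min d (pi - x0) / 2"
      have e: "0 < e" "e < d" "x0 + e < pi" using d i by (auto simp: e_def min_def field_simps)
      have "u x0 < u (x0 + e)"
      proof (rule DERIV_pos_imp_increasing_open[of x0 "x0 + e" u])
        fix z assume z: "x0 < z" "z < x0 + e"
        then have "at z within {0..pi} = at z" using i e by (intro at_within_Icc_at) auto
        moreover have "0 < u1 z" using d(2)[of "z - x0"] z e c by auto
        ultimately show "\<exists>y. (u has_real_derivative y) (at z) \<and> 0 < y"
          using u(1)[of z] z i e by auto
      qed (use e i in \<open>auto intro: continuous_on_subset[OF cu]\<close>)
      then show False using x0(2)[of "x0 + e"] e i by auto
    qed
  qed
  then show "u x < b" if "x \<in> {0..pi}" for x using x0(2)[OF that] by simp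
qed

context nonlinearity
begin

text \<open>The amplitude \<open>p\<close> carries the sign of the initial slope. The bounds
  \<open>ym\<close> and \<open>yp\<close> are part of the predicate because \<open>h\<close> and
  \<open>h1\<close> have their meaning only between them.\<close>

definition phase :: "real \<Rightarrow> real \<Rightarrow> real \<Rightarrow> (real \<Rightarrow> real) \<Rightarrow> bool" where
  "phase p lam X \<theta> \<longleftrightarrow> \<theta> 0 = 0 \<and> (\<forall>x\<in>{0..X}.
     (\<theta> has_real_derivative sqrt lam / h1 (p * sin (\<theta> x))) (at x within {0..X})
     \<and> ym < p * sin (\<theta> x) \<and> p * sin (\<theta> x) < yp)"

lemma phaseD:
  assumes "phase p lam X \<theta>"
  shows "\<theta> 0 = 0"
    "x \<in> {0..X} \<Longrightarrow> (\<theta> has_real_derivative sqrt lam / h1 (p * sin (\<theta> x))) (at x within {0..X})"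
    "x \<in> {0..X} \<Longrightarrow> ym < p * sin (\<theta> x)" "x \<in> {0..X} \<Longrightarrow> p * sin (\<theta> x) < yp"
  using assms by (auto simp: phase_def)

lemma phase_cont: "phase p lam X \<theta> \<Longrightarrow> continuous_on {0..X} \<theta>"
  by (rule DERIV_continuous_on, rule phaseD(2))

lemma h1_pos: "ym < y \<Longrightarrow> y < yp \<Longrightarrow> 0 < h1 y"
  using h1_ge_1[of y] by simp

lemma phase_mono:
  assumes "phase p lam X \<theta>" "0 < lam" "0 \<le> x" "x < y" "y \<le> X"
  shows "\<theta> x < \<theta> y"
  by (rule strict_mono_from_deriv[OF phaseD(2)[OF assms(1)] _ assms(3-5)])
    (use assms(2) phaseD[OF assms(1)] h1_pos in auto)

lemma phase_subset:
  assumes "phase p lam X \<theta>" "X' \<le> X"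
  shows "phase p lam X' \<theta>"
  unfolding phase_def
proof (intro conjI ballI)
  fix x assume "x \<in> {0..X'}"
  then have x: "x \<in> {0..X}" using assms(2) by auto
  show "(\<theta> has_real_derivative sqrt lam / h1 (p * sin (\<theta> x))) (at x within {0..X'})"
    by (rule DERIV_subset[OF phaseD(2)[OF assms(1) x]]) (use assms(2) in auto)
qed (use phaseD[OF assms(1)] assms(2) in auto)

text \<open>In the first derivative h1 cancels against the denominator of the phase equation; the
  second uses f(h(y)) = y / h1(y).\<close>

lemma phase_wave:
  assumes ph: "phase p lam X \<theta>" and lam: "0 < lam" and x: "x \<in> {0..X}"
  shows "((\<lambda>x. h (p * sin (\<theta> x))) has_real_derivative sqrt lam * p * cos (\<theta> x)) (at x within {0..X})"
    "((\<lambda>x. sqrt lam * p * cos (\<theta> x)) has_real_derivative - lam * f (h (p * sin (\<theta> x)))) (at x within {0..X})"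
proof -
  note r = phaseD(3,4)[OF ph x] and d = phaseD(2)[OF ph x]
  have pos: "0 < h1 (p * sin (\<theta> x))" using h1_pos[OF r] .
  have "((\<lambda>x. h (p * sin (\<theta> x))) has_real_derivative
      h1 (p * sin (\<theta> x)) * (p * (cos (\<theta> x) * (sqrt lam / h1 (p * sin (\<theta> x)))))) (at x within {0..X})"
    by (rule DERIV_chain2[where f = h and g = "\<lambda>x. p * sin (\<theta> x)", OF h_deriv[OF r]]) (auto intro!: derivative_eq_intros d)
  then show "((\<lambda>x. h (p * sin (\<theta> x))) has_real_derivative sqrt lam * p * cos (\<theta> x)) (at x within {0..X})"
    by (rule DERIV_cong) (use pos in \<open>auto simp: field_simps\<close>)
  have "((\<lambda>x. sqrt lam * p * cos (\<theta> x)) has_real_derivative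
      sqrt lam * p * (- sin (\<theta> x) * (sqrt lam / h1 (p * sin (\<theta> x))))) (at x within {0..X})"
    by (auto intro!: derivative_eq_intros d)
  then show "((\<lambda>x. sqrt lam * p * cos (\<theta> x)) has_real_derivative - lam * f (h (p * sin (\<theta> x)))) (at x within {0..X})"
  proof (rule DERIV_cong)
    have "f (h (p * sin (\<theta> x))) = p * sin (\<theta> x) / h1 (p * sin (\<theta> x))"
      using f_h_h1[OF r] pos by (simp add: field_simps)
    then show "sqrt lam * p * (- sin (\<theta> x) * (sqrt lam / h1 (p * sin (\<theta> x)))) = - lam * f (h (p * sin (\<theta> x)))"
      using lam by (simp add: field_simps)
  qed
qed

text \<open>A solution without interior zeros has one sign and meets only the barrier on its side;
  all others reach both sides, so the closer barrier limits the amplitude.\<close>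

definition pmax :: "nat \<Rightarrow> real \<Rightarrow> real" where
  "pmax j s = (if j = 1 then (if 0 < s then yp else - ym) else min yp (- ym))"

lemma range_pmax:
  assumes s: "s = 1 \<or> s = -1" and \<rho>: "0 \<le> \<rho>" "\<rho> < pmax j s" and \<theta>: "\<theta> \<in> {0..real j * pi}"
  shows "ym < s * \<rho> * sin \<theta> \<and> s * \<rho> * sin \<theta> < yp"
proof (cases "j = 1")
  case True
  then have "0 \<le> sin \<theta>" "sin \<theta> \<le> 1" using \<theta> by (auto intro: sin_ge_zero)
  then have "0 \<le> \<rho> * sin \<theta>" "\<rho> * sin \<theta> \<le> \<rho>" using \<rho> by (auto intro: mult_left_le)
  then show ?thesis using s \<rho> True ym_neg yp_pos by (auto simp: pmax_def)
next
  case False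
  have "\<bar>s * \<rho> * sin \<theta>\<bar> = \<rho> * \<bar>sin \<theta>\<bar>" using s \<rho> by (auto simp: abs_mult)
  also have "\<dots> \<le> \<rho> * 1" using \<rho> by (intro mult_left_mono) auto
  finally have "\<bar>s * \<rho> * sin \<theta>\<bar> \<le> \<rho>" by simp
  then show ?thesis using \<rho> False by (auto simp: pmax_def)
qed

text \<open>The length of the interval on which \<open>j\<close> half turns take place, for lam = 1;
  for general lam it is divided by sqrt lam.\<close>

definition Theta :: "nat \<Rightarrow> real \<Rightarrow> real" where
  "Theta j p = integral {0..real j * pi} (\<lambda>\<theta>. h1 (p * sin \<theta>))"

lemma h1_sin_cont:
  assumes "\<And>\<theta>. \<theta> \<in> S \<Longrightarrow> ym < p * sin \<theta> \<and> p * sin \<theta> < yp"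
  shows "continuous_on S (\<lambda>\<theta>. h1 (p * sin \<theta>))"
  by (rule continuous_on_compose2[OF h1_cont]) (use assms in \<open>auto intro!: continuous_intros\<close>)

lemma phase_exists:
  assumes adm: "\<And>\<theta>. \<theta> \<in> {0..real j * pi} \<Longrightarrow> ym < p * sin \<theta> \<and> p * sin \<theta> < yp" and lam: "0 < lam"
  obtains \<theta> where "phase p lam (Theta j p / sqrt lam) \<theta>" "\<theta> (Theta j p / sqrt lam) = real j * pi"
proof -
  obtain \<theta> where \<theta>: "\<And>x. x \<in> {0..Theta j p / sqrt lam} \<Longrightarrow>
      (\<theta> has_real_derivative sqrt lam / h1 (p * sin (\<theta> x))) (at x within {0..Theta j p / sqrt lam})"
    "\<And>x. x \<in> {0..Theta j p / sqrt lam} \<Longrightarrow> \<theta> x \<in> {0..real j * pi}" "\<theta> 0 = 0"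
    "\<theta> (Theta j p / sqrt lam) = real j * pi"
    by (rule autonomous_ode_solution[OF h1_sin_cont, of "real j * pi" p "sqrt lam" "Theta j p / sqrt lam"])
      (use adm lam h1_pos in \<open>auto simp: Theta_def\<close>)
  then have "phase p lam (Theta j p / sqrt lam) \<theta>" using adm by (auto simp: phase_def)
  then show ?thesis using that \<theta>(4) by blast
qed

lemma Theta_pos:
  assumes adm: "\<And>\<theta>. \<theta> \<in> {0..real j * pi} \<Longrightarrow> ym < p * sin \<theta> \<and> p * sin \<theta> < yp" and j: "1 \<le> j"
  shows "real j * pi \<le> Theta j p"
proof -
  have "integral {0..real j * pi} (\<lambda>_. 1) \<le> Theta j p"
    unfolding Theta_def using adm
    by (intro integral_le integrable_continuous_real h1_sin_cont) (auto intro: h1_ge_1)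
  then show ?thesis by simp
qed

lemma wave_dirichlet:
  assumes ph: "phase p lam pi \<theta>" and lam: "0 < lam" and p: "p \<noteq> 0" and \<theta>: "\<theta> pi = real j * pi"
    and u: "\<And>x. x \<in> {0..pi} \<Longrightarrow> u x = h (p * sin (\<theta> x))"
  shows "has_C2_deriv u (\<lambda>x. sqrt lam * p * cos (\<theta> x)) (\<lambda>x. - (lam * f (u x)))"
    "u 0 = 0" "u pi = 0" "has_n_zeros (j - 1) u"
proof -
  note w = phase_wave[OF ph lam]
  have du: "(u has_real_derivative sqrt lam * p * cos (\<theta> x)) (at x within {0..pi})" if "x \<in> {0..pi}" for x
    by (rule has_field_derivative_transform_within[OF w(1)[OF that] zero_less_one that]) (use u in auto)
  then have "cts u" by (rule DERIV_continuous_on)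
  then have c: "cts (\<lambda>x. - (lam * f (u x)))"
    by (intro continuous_intros continuous_on_compose2[OF f_cont[of UNIV]]) auto
  show "has_C2_deriv u (\<lambda>x. sqrt lam * p * cos (\<theta> x)) (\<lambda>x. - (lam * f (u x)))"
    unfolding has_C2_deriv_def using c du w(2) u by auto
  show "u 0 = 0" "u pi = 0" using u[of 0] u[of pi] phaseD(1)[OF ph] \<theta> by (auto simp: h_0)
  have "{x \<in> {0<..<pi}. u x = 0} = {x \<in> {0<..<pi}. sin (\<theta> x) = 0}"
    using u h_eq_0_iff[OF phaseD(3,4)[OF ph]] p h_0 by auto
  then show "has_n_zeros (j - 1) u"
    unfolding has_n_zeros_def
    using card_phase_zeros[OF phase_mono[OF ph lam] phase_cont[OF ph] phaseD(1)[OF ph] \<theta>] by auto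
qed

text \<open>The initial slope determines an amplitude, and the energy at an extremum keeps it below
  \<open>pmax j s\<close>. The wave with this amplitude has the same initial data as
  \<open>u\<close>, hence agrees with it wherever both are defined, and the number of zeros forces
  its \<open>j\<close> half turns to take exactly the length pi.\<close>

lemma solution_is_wave:
  assumes lam: "0 < lam" and j: "1 \<le> j" and s: "s = 1 \<or> s = -1"
    and u: "has_C2_deriv u u1 (\<lambda>x. - (lam * f (u x)))" "u 0 = 0" "u pi = 0"
    and zeros: "has_n_zeros (j - 1) u" and s0: "0 < s * u1 0"
  obtains \<rho> \<theta> where "0 < \<rho>" "\<rho> < pmax j s" "u1 0 = sqrt lam * (s * \<rho>)" "Theta j (s * \<rho>) = pi * sqrt lam"
    "phase (s * \<rho>) lam pi \<theta>" "\<theta> pi = real j * pi" "\<And>x. x \<in> {0..pi} \<Longrightarrow> u x = h (s * \<rho> * sin (\<theta> x))"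
proof -
  note du = has_C2_derivD(1,2)[OF u(1)]
  have dg: "((\<lambda>v. - (lam * f v)) has_real_derivative - (lam * f' v)) (at v)" for v
    by (auto intro!: derivative_eq_intros f_deriv)
  have cg: "continuous_on UNIV (\<lambda>v. - (lam * f' v))" by (intro continuous_intros f'_cont)
  have ub: "u x < bp" if "x \<in> {0..pi}" for x
    by (rule solution_below(1)[OF dg cg bp(1) _ _ du u(2,3) that])
      (use bp f_neg_above lam in \<open>auto simp: mult_less_0_iff\<close>)
  have max: "\<exists>x\<in>{0..pi}. u1 x = 0 \<and> 0 < u x" if "x1 \<in> {0..pi}" "0 < u x1" for x1
    by (rule solution_below(2)[OF dg cg bp(1) _ _ du u(2,3) that])
      (use bp f_neg_above lam in \<open>auto simp: mult_less_0_iff\<close>)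
  \<comment> \<open>The reflected function - u turns the lower barrier \<open>bm\<close> into an
    upper one, so \<open>solution_below\<close> can be applied once more.\<close>
  have dg': "((\<lambda>v. lam * f (- v)) has_real_derivative - (lam * f' (- v))) (at v)" for v
    by (auto intro!: derivative_eq_intros DERIV_chain2[OF f_deriv])
  have cg': "continuous_on UNIV (\<lambda>v. - (lam * f' (- v)))"
    by (intro continuous_intros continuous_on_compose2[OF f'_cont[of UNIV]]) auto
  have du': "((\<lambda>x. - u x) has_real_derivative - u1 x) (at x within {0..pi})"
    "((\<lambda>x. - u1 x) has_real_derivative lam * f (- (- u x))) (at x within {0..pi})" if "x \<in> {0..pi}" for x
    using du[OF that] by (auto intro!: derivative_eq_intros)
  have lb: "bm < u x" if "x \<in> {0..pi}" for x
  proof -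
    have "- u x < - bm"
      by (rule solution_below(1)[OF dg' cg' _ _ _ du' _ _ that])
        (use bm f_pos_below lam u in auto)
    then show ?thesis by simp
  qed
  have min: "\<exists>x\<in>{0..pi}. u1 x = 0 \<and> u x < 0" if "x1 \<in> {0..pi}" "u x1 < 0" for x1
  proof -
    have "\<exists>x\<in>{0..pi}. - u1 x = 0 \<and> 0 < - u x"
      by (rule solution_below(2)[OF dg' cg' _ _ _ du' _ _ that(1), of "- bm"])
        (use bm f_pos_below lam u that in auto)
    then show ?thesis by simp
  qed
  define p where "p = u1 0 / sqrt lam"
  have p: "u1 0 = sqrt lam * p" "p \<noteq> 0" "0 < s * p" using lam s0 s by (auto simp: p_def field_simps)
  define \<rho> where "\<rho> = s * p"
  have \<rho>: "0 < \<rho>" "p = s * \<rho>" "\<bar>p\<bar> = \<rho>" using p s by (auto simp: \<rho>_def)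
  have energy: "(u1 x)\<^sup>2 + 2 * lam * F (u x) = lam * p\<^sup>2" if x: "x \<in> {0..pi}" for x
  proof -
    define E where "E x = (u1 x)\<^sup>2 + 2 * lam * F (u x)" for x
    have "(E has_real_derivative 0) (at x within {0..pi})" if x: "x \<in> {0..pi}" for x
    proof -
      have "((\<lambda>x. F (u x)) has_real_derivative f (u x) * u1 x) (at x within {0..pi})"
        by (rule DERIV_chain2[where f = F and g = u, OF F_deriv du(1)[OF x]]) (use lb[OF x] ub[OF x] in auto)
      then show ?thesis unfolding E_def
        by (auto intro!: derivative_eq_intros du(2) x simp: algebra_simps)
    qed
    then have "E x = E 0"
      by (metis (no_types, lifting) has_field_derivative_zero_constant convex_real_interval(5)
          atLeastAtMost_iff order_refl pi_ge_zero x)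
    then show ?thesis using lam u p by (simp add: E_def F_0 power_mult_distrib)
  qed
  \<comment> \<open>At a positive critical point all energy is potential, so \<rho> equals
    \<open>Y\<close> of the value there, and this value lies strictly below \<open>bp\<close>. The
    statement \<open>Ym\<close> is the mirror image.\<close>
  have Yp: "\<rho> < yp" if x1: "x1 \<in> {0..pi}" "0 < u x1" for x1
  proof -
    obtain x where x: "x \<in> {0..pi}" "u1 x = 0" "0 < u x" using max[OF x1] by auto
    have "p\<^sup>2 = \<rho>\<^sup>2" using \<rho>(3) by (metis power2_abs)
    moreover have "(Y (u x))\<^sup>2 = 2 * F (u x)" using Y_sq[of "u x"] lb[OF x(1)] ub[OF x(1)] by simp
    ultimately have "lam * \<rho>\<^sup>2 = lam * (Y (u x))\<^sup>2" using energy[OF x(1)] x(2) by algebra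
    then have "\<rho>\<^sup>2 = (Y (u x))\<^sup>2" using lam by simp
    then have "\<rho> = Y (u x)" using Y_pos[of "u x"] x ub[OF x(1)] \<rho> by (simp add: power2_eq_iff_nonneg)
    then show ?thesis using Y_in[of "u x"] lb[OF x(1)] ub[OF x(1)] by simp
  qed
  have Ym: "\<rho> < - ym" if x1: "x1 \<in> {0..pi}" "u x1 < 0" for x1
  proof -
    obtain x where x: "x \<in> {0..pi}" "u1 x = 0" "u x < 0" using min[OF x1] by auto
    have "p\<^sup>2 = \<rho>\<^sup>2" using \<rho>(3) by (metis power2_abs)
    moreover have "(Y (u x))\<^sup>2 = 2 * F (u x)" using Y_sq[of "u x"] lb[OF x(1)] ub[OF x(1)] by simp
    ultimately have "lam * \<rho>\<^sup>2 = lam * (Y (u x))\<^sup>2" using energy[OF x(1)] x(2) by algebra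
    then have "\<rho>\<^sup>2 = (- Y (u x))\<^sup>2" using lam by simp
    then have "\<rho> = - Y (u x)" using Y_neg[of "u x"] x lb[OF x(1)] \<rho> by (subst (asm) power2_eq_iff_nonneg) auto
    then show ?thesis using Y_in[of "u x"] lb[OF x(1)] ub[OF x(1)] by simp
  qed
  have pos_somewhere: "\<exists>x1\<in>{0..pi}. 0 < u x1" if z: "z \<in> {0..<pi}" "u z = 0" "0 < u1 z" for z
  proof -
    obtain d where d: "0 < d" "\<And>e. 0 < e \<Longrightarrow> z + e \<in> {0..pi} \<Longrightarrow> e < d \<Longrightarrow> u z < u (z + e)"
      using has_real_derivative_pos_inc_right[OF du(1)[of z]] z by auto
    define e where "e = min d (pi - z) / 2"
    have "0 < e" "e < d" "z + e < pi" using d z by (auto simp: e_def min_def field_simps)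
    then show ?thesis using d(2)[of e] z by (intro bexI[of _ "z + e"]) auto
  qed
  have neg_somewhere: "\<exists>x1\<in>{0..pi}. u x1 < 0" if z: "z \<in> {0..<pi}" "u z = 0" "u1 z < 0" for z
  proof -
    obtain d where d: "0 < d" "\<And>e. 0 < e \<Longrightarrow> z + e \<in> {0..pi} \<Longrightarrow> e < d \<Longrightarrow> u z > u (z + e)"
      using has_real_derivative_neg_dec_right[OF du(1)[of z]] z by auto
    define e where "e = min d (pi - z) / 2"
    have "0 < e" "e < d" "z + e < pi" using d z by (auto simp: e_def min_def field_simps)
    then show ?thesis using d(2)[of e] z by (intro bexI[of _ "z + e"]) auto
  qed
  have neg_left: "\<exists>x1\<in>{0..pi}. 0 < u x1" if z: "z \<in> {0<..<pi}" "u z = 0" "u1 z < 0" for z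
  proof -
    obtain d where d: "0 < d" "\<And>e. 0 < e \<Longrightarrow> z - e \<in> {0..pi} \<Longrightarrow> e < d \<Longrightarrow> u z < u (z - e)"
      using has_real_derivative_neg_dec_left[OF du(1)[of z]] z by auto
    define e where "e = min d z / 2"
    have "0 < e" "e < d" "0 < z - e" using d z by (auto simp: e_def min_def field_simps)
    then show ?thesis using d(2)[of e] z by (intro bexI[of _ "z - e"]) auto
  qed
  have pos_left: "\<exists>x1\<in>{0..pi}. u x1 < 0" if z: "z \<in> {0<..<pi}" "u z = 0" "0 < u1 z" for z
  proof -
    obtain d where d: "0 < d" "\<And>e. 0 < e \<Longrightarrow> z - e \<in> {0..pi} \<Longrightarrow> e < d \<Longrightarrow> u (z - e) < u z"
      using has_real_derivative_pos_inc_left[OF du(1)[of z]] z by auto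
    define e where "e = min d z / 2"
    have "0 < e" "e < d" "0 < z - e" using d z by (auto simp: e_def min_def field_simps)
    then show ?thesis using d(2)[of e] z by (intro bexI[of _ "z - e"]) auto
  qed
  have \<rho>max: "\<rho> < pmax j s"
  proof (cases "j = 1")
    case True
    show ?thesis
    proof (cases "s = 1")
      case s1: True
      then obtain x1 where "x1 \<in> {0..pi}" "0 < u x1" using pos_somewhere[of 0] u s0 by auto
      then show ?thesis using Yp True s1 by (simp add: pmax_def)
    next
      case False
      with s have s1: "s = -1" by simp
      then obtain x1 where "x1 \<in> {0..pi}" "u x1 < 0" using neg_somewhere[of 0] u s0 by auto
      then show ?thesis using Ym True s1 by (simp add: pmax_def)
    qed
  next
    \<comment> \<open>For \<open>j\<close> at least 2 there is an interior zero. By conservation of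
      energy its slope is not 0, so \<open>u\<close> takes both signs and both barriers
      apply.\<close>
    case False
    then have "card {x \<in> {0<..<pi}. u x = 0} \<noteq> 0" using zeros j by (auto simp: has_n_zeros_def)
    then obtain z where z: "z \<in> {0<..<pi}" "u z = 0" by (metis (mono_tags, lifting) card.empty empty_Collect_eq)
    then have "(u1 z)\<^sup>2 = lam * p\<^sup>2" using energy[of z] by (auto simp: F_0)
    then have "u1 z \<noteq> 0" using lam p by auto
    then have "(\<exists>x1\<in>{0..pi}. 0 < u x1) \<and> (\<exists>x1\<in>{0..pi}. u x1 < 0)"
      using pos_somewhere[of z] neg_somewhere[of z] neg_left[OF z] pos_left[OF z] z by (cases "0 < u1 z") auto
    then show ?thesis using Yp Ym False by (auto simp: pmax_def)
  qed
  have adm: "ym < p * sin \<theta> \<and> p * sin \<theta> < yp" if "\<theta> \<in> {0..real j * pi}" for \<theta>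
    using range_pmax[OF s _ \<rho>max that] \<rho> by auto
  define X where "X = Theta j p / sqrt lam"
  obtain \<theta> where ph: "phase p lam X \<theta>" and \<theta>X: "\<theta> X = real j * pi"
    using phase_exists[OF adm lam] unfolding X_def by blast
  have X: "0 < X"
  proof -
    have "0 < real j * pi" using j by simp
    then have "0 < Theta j p" using Theta_pos[OF adm j] by simp
    then show ?thesis using lam by (simp add: X_def)
  qed
  \<comment> \<open>\<open>u\<close> lives on [0, pi] and the wave on [0, X]; that X = pi is not
    known yet.\<close>
  have agree: "u x = h (p * sin (\<theta> x))" if x: "x \<in> {0..min X pi}" for x
  proof -
    define m where "m = min X pi"
    have phm: "phase p lam m \<theta>" by (rule phase_subset[OF ph]) (simp add: m_def)
    have "u x = h (p * sin (\<theta> x)) \<and> u1 x = sqrt lam * p * cos (\<theta> x)"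
    proof (rule second_order_unique[OF dg cg, of 0 m u u1 "\<lambda>x. h (p * sin (\<theta> x))" "\<lambda>x. sqrt lam * p * cos (\<theta> x)" 0 x])
      fix y assume y: "y \<in> {0..m}"
      then have y': "y \<in> {0..pi}" by (auto simp: m_def)
      show "(u has_real_derivative u1 y) (at y within {0..m})"
        by (rule DERIV_subset[OF du(1)[OF y']]) (auto simp: m_def)
      show "(u1 has_real_derivative - (lam * f (u y))) (at y within {0..m})"
        by (rule DERIV_subset[OF du(2)[OF y']]) (auto simp: m_def)
      show "((\<lambda>x. h (p * sin (\<theta> x))) has_real_derivative sqrt lam * p * cos (\<theta> y)) (at y within {0..m})"
        by (rule phase_wave(1)[OF phm lam y])
      show "((\<lambda>x. sqrt lam * p * cos (\<theta> x)) has_real_derivative - (lam * f (h (p * sin (\<theta> y))))) (at y within {0..m})"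
        using phase_wave(2)[OF phm lam y] by simp
    qed (use x u p X phaseD(1)[OF ph] in \<open>auto simp: m_def h_0\<close>)
    then show ?thesis by simp
  qed
  have zero_iff: "u x = 0 \<longleftrightarrow> sin (\<theta> x) = 0" if "x \<in> {0..min X pi}" for x
    using agree[OF that] h_eq_0_iff[OF phaseD(3,4)[OF ph]] that p by auto
  have fin: "finite {x \<in> {0<..<pi}. u x = 0}" and cd: "card {x \<in> {0<..<pi}. u x = 0} = j - 1"
    using zeros by (auto simp: has_n_zeros_def)
  \<comment> \<open>A short wave would give its j - 1 interior zeros and the point \<open>X\<close>
    itself: one zero too many.\<close>
  have "\<not> X < pi"
  proof
    assume Xpi: "X < pi"
    define Z where "Z = {x \<in> {0<..<X}. sin (\<theta> x) = 0}"
    have Z: "finite Z" "card Z = j - 1"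
      unfolding Z_def using card_phase_zeros[OF phase_mono[OF ph lam] phase_cont[OF ph] phaseD(1)[OF ph] \<theta>X X] by auto
    have "insert X Z \<subseteq> {x \<in> {0<..<pi}. u x = 0}"
      using Xpi X zero_iff \<theta>X by (auto simp: Z_def)
    then have "card (insert X Z) \<le> j - 1" using card_mono[OF fin] cd by auto
    moreover have "X \<notin> Z" by (auto simp: Z_def)
    ultimately show False using Z j by auto
  qed
  \<comment> \<open>If the wave were longer, then \<theta> pi = i pi with i < j, because
    \<open>u\<close> vanishes at pi; that leaves only i - 1 interior zeros.\<close>
  moreover have "\<not> pi < X"
  proof
    assume Xpi: "pi < X"
    then have "sin (\<theta> pi) = 0" using zero_iff[of pi] u by auto
    then obtain i :: int where i: "\<theta> pi = of_int i * pi" by (auto simp: sin_zero_iff_int2)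
    have "0 < \<theta> pi" "\<theta> pi < real j * pi"
      using phase_mono[OF ph lam, of 0 pi] phase_mono[OF ph lam, of pi X] phaseD(1)[OF ph] \<theta>X Xpi by auto
    then have i2: "0 < i" "i < int j" using i by (auto simp: zero_less_mult_iff of_int_less_iff[symmetric] simp del: of_int_less_iff)
    have ph': "phase p lam pi \<theta>" by (rule phase_subset[OF ph]) (use Xpi in simp)
    have "\<theta> pi = real (nat i) * pi" using i i2 by simp
    from card_phase_zeros(2)[OF phase_mono[OF ph' lam] phase_cont[OF ph'] phaseD(1)[OF ph'] this]
    have "card {x \<in> {0<..<pi}. sin (\<theta> x) = 0} = nat i - 1" by simp
    moreover have "{x \<in> {0<..<pi}. sin (\<theta> x) = 0} = {x \<in> {0<..<pi}. u x = 0}"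
      using zero_iff Xpi by auto
    ultimately show False using cd i2 by auto
  qed
  ultimately have "X = pi" by simp
  show ?thesis
  proof (rule that[of \<rho> \<theta>])
    show "0 < \<rho>" "\<rho> < pmax j s" by fact+
    show "u1 0 = sqrt lam * (s * \<rho>)" using p \<rho> by simp
    show "Theta j (s * \<rho>) = pi * sqrt lam" using \<open>X = pi\<close> lam \<rho> by (simp add: X_def field_simps)
    show "phase (s * \<rho>) lam pi \<theta>" using ph \<rho> \<open>X = pi\<close> by simp
    show "\<theta> pi = real j * pi" using \<theta>X \<open>X = pi\<close> by simp
    show "u x = h (s * \<rho> * sin (\<theta> x))" if "x \<in> {0..pi}" for x
      using agree[of x] that \<open>X = pi\<close> \<rho> by auto
  qed
qed

end

subsection \<open>The branches of solutions\<close>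

lemma DERIV_chain_Icc:
  fixes f g :: "real \<Rightarrow> real"
  assumes f: "(f has_real_derivative d) (at (g x) within T)" and g: "(g has_real_derivative e) (at x within S)"
    and "g ` S \<subseteq> T"
  shows "((\<lambda>x. f (g x)) has_real_derivative d * e) (at x within S)"
  using DERIV_image_chain[OF DERIV_subset[OF f assms(3)] g] by (simp add: o_def)

locale branch = nonlinearity +
  fixes j :: nat and s :: real
  assumes j: "1 \<le> j" and s: "s = 1 \<or> s = -1"
begin

abbreviation "pm \<equiv> pmax j s"
abbreviation "TT \<equiv> {0..real j * pi}"

lemma range: "0 \<le> \<rho> \<Longrightarrow> \<rho> < pm \<Longrightarrow> \<theta> \<in> TT \<Longrightarrow> ym < s * \<rho> * sin \<theta> \<and> s * \<rho> * sin \<theta> < yp"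
  using range_pmax[OF s] by blast

text \<open>The \<open>j\<close> half turns fit into [0, pi] exactly if Th \<rho> = pi sqrt lam;
  solved for lam this is \<open>Lam\<close>. Substituting dx = h1 d\<theta> / sqrt lam in the
  integral of \<psi>'^2 = lam \<rho>^2 cos^2 \<theta> gives sqrt lam times \<open>Jf\<close>, which
  is \<open>Rf\<close>. Thus the amplitude parametrizes the branch explicitly.\<close>

definition Th :: "real \<Rightarrow> real" where
  "Th \<rho> = Theta j (s * \<rho>)"
definition dTh :: "real \<Rightarrow> real" where
  "dTh \<rho> = integral TT (\<lambda>\<theta>. h2 (s * \<rho> * sin \<theta>) * (s * sin \<theta>))"
definition Jf :: "real \<Rightarrow> real" where
  "Jf \<rho> = integral TT (\<lambda>\<theta>. (\<rho> * cos \<theta>)\<^sup>2 * h1 (s * \<rho> * sin \<theta>))"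
definition Lam :: "real \<Rightarrow> real" where
  "Lam \<rho> = (Th \<rho> / pi)\<^sup>2"
definition Rf :: "real \<Rightarrow> real" where
  "Rf \<rho> = Th \<rho> * Jf \<rho> / pi"
definition dRf :: "real \<Rightarrow> real" where
  "dRf \<rho> = (dTh \<rho> * Jf \<rho> + Th \<rho> * (\<rho> * Th \<rho>)) / pi"
definition dLam :: "real \<Rightarrow> real" where
  "dLam \<rho> = 2 * Th \<rho> * dTh \<rho> / pi\<^sup>2"

lemma cont2:
  assumes "continuous_on {ym<..<yp} g"
  shows "continuous_on ({0..<pm} \<times> TT) (\<lambda>(\<rho>, \<theta>). g (s * \<rho> * sin \<theta>))"
  unfolding case_prod_beta
  by (rule continuous_on_compose2[OF assms]) (use range in \<open>auto intro!: continuous_intros\<close>)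

lemma cont1:
  assumes "continuous_on {ym<..<yp} g" "0 \<le> \<rho>" "\<rho> < pm"
  shows "continuous_on TT (\<lambda>\<theta>. g (s * \<rho> * sin \<theta>))"
  by (rule continuous_on_compose2[OF assms(1)]) (use range[OF assms(2,3)] in \<open>auto intro!: continuous_intros\<close>)

lemma h1_comp_deriv:
  assumes "0 \<le> \<rho>" "\<rho> < pm" "\<theta> \<in> TT"
  shows "((\<lambda>\<rho>. h1 (s * \<rho> * sin \<theta>)) has_real_derivative h2 (s * \<rho> * sin \<theta>) * (s * sin \<theta>)) (at \<rho> within S)"
  by (rule DERIV_chain2[where f = h1 and g = "\<lambda>\<rho>. s * \<rho> * sin \<theta>", OF h1_deriv])
    (use range[OF assms] in \<open>auto intro!: derivative_eq_intros\<close>)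

lemma Th_deriv_within:
  assumes "0 \<le> \<rho>" "\<rho> < pm"
  shows "(Th has_real_derivative dTh \<rho>) (at \<rho> within {0..<pm})"
  unfolding Th_def Theta_def dTh_def
proof (rule leibniz_rule_field_derivative[of "{0..<pm}" 0 "real j * pi", unfolded cbox_interval])
  show "(\<lambda>\<theta>. h1 (s * \<rho> * sin \<theta>)) integrable_on TT" if "\<rho> \<in> {0..<pm}" for \<rho>
    by (rule integrable_continuous_real, rule cont1[OF h1_cont]) (use that in auto)
  have "continuous_on ({0..<pm} \<times> TT) (\<lambda>z. s * sin (snd z))" by (intro continuous_intros)
  with cont2[OF h2_cont]
  have "continuous_on ({0..<pm} \<times> TT) (\<lambda>z. (case z of (\<rho>, \<theta>) \<Rightarrow> h2 (s * \<rho> * sin \<theta>)) * (s * sin (snd z)))"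
    by (rule continuous_on_mult)
  then show "continuous_on ({0..<pm} \<times> TT) (\<lambda>(\<rho>, \<theta>). h2 (s * \<rho> * sin \<theta>) * (s * sin \<theta>))"
    by (simp add: case_prod_beta)
qed (use h1_comp_deriv assms in auto)

lemma at_interior: "0 < \<rho> \<Longrightarrow> \<rho> < pm \<Longrightarrow> at \<rho> within {0..<pm} = at \<rho>"
  by (rule at_within_interior) (simp add: interior_atLeastLessThan)

lemma Th_deriv: "0 < \<rho> \<Longrightarrow> \<rho> < pm \<Longrightarrow> (Th has_real_derivative dTh \<rho>) (at \<rho>)"
  using Th_deriv_within[of \<rho>] at_interior[of \<rho>] by simp

text \<open>By \<open>h2_sign\<close> the integrand is positive wherever sin \<theta> is not 0. This
  strict increase of the turning time with the amplitude also yields the nondegeneracy in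
  \<open>v_pi_nz\<close>.\<close>

lemma dTh_pos:
  assumes "0 < \<rho>" "\<rho> < pm"
  shows "0 < dTh \<rho>"
proof -
  let ?g = "\<lambda>\<theta>. h2 (s * \<rho> * sin \<theta>) * (s * sin \<theta>)"
  have pos: "0 < ?g \<theta>" if "\<theta> \<in> TT" "sin \<theta> \<noteq> 0" for \<theta>
  proof -
    have "0 < (s * \<rho> * sin \<theta>) * h2 (s * \<rho> * sin \<theta>)"
      by (rule h2_sign) (use range[OF _ assms(2) that(1)] assms that s in auto)
    then have "0 < \<rho> * ?g \<theta>" by (simp add: mult_ac)
    then show ?thesis using assms by (simp add: zero_less_mult_iff)
  qed
  have nn: "0 \<le> ?g \<theta>" if "\<theta> \<in> TT" for \<theta> using pos[OF that] by (cases "sin \<theta> = 0") auto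
  have c: "continuous_on TT ?g"
    by (intro continuous_on_mult cont1[OF h2_cont] continuous_intros) (use assms in auto)
  have jp: "0 < real j * pi" using j by simp
  have "pi \<le> real j * pi" using j by simp
  then have half: "pi / 2 \<in> TT" using pi_gt_zero by auto
  have "integral TT ?g \<noteq> 0"
  proof
    assume "integral TT ?g = 0"
    then have "\<forall>x\<in>TT. ?g x = 0" using integral_eq_0_iff[OF c jp nn] by blast
    with half have "?g (pi / 2) = 0" by blast
    then show False using pos[OF half] by auto
  qed
  moreover have "0 \<le> integral TT ?g"
    by (rule integral_nonneg[OF integrable_continuous_real[OF c] nn])
  ultimately show ?thesis by (simp add: dTh_def)
qed

lemma Th_0: "Th 0 = real j * pi"
  by (simp add: Th_def Theta_def h1_def)

lemma Th_cont: "continuous_on {0..<pm} Th"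
  by (rule DERIV_continuous_on, rule Th_deriv_within) auto

lemma Th_mono:
  assumes "0 \<le> \<rho>" "\<rho> < \<rho>'" "\<rho>' < pm"
  shows "Th \<rho> < Th \<rho>'"
proof (rule DERIV_pos_imp_increasing_open[OF assms(2)])
  fix x assume "\<rho> < x" "x < \<rho>'"
  then show "\<exists>y. (Th has_real_derivative y) (at x) \<and> 0 < y"
    using Th_deriv[of x] dTh_pos[of x] assms by auto
qed (rule continuous_on_subset[OF Th_cont], use assms in auto)

lemma Th_pos: "0 \<le> \<rho> \<Longrightarrow> \<rho> < pm \<Longrightarrow> real j * pi \<le> Th \<rho>"
  unfolding Th_def using Theta_pos[OF range j] by blast

lemma Th_gt0: "0 \<le> \<rho> \<Longrightarrow> \<rho> < pm \<Longrightarrow> 0 < Th \<rho>"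
  using Th_pos[of \<rho>] j by (smt (verit) mult_pos_pos of_nat_0_less_iff pi_gt_zero less_le_trans zero_less_one
    One_nat_def Suc_le_lessD)

lemma Th_inj: "0 \<le> \<rho> \<Longrightarrow> \<rho> < pm \<Longrightarrow> 0 \<le> \<rho>' \<Longrightarrow> \<rho>' < pm \<Longrightarrow> Th \<rho> = Th \<rho>' \<Longrightarrow> \<rho> = \<rho>'"
  using Th_mono[of \<rho> \<rho>'] Th_mono[of \<rho>' \<rho>] by linarith

text \<open>The derivative of the integrand contains h2, but an integration by parts removes it,
  which leaves a quantity of evident sign.\<close>

lemma Jf_deriv_within:
  assumes "0 \<le> \<rho>" "\<rho> < pm"
  shows "(Jf has_real_derivative \<rho> * Th \<rho>) (at \<rho> within {0..<pm})"
proof -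
  let ?k = "\<lambda>\<rho> \<theta>. 2 * \<rho> * (cos \<theta>)\<^sup>2 * h1 (s * \<rho> * sin \<theta>) + (\<rho> * cos \<theta>)\<^sup>2 * (h2 (s * \<rho> * sin \<theta>) * (s * sin \<theta>))"
  have "(Jf has_real_derivative integral TT (?k \<rho>)) (at \<rho> within {0..<pm})"
    unfolding Jf_def
  proof (rule leibniz_rule_field_derivative[of "{0..<pm}" 0 "real j * pi", unfolded cbox_interval])
    show "(\<lambda>\<theta>. (\<rho> * cos \<theta>)\<^sup>2 * h1 (s * \<rho> * sin \<theta>)) integrable_on TT" if "\<rho> \<in> {0..<pm}" for \<rho>
      by (rule integrable_continuous_real, intro continuous_on_mult continuous_intros cont1[OF h1_cont]) (use that in auto)
    have "continuous_on ({0..<pm} \<times> TT) (\<lambda>z. 2 * fst z * (cos (snd z))\<^sup>2 * (case z of (\<rho>, \<theta>) \<Rightarrow> h1 (s * \<rho> * sin \<theta>))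
       + (fst z * cos (snd z))\<^sup>2 * ((case z of (\<rho>, \<theta>) \<Rightarrow> h2 (s * \<rho> * sin \<theta>)) * (s * sin (snd z))))"
      by (intro continuous_on_add continuous_on_mult cont2[OF h2_cont] cont2[OF h1_cont] continuous_intros)
    then show "continuous_on ({0..<pm} \<times> TT) (\<lambda>(\<rho>, \<theta>). ?k \<rho> \<theta>)"
      by (simp add: case_prod_beta)
    show "((\<lambda>\<rho>. (\<rho> * cos \<theta>)\<^sup>2 * h1 (s * \<rho> * sin \<theta>)) has_real_derivative ?k \<rho> \<theta>) (at \<rho> within {0..<pm})"
      if "\<rho> \<in> {0..<pm}" "\<theta> \<in> TT" for \<rho> \<theta>
    proof -
      have d1: "((\<lambda>\<rho>. (\<rho> * cos \<theta>)\<^sup>2) has_real_derivative 2 * \<rho> * (cos \<theta>)\<^sup>2) (at \<rho> within {0..<pm})"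
        by (auto intro!: derivative_eq_intros simp: power2_eq_square)
      have d2: "((\<lambda>\<rho>. h1 (s * \<rho> * sin \<theta>)) has_real_derivative h2 (s * \<rho> * sin \<theta>) * (s * sin \<theta>)) (at \<rho> within {0..<pm})"
        by (rule h1_comp_deriv) (use that in auto)
      show ?thesis by (rule DERIV_cong[OF DERIV_mult[OF d1 d2]]) (simp add: mult.commute)
    qed
  qed (use assms in auto)
  moreover have "integral TT (?k \<rho>) = \<rho> * Th \<rho>"
  proof -
    \<comment> \<open>The derivative of \<open>?g\<close> is the integrand minus \<rho> h1, by sin^2
      = 1 - cos^2, and \<open>?g\<close> vanishes at both ends.\<close>
    let ?g = "\<lambda>\<theta>. \<rho> * cos \<theta> * sin \<theta> * h1 (s * \<rho> * sin \<theta>)"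
    let ?g' = "\<lambda>\<theta>. ?k \<rho> \<theta> - \<rho> * h1 (s * \<rho> * sin \<theta>)"
    have "(?g has_real_derivative ?g' \<theta>) (at \<theta> within TT)" if \<theta>: "\<theta> \<in> TT" for \<theta>
    proof -
      note r = range[OF assms \<theta>]
      have "((\<lambda>\<theta>. h1 (s * \<rho> * sin \<theta>)) has_real_derivative h2 (s * \<rho> * sin \<theta>) * (s * \<rho> * cos \<theta>)) (at \<theta> within TT)"
        by (rule DERIV_chain2[where f = h1 and g = "\<lambda>\<theta>. s * \<rho> * sin \<theta>", OF h1_deriv])
          (use r in \<open>auto intro!: derivative_eq_intros\<close>)
      then have "(?g has_real_derivative \<rho> * cos \<theta> * sin \<theta> * (h2 (s * \<rho> * sin \<theta>) * (s * \<rho> * cos \<theta>))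
          + (\<rho> * cos \<theta> * cos \<theta> - \<rho> * sin \<theta> * sin \<theta>) * h1 (s * \<rho> * sin \<theta>)) (at \<theta> within TT)"
        by (auto intro!: derivative_eq_intros simp: algebra_simps)
      then show ?thesis
      proof (rule DERIV_cong)
        have "sin \<theta> * sin \<theta> = 1 - cos \<theta> * cos \<theta>"
          using sin_cos_squared_add[of \<theta>] by (simp add: power2_eq_square)
        then show "\<rho> * cos \<theta> * sin \<theta> * (h2 (s * \<rho> * sin \<theta>) * (s * \<rho> * cos \<theta>))
          + (\<rho> * cos \<theta> * cos \<theta> - \<rho> * sin \<theta> * sin \<theta>) * h1 (s * \<rho> * sin \<theta>) = ?g' \<theta>"
          by algebra
      qed
    qed
    then have "(?g' has_integral ?g (real j * pi) - ?g 0) TT"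
      by (intro fundamental_theorem_of_calculus) (auto simp: has_real_derivative_iff_has_vector_derivative)
    then have g': "(?g' has_integral 0) TT" by simp
    have "continuous_on TT (\<lambda>\<theta>. \<rho> * h1 (s * \<rho> * sin \<theta>))"
      by (intro continuous_on_mult continuous_intros cont1[OF h1_cont] assms)
    then have "((\<lambda>\<theta>. \<rho> * h1 (s * \<rho> * sin \<theta>)) has_integral \<rho> * Th \<rho>) TT"
      using integrable_integral[OF integrable_continuous_real] by (fastforce simp: Th_def Theta_def)
    from has_integral_add[OF g' this] show ?thesis by (simp add: integral_unique)
  qed
  ultimately show ?thesis by simp
qed

lemma Jf_deriv: "0 < \<rho> \<Longrightarrow> \<rho> < pm \<Longrightarrow> (Jf has_real_derivative \<rho> * Th \<rho>) (at \<rho>)"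
  using Jf_deriv_within[of \<rho>] at_interior[of \<rho>] by simp

lemma Jf_0: "Jf 0 = 0"
  by (simp add: Jf_def)

lemma Jf_cont: "continuous_on {0..<pm} Jf"
  by (rule DERIV_continuous_on, rule Jf_deriv_within) auto

lemma Jf_pos:
  assumes "0 < \<rho>" "\<rho> < pm"
  shows "0 < Jf \<rho>"
proof -
  have "Jf 0 < Jf \<rho>"
  proof (rule DERIV_pos_imp_increasing_open[OF assms(1)])
    fix x assume x: "0 < x" "x < \<rho>"
    then have "0 < x * Th x" using Th_gt0[of x] assms by simp
    then show "\<exists>y. (Jf has_real_derivative y) (at x) \<and> 0 < y" using Jf_deriv[of x] x assms by auto
  qed (rule continuous_on_subset[OF Jf_cont], use assms in auto)
  then show ?thesis by (simp add: Jf_0)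
qed

lemma Rf_deriv: "0 < \<rho> \<Longrightarrow> \<rho> < pm \<Longrightarrow> (Rf has_real_derivative dRf \<rho>) (at \<rho>)"
  unfolding Rf_def dRf_def by (auto intro!: derivative_eq_intros Th_deriv Jf_deriv simp: field_simps)

lemma Lam_deriv: "0 < \<rho> \<Longrightarrow> \<rho> < pm \<Longrightarrow> (Lam has_real_derivative dLam \<rho>) (at \<rho>)"
  unfolding Lam_def dLam_def
  by (auto intro!: derivative_eq_intros Th_deriv simp: power2_eq_square field_simps)

lemma dRf_pos: "0 < \<rho> \<Longrightarrow> \<rho> < pm \<Longrightarrow> 0 < dRf \<rho>"
  unfolding dRf_def using dTh_pos[of \<rho>] Jf_pos[of \<rho>] Th_gt0[of \<rho>] by (auto intro!: divide_pos_pos add_pos_pos)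

lemma dLam_pos: "0 < \<rho> \<Longrightarrow> \<rho> < pm \<Longrightarrow> 0 < dLam \<rho>"
  unfolding dLam_def using dTh_pos[of \<rho>] Th_gt0[of \<rho>] by (auto intro!: divide_pos_pos)

lemma Lam_pos: "0 \<le> \<rho> \<Longrightarrow> \<rho> < pm \<Longrightarrow> 0 < Lam \<rho>"
  unfolding Lam_def using Th_gt0[of \<rho>] by auto

lemma sqrt_Lam: "0 \<le> \<rho> \<Longrightarrow> \<rho> < pm \<Longrightarrow> sqrt (Lam \<rho>) = Th \<rho> / pi"
  unfolding Lam_def using Th_gt0[of \<rho>] by simp

lemma Rf_mono:
  assumes "0 \<le> \<rho>" "\<rho> < \<rho>'" "\<rho>' < pm"
  shows "Rf \<rho> < Rf \<rho>'"
proof (rule DERIV_pos_imp_increasing_open[OF assms(2)])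
  fix x assume "\<rho> < x" "x < \<rho>'"
  then show "\<exists>y. (Rf has_real_derivative y) (at x) \<and> 0 < y"
    using Rf_deriv[of x] dRf_pos[of x] assms by auto
next
  have "continuous_on {0..<pm} Rf" unfolding Rf_def by (intro continuous_intros Th_cont Jf_cont) simp
  then show "continuous_on {\<rho>..\<rho>'} Rf" by (rule continuous_on_subset) (use assms in auto)
qed

lemma Rf_pos: "0 < \<rho> \<Longrightarrow> \<rho> < pm \<Longrightarrow> 0 < Rf \<rho>"
  using Rf_mono[of 0 \<rho>] by (simp add: Rf_def Jf_0)

lemma Rf_inj: "0 \<le> \<rho> \<Longrightarrow> \<rho> < pm \<Longrightarrow> 0 \<le> \<rho>' \<Longrightarrow> \<rho>' < pm \<Longrightarrow> Rf \<rho> = Rf \<rho>' \<Longrightarrow> \<rho> = \<rho>'"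
  using Rf_mono[of \<rho> \<rho>'] Rf_mono[of \<rho>' \<rho>] by linarith

end

section \<open>Unboundedness of the turning time near the barriers\<close>

context nonlinearity
begin

text \<open>A quarter turn takes long if it ends near the zero \<open>b\<close> of \<open>f\<close>: the function \<open>(b - u)\<^sup>2 + u'\<^sup>2\<close>
  decays at most exponentially.\<close>

lemma quarter_turn_bound:
  assumes a: "sin a = 0" and b: "b = bm \<or> b = bp"
    and rng: "\<And>\<theta>. \<theta> \<in> {a..a + pi / 2} \<Longrightarrow> ym < p * sin \<theta> \<and> p * sin \<theta> < yp"
    and C: "\<And>u. u \<in> {bm..bp} \<Longrightarrow> \<bar>f u\<bar> \<le> C * \<bar>b - u\<bar>" "0 \<le> C"
  shows "b\<^sup>2 \<le> (b - h (p * cos a))\<^sup>2 * exp ((1 + C) * integral {a..a + pi / 2} (\<lambda>\<theta>. h1 (p * sin \<theta>)))"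
proof -
  let ?I = "{a..a + pi / 2}"
  define e where "e \<theta> = (b - h (p * sin \<theta>))\<^sup>2 + (p * cos \<theta>)\<^sup>2" for \<theta>
  define e1 where "e1 \<theta> = - 2 * h1 (p * sin \<theta>) * (p * cos \<theta>) * ((b - h (p * sin \<theta>)) + f (h (p * sin \<theta>)))" for \<theta>
  \<comment> \<open>\<open>t\<close> is the elapsed time, dt = h1 d\<theta>. The aim is that
    \<open>e\<close> times exp ((1 + C) t) is nondecreasing; the Lipschitz bound \<open>C\<close>
    for \<open>f\<close> at its zero \<open>b\<close> and 2 |x y| <= x^2 + y^2 give this.\<close>
  define t where "t \<theta> = integral {a..\<theta>} (\<lambda>\<theta>. h1 (p * sin \<theta>))" for \<theta>
  have c: "continuous_on ?I (\<lambda>\<theta>. h1 (p * sin \<theta>))" using rng by (rule h1_sin_cont)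
  have dt: "(t has_real_derivative h1 (p * sin \<theta>)) (at \<theta> within ?I)" if "\<theta> \<in> ?I" for \<theta>
    unfolding t_def by (rule integral_has_real_derivative[OF c that])
  have de: "(e has_real_derivative e1 \<theta>) (at \<theta> within ?I)" if "\<theta> \<in> ?I" for \<theta>
  proof -
    note r = rng[OF that]
    have "((\<lambda>\<theta>. h (p * sin \<theta>)) has_real_derivative h1 (p * sin \<theta>) * (p * cos \<theta>)) (at \<theta> within ?I)"
      by (rule DERIV_chain2[where f = h and g = "\<lambda>\<theta>. p * sin \<theta>", OF h_deriv])
        (use r in \<open>auto intro!: derivative_eq_intros\<close>)
    then have "(e has_real_derivative 2 * (b - h (p * sin \<theta>)) * (- (h1 (p * sin \<theta>) * (p * cos \<theta>)))
        + 2 * (p * cos \<theta>) * (- (p * sin \<theta>))) (at \<theta> within ?I)"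
      unfolding e_def by (auto intro!: derivative_eq_intros)
    then show ?thesis
    proof (rule DERIV_cong)
      have "p * sin \<theta> = f (h (p * sin \<theta>)) * h1 (p * sin \<theta>)" using f_h_h1 r by simp
      then show "2 * (b - h (p * sin \<theta>)) * (- (h1 (p * sin \<theta>) * (p * cos \<theta>)))
        + 2 * (p * cos \<theta>) * (- (p * sin \<theta>)) = e1 \<theta>" unfolding e1_def by algebra
    qed
  qed
  have e1: "0 \<le> e1 \<theta> + (1 + C) * h1 (p * sin \<theta>) * e \<theta>" if "\<theta> \<in> ?I" for \<theta>
  proof -
    note r = rng[OF that]
    define \<zeta> where "\<zeta> = b - h (p * sin \<theta>)"
    define q where "q = p * cos \<theta>"
    have h1: "0 < h1 (p * sin \<theta>)" using h1_pos r by blast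
    have "\<bar>f (h (p * sin \<theta>))\<bar> \<le> C * \<bar>\<zeta>\<bar>"
      unfolding \<zeta>_def using C(1)[of "h (p * sin \<theta>)"] Y_h[of "p * sin \<theta>"] r by auto
    then have "\<bar>\<zeta> + f (h (p * sin \<theta>))\<bar> \<le> (1 + C) * \<bar>\<zeta>\<bar>" by (simp add: algebra_simps)
    then have "\<bar>q\<bar> * \<bar>\<zeta> + f (h (p * sin \<theta>))\<bar> \<le> \<bar>q\<bar> * ((1 + C) * \<bar>\<zeta>\<bar>)" by (rule mult_left_mono) simp
    moreover have "q * (\<zeta> + f (h (p * sin \<theta>))) \<le> \<bar>q\<bar> * \<bar>\<zeta> + f (h (p * sin \<theta>))\<bar>"
      unfolding abs_mult[symmetric] by (rule abs_ge_self)
    moreover have "2 * (\<bar>q\<bar> * ((1 + C) * \<bar>\<zeta>\<bar>)) \<le> (1 + C) * (\<zeta>\<^sup>2 + q\<^sup>2)"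
    proof -
      have "0 \<le> (\<bar>q\<bar> - \<bar>\<zeta>\<bar>)\<^sup>2" by simp
      then have "2 * (\<bar>q\<bar> * \<bar>\<zeta>\<bar>) \<le> \<zeta>\<^sup>2 + q\<^sup>2" by (simp add: power2_eq_square algebra_simps)
      then have "(1 + C) * (2 * (\<bar>q\<bar> * \<bar>\<zeta>\<bar>)) \<le> (1 + C) * (\<zeta>\<^sup>2 + q\<^sup>2)" using C(2) by (intro mult_left_mono) auto
      then show ?thesis by (simp add: algebra_simps)
    qed
    ultimately have "0 \<le> (1 + C) * (\<zeta>\<^sup>2 + q\<^sup>2) - 2 * (q * (\<zeta> + f (h (p * sin \<theta>))))" by linarith
    then have "0 \<le> h1 (p * sin \<theta>) * ((1 + C) * (\<zeta>\<^sup>2 + q\<^sup>2) - 2 * (q * (\<zeta> + f (h (p * sin \<theta>)))))"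
      using h1 by simp
    also have "\<dots> = e1 \<theta> + (1 + C) * h1 (p * sin \<theta>) * e \<theta>"
      by (simp add: e1_def e_def \<zeta>_def q_def algebra_simps)
    finally show ?thesis .
  qed
  have "e a * exp ((1 + C) * t a) \<le> e (a + pi / 2) * exp ((1 + C) * t (a + pi / 2))"
  proof (rule DERIV_nonneg_imp_increasing_open[of a "a + pi / 2" "\<lambda>\<theta>. e \<theta> * exp ((1 + C) * t \<theta>)"])
    fix \<theta> assume \<theta>: "a < \<theta>" "\<theta> < a + pi / 2"
    then have at: "at \<theta> within ?I = at \<theta>" "\<theta> \<in> ?I" by (auto intro!: at_within_Icc_at)
    have "((\<lambda>\<theta>. e \<theta> * exp ((1 + C) * t \<theta>)) has_real_derivative
        (e1 \<theta> + (1 + C) * h1 (p * sin \<theta>) * e \<theta>) * exp ((1 + C) * t \<theta>)) (at \<theta>)"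
      using de[OF at(2)] dt[OF at(2)] unfolding at(1)
      by (auto intro!: derivative_eq_intros simp: algebra_simps)
    moreover have "0 \<le> (e1 \<theta> + (1 + C) * h1 (p * sin \<theta>) * e \<theta>) * exp ((1 + C) * t \<theta>)"
      using e1[OF at(2)] by simp
    ultimately show "\<exists>y. ((\<lambda>\<theta>. e \<theta> * exp ((1 + C) * t \<theta>)) has_real_derivative y) (at \<theta>) \<and> 0 \<le> y" by blast
  next
    have "continuous_on ?I e" "continuous_on ?I t"
      by (rule DERIV_continuous_on, erule de, rule DERIV_continuous_on, erule dt)
    then show "continuous_on ?I (\<lambda>\<theta>. e \<theta> * exp ((1 + C) * t \<theta>))" by (intro continuous_intros)
  qed simp
  moreover have "b\<^sup>2 \<le> e a" using a by (simp add: e_def h_0)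
  moreover have "e (a + pi / 2) = (b - h (p * cos a))\<^sup>2" using a by (simp add: e_def sin_add cos_add)
  ultimately show ?thesis by (simp add: t_def)
qed

end

context branch
begin

text \<open>A wave that turns close to an equilibrium \<open>b\<close> spends a long time there. For
  one half turn the sign \<open>s\<close> decides which barrier is approached; otherwise it is the
  closer one, in the first or the second half turn.\<close>

lemma Th_unbounded:
  obtains \<rho> where "0 < \<rho>" "\<rho> < pm" "K < Th \<rho>"
proof -
  text \<open>The zero \<open>b\<close> that is approached as \<open>\<rho>\<close> tends to \<open>pm\<close>, and the half turn in which this happens.\<close>
  obtain a \<sigma> b where a: "a = 0 \<or> a = pi \<and> j \<noteq> 1" "\<sigma> = s * cos a"
    and b: "b = (if \<sigma> = 1 then bp else bm)" and Yb: "\<bar>Y b\<bar> = pm"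
  proof (cases "j = 1")
    case True
    then show ?thesis using s yp_pos ym_neg
      by (intro that[of 0 s "if s = 1 then bp else bm"]) (auto simp: pmax_def yp_def ym_def)
  next
    case False
    show ?thesis
    proof (cases "yp \<le> - ym")
      case True
      then show ?thesis using s yp_pos ym_neg False
        by (intro that[of "if s = 1 then 0 else pi" 1 bp]) (auto simp: pmax_def yp_def ym_def)
    next
      case False': False
      then show ?thesis using s yp_pos ym_neg False
        by (intro that[of "if s = 1 then pi else 0" "-1" bm]) (auto simp: pmax_def yp_def ym_def)
    qed
  qed
  have \<sigma>: "\<sigma> = 1 \<or> \<sigma> = -1" using a s by auto
  have b0: "b \<noteq> 0" "f b = 0" "b \<in> {bm..bp}" using b bm bp by auto
  obtain C where C: "0 \<le> C" "\<And>x. x \<in> {bm..bp} \<Longrightarrow> \<bar>f' x\<bar> \<le> C"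
    using continuous_on_Icc_bounded[OF f'_cont] by metis
  have fC: "\<bar>f u\<bar> \<le> C * \<bar>b - u\<bar>" if "u \<in> {bm..bp}" for u
  proof -
    have "norm (f b - f u) \<le> C * norm (b - u)"
      by (rule field_differentiable_bound[of "{bm..bp}" f f'])
        (use that b0 C f_deriv in \<open>auto intro: has_field_derivative_at_within\<close>)
    then show ?thesis using b0 by simp
  qed
  \<comment> \<open>The turning point is u = b (1 - \<delta>). The exponential is chosen so that
    \<delta>^2 exp ((1 + C) (|K| + 1)) is at most 1, which makes the quarter turn last at least |K|
    + 1; the minimum with 1/2 makes \<delta> < 1 evident.\<close>
  define \<delta> where "\<delta> = min (1 / 2) (exp (- ((1 + C) * (\<bar>K\<bar> + 1)) / 2))"
  have \<delta>: "0 < \<delta>" "\<delta> < 1" by (auto simp: \<delta>_def)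
  define u where "u = b * (1 - \<delta>)"
  have u: "bm < u" "u < bp" "u \<noteq> 0" "0 < \<sigma> * u"
  proof -
    have "bp * (1 - \<delta>) < bp * 1" "0 < bp * (1 - \<delta>)" "bm * 1 < bm * (1 - \<delta>)" "bm * (1 - \<delta>) < 0"
      using \<delta> bm bp by (auto intro: mult_strict_left_mono mult_strict_left_mono_neg mult_neg_pos)
    then show "bm < u" "u < bp" "u \<noteq> 0" "0 < \<sigma> * u"
      using \<sigma> bm bp unfolding u_def b by auto
  qed
  define \<rho> where "\<rho> = \<sigma> * Y u"
  have Yu: "ym < Y u" "Y u < yp" using Y_in[OF u(1,2)] by auto
  have \<rho>: "0 < \<rho>" "\<rho> < pm"
  proof -
    show "0 < \<rho>" using \<sigma> u Y_pos[of u] Y_neg[of u] by (auto simp: \<rho>_def)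
    have "\<sigma> = 1 \<Longrightarrow> pm = yp" "\<sigma> = -1 \<Longrightarrow> pm = - ym" using Yb b yp_pos ym_neg by (auto simp: yp_def ym_def)
    then show "\<rho> < pm" using \<sigma> Yu by (auto simp: \<rho>_def)
  qed
  have sub: "{a..a + pi / 2} \<subseteq> TT"
  proof -
    have "pi \<le> real j * pi" using j by simp
    moreover have "2 * pi \<le> real j * pi" if "j \<noteq> 1" using j that by (intro mult_right_mono) auto
    ultimately show ?thesis using a pi_gt_zero by auto
  qed
  have rng: "ym < s * \<rho> * sin \<theta> \<and> s * \<rho> * sin \<theta> < yp" if "\<theta> \<in> {a..a + pi / 2}" for \<theta>
    using range[of \<rho> \<theta>] \<rho> sub that by auto
  have "s * \<rho> * cos a = Y u" using a s by (auto simp: \<rho>_def)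
  then have hu: "h (s * \<rho> * cos a) = u" using h_Y[of u] u by simp
  define I where "I = integral {a..a + pi / 2} (\<lambda>\<theta>. h1 (s * \<rho> * sin \<theta>))"
  have "b\<^sup>2 \<le> (b - u)\<^sup>2 * exp ((1 + C) * I)"
  proof -
    have "sin a = 0" "b = bm \<or> b = bp" using a b by auto
    from quarter_turn_bound[OF this rng fC C(1)] show ?thesis unfolding I_def hu .
  qed
  also have "(b - u)\<^sup>2 = b\<^sup>2 * \<delta>\<^sup>2" by (simp add: u_def power2_eq_square algebra_simps)
  finally have "b\<^sup>2 * 1 \<le> b\<^sup>2 * (\<delta>\<^sup>2 * exp ((1 + C) * I))" by (simp add: mult.assoc)
  then have "1 \<le> \<delta>\<^sup>2 * exp ((1 + C) * I)" using b0 by (subst (asm) mult_le_cancel_left_pos) auto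
  also have "\<delta>\<^sup>2 \<le> (exp (- ((1 + C) * (\<bar>K\<bar> + 1)) / 2))\<^sup>2"
    using \<delta> by (intro power_mono) (auto simp: \<delta>_def)
  also have "\<dots> = exp (- ((1 + C) * (\<bar>K\<bar> + 1)))" by (simp add: power2_eq_square exp_add[symmetric])
  finally have "1 \<le> exp ((1 + C) * (I - (\<bar>K\<bar> + 1)))"
    by (simp add: exp_add[symmetric] algebra_simps)
  then have "0 \<le> (1 + C) * (I - (\<bar>K\<bar> + 1))" by simp
  then have "\<bar>K\<bar> + 1 \<le> I" using C(1) by (simp add: zero_le_mult_iff)
  also have "I \<le> Th \<rho>" unfolding I_def Th_def Theta_def
  proof (rule integral_subset_le[OF sub])
    have c: "continuous_on TT (\<lambda>\<theta>. h1 (s * \<rho> * sin \<theta>))" by (rule cont1[OF h1_cont]) (use \<rho> in auto)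
    then show "(\<lambda>\<theta>. h1 (s * \<rho> * sin \<theta>)) integrable_on TT" by (rule integrable_continuous_real)
    show "(\<lambda>\<theta>. h1 (s * \<rho> * sin \<theta>)) integrable_on {a..a + pi / 2}"
      by (rule integrable_continuous_real[OF continuous_on_subset[OF c sub]])
    show "\<forall>\<theta>\<in>TT. 0 \<le> h1 (s * \<rho> * sin \<theta>)"
    proof
      fix \<theta> assume "\<theta> \<in> TT"
      then show "0 \<le> h1 (s * \<rho> * sin \<theta>)"
        using h1_pos[of "s * \<rho> * sin \<theta>"] range[of \<rho> \<theta>] \<rho> by (simp add: less_imp_le)
    qed
  qed
  finally show ?thesis using that[of \<rho>] \<rho> by simp
qed

section \<open>Identification of \<open>phi\<close>, \<open>lam_of\<close> and the derivative of
  c\<close>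

lemma amplitude_exists:
  assumes "(real j)\<^sup>2 < lam"
  obtains \<rho> where "0 < \<rho>" "\<rho> < pm" "Th \<rho> = pi * sqrt lam"
proof -
  have "sqrt ((real j)\<^sup>2) < sqrt lam" using assms by (rule real_sqrt_less_mono)
  then have lo: "Th 0 < pi * sqrt lam" by (simp add: Th_0 mult.commute)
  obtain \<rho>' where r: "0 < \<rho>'" "\<rho>' < pm" "pi * sqrt lam < Th \<rho>'" by (rule Th_unbounded)
  have "\<exists>x\<ge>0. x \<le> \<rho>' \<and> Th x = pi * sqrt lam"
    by (rule IVT') (use lo r in \<open>auto intro: continuous_on_subset[OF Th_cont]\<close>)
  then obtain x where "0 \<le> x" "x \<le> \<rho>'" "Th x = pi * sqrt lam" by auto
  moreover then have "x \<noteq> 0" using lo by auto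
  ultimately show ?thesis using that[of x] r by auto
qed

lemma phase_range:
  assumes "phase (s * \<rho>) lam pi \<theta>" "0 < lam" "\<theta> pi = real j * pi" "x \<in> {0..pi}"
  shows "\<theta> x \<in> TT"
  using phase_mono[OF assms(1,2), of 0 x] phase_mono[OF assms(1,2), of x pi] phaseD(1)[OF assms(1)] assms(3,4)
  by (cases "x = 0"; cases "x = pi") auto

text \<open>The substitution from \<open>x\<close> to \<theta> is performed by differentiating the
  primitive \<open>G\<close> along the phase.\<close>

lemma wave_energy:
  assumes ph: "phase (s * \<rho>) lam pi \<theta>" "\<theta> pi = real j * pi" and lam: "0 < lam" and \<rho>: "0 < \<rho>" "\<rho> < pm"
    and eq: "Th \<rho> = pi * sqrt lam"
  shows "ip (\<lambda>x. sqrt lam * (s * \<rho>) * cos (\<theta> x)) (\<lambda>x. sqrt lam * (s * \<rho>) * cos (\<theta> x)) = Rf \<rho>"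
proof -
  define G where "G t = integral {0..t} (\<lambda>\<theta>. (\<rho> * cos \<theta>)\<^sup>2 * h1 (s * \<rho> * sin \<theta>))" for t
  have c: "continuous_on TT (\<lambda>\<theta>. (\<rho> * cos \<theta>)\<^sup>2 * h1 (s * \<rho> * sin \<theta>))"
    by (intro continuous_on_mult continuous_intros cont1[OF h1_cont]) (use \<rho> in auto)
  have d: "((\<lambda>x. sqrt lam * G (\<theta> x)) has_real_derivative (sqrt lam * (s * \<rho>) * cos (\<theta> x)) * (sqrt lam * (s * \<rho>) * cos (\<theta> x)))
      (at x within {0..pi})" if x: "x \<in> {0..pi}" for x
  proof -
    have "((\<lambda>x. G (\<theta> x)) has_real_derivative ((\<rho> * cos (\<theta> x))\<^sup>2 * h1 (s * \<rho> * sin (\<theta> x))) * (sqrt lam / h1 (s * \<rho> * sin (\<theta> x))))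
        (at x within {0..pi})"
    proof (rule DERIV_chain_Icc[where f = G and g = \<theta>])
      show "(G has_real_derivative (\<rho> * cos (\<theta> x))\<^sup>2 * h1 (s * \<rho> * sin (\<theta> x))) (at (\<theta> x) within TT)"
        unfolding G_def by (rule integral_has_real_derivative[OF c phase_range[OF ph(1) lam ph(2) x]])
      show "\<theta> ` {0..pi} \<subseteq> TT" using phase_range[OF ph(1) lam ph(2)] by blast
    qed (rule phaseD(2)[OF ph(1) x])
    moreover have "h1 (s * \<rho> * sin (\<theta> x)) \<noteq> 0" using h1_pos[OF phaseD(3,4)[OF ph(1) x]] by simp
    moreover have "s * s = 1" using s by auto
    ultimately show ?thesis using lam
      by (auto intro!: derivative_eq_intros simp: power2_eq_square) (auto simp: algebra_simps)
  qed
  have "((\<lambda>x. (sqrt lam * (s * \<rho>) * cos (\<theta> x)) * (sqrt lam * (s * \<rho>) * cos (\<theta> x))) has_integral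
      sqrt lam * G (\<theta> pi) - sqrt lam * G (\<theta> 0)) {0..pi}"
    by (rule fundamental_theorem_of_calculus) (use d in \<open>auto simp: has_real_derivative_iff_has_vector_derivative\<close>)
  then have "ip (\<lambda>x. sqrt lam * (s * \<rho>) * cos (\<theta> x)) (\<lambda>x. sqrt lam * (s * \<rho>) * cos (\<theta> x)) = sqrt lam * G (\<theta> pi) - sqrt lam * G (\<theta> 0)"
    unfolding ip_def by (rule integral_unique)
  also have "\<dots> = sqrt lam * Jf \<rho>" using phaseD(1)[OF ph(1)] ph(2) by (simp add: G_def Jf_def)
  also have "\<dots> = Rf \<rho>" using eq by (simp add: Rf_def)
  finally show ?thesis .
qed

lemma L2norm_dx:
  assumes "has_C2_deriv u u1 u2"
  shows "(L2norm (dx u))\<^sup>2 = ip u1 u1"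
proof -
  have "L2norm (dx u) = L2norm u1"
    unfolding L2norm_def
    by (intro arg_cong[where f = sqrt] Bochner_Integration.integral_cong refl)
      (use has_C2_deriv_dx(1)[OF assms] in \<open>auto simp: space_restrict_space\<close>)
  then show ?thesis using L2norm_cts[OF has_C2_derivD(4)[OF assms]] ip_self_nonneg[of u1] by simp
qed

lemma dirichlet_f_iff:
  "dirichlet_solution (\<lambda>u. lam * f u) u \<longleftrightarrow> (\<exists>u1. has_C2_deriv u u1 (\<lambda>x. - (lam * f (u x)))) \<and> u 0 = 0 \<and> u pi = 0"
  by (rule dirichlet_solution_iff) (intro continuous_intros f_cont)

lemma wave_unique:
  assumes u: "has_C2_deriv u u1 (\<lambda>x. - (lam * f (u x)))" and v: "has_C2_deriv v v1 (\<lambda>x. - (lam * f (v x)))"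
    and "u 0 = v 0" "u1 0 = v1 0" "x \<in> {0..pi}"
  shows "u x = v x"
proof -
  have dg: "((\<lambda>v. - (lam * f v)) has_real_derivative - (lam * f' v)) (at v)" for v
    by (auto intro!: derivative_eq_intros f_deriv)
  have cg: "continuous_on UNIV (\<lambda>v. - (lam * f' v))" by (intro continuous_intros f'_cont)
  show ?thesis
    using second_order_unique[of _ _ 0 pi u u1 v v1 0 x, OF dg cg has_C2_derivD(1,2)[OF u] has_C2_derivD(1,2)[OF v]]
      assms(3-5) by auto
qed

text \<open>For the definite description: any competitor is a wave by
  \<open>solution_is_wave\<close>, injectivity of \<open>Th\<close> fixes its amplitude and hence
  its initial slope, and the values outside [0, pi] are prescribed.\<close>

lemma phi_wave:
  assumes lam: "(real j)\<^sup>2 < lam" and \<rho>: "0 < \<rho>" "\<rho> < pm" and eq: "Th \<rho> = pi * sqrt lam"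
  shows "(L2norm (dx (phi f j s lam)))\<^sup>2 = Rf \<rho>"
proof -
  have lam0: "0 < lam" using lam by (meson le_less_trans zero_le_power2)
  obtain \<theta> where ph: "phase (s * \<rho>) lam (Theta j (s * \<rho>) / sqrt lam) \<theta>"
    "\<theta> (Theta j (s * \<rho>) / sqrt lam) = real j * pi"
    by (rule phase_exists[OF range[OF less_imp_le[OF \<rho>(1)] \<rho>(2)] lam0])
  have "Theta j (s * \<rho>) / sqrt lam = pi" using eq lam0 by (simp add: Th_def)
  with ph have ph: "phase (s * \<rho>) lam pi \<theta>" "\<theta> pi = real j * pi" by simp_all
  define w where "w x = (if x \<in> {0..pi} then h (s * \<rho> * sin (\<theta> x)) else 0)" for x
  let ?w1 = "\<lambda>x. sqrt lam * (s * \<rho>) * cos (\<theta> x)"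
  have "s * \<rho> \<noteq> 0" using s \<rho>(1) by auto
  have weq: "w x = h (s * \<rho> * sin (\<theta> x))" if "x \<in> {0..pi}" for x using that by (simp add: w_def)
  note w1 = wave_dirichlet[OF ph(1) lam0 \<open>s * \<rho> \<noteq> 0\<close> ph(2), of w, OF weq]
  have dw0: "0 < s * dx w 0"
    using has_C2_deriv_dx(1)[OF w1(1), of 0] phaseD(1)[OF ph(1)] s \<rho> lam0 by auto
  have "phi f j s lam = w"
  proof -
    have "(THE \<phi>. dirichlet_solution (\<lambda>u. lam * f u) \<phi> \<and> has_n_zeros (j - 1) \<phi>
                  \<and> s * dx \<phi> 0 > 0 \<and> (\<forall>x. x \<notin> {0..pi} \<longrightarrow> \<phi> x = 0)) = w"
    proof (rule the_equality)
      show "dirichlet_solution (\<lambda>u. lam * f u) w \<and> has_n_zeros (j - 1) w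
                  \<and> s * dx w 0 > 0 \<and> (\<forall>x. x \<notin> {0..pi} \<longrightarrow> w x = 0)"
        unfolding dirichlet_f_iff using w1 dw0 by (auto simp: w_def)
    next
      fix v assume v: "dirichlet_solution (\<lambda>u. lam * f u) v \<and> has_n_zeros (j - 1) v
                  \<and> s * dx v 0 > 0 \<and> (\<forall>x. x \<notin> {0..pi} \<longrightarrow> v x = 0)"
      then obtain v1 where v1: "has_C2_deriv v v1 (\<lambda>x. - (lam * f (v x)))" "v 0 = 0" "v pi = 0"
        unfolding dirichlet_f_iff by auto
      have vz: "has_n_zeros (j - 1) v" using v by blast
      have v0: "0 < s * v1 0" using v has_C2_deriv_dx(1)[OF v1(1), of 0] by simp
      obtain \<rho>' where r': "0 < \<rho>'" "\<rho>' < pm" "v1 0 = sqrt lam * (s * \<rho>')" "Theta j (s * \<rho>') = pi * sqrt lam"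
        by (rule solution_is_wave[OF lam0 j s v1 vz v0])
      then have "\<rho>' = \<rho>" using Th_inj[of \<rho>' \<rho>] \<rho> eq by (simp add: Th_def)
      then have "v x = w x" if "x \<in> {0..pi}" for x
        using wave_unique[OF v1(1) w1(1) _ _ that] r' v1(2) w1(2) phaseD(1)[OF ph(1)] by simp
      then show "v = w" using v by (auto simp: w_def fun_eq_iff)
    qed
    then show ?thesis using lam by (simp add: phi_def)
  qed
  then show ?thesis using L2norm_dx[OF w1(1)] wave_energy[OF ph lam0 \<rho> eq] by simp
qed

text \<open>Another parameter with the same energy would have an amplitude \<rho>' with Rf \<rho>' =
  Rf \<rho>, and \<open>Rf\<close> is injective. The value lam = j^2 is excluded separately, since
  there \<open>phi\<close> is 0 and the energy vanishes.\<close>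

lemma lam_of_Rf:
  assumes \<rho>: "0 < \<rho>" "\<rho> < pm"
  shows "lam_of f j s (Rf \<rho>) = Lam \<rho>"
  unfolding lam_of_def
proof (rule the_equality)
  have "Th 0 < Th \<rho>" using Th_mono[of 0 \<rho>] \<rho> by simp
  then have "real j < Th \<rho> / pi" by (simp add: Th_0 field_simps)
  then have L: "(real j)\<^sup>2 < Lam \<rho>" unfolding Lam_def by (intro power_strict_mono) auto
  have "Th \<rho> = pi * sqrt (Lam \<rho>)" using sqrt_Lam[of \<rho>] \<rho> by simp
  then show "(real j)\<^sup>2 \<le> Lam \<rho> \<and> (L2norm (dx (phi f j s (Lam \<rho>))))\<^sup>2 = Rf \<rho>"
    using phi_wave[OF L \<rho>] L by simp
next
  fix lam assume lam: "(real j)\<^sup>2 \<le> lam \<and> (L2norm (dx (phi f j s lam)))\<^sup>2 = Rf \<rho>"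
  have "lam \<noteq> (real j)\<^sup>2"
  proof
    assume e: "lam = (real j)\<^sup>2"
    have "has_C2_deriv (\<lambda>_. 0) (\<lambda>_. 0) (\<lambda>_. 0)" by (auto simp: has_C2_deriv_def)
    then have "(L2norm (dx (phi f j s lam)))\<^sup>2 = 0" using L2norm_dx e by (simp add: phi_def)
    then show False using lam Rf_pos[OF \<rho>] by simp
  qed
  then have l: "(real j)\<^sup>2 < lam" using lam by simp
  then obtain \<rho>' where r: "0 < \<rho>'" "\<rho>' < pm" "Th \<rho>' = pi * sqrt lam" by (rule amplitude_exists)
  have "Rf \<rho>' = Rf \<rho>" using phi_wave[OF l r] lam by simp
  then have "\<rho>' = \<rho>" using Rf_inj[of \<rho>' \<rho>] r \<rho> by simp
  moreover have "0 < lam" using l by (meson le_less_trans zero_le_power2)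
  ultimately show "lam = Lam \<rho>" using r by (simp add: Lam_def)
qed

text \<open>Near Rf \<rho> the function is 1 / Lam composed with the inverse of \<open>Rf\<close>.
  The inverse is taken on a compact interval around \<rho> inside the admissible range, and the
  value follows from the chain rule.\<close>

lemma deriv_c:
  assumes \<rho>: "0 < \<rho>" "\<rho> < pm"
  shows "deriv (\<lambda>r. 1 / lam_of f j s r) (Rf \<rho>) = - dLam \<rho> / ((Lam \<rho>)\<^sup>2 * dRf \<rho>)"
proof -
  define a b where "a = \<rho> / 2" and "b = (\<rho> + pm) / 2"
  have ab: "0 < a" "a < \<rho>" "\<rho> < b" "b < pm" using \<rho> by (auto simp: a_def b_def)
  have inj: "inj_on Rf {a..b}"
    by (rule strict_mono_on_imp_inj_on) (use ab in \<open>auto simp: strict_mono_on_def intro!: Rf_mono\<close>)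
  define g where "g = inv_into {a..b} Rf"
  have gR: "g (Rf t) = t" if "a \<le> t" "t \<le> b" for t
    unfolding g_def by (rule inv_into_f_f[OF inj]) (use that in auto)
  have cR: "isCont Rf t" if "a \<le> t" "t \<le> b" for t
    by (rule DERIV_isCont, rule Rf_deriv) (use ab that in auto)
  have Rg: "Rf (g y) = y \<and> a \<le> g y \<and> g y \<le> b" if "Rf a < y" "y < Rf b" for y
  proof -
    have "\<exists>x\<ge>a. x \<le> b \<and> Rf x = y" by (rule IVT) (use that cR ab in auto)
    then show ?thesis using gR by auto
  qed
  have Rab: "Rf a < Rf \<rho>" "Rf \<rho> < Rf b" using Rf_mono ab \<rho> by auto
  have cg: "isCont g (Rf \<rho>)"
  proof (rule isCont_inverse_function[where f = Rf and g = g and x = \<rho> and d = "min (\<rho> - a) (b - \<rho>)"])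
    fix z assume "\<bar>z - \<rho>\<bar> \<le> min (\<rho> - a) (b - \<rho>)"
    then have "a \<le> z" "z \<le> b" using abs_ge_self[of "z - \<rho>"] abs_ge_minus_self[of "z - \<rho>"] by linarith+
    then show "g (Rf z) = z" "isCont Rf z" using gR cR by auto
  qed (use ab in auto)
  have g\<rho>: "g (Rf \<rho>) = \<rho>" using gR ab by simp
  have "(Rf has_real_derivative dRf \<rho>) (at (g (Rf \<rho>)))" using Rf_deriv[OF \<rho>] g\<rho> by simp
  then have dg: "(g has_real_derivative inverse (dRf \<rho>)) (at (Rf \<rho>))"
    by (rule DERIV_inverse_function[where f = Rf and g = g and a = "Rf a" and b = "Rf b" and x = "Rf \<rho>", OF _ _ Rab _ cg])
      (use dRf_pos[OF \<rho>] Rg in auto)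
  have "(Lam has_real_derivative dLam \<rho>) (at (g (Rf \<rho>)))" using Lam_deriv[OF \<rho>] g\<rho> by simp
  from DERIV_chain2[OF this dg]
  have dL: "((\<lambda>r. Lam (g r)) has_real_derivative dLam \<rho> * inverse (dRf \<rho>)) (at (Rf \<rho>))" .
  have "((\<lambda>r. 1 / Lam (g r)) has_real_derivative - dLam \<rho> / ((Lam \<rho>)\<^sup>2 * dRf \<rho>)) (at (Rf \<rho>))"
    by (rule derivative_eq_intros dL refl)+
      (use Lam_pos[of \<rho>] \<rho> dRf_pos[OF \<rho>] g\<rho> in \<open>auto simp: field_simps power2_eq_square\<close>)
  then have "((\<lambda>r. 1 / lam_of f j s r) has_real_derivative - dLam \<rho> / ((Lam \<rho>)\<^sup>2 * dRf \<rho>)) (at (Rf \<rho>))"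
  proof (rule has_field_derivative_transform_within_open[of _ _ _ "{Rf a<..<Rf b}"])
    fix r assume "r \<in> {Rf a<..<Rf b}"
    then have g: "Rf (g r) = r" "a \<le> g r" "g r \<le> b" using Rg by auto
    then show "1 / Lam (g r) = 1 / lam_of f j s r" using lam_of_Rf[of "g r"] ab by simp
  qed (use Rab in auto)
  then show ?thesis by (rule DERIV_imp_deriv)
qed

end

subsection \<open>The linearized equation\<close>

lemma FTC_Icc:
  fixes u :: "real \<Rightarrow> real"
  assumes "a \<le> b" "\<And>x. x \<in> {a..b} \<Longrightarrow> (u has_real_derivative u' x) (at x within {a..b})"
  shows "integral {a..b} u' = u b - u a"
  by (rule integral_unique, rule fundamental_theorem_of_calculus[OF assms(1)])
    (use assms(2) in \<open>auto simp: has_real_derivative_iff_has_vector_derivative\<close>)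

lemma partial_ip_bound:
  assumes "cts u" "cts h" "x \<in> {0..pi}"
  shows "\<bar>integral {0..x} (\<lambda>t. u t * h t)\<bar> \<le> sqrt (ip u u) * sqrt (ip h h)"
proof -
  have c: "cts (\<lambda>t. u t * h t)" "cts (\<lambda>t. \<bar>u t\<bar>)" "cts (\<lambda>t. \<bar>h t\<bar>)" "cts (\<lambda>t. \<bar>u t\<bar> * \<bar>h t\<bar>)"
    using assms by (auto intro!: continuous_intros)
  have sub: "{0..x} \<subseteq> {0..pi}" using assms(3) by auto
  have i: "(\<lambda>t. u t * h t) integrable_on {0..x}" "(\<lambda>t. \<bar>u t\<bar> * \<bar>h t\<bar>) integrable_on {0..x}"
    "(\<lambda>t. \<bar>u t\<bar> * \<bar>h t\<bar>) integrable_on {0..pi}"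
    by (rule integrable_continuous_real, rule continuous_on_subset[OF c(1) sub])
      (rule integrable_continuous_real, rule continuous_on_subset[OF c(4) sub],
        rule integrable_continuous_real, rule c(4))
  have "\<bar>integral {0..x} (\<lambda>t. u t * h t)\<bar> \<le> integral {0..x} (\<lambda>t. \<bar>u t\<bar> * \<bar>h t\<bar>)"
    using integral_norm_bound_integral[OF i(1,2)] by (simp add: abs_mult)
  also have "\<dots> \<le> integral {0..pi} (\<lambda>t. \<bar>u t\<bar> * \<bar>h t\<bar>)"
    by (rule integral_subset_le[OF sub i(2,3)]) simp
  also have "\<dots> = ip (\<lambda>t. \<bar>u t\<bar>) (\<lambda>t. \<bar>h t\<bar>)" by (simp add: ip_def)
  also have "\<dots> \<le> sqrt (ip (\<lambda>t. \<bar>u t\<bar>) (\<lambda>t. \<bar>u t\<bar>)) * sqrt (ip (\<lambda>t. \<bar>h t\<bar>) (\<lambda>t. \<bar>h t\<bar>))"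
    using ip_bound[OF c(2,3)] by simp
  also have "ip (\<lambda>t. \<bar>u t\<bar>) (\<lambda>t. \<bar>u t\<bar>) = ip u u" by (simp add: ip_def)
  also have "ip (\<lambda>t. \<bar>h t\<bar>) (\<lambda>t. \<bar>h t\<bar>) = ip h h" by (simp add: ip_def)
  finally show ?thesis .
qed

locale linearized = branch +
  fixes \<rho> lam :: real and \<theta> \<psi> :: "real \<Rightarrow> real"
  assumes \<rho>: "0 < \<rho>" "\<rho> < pm" and lam: "0 < lam" and Th_eq: "Th \<rho> = pi * sqrt lam"
    and ph: "phase (s * \<rho>) lam pi \<theta>" and \<theta>_pi: "\<theta> pi = real j * pi"
    and \<psi>_eq: "\<And>x. x \<in> {0..pi} \<Longrightarrow> \<psi> x = h (s * \<rho> * sin (\<theta> x))"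
begin

definition "\<eta> = sqrt lam * (s * \<rho>)"
definition "\<psi>1 x = \<eta> * cos (\<theta> x)"
definition "g x = f (\<psi> x)"
definition "q x = lam * f' (\<psi> x)"
text \<open>Write p = s \<rho>. This is the derivative in p, at fixed angle, of the time integral of
  h1 (p sin \<alpha>). Hence at fixed x the angle changes at the rate - \<tau> / h1. Inserting this
  in the derivative of h (p sin \<theta>) and dividing by sqrt lam, the derivative of the initial
  slope, gives the formula for \<open>v\<close>.\<close>

definition "\<tau> x = integral {0..\<theta> x} (\<lambda>\<alpha>. h2 (s * \<rho> * sin \<alpha>) * sin \<alpha>)"
definition "v x = (h1 (s * \<rho> * sin (\<theta> x)) * sin (\<theta> x) - s * \<rho> * cos (\<theta> x) * \<tau> x) / sqrt lam"
definition "v1 x = cos (\<theta> x) + g x * \<tau> x"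

lemma ss: "s * s = 1"
  using s by auto

lemma p_nz: "s * \<rho> \<noteq> 0"
  using s \<rho> by auto

lemma \<eta>_nz: "\<eta> \<noteq> 0"
  using p_nz lam by (simp add: \<eta>_def)

lemma \<eta>_sq: "\<eta> * \<eta> = lam * (\<rho> * \<rho>)"
proof -
  have "\<eta> * \<eta> = (sqrt lam * sqrt lam) * (s * s) * (\<rho> * \<rho>)" by (simp add: \<eta>_def)
  then show ?thesis using lam by (simp add: ss)
qed

lemma wave: "has_C2_deriv \<psi> \<psi>1 (\<lambda>x. - (lam * g x))" "\<psi> 0 = 0" "\<psi> pi = 0" "has_n_zeros (j - 1) \<psi>"
  using wave_dirichlet[OF ph lam p_nz \<theta>_pi \<psi>_eq] unfolding \<psi>1_def \<eta>_def g_def by auto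

lemma \<psi>1_deriv: "x \<in> {0..pi} \<Longrightarrow> (\<psi>1 has_real_derivative - (lam * g x)) (at x within {0..pi})"
  by (rule has_C2_derivD(2)[OF wave(1)])

lemma \<psi>_deriv: "x \<in> {0..pi} \<Longrightarrow> (\<psi> has_real_derivative \<psi>1 x) (at x within {0..pi})"
  by (rule has_C2_derivD(1)[OF wave(1)])

lemma cts_\<psi>: "cts \<psi>" and cts_\<psi>1: "cts \<psi>1"
  by (rule has_C2_derivD(3)[OF wave(1)]) (rule has_C2_derivD(4)[OF wave(1)])

lemma g_deriv: "x \<in> {0..pi} \<Longrightarrow> (g has_real_derivative f' (\<psi> x) * \<psi>1 x) (at x within {0..pi})"
  unfolding g_def by (rule DERIV_chain2[where f = f and g = \<psi>, OF f_deriv \<psi>_deriv])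

lemma cts_g: "cts g"
  by (rule DERIV_continuous_on, rule g_deriv)

lemma cts_q: "cts q"
  unfolding q_def by (intro continuous_intros continuous_on_compose2[OF f'_cont[of UNIV] cts_\<psi>]) auto

lemma rng: "x \<in> {0..pi} \<Longrightarrow> ym < s * \<rho> * sin (\<theta> x)" "x \<in> {0..pi} \<Longrightarrow> s * \<rho> * sin (\<theta> x) < yp"
  by (rule phaseD(3)[OF ph], assumption) (rule phaseD(4)[OF ph])

lemma h1_nz: "x \<in> {0..pi} \<Longrightarrow> h1 (s * \<rho> * sin (\<theta> x)) \<noteq> 0"
  using h1_pos[OF rng] by (metis less_irrefl)

lemma g_h1: "x \<in> {0..pi} \<Longrightarrow> g x * h1 (s * \<rho> * sin (\<theta> x)) = s * \<rho> * sin (\<theta> x)"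
  unfolding g_def using f_h_h1[OF rng] \<psi>_eq by simp

lemma \<theta>_deriv: "x \<in> {0..pi} \<Longrightarrow> (\<theta> has_real_derivative sqrt lam / h1 (s * \<rho> * sin (\<theta> x))) (at x within {0..pi})"
  by (rule phaseD(2)[OF ph])

lemma \<theta>_0: "\<theta> 0 = 0"
  by (rule phaseD(1)[OF ph])

lemma \<theta>_TT: "x \<in> {0..pi} \<Longrightarrow> \<theta> x \<in> TT"
  by (rule phase_range[OF ph lam \<theta>_pi])

lemma \<theta>_mono: "0 \<le> x \<Longrightarrow> x < y \<Longrightarrow> y \<le> pi \<Longrightarrow> \<theta> x < \<theta> y"
  by (rule phase_mono[OF ph lam])

lemma \<theta>_cont: "cts \<theta>"
  by (rule phase_cont[OF ph])

lemma \<tau>_deriv: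
  assumes x: "x \<in> {0..pi}"
  shows "(\<tau> has_real_derivative h2 (s * \<rho> * sin (\<theta> x)) * sin (\<theta> x) * (sqrt lam / h1 (s * \<rho> * sin (\<theta> x))))
    (at x within {0..pi})"
  unfolding \<tau>_def
proof (rule DERIV_chain_Icc[where g = \<theta> and f = "\<lambda>t. integral {0..t} (\<lambda>\<alpha>. h2 (s * \<rho> * sin \<alpha>) * sin \<alpha>)"])
  have "continuous_on TT (\<lambda>\<alpha>. h2 (s * \<rho> * sin \<alpha>) * sin \<alpha>)"
    by (intro continuous_on_mult cont1[OF h2_cont] continuous_intros) (use \<rho> in auto)
  then show "((\<lambda>t. integral {0..t} (\<lambda>\<alpha>. h2 (s * \<rho> * sin \<alpha>) * sin \<alpha>)) has_real_derivative
      h2 (s * \<rho> * sin (\<theta> x)) * sin (\<theta> x)) (at (\<theta> x) within TT)"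
    by (rule integral_has_real_derivative) (rule \<theta>_TT[OF x])
  show "\<theta> ` {0..pi} \<subseteq> TT" using \<theta>_TT by blast
qed (rule \<theta>_deriv[OF x])

text \<open>\<open>v\<close> is the derivative of the solution with respect to its initial slope, written in polar coordinates.\<close>

lemma v_deriv:
  assumes x: "x \<in> {0..pi}"
  shows "(v has_real_derivative v1 x) (at x within {0..pi})"
proof -
  let ?y = "s * \<rho> * sin (\<theta> x)"
  have d: "((\<lambda>x. h1 (s * \<rho> * sin (\<theta> x))) has_real_derivative h2 ?y * (s * \<rho> * (cos (\<theta> x) * (sqrt lam / h1 ?y))))
      (at x within {0..pi})"
    by (rule DERIV_chain2[where f = h1 and g = "\<lambda>x. s * \<rho> * sin (\<theta> x)", OF h1_deriv[OF rng[OF x]]])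
      (auto intro!: derivative_eq_intros \<theta>_deriv[OF x])
  have "(v has_real_derivative
      (h2 ?y * (s * \<rho> * (cos (\<theta> x) * (sqrt lam / h1 ?y))) * sin (\<theta> x) + cos (\<theta> x) * (sqrt lam / h1 ?y) * h1 ?y
       - (s * \<rho> * (- sin (\<theta> x) * (sqrt lam / h1 ?y)) * \<tau> x
        + h2 ?y * sin (\<theta> x) * (sqrt lam / h1 ?y) * (s * \<rho> * cos (\<theta> x)))) / sqrt lam) (at x within {0..pi})"
    unfolding v_def
    by (intro DERIV_cdivide DERIV_diff DERIV_mult d \<tau>_deriv[OF x])
      (auto intro!: derivative_eq_intros \<theta>_deriv[OF x])
  then show ?thesis
  proof (rule DERIV_cong)
    have alg: "(a * (p * (C * (r / H))) * D + C * (r / H) * H - (p * (- D * (r / H)) * t + a * D * (r / H) * (p * C))) / r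
        = C + (p * D / H) * t" if "H \<noteq> 0" "r \<noteq> 0" for a p C r H D t :: real
    proof -
      define u where "u = r / H"
      have r: "r = u * H" "u \<noteq> 0" using that by (auto simp: u_def)
      have num: "a * (p * (C * u)) * D + C * u * H - (p * (- D * u) * t + a * D * u * (p * C)) = u * (C * H + p * D * t)"
        by (simp add: algebra_simps)
      have "(a * (p * (C * u)) * D + C * u * H - (p * (- D * u) * t + a * D * u * (p * C))) / r = (u * (C * H + p * D * t)) / (u * H)"
        unfolding num r(1)[symmetric] ..
      also have "\<dots> = (C * H + p * D * t) / H" using r(2) by simp
      also have "\<dots> = C + p * D / H * t" using that by (simp add: add_divide_distrib)
      finally show ?thesis unfolding u_def .
    qed
    have "s * \<rho> * sin (\<theta> x) / h1 ?y = g x" using g_h1[OF x] h1_nz[OF x] by (simp add: field_simps)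
    moreover have "(h2 ?y * (s * \<rho> * (cos (\<theta> x) * (sqrt lam / h1 ?y))) * sin (\<theta> x) + cos (\<theta> x) * (sqrt lam / h1 ?y) * h1 ?y
       - (s * \<rho> * (- sin (\<theta> x) * (sqrt lam / h1 ?y)) * \<tau> x
        + h2 ?y * sin (\<theta> x) * (sqrt lam / h1 ?y) * (s * \<rho> * cos (\<theta> x)))) / sqrt lam
        = cos (\<theta> x) + (s * \<rho> * sin (\<theta> x) / h1 ?y) * \<tau> x"
      by (rule alg) (use h1_nz[OF x] lam in auto)
    ultimately show "(h2 ?y * (s * \<rho> * (cos (\<theta> x) * (sqrt lam / h1 ?y))) * sin (\<theta> x) + cos (\<theta> x) * (sqrt lam / h1 ?y) * h1 ?y
       - (s * \<rho> * (- sin (\<theta> x) * (sqrt lam / h1 ?y)) * \<tau> x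
        + h2 ?y * sin (\<theta> x) * (sqrt lam / h1 ?y) * (s * \<rho> * cos (\<theta> x)))) / sqrt lam = v1 x"
      by (simp add: v1_def)
  qed
qed

lemma v1_deriv:
  assumes x: "x \<in> {0..pi}"
  shows "(v1 has_real_derivative - (q x * v x)) (at x within {0..pi})"
proof -
  let ?y = "s * \<rho> * sin (\<theta> x)"
  define H where "H = h1 ?y"
  have H: "H \<noteq> 0" using h1_nz[OF x] by (simp add: H_def)
  have id: "f' (\<psi> x) * H\<^sup>2 + g x * h2 ?y = 1"
    using h1_h2[OF rng[OF x]] by (simp add: g_def \<psi>_eq[OF x] H_def)
  have "(v1 has_real_derivative - sin (\<theta> x) * (sqrt lam / H) + (f' (\<psi> x) * \<psi>1 x * \<tau> x
      + h2 ?y * sin (\<theta> x) * (sqrt lam / H) * g x)) (at x within {0..pi})"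
    unfolding v1_def H_def
    by (intro DERIV_add DERIV_mult g_deriv[OF x] \<tau>_deriv[OF x])
      (auto intro!: derivative_eq_intros \<theta>_deriv[OF x])
  then show ?thesis
  proof (rule DERIV_cong)
    have "- sin (\<theta> x) * (sqrt lam / H) + h2 ?y * sin (\<theta> x) * (sqrt lam / H) * g x
        = - sin (\<theta> x) * (sqrt lam / H) * (1 - g x * h2 ?y)" by (simp add: algebra_simps)
    also have "1 - g x * h2 ?y = f' (\<psi> x) * H\<^sup>2" using id by simp
    also have "- sin (\<theta> x) * (sqrt lam / H) * (f' (\<psi> x) * H\<^sup>2) = - (sqrt lam * f' (\<psi> x) * H * sin (\<theta> x))"
      using H by (simp add: power2_eq_square)
    finally have 1: "- sin (\<theta> x) * (sqrt lam / H) + h2 ?y * sin (\<theta> x) * (sqrt lam / H) * g x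
        = - (sqrt lam * f' (\<psi> x) * H * sin (\<theta> x))" .
    have "q x * v x = (lam / sqrt lam) * (f' (\<psi> x) * (H * sin (\<theta> x) - s * \<rho> * cos (\<theta> x) * \<tau> x))"
      unfolding q_def v_def H_def[symmetric] by simp
    also have "lam / sqrt lam = sqrt lam" using lam by (simp add: real_div_sqrt)
    also have "sqrt lam * (f' (\<psi> x) * (H * sin (\<theta> x) - s * \<rho> * cos (\<theta> x) * \<tau> x))
        = f' (\<psi> x) * sqrt lam * (H * sin (\<theta> x) - s * \<rho> * cos (\<theta> x) * \<tau> x)" by simp
    also have "\<dots> = sqrt lam * f' (\<psi> x) * H * sin (\<theta> x) - f' (\<psi> x) * \<psi>1 x * \<tau> x"
      by (simp add: \<psi>1_def \<eta>_def algebra_simps)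
    finally show "- sin (\<theta> x) * (sqrt lam / H) + (f' (\<psi> x) * \<psi>1 x * \<tau> x
      + h2 ?y * sin (\<theta> x) * (sqrt lam / H) * g x) = - (q x * v x)" using 1 by simp
  qed
qed

lemma cts_v: "cts v" and cts_v1: "cts v1"
  by (rule DERIV_continuous_on, erule v_deriv) (rule DERIV_continuous_on, erule v1_deriv)

lemma v_0: "v 0 = 0"
  by (simp add: v_def \<theta>_0 \<tau>_def)

lemma cos_sq: "cos (\<theta> pi) * cos (\<theta> pi) = 1"
  using sin_cos_squared_add[of "\<theta> pi"] by (simp add: \<theta>_pi power2_eq_square)

lemma v_pi: "v pi = - (\<rho> * dTh \<rho> * cos (\<theta> pi)) / sqrt lam"
proof -
  have "dTh \<rho> = s * \<tau> pi"
    unfolding dTh_def \<tau>_def \<theta>_pi integral_mult_right[symmetric] by (simp add: mult_ac)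
  then have "s * \<rho> * \<tau> pi = \<rho> * dTh \<rho>" by simp
  moreover have "v pi = - ((s * \<rho> * \<tau> pi) * cos (\<theta> pi)) / sqrt lam"
    by (simp add: v_def \<theta>_pi)
  ultimately show ?thesis by simp
qed

text \<open>\<open>v\<close> solves the homogeneous equation with v(0) = 0 and v'(0) = 1, so this
  says that 0 is not a Dirichlet eigenvalue of L0. It holds because the turning time is strictly
  monotone in the amplitude.\<close>

lemma v_pi_nz: "v pi \<noteq> 0"
  unfolding v_pi using dTh_pos[OF \<rho>] \<rho> lam cos_sq by auto

text \<open>\<psi>' and \<open>v\<close> both solve the homogeneous equation, so their Wronskian is
  constant; here it is computed directly from the polar formulas.\<close>

lemma wronskian: "x \<in> {0..pi} \<Longrightarrow> \<psi>1 x * v1 x + lam * g x * v x = \<eta>"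
proof -
  assume x: "x \<in> {0..pi}"
  have l: "lam / sqrt lam = sqrt lam" using lam by (simp add: real_div_sqrt)
  have sc: "sin (\<theta> x) * sin (\<theta> x) = 1 - cos (\<theta> x) * cos (\<theta> x)"
    using sin_cos_squared_add[of "\<theta> x"] by (simp add: power2_eq_square)
  have "lam * g x * v x = (lam / sqrt lam) * (g x * h1 (s * \<rho> * sin (\<theta> x)) * sin (\<theta> x) - g x * (s * \<rho> * cos (\<theta> x) * \<tau> x))"
    by (simp add: v_def algebra_simps diff_divide_distrib)
  also have "\<dots> = sqrt lam * (s * \<rho> * (sin (\<theta> x) * sin (\<theta> x)) - g x * (s * \<rho> * cos (\<theta> x) * \<tau> x))"
    unfolding l g_h1[OF x] by (simp add: mult.assoc)
  also have "\<dots> = \<eta> * (1 - cos (\<theta> x) * cos (\<theta> x)) - \<eta> * cos (\<theta> x) * (g x * \<tau> x)"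
    unfolding sc by (simp add: \<eta>_def algebra_simps)
  finally show ?thesis by (simp add: \<psi>1_def v1_def algebra_simps)
qed

text \<open>A relation between \<open>w\<close> and its image l = L0 w instead of an operator, since
  functions matter only on [0, pi]. It includes the boundary conditions and the continuity of
  \<open>l\<close>.\<close>

definition isL0 :: "(real \<Rightarrow> real) \<Rightarrow> (real \<Rightarrow> real) \<Rightarrow> bool" where
  "isL0 w l \<longleftrightarrow> (\<exists>w1. has_C2_deriv w w1 (\<lambda>x. l x - q x * w x)) \<and> w 0 = 0 \<and> w pi = 0 \<and> cts l"

lemma isL0D: "isL0 w l \<Longrightarrow> cts w" "isL0 w l \<Longrightarrow> cts l" "isL0 w l \<Longrightarrow> w 0 = 0" "isL0 w l \<Longrightarrow> w pi = 0"
  unfolding isL0_def using has_C2_derivD(3) by blast+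

lemma isL0I:
  assumes "\<And>x. x \<in> {0..pi} \<Longrightarrow> (w has_real_derivative w1 x) (at x within {0..pi})"
    "\<And>x. x \<in> {0..pi} \<Longrightarrow> (w1 has_real_derivative l x - q x * w x) (at x within {0..pi})"
    "w 0 = 0" "w pi = 0" "cts l"
  shows "isL0 w l"
proof -
  have "cts w" using assms(1) by (rule DERIV_continuous_on)
  then have "cts (\<lambda>x. l x - q x * w x)" by (intro continuous_intros assms(5) cts_q)
  then have "has_C2_deriv w w1 (\<lambda>x. l x - q x * w x)" using assms by (auto simp: has_C2_deriv_def)
  then show ?thesis using assms by (auto simp: isL0_def)
qed

lemma isL0_cong:
  assumes "isL0 w l" "\<And>x. x \<in> {0..pi} \<Longrightarrow> w' x = w x" "\<And>x. x \<in> {0..pi} \<Longrightarrow> l' x = l x"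
  shows "isL0 w' l'"
proof -
  obtain w1 where w: "has_C2_deriv w w1 (\<lambda>x. l x - q x * w x)" using assms by (auto simp: isL0_def)
  show ?thesis
  proof (rule isL0I)
    show "(w' has_real_derivative w1 x) (at x within {0..pi})" if "x \<in> {0..pi}" for x
      by (rule has_field_derivative_transform_within[OF has_C2_derivD(1)[OF w that] zero_less_one that])
        (use assms in auto)
    show "(w1 has_real_derivative l' x - q x * w' x) (at x within {0..pi})" if "x \<in> {0..pi}" for x
      using has_C2_derivD(2)[OF w that] assms(2,3)[OF that] by simp
    show "cts l'" by (rule continuous_on_eq[OF isL0D(2)[OF assms(1)]]) (use assms(3) in auto)
  qed (use isL0D[OF assms(1)] assms in auto)
qed

lemma isL0_lin:
  assumes "isL0 w l" "isL0 w' l'"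
  shows "isL0 (\<lambda>x. a * w x + b * w' x) (\<lambda>x. a * l x + b * l' x)"
proof -
  obtain w1 where w: "has_C2_deriv w w1 (\<lambda>x. l x - q x * w x)" using assms by (auto simp: isL0_def)
  obtain w1' where w': "has_C2_deriv w' w1' (\<lambda>x. l' x - q x * w' x)" using assms by (auto simp: isL0_def)
  show ?thesis
  proof (rule isL0I)
    fix x assume x: "x \<in> {0..pi}"
    show "((\<lambda>x. a * w x + b * w' x) has_real_derivative a * w1 x + b * w1' x) (at x within {0..pi})"
      by (auto intro!: derivative_eq_intros has_C2_derivD(1)[OF w x] has_C2_derivD(1)[OF w' x])
    show "((\<lambda>x. a * w1 x + b * w1' x) has_real_derivative a * l x + b * l' x - q x * (a * w x + b * w' x)) (at x within {0..pi})"
      by (rule derivative_eq_intros has_C2_derivD(2)[OF w x] has_C2_derivD(2)[OF w' x] refl)+ (simp add: algebra_simps)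
  qed (use isL0D[OF assms(1)] isL0D[OF assms(2)] in \<open>auto intro!: continuous_intros\<close>)
qed

lemma isL0_sym:
  assumes "isL0 w l" "isL0 w' l'"
  shows "ip l w' = ip w l'"
proof -
  obtain w1 where w: "has_C2_deriv w w1 (\<lambda>x. l x - q x * w x)" using assms by (auto simp: isL0_def)
  obtain w1' where w': "has_C2_deriv w' w1' (\<lambda>x. l' x - q x * w' x)" using assms by (auto simp: isL0_def)
  note c = isL0D[OF assms(1)] isL0D[OF assms(2)]
  have "integral {0..pi} (\<lambda>x. l x * w' x - w x * l' x) = (w1 pi * w' pi - w pi * w1' pi) - (w1 0 * w' 0 - w 0 * w1' 0)"
  proof (rule FTC_Icc)
    fix x assume x: "x \<in> {0..pi}"
    show "((\<lambda>x. w1 x * w' x - w x * w1' x) has_real_derivative l x * w' x - w x * l' x) (at x within {0..pi})"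
      by (rule derivative_eq_intros has_C2_derivD(1,2)[OF w x] has_C2_derivD(1,2)[OF w' x] refl)+ (simp add: algebra_simps)
  qed simp
  moreover have "integral {0..pi} (\<lambda>x. l x * w' x - w x * l' x) = ip l w' - ip w l'"
    unfolding ip_def by (intro integral_diff ip_integrable c)
  ultimately show ?thesis using c by simp
qed

text \<open>The Wronskian of \<open>w\<close> and \<open>v\<close> is constant, and it vanishes at
  0. As v(pi) is not 0, this forces w'(pi) = 0, so \<open>w\<close> has zero initial data at
  pi.\<close>

lemma isL0_unique:
  assumes L: "isL0 w l" and l: "\<And>x. x \<in> {0..pi} \<Longrightarrow> l x = 0" and x: "x \<in> {0..pi}"
  shows "w x = 0"
proof -
  obtain w1 where w: "has_C2_deriv w w1 (\<lambda>x. l x - q x * w x)" using L by (auto simp: isL0_def)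
  have d2: "(w1 has_real_derivative - (q x * w x)) (at x within {0..pi})" if "x \<in> {0..pi}" for x
    using has_C2_derivD(2)[OF w that] l[OF that] by simp
  have "integral {0..pi} (\<lambda>x. 0) = (w pi * v1 pi - w1 pi * v pi) - (w 0 * v1 0 - w1 0 * v 0)"
  proof (rule FTC_Icc)
    fix x assume x: "x \<in> {0..pi}"
    show "((\<lambda>x. w x * v1 x - w1 x * v x) has_real_derivative 0) (at x within {0..pi})"
      by (rule derivative_eq_intros has_C2_derivD(1)[OF w x] d2[OF x] v_deriv[OF x] v1_deriv[OF x] refl)+
        (simp add: algebra_simps)
  qed simp
  then have "w1 pi = 0" using isL0D[OF L] v_pi_nz v_0 by simp
  obtain C where C: "\<And>x. x \<in> {0..pi} \<Longrightarrow> \<bar>q x\<bar> \<le> C" using continuous_on_Icc_bounded[OF cts_q] by metis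
  have "w x = 0 \<and> w1 x = 0"
  proof (rule linear_second_order_unique[of 0 pi w w1 "\<lambda>x. - (q x * w x)" C pi x])
    show "\<bar>- (q x * w x)\<bar> \<le> C * \<bar>w x\<bar>" if "x \<in> {0..pi}" for x
      using C[OF that] by (simp add: abs_mult mult_right_mono)
  qed (use has_C2_derivD(1)[OF w] d2 isL0D[OF L] \<open>w1 pi = 0\<close> x in auto)
  then show ?thesis by simp
qed

text \<open>Since \<open>x \<psi>'\<close> solves the inhomogeneous equation with right-hand side \<open>2 \<psi>''\<close>, the function \<open>z\<close>, which is the
  derivative of the branch with respect to \<open>lam\<close>, is explicit.\<close>

definition "tz = - (pi * \<psi>1 pi) / (2 * lam * v pi)"
definition "z x = x * \<psi>1 x / (2 * lam) + tz * v x"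

lemma isL0_z: "isL0 z (\<lambda>x. - g x)"
proof (rule isL0I[where ?w1.0 = "\<lambda>x. (\<psi>1 x - x * (lam * g x)) / (2 * lam) + tz * v1 x"])
  fix x assume x: "x \<in> {0..pi}"
  have d1: "((\<lambda>x. x * \<psi>1 x) has_real_derivative \<psi>1 x - x * (lam * g x)) (at x within {0..pi})"
    by (rule derivative_eq_intros \<psi>1_deriv[OF x] refl)+ simp
  show "(z has_real_derivative (\<psi>1 x - x * (lam * g x)) / (2 * lam) + tz * v1 x) (at x within {0..pi})"
    unfolding z_def by (intro DERIV_add DERIV_cdivide DERIV_cmult d1 v_deriv[OF x])
  have d2: "((\<lambda>x. \<psi>1 x - x * (lam * g x)) has_real_derivative - (2 * lam * g x) - x * q x * \<psi>1 x) (at x within {0..pi})"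
    by (rule derivative_eq_intros \<psi>1_deriv[OF x] g_deriv[OF x] refl)+ (simp add: q_def algebra_simps)
  have "((\<lambda>x. (\<psi>1 x - x * (lam * g x)) / (2 * lam) + tz * v1 x) has_real_derivative
      (- (2 * lam * g x) - x * q x * \<psi>1 x) / (2 * lam) + tz * (- (q x * v x))) (at x within {0..pi})"
    by (intro DERIV_add DERIV_cdivide DERIV_cmult d2 v1_deriv[OF x])
  then show "((\<lambda>x. (\<psi>1 x - x * (lam * g x)) / (2 * lam) + tz * v1 x) has_real_derivative - g x - q x * z x) (at x within {0..pi})"
    by (rule DERIV_cong) (use lam in \<open>simp add: z_def field_simps\<close>)
next
  show "z 0 = 0" by (simp add: z_def v_0)
  show "z pi = 0" using v_pi_nz lam by (simp add: z_def tz_def field_simps)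
qed (intro continuous_intros cts_g)

lemma cts_z: "cts z"
  by (rule isL0D(1)[OF isL0_z])

definition "s0 = ip g z"

lemma ip_\<psi>1: "ip \<psi>1 \<psi>1 = Rf \<rho>"
  using wave_energy[OF ph \<theta>_pi lam \<rho> Th_eq] unfolding \<psi>1_def[abs_def] \<eta>_def .

text \<open>Formally dR / dlam = 2 (\<psi>', z') = 2 lam (g, z). The proof instead evaluates (g, x
  \<psi>') and (g, v) from the exact derivatives of x \<psi>'^2 and \<psi>' v, which avoids
  differentiating the branch with respect to lam.\<close>

lemma s0_eq: "s0 = dRf \<rho> / (2 * lam * dLam \<rho>)"
proof -
  have "integral {0..pi} (\<lambda>x. \<psi>1 x * \<psi>1 x - 2 * lam * (g x * (x * \<psi>1 x))) = pi * \<psi>1 pi * \<psi>1 pi - 0 * \<psi>1 0 * \<psi>1 0"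
  proof (rule FTC_Icc)
    fix x assume x: "x \<in> {0..pi}"
    show "((\<lambda>x. x * \<psi>1 x * \<psi>1 x) has_real_derivative \<psi>1 x * \<psi>1 x - 2 * lam * (g x * (x * \<psi>1 x))) (at x within {0..pi})"
      by (rule derivative_eq_intros \<psi>1_deriv[OF x] refl)+ (simp add: algebra_simps)
  qed simp
  moreover have "integral {0..pi} (\<lambda>x. \<psi>1 x * \<psi>1 x - 2 * lam * (g x * (x * \<psi>1 x))) = ip \<psi>1 \<psi>1 - 2 * lam * ip g (\<lambda>x. x * \<psi>1 x)"
    unfolding ip_def integral_mult_right[symmetric]
    by (intro integral_diff ip_integrable cts_\<psi>1 integrable_continuous_real continuous_intros cts_g)
  moreover have "\<psi>1 pi * \<psi>1 pi = \<eta> * \<eta>"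
    using cos_sq by (simp add: \<psi>1_def mult_ac)
  ultimately have A: "2 * lam * ip g (\<lambda>x. x * \<psi>1 x) = Rf \<rho> - pi * (lam * (\<rho> * \<rho>))"
    unfolding ip_\<psi>1 \<eta>_sq by (simp add: mult.assoc)
  have "integral {0..pi} (\<lambda>x. \<eta> - 2 * lam * (g x * v x)) = \<psi>1 pi * v pi - \<psi>1 0 * v 0"
  proof (rule FTC_Icc)
    fix x assume x: "x \<in> {0..pi}"
    show "((\<lambda>x. \<psi>1 x * v x) has_real_derivative \<eta> - 2 * lam * (g x * v x)) (at x within {0..pi})"
      by (rule derivative_eq_intros \<psi>1_deriv[OF x] v_deriv[OF x] refl)+
        (use wronskian[OF x] in \<open>simp add: algebra_simps\<close>)
  qed simp
  moreover have "integral {0..pi} (\<lambda>x. \<eta> - 2 * lam * (g x * v x)) = pi * \<eta> - 2 * lam * ip g v"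
  proof -
    have "integral {0..pi} (\<lambda>x. \<eta> - 2 * lam * (g x * v x)) = integral {0..pi} (\<lambda>x. \<eta>) - integral {0..pi} (\<lambda>x. 2 * lam * (g x * v x))"
      by (intro integral_diff integrable_continuous_real continuous_intros cts_g cts_v)
    then show ?thesis by (simp add: ip_def mult.commute)
  qed
  ultimately have B: "2 * lam * ip g v = pi * \<eta> - \<psi>1 pi * v pi" by (simp add: v_0)
  \<comment> \<open>With r for sqrt lam, c for cos (\<theta> pi), where c^2 = 1, and d for dTh
    \<rho>, the claim becomes an identity of rational functions.\<close>
  define r where "r = sqrt lam"
  have r: "0 < r" "lam = r * r" using lam by (auto simp: r_def)
  define c where "c = cos (\<theta> pi)"
  have c: "c * c = 1" "c \<noteq> 0" using cos_sq by (auto simp: c_def)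
  define d where "d = dTh \<rho>"
  have d: "0 < d" using dTh_pos[OF \<rho>] by (simp add: d_def)
  have \<psi>1pi: "\<psi>1 pi = \<eta> * c" and vpi: "v pi = - (\<rho> * d * c) / r" by (simp_all add: \<psi>1_def v_pi c_def d_def r_def)
  have pv: "\<psi>1 pi * v pi = - (\<eta> * \<rho> * d) / r"
  proof -
    have "\<psi>1 pi * v pi = - (\<eta> * \<rho> * d * (c * c)) / r" unfolding \<psi>1pi vpi by simp
    then show ?thesis by (simp add: c)
  qed
  have tz: "tz = pi * \<eta> / (2 * r * \<rho> * d)"
    unfolding tz_def \<psi>1pi vpi using r c d \<rho> by (simp add: field_simps)
  have "s0 = ip g (\<lambda>x. x * \<psi>1 x) / (2 * lam) + tz * ip g v"
  proof -
    have "s0 = ip g (\<lambda>x. (1 / (2 * lam)) * (x * \<psi>1 x) + tz * v x)"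
      unfolding s0_def by (rule ip_cong) (auto simp: z_def)
    also have "\<dots> = ip g (\<lambda>x. (1 / (2 * lam)) * (x * \<psi>1 x)) + ip g (\<lambda>x. tz * v x)"
      by (intro ip_add_right continuous_intros cts_\<psi>1 cts_v cts_g)
    finally show ?thesis unfolding ip_scale_right by simp
  qed
  moreover have "ip g (\<lambda>x. x * \<psi>1 x) = (Rf \<rho> - pi * (lam * (\<rho> * \<rho>))) / (2 * lam)"
    using A lam by (simp add: field_simps)
  moreover have "ip g v = (pi * \<eta> + \<eta> * \<rho> * d / r) / (2 * lam)"
    using B pv lam by (simp add: field_simps)
  ultimately have "s0 = (Rf \<rho> - pi * (lam * (\<rho> * \<rho>))) / (4 * lam * lam)
      + (\<eta> * \<eta>) * (pi / (2 * r * \<rho> * d)) * (pi + \<rho> * d / r) / (2 * lam)"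
    unfolding tz by (simp add: field_simps)
  also have "\<dots> = (Rf \<rho> - pi * (r * r * (\<rho> * \<rho>))) / (4 * (r * r) * (r * r))
      + (r * r * (\<rho> * \<rho>)) * (pi / (2 * r * \<rho> * d)) * (pi + \<rho> * d / r) / (2 * (r * r))"
    unfolding \<eta>_sq r(2)[symmetric] by simp
  also have "Rf \<rho> = r * Jf \<rho>" using Th_eq by (simp add: Rf_def r_def)
  also have "(r * Jf \<rho> - pi * (r * r * (\<rho> * \<rho>))) / (4 * (r * r) * (r * r))
      + (r * r * (\<rho> * \<rho>)) * (pi / (2 * r * \<rho> * d)) * (pi + \<rho> * d / r) / (2 * (r * r))
      = ((d * Jf \<rho> + pi * r * (\<rho> * (pi * r))) / pi) / (2 * (r * r) * (2 * (pi * r) * d / pi\<^sup>2))"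
    using r(1) d \<rho>(1) by (simp add: field_simps power2_eq_square)
  also have "\<dots> = dRf \<rho> / (2 * lam * dLam \<rho>)"
    unfolding dRf_def dLam_def Th_eq r_def[symmetric] d_def[symmetric] by (simp add: r(2)[symmetric])
  finally show ?thesis .
qed

lemma s0_pos: "0 < s0"
  unfolding s0_eq using dRf_pos[OF \<rho>] dLam_pos[OF \<rho>] lam by simp

subsection \<open>The inverse of the linearized operator\<close>

definition "P u k x = integral {0..x} (\<lambda>t. u t * k t)"

lemma P_deriv:
  "cts u \<Longrightarrow> cts k \<Longrightarrow> x \<in> {0..pi} \<Longrightarrow> (P u k has_real_derivative u x * k x) (at x within {0..pi})"
  unfolding P_def by (rule integral_has_real_derivative) (auto intro!: continuous_intros)

text \<open>Variation of constants with the fundamental system \<psi>', \<open>v\<close>, whose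
  Wronskian is \<eta>. \<open>S\<close> solves the equation with zero initial data at 0, and
  \<open>M0\<close> adds the multiple of \<open>v\<close> that corrects the boundary value at
  pi.\<close>

definition "S k x = (v x * P \<psi>1 k x - \<psi>1 x * P v k x) / \<eta>"
definition "S1 k x = (v1 x * P \<psi>1 k x + lam * g x * P v k x) / \<eta>"
definition "M0 k x = S k x - S k pi / v pi * v x"

lemma S_deriv:
  assumes k: "cts k" and x: "x \<in> {0..pi}"
  shows "(S k has_real_derivative S1 k x) (at x within {0..pi})"
    "(S1 k has_real_derivative k x - q x * S k x) (at x within {0..pi})"
proof -
  note d = P_deriv[OF cts_\<psi>1 k x] P_deriv[OF cts_v k x] v_deriv[OF x] v1_deriv[OF x] \<psi>1_deriv[OF x] g_deriv[OF x]
  have "(S k has_real_derivative (v1 x * P \<psi>1 k x + \<psi>1 x * k x * v x - (- (lam * g x) * P v k x + v x * k x * \<psi>1 x)) / \<eta>)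
      (at x within {0..pi})"
    unfolding S_def by (intro DERIV_cdivide DERIV_diff DERIV_mult d)
  then show "(S k has_real_derivative S1 k x) (at x within {0..pi})"
    by (rule DERIV_cong) (simp add: S1_def)
  have "(S1 k has_real_derivative (- (q x * v x) * P \<psi>1 k x + \<psi>1 x * k x * v1 x
      + (lam * (f' (\<psi> x) * \<psi>1 x) * P v k x + v x * k x * (lam * g x))) / \<eta>) (at x within {0..pi})"
    unfolding S1_def by (intro DERIV_cdivide DERIV_add DERIV_mult DERIV_cmult d)
  then show "(S1 k has_real_derivative k x - q x * S k x) (at x within {0..pi})"
  proof (rule DERIV_cong)
    have "- (q x * v x) * P \<psi>1 k x + \<psi>1 x * k x * v1 x + (lam * (f' (\<psi> x) * \<psi>1 x) * P v k x + v x * k x * (lam * g x))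
        = (\<psi>1 x * v1 x + lam * g x * v x) * k x - q x * (v x * P \<psi>1 k x - \<psi>1 x * P v k x)"
      by (simp add: q_def algebra_simps)
    then show "(- (q x * v x) * P \<psi>1 k x + \<psi>1 x * k x * v1 x
      + (lam * (f' (\<psi> x) * \<psi>1 x) * P v k x + v x * k x * (lam * g x))) / \<eta> = k x - q x * S k x"
      unfolding wronskian[OF x] S_def
      by (simp only: diff_divide_distrib[of "\<eta> * k x"] nonzero_mult_div_cancel_left[OF \<eta>_nz] times_divide_eq_right)
  qed
qed

lemma S_0: "S k 0 = 0"
  by (simp add: S_def P_def)

lemma isL0_M0:
  assumes k: "cts k"
  shows "isL0 (M0 k) k"
proof (rule isL0I[where ?w1.0 = "\<lambda>x. S1 k x - S k pi / v pi * v1 x"])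
  fix x assume x: "x \<in> {0..pi}"
  show "(M0 k has_real_derivative S1 k x - S k pi / v pi * v1 x) (at x within {0..pi})"
    unfolding M0_def by (intro DERIV_diff DERIV_cmult S_deriv(1)[OF k x] v_deriv[OF x])
  have "((\<lambda>x. S1 k x - S k pi / v pi * v1 x) has_real_derivative (k x - q x * S k x) - S k pi / v pi * (- (q x * v x)))
      (at x within {0..pi})"
    by (intro DERIV_diff DERIV_cmult S_deriv(2)[OF k x] v1_deriv[OF x])
  then show "((\<lambda>x. S1 k x - S k pi / v pi * v1 x) has_real_derivative k x - q x * M0 k x) (at x within {0..pi})"
    by (rule DERIV_cong) (simp add: M0_def algebra_simps)
next
  show "M0 k 0 = 0" by (simp add: M0_def S_0 v_0)
  show "M0 k pi = 0" using v_pi_nz by (simp add: M0_def)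
qed (rule k)

text \<open>Uniform and Lipschitz bounds in terms of the norm of the right-hand side: this is the
  compactness that the Arzela-Ascoli argument requires.\<close>

lemma M0_bounds:
  obtains C where "0 \<le> C" "\<And>k x. cts k \<Longrightarrow> x \<in> {0..pi} \<Longrightarrow> \<bar>M0 k x\<bar> \<le> C * sqrt (ip k k)"
    "\<And>k x y. cts k \<Longrightarrow> x \<in> {0..pi} \<Longrightarrow> y \<in> {0..pi} \<Longrightarrow> \<bar>M0 k x - M0 k y\<bar> \<le> C * sqrt (ip k k) * \<bar>x - y\<bar>"
proof -
  have cg: "cts (\<lambda>x. lam * g x)" by (intro continuous_intros cts_g)
  obtain B1 where B1: "0 \<le> B1" "\<And>x. x \<in> {0..pi} \<Longrightarrow> \<bar>v x\<bar> \<le> B1" using continuous_on_Icc_bounded[OF cts_v] by metis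
  obtain B2 where B2: "0 \<le> B2" "\<And>x. x \<in> {0..pi} \<Longrightarrow> \<bar>v1 x\<bar> \<le> B2" using continuous_on_Icc_bounded[OF cts_v1] by metis
  obtain B3 where B3: "0 \<le> B3" "\<And>x. x \<in> {0..pi} \<Longrightarrow> \<bar>\<psi>1 x\<bar> \<le> B3" using continuous_on_Icc_bounded[OF cts_\<psi>1] by metis
  obtain B4 where B4: "0 \<le> B4" "\<And>x. x \<in> {0..pi} \<Longrightarrow> \<bar>lam * g x\<bar> \<le> B4" using continuous_on_Icc_bounded[OF cg] by metis
  define B where "B = B1 + B2 + B3 + B4"
  have B0: "0 \<le> B" using B1(1) B2(1) B3(1) B4(1) by (simp add: B_def)
  have Bx: "\<bar>v x\<bar> \<le> B" "\<bar>v1 x\<bar> \<le> B" "\<bar>\<psi>1 x\<bar> \<le> B" "\<bar>lam * g x\<bar> \<le> B" if "x \<in> {0..pi}" for x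
    using B1(1) B2(1) B3(1) B4(1) B1(2)[OF that] B2(2)[OF that] B3(2)[OF that] B4(2)[OF that]
    unfolding B_def by linarith+
  note B = B0 Bx
  define K where "K = sqrt (ip \<psi>1 \<psi>1) + sqrt (ip v v)"
  have K: "0 \<le> K" "sqrt (ip \<psi>1 \<psi>1) \<le> K" "sqrt (ip v v) \<le> K" by (auto simp: K_def ip_self_nonneg)
  define C0 where "C0 = 2 * B * K / \<bar>\<eta>\<bar>"
  have C0: "0 \<le> C0" using B K by (simp add: C0_def)
  have P: "\<bar>P \<psi>1 k x\<bar> \<le> K * sqrt (ip k k)" "\<bar>P v k x\<bar> \<le> K * sqrt (ip k k)" if "cts k" "x \<in> {0..pi}" for k x
    using partial_ip_bound[OF cts_\<psi>1 that] partial_ip_bound[OF cts_v that] K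
      mult_right_mono[OF K(2), of "sqrt (ip k k)"] mult_right_mono[OF K(3), of "sqrt (ip k k)"]
      ip_self_nonneg[of k] unfolding P_def by auto
  have comb: "\<bar>(a * P \<psi>1 k x + b * P v k x) / \<eta>\<bar> \<le> C0 * sqrt (ip k k)"
    if "cts k" "x \<in> {0..pi}" "\<bar>a\<bar> \<le> B" "\<bar>b\<bar> \<le> B" for k x a b
  proof -
    have "\<bar>a * P \<psi>1 k x + b * P v k x\<bar> \<le> \<bar>a\<bar> * \<bar>P \<psi>1 k x\<bar> + \<bar>b\<bar> * \<bar>P v k x\<bar>"
      unfolding abs_mult[symmetric] by (rule abs_triangle_ineq)
    also have "\<dots> \<le> B * (K * sqrt (ip k k)) + B * (K * sqrt (ip k k))"
      by (intro add_mono mult_mono that P B) auto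
    finally have "\<bar>a * P \<psi>1 k x + b * P v k x\<bar> / \<bar>\<eta>\<bar> \<le> (2 * B * K * sqrt (ip k k)) / \<bar>\<eta>\<bar>"
      by (intro divide_right_mono) auto
    then show ?thesis by (simp add: C0_def)
  qed
  have S: "\<bar>S k x\<bar> \<le> C0 * sqrt (ip k k)" "\<bar>S1 k x\<bar> \<le> C0 * sqrt (ip k k)" if "cts k" "x \<in> {0..pi}" for k x
    using comb[OF that, of "v x" "- \<psi>1 x"] comb[OF that, of "v1 x" "lam * g x"] B that by (auto simp: S_def S1_def)
  define C where "C = C0 + C0 / \<bar>v pi\<bar> * B"
  have C: "0 \<le> C" using C0 B by (simp add: C_def)
  have tail: "\<bar>S k pi / v pi * a\<bar> \<le> C0 / \<bar>v pi\<bar> * B * sqrt (ip k k)" if "cts k" "\<bar>a\<bar> \<le> B" for k a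
  proof -
    have "\<bar>S k pi / v pi * a\<bar> = \<bar>S k pi\<bar> / \<bar>v pi\<bar> * \<bar>a\<bar>" by (simp add: abs_mult)
    also have "\<dots> \<le> (C0 * sqrt (ip k k)) / \<bar>v pi\<bar> * B"
      by (intro mult_mono divide_right_mono S that) (auto simp: C0 ip_self_nonneg)
    finally show ?thesis by (simp add: mult_ac)
  qed
  have 1: "\<bar>M0 k x\<bar> \<le> C * sqrt (ip k k)" if "cts k" "x \<in> {0..pi}" for k x
  proof -
    have "\<bar>M0 k x\<bar> \<le> \<bar>S k x\<bar> + \<bar>S k pi / v pi * v x\<bar>" unfolding M0_def by (rule abs_triangle_ineq4)
    also have "\<dots> \<le> C0 * sqrt (ip k k) + C0 / \<bar>v pi\<bar> * B * sqrt (ip k k)"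
      by (intro add_mono S tail that B)
    finally show ?thesis by (simp add: C_def distrib_right)
  qed
  have 2: "\<bar>M0 k x - M0 k y\<bar> \<le> C * sqrt (ip k k) * \<bar>x - y\<bar>" if "cts k" "x \<in> {0..pi}" "y \<in> {0..pi}" for k x y
  proof -
    have "norm (M0 k x - M0 k y) \<le> C * sqrt (ip k k) * norm (x - y)"
    proof (rule field_differentiable_bound[of "{0..pi}" "M0 k" "\<lambda>x. S1 k x - S k pi / v pi * v1 x"])
      fix t assume t: "t \<in> {0..pi}"
      show "(M0 k has_real_derivative S1 k t - S k pi / v pi * v1 t) (at t within {0..pi})"
        unfolding M0_def by (intro DERIV_diff DERIV_cmult S_deriv(1)[OF that(1) t] v_deriv[OF t])
      have "\<bar>S1 k t - S k pi / v pi * v1 t\<bar> \<le> \<bar>S1 k t\<bar> + \<bar>S k pi / v pi * v1 t\<bar>" by (rule abs_triangle_ineq4)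
      also have "\<dots> \<le> C0 * sqrt (ip k k) + C0 / \<bar>v pi\<bar> * B * sqrt (ip k k)"
        by (intro add_mono S tail that B t)
      finally show "norm (S1 k t - S k pi / v pi * v1 t) \<le> C * sqrt (ip k k)" by (simp add: C_def distrib_right)
    qed (use that in auto)
    then show ?thesis by simp
  qed
  from that[OF C 1 2] show ?thesis by blast
qed

subsection \<open>Functions vanishing at the zeros of the equilibrium\<close>

lemma \<psi>_zero_iff: "x \<in> {0..pi} \<Longrightarrow> \<psi> x = 0 \<longleftrightarrow> sin (\<theta> x) = 0"
  using h_eq_0_iff[OF rng] \<psi>_eq p_nz by simp

lemma \<psi>1_nz_at_zero: "x \<in> {0..pi} \<Longrightarrow> \<psi> x = 0 \<Longrightarrow> \<psi>1 x \<noteq> 0"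
  using \<psi>_zero_iff \<eta>_nz sin_cos_squared_add[of "\<theta> x"] by (auto simp: \<psi>1_def)

definition "ft u = (if u = 0 then 1 else f u / u)"

lemma ft_cont: "continuous_on UNIV ft"
proof (intro continuous_at_imp_continuous_on ballI)
  fix u :: real
  show "isCont ft u"
  proof (cases "u = 0")
    case True
    have "(ft \<longlongrightarrow> 1) (at 0)"
      by (rule Lim_transform_eventually[OF slope_limit]) (auto simp: ft_def eventually_at_filter)
    then show ?thesis using True by (simp add: isCont_def ft_def)
  next
    case False
    have "isCont (\<lambda>u. f u / u) u" using False DERIV_isCont[OF f_deriv] by (intro continuous_intros) auto
    moreover have "\<forall>\<^sub>F y in nhds u. ft y = f y / y"
      using False by (intro eventually_nhds_in_open[of "- {0}" u, THEN eventually_mono]) (auto simp: ft_def)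
    ultimately show ?thesis by (simp add: isCont_cong)
  qed
qed

lemma ft_minus_f': "f' u \<le> ft u" "u \<noteq> 0 \<Longrightarrow> f' u < ft u"
  using f'_less_slope[of u] by (auto simp: ft_def f'_0)

text \<open>Jacobi's identity: with \<open>r = w\<^sup>2 \<psi>' / \<psi>\<close> one has \<open>w'\<^sup>2 = r' + (w' - w \<psi>' / \<psi>)\<^sup>2 + lam (f \<psi> / \<psi>) w\<^sup>2\<close>.\<close>

lemma form_negative:
  assumes L: "isL0 w l" and wz: "\<And>x. x \<in> {0<..<pi} \<Longrightarrow> \<psi> x = 0 \<Longrightarrow> w x = 0"
  shows "ip l w \<le> 0" "ip l w = 0 \<Longrightarrow> x \<in> {0..pi} \<Longrightarrow> w x = 0"
proof -
  obtain w1 where w: "has_C2_deriv w w1 (\<lambda>x. l x - q x * w x)" using L by (auto simp: isL0_def)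
  note c = isL0D[OF L]
  have wz': "w x = 0" if "x \<in> {0..pi}" "\<psi> x = 0" for x
    using wz[of x] c(3,4) that by (cases "x = 0 \<or> x = pi") auto
  define r where "r x = w x * (w x / \<psi> x) * \<psi>1 x" for x
  \<comment> \<open>Zeros of \<psi> are simple, so w / \<psi> has the finite limit w1 / \<psi>1
    there; hence \<open>r\<close> tends to 0, which is also its value since \<open>w\<close>
    vanishes.\<close>
  have cr: "cts r"
    unfolding continuous_on_def
  proof
    fix x assume x: "x \<in> {0..pi}"
    have lims: "(w \<longlongrightarrow> w x) (at x within {0..pi})" "(\<psi> \<longlongrightarrow> \<psi> x) (at x within {0..pi})"
      "(\<psi>1 \<longlongrightarrow> \<psi>1 x) (at x within {0..pi})"
      using c(1) cts_\<psi> cts_\<psi>1 x by (auto simp: continuous_on_def)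
    show "(r \<longlongrightarrow> r x) (at x within {0..pi})"
    proof (cases "\<psi> x = 0")
      case False
      then show ?thesis unfolding r_def by (intro tendsto_intros lims)
    next
      case True
      have "((\<lambda>y. ((w y - w x) / (y - x)) / ((\<psi> y - \<psi> x) / (y - x))) \<longlongrightarrow> w1 x / \<psi>1 x) (at x within {0..pi})"
        using has_C2_derivD(1)[OF w x] \<psi>_deriv[OF x] \<psi>1_nz_at_zero[OF x True]
        by (intro tendsto_divide) (auto simp: has_field_derivative_iff)
      then have "((\<lambda>y. w y / \<psi> y) \<longlongrightarrow> w1 x / \<psi>1 x) (at x within {0..pi})"
        by (rule Lim_transform_eventually) (use True wz'[OF x] in \<open>auto simp: eventually_at_filter\<close>)
      then have "(r \<longlongrightarrow> 0 * (w1 x / \<psi>1 x) * \<psi>1 x) (at x within {0..pi})"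
        unfolding r_def using lims(1) wz'[OF x True] by (intro tendsto_mult lims(3)) auto
      then show ?thesis by (simp add: r_def wz'[OF x True])
    qed
  qed
  define m where "m x = lam * (ft (\<psi> x) - f' (\<psi> x)) * (w x)\<^sup>2" for x
  have m_nn: "0 \<le> m x" for x using ft_minus_f'(1)[of "\<psi> x"] lam by (simp add: m_def)
  have cm: "cts m" unfolding m_def
    by (intro continuous_intros c(1) continuous_on_compose2[OF ft_cont cts_\<psi>] continuous_on_compose2[OF f'_cont[of UNIV] cts_\<psi>]) auto
  define T where "T x = w1 x * w x - r x" for x
  \<comment> \<open>Away from the zeros of \<psi> this is the derivative of \<open>T\<close>. At the
    zeros the value 0 is a convention; l w + m is 0 there as well, so the comparison of the
    integrands holds at every point.\<close>
  define T' where "T' x = (if \<psi> x = 0 then 0 else l x * w x + m x + (w1 x - w x * \<psi>1 x / \<psi> x)\<^sup>2)" for x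
  define Z where "Z = {x \<in> {0<..<pi}. \<psi> x = 0}"
  have "(T' has_integral T pi - T 0) {0..pi}"
  proof (rule fundamental_theorem_of_calculus_interior_strong[of Z])
    show "finite Z" using wave(4) by (simp add: Z_def has_n_zeros_def)
    show "cts T" unfolding T_def by (intro continuous_intros has_C2_derivD(4)[OF w] c(1) cr)
    fix x assume x: "x \<in> {0<..<pi} - Z"
    then have x': "x \<in> {0..pi}" and nz: "\<psi> x \<noteq> 0" by (auto simp: Z_def)
    have at: "at x within {0..pi} = at x" using x by (intro at_within_Icc_at) auto
    have dr: "(r has_real_derivative (w1 x * (w x / \<psi> x) + w x * ((w1 x * \<psi> x - w x * \<psi>1 x) / (\<psi> x * \<psi> x))) * \<psi>1 x
        + w x * (w x / \<psi> x) * (- (lam * g x))) (at x within {0..pi})"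
      unfolding r_def
      by (rule derivative_eq_intros has_C2_derivD(1)[OF w x'] \<psi>_deriv[OF x'] \<psi>1_deriv[OF x'] refl nz)+
        (simp add: algebra_simps)
    have "(T has_real_derivative (w1 x * w1 x + (l x - q x * w x) * w x)
        - ((w1 x * (w x / \<psi> x) + w x * ((w1 x * \<psi> x - w x * \<psi>1 x) / (\<psi> x * \<psi> x))) * \<psi>1 x
        + w x * (w x / \<psi> x) * (- (lam * g x)))) (at x within {0..pi})"
      unfolding T_def
      by (intro DERIV_diff dr) (rule derivative_eq_intros has_C2_derivD(1,2)[OF w x'] refl | simp add: algebra_simps)+
    then have "(T has_real_derivative T' x) (at x within {0..pi})"
      by (rule DERIV_cong) (use nz in \<open>simp add: T'_def m_def ft_def q_def g_def power2_eq_square field_simps\<close>)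
    then show "(T has_vector_derivative T' x) (at x)"
      unfolding at by (simp add: has_real_derivative_iff_has_vector_derivative)
  qed simp
  moreover have "T pi - T 0 = 0" using c wave(2,3) by (simp add: T_def r_def)
  ultimately have T': "(T' has_integral 0) {0..pi}" by simp
  have "((\<lambda>x. l x * w x + m x) has_integral ip l w + integral {0..pi} m) {0..pi}"
    unfolding ip_def by (intro has_integral_add integrable_integral ip_integrable c integrable_continuous_real cm)
  then have le: "ip l w + integral {0..pi} m \<le> 0"
    by (rule has_integral_le[OF _ T']) (use wz' in \<open>auto simp: T'_def m_def\<close>)
  have int_m: "0 \<le> integral {0..pi} m"
    by (rule integral_nonneg[OF integrable_continuous_real[OF cm]]) (rule m_nn)
  with le show "ip l w \<le> 0" by simp
  show "w x = 0" if "ip l w = 0" "x \<in> {0..pi}"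
  proof -
    have "integral {0..pi} m = 0" using le int_m that(1) by simp
    then have "m x = 0" using integral_eq_0_iff[OF cm] m_nn that(2) by auto
    then show ?thesis using wz'[OF that(2)] ft_minus_f'(2)[of "\<psi> x"] lam by (cases "\<psi> x = 0") (auto simp: m_def)
  qed
qed

end

section \<open>Smooth cut-off functions\<close>

lemma arctan_step_limit:
  assumes "t \<noteq> 0"
  shows "(\<lambda>n. arctan (real n * t)) \<longlonglongrightarrow> sgn t * (pi / 2)"
proof (cases "t > 0")
  case True
  have "filterlim (\<lambda>n. real n * t) at_top sequentially"
    using True by (intro filterlim_at_top_mult_tendsto_pos[OF tendsto_const _ filterlim_real_sequentially]) auto
  from filterlim_compose[OF tendsto_arctan_at_top this] True show ?thesis by simp
next
  case False
  then have "0 < - t" using assms by simp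
  then have "filterlim (\<lambda>n. real n * (- t)) at_top sequentially"
    by (intro filterlim_at_top_mult_tendsto_pos[OF tendsto_const _ filterlim_real_sequentially]) auto
  from tendsto_minus[OF filterlim_compose[OF tendsto_arctan_at_top this]] False assms show ?thesis
    by (simp add: arctan_minus sgn_if)
qed

lemma bump_limit:
  assumes "t \<noteq> (0::real)"
  shows "(\<lambda>n. real n / (1 + (real n * t)\<^sup>2)) \<longlonglongrightarrow> 0"
proof (rule tendsto_sandwich[OF always_eventually always_eventually tendsto_const])
  show "\<forall>n. 0 \<le> real n / (1 + (real n * t)\<^sup>2)" by simp
  show "\<forall>n. real n / (1 + (real n * t)\<^sup>2) \<le> (1 / t\<^sup>2) * (1 / real n)"
  proof
    fix n :: nat
    show "real n / (1 + (real n * t)\<^sup>2) \<le> (1 / t\<^sup>2) * (1 / real n)"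
    proof (cases "n = 0")
      case False
      have "real n / (1 + (real n * t)\<^sup>2) \<le> real n / (real n * t)\<^sup>2"
        using False assms by (intro divide_left_mono) (auto intro!: mult_pos_pos add_pos_nonneg)
      also have "\<dots> = (1 / t\<^sup>2) * (1 / real n)" using False assms by (simp add: power2_eq_square)
      finally show ?thesis .
    qed simp
  qed
  show "(\<lambda>n. (1 / t\<^sup>2) * (1 / real n)) \<longlonglongrightarrow> 0"
    by (intro tendsto_mult_right_zero lim_1_over_n)
qed

text \<open>The derivative of the cut-off grows like n at its jump, but \<psi>' vanishes there to
  first order. This bound makes the product bounded uniformly in n.\<close>

lemma bump_bound: "\<bar>t\<bar> * (real n / (1 + (real n * t)\<^sup>2)) \<le> 1"
proof -
  define y where "y = real n * \<bar>t\<bar>"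
  have "0 \<le> (y - 1)\<^sup>2" by simp
  then have "2 * y \<le> 1 + y\<^sup>2" by (simp add: power2_eq_square algebra_simps)
  moreover have "0 \<le> y" by (simp add: y_def)
  ultimately have "y \<le> 1 + y\<^sup>2" by linarith
  then have "y / (1 + y\<^sup>2) \<le> 1" by (simp add: divide_le_eq_1 add_pos_nonneg)
  moreover have "y\<^sup>2 = (real n * t)\<^sup>2" by (simp add: y_def power_mult_distrib)
  ultimately show ?thesis by (simp add: y_def mult.commute)
qed

text \<open>A difference of arctangents has rational derivatives and explicit bounds.
  \<open>ramp\<close> subtracts the affine interpolation of its boundary values, which tends to 0 as
  n grows.\<close>

definition ramp0 :: "real \<Rightarrow> real \<Rightarrow> nat \<Rightarrow> real \<Rightarrow> real" where
  "ramp0 a b n x = (arctan (real n * (x - a)) - arctan (real n * (x - b))) / pi"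

text \<open>Smooth approximations of the indicator function of \<open>(a, b)\<close> that vanish at \<open>0\<close> and \<open>\<pi>\<close>.\<close>

definition ramp :: "real \<Rightarrow> real \<Rightarrow> nat \<Rightarrow> real \<Rightarrow> real" where
  "ramp a b n x = ramp0 a b n x - (ramp0 a b n 0 + (ramp0 a b n pi - ramp0 a b n 0) / pi * x)"

definition ramp1 :: "real \<Rightarrow> real \<Rightarrow> nat \<Rightarrow> real \<Rightarrow> real" where
  "ramp1 a b n x = (real n / (1 + (real n * (x - a))\<^sup>2) - real n / (1 + (real n * (x - b))\<^sup>2)) / pi
     - (ramp0 a b n pi - ramp0 a b n 0) / pi"

definition ramp2 :: "real \<Rightarrow> real \<Rightarrow> nat \<Rightarrow> real \<Rightarrow> real" where
  "ramp2 a b n x = (- 2 * real n ^ 3 * (x - a) / (1 + (real n * (x - a))\<^sup>2)\<^sup>2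
     + 2 * real n ^ 3 * (x - b) / (1 + (real n * (x - b))\<^sup>2)\<^sup>2) / pi"

lemma ramp_deriv: "(ramp a b n has_real_derivative ramp1 a b n x) (at x within T)"
proof -
  have d: "((\<lambda>x. arctan (real n * (x - c))) has_real_derivative real n / (1 + (real n * (x - c))\<^sup>2)) (at x within T)" for c
    by (auto intro!: derivative_eq_intros simp: field_simps)
  have "(ramp0 a b n has_real_derivative (real n / (1 + (real n * (x - a))\<^sup>2) - real n / (1 + (real n * (x - b))\<^sup>2)) / pi) (at x within T)"
    unfolding ramp0_def by (intro DERIV_cdivide DERIV_diff d)
  moreover have "((\<lambda>x. ramp0 a b n 0 + (ramp0 a b n pi - ramp0 a b n 0) / pi * x) has_real_derivative
      (ramp0 a b n pi - ramp0 a b n 0) / pi) (at x within T)"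
    by (auto intro!: derivative_eq_intros)
  ultimately show ?thesis unfolding ramp_def ramp1_def by (intro DERIV_diff)
qed

lemma ramp1_deriv: "(ramp1 a b n has_real_derivative ramp2 a b n x) (at x within T)"
proof -
  have d: "((\<lambda>x. real n / (1 + (real n * (x - c))\<^sup>2)) has_real_derivative
      - 2 * real n ^ 3 * (x - c) / (1 + (real n * (x - c))\<^sup>2)\<^sup>2) (at x within T)" for c
  proof -
    have nz: "1 + (real n * (x - c))\<^sup>2 \<noteq> 0" by (metis add_pos_nonneg less_irrefl zero_le_power2 zero_less_one)
    have "((\<lambda>x. real n / (1 + (real n * (x - c))\<^sup>2)) has_real_derivative
        (0 * (1 + (real n * (x - c))\<^sup>2) - real n * (2 * (real n * (x - c)) * real n)) / ((1 + (real n * (x - c))\<^sup>2) * (1 + (real n * (x - c))\<^sup>2)))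
        (at x within T)"
      by (intro DERIV_divide nz) (auto intro!: derivative_eq_intros)
    then show ?thesis by (rule DERIV_cong) (simp add: power2_eq_square power3_eq_cube mult_ac)
  qed
  have "(ramp1 a b n has_real_derivative (- 2 * real n ^ 3 * (x - a) / (1 + (real n * (x - a))\<^sup>2)\<^sup>2
     - (- 2 * real n ^ 3 * (x - b) / (1 + (real n * (x - b))\<^sup>2)\<^sup>2)) / pi - 0) (at x within T)"
    unfolding ramp1_def by (intro DERIV_diff[OF DERIV_cdivide DERIV_const] DERIV_diff d)
  then show ?thesis by (rule DERIV_cong) (simp add: ramp2_def)
qed

lemma ramp2_cont: "continuous_on T (ramp2 a b n)"
proof -
  have nz: "1 + (real n * (x - c))\<^sup>2 \<noteq> 0" for x c by (metis add_pos_nonneg less_irrefl zero_le_power2 zero_less_one)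
  show ?thesis unfolding ramp2_def by (intro continuous_intros) (use nz in auto)
qed

lemma ramp_cont: "continuous_on T (ramp a b n)" and ramp1_cont: "continuous_on T (ramp1 a b n)"
  by (rule DERIV_continuous_on, rule ramp_deriv) (rule DERIV_continuous_on, rule ramp1_deriv)

lemma ramp_ends: "ramp a b n 0 = 0" "ramp a b n pi = 0"
  by (simp_all add: ramp_def)

lemma ramp0_bound: "\<bar>ramp0 a b n x\<bar> \<le> 1"
proof -
  have "\<bar>arctan (real n * (x - a)) - arctan (real n * (x - b))\<bar> \<le> pi"
    using arctan_bounded[of "real n * (x - a)"] arctan_bounded[of "real n * (x - b)"] by (simp add: abs_le_iff)
  then show ?thesis by (simp add: ramp0_def)
qed

lemma ramp_bound:
  assumes "x \<in> {0..pi}"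
  shows "\<bar>ramp a b n x\<bar> \<le> 4"
proof -
  have "\<bar>x / pi\<bar> \<le> 1" using assms by simp
  moreover have "\<bar>ramp0 a b n pi - ramp0 a b n 0\<bar> \<le> 2"
    using ramp0_bound[of a b n pi] ramp0_bound[of a b n 0] by linarith
  ultimately have "\<bar>(ramp0 a b n pi - ramp0 a b n 0)\<bar> * \<bar>x / pi\<bar> \<le> 2 * 1" by (intro mult_mono) auto
  then have "\<bar>(ramp0 a b n pi - ramp0 a b n 0) / pi * x\<bar> \<le> 2" by (simp add: abs_mult)
  then show ?thesis unfolding ramp_def using ramp0_bound[of a b n x] ramp0_bound[of a b n 0] by linarith
qed

lemma ramp0_limit:
  assumes "x \<noteq> a" "x \<noteq> b"
  shows "(\<lambda>n. ramp0 a b n x) \<longlonglongrightarrow> (sgn (x - a) - sgn (x - b)) / 2"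
proof -
  have "(\<lambda>n. ramp0 a b n x) \<longlonglongrightarrow> (sgn (x - a) * (pi / 2) - sgn (x - b) * (pi / 2)) / pi"
    unfolding ramp0_def by (intro tendsto_intros arctan_step_limit) (use assms in auto)
  then show ?thesis by (simp add: diff_divide_distrib)
qed

lemma ramp0_ends_limit:
  assumes "0 < a" "a < b" "b < pi"
  shows "(\<lambda>n. ramp0 a b n 0) \<longlonglongrightarrow> 0" "(\<lambda>n. ramp0 a b n pi) \<longlonglongrightarrow> 0"
  using ramp0_limit[of 0 a b] ramp0_limit[of pi a b] assms by (auto simp: sgn_if)

lemma ramp_limit:
  assumes "0 < a" "a < b" "b < pi" "x \<noteq> a" "x \<noteq> b"
  shows "(\<lambda>n. ramp a b n x) \<longlonglongrightarrow> (sgn (x - a) - sgn (x - b)) / 2"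
proof -
  have "(\<lambda>n. ramp a b n x) \<longlonglongrightarrow> (sgn (x - a) - sgn (x - b)) / 2 - (0 + (0 - 0) / pi * x)"
    unfolding ramp_def by (intro tendsto_intros ramp0_limit ramp0_ends_limit assms) simp
  then show ?thesis by simp
qed

lemma ramp1_limit:
  assumes "0 < a" "a < b" "b < pi" "x \<noteq> a" "x \<noteq> b"
  shows "(\<lambda>n. ramp1 a b n x) \<longlonglongrightarrow> 0"
proof -
  have "(\<lambda>n. ramp1 a b n x) \<longlonglongrightarrow> (0 - 0) / pi - (0 - 0) / pi"
    unfolding ramp1_def by (intro tendsto_intros bump_limit ramp0_ends_limit assms) (use assms in simp_all)
  then show ?thesis by simp
qed

context linearized
begin

subsection \<open>Test functions\<close>

text \<open>Since L0 \<psi>' = 0, the image of \<psi>' k contains only k' and k'', and an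
  integration by parts turns the form into minus the integral of (\<psi>' k')^2. The form is
  therefore small if \<open>k\<close> varies only near zeros of \<psi>', which is why the cut-offs
  jump at critical points of \<psi>.\<close>

lemma isL0_product:
  assumes k: "\<And>x. x \<in> {0..pi} \<Longrightarrow> (k has_real_derivative k1 x) (at x within {0..pi})"
    "\<And>x. x \<in> {0..pi} \<Longrightarrow> (k1 has_real_derivative k2 x) (at x within {0..pi})"
    "cts k2" "k 0 = 0" "k pi = 0"
  defines "l \<equiv> \<lambda>x. \<psi>1 x * k2 x - 2 * (lam * g x) * k1 x"
  shows "isL0 (\<lambda>x. \<psi>1 x * k x) l"
    "ip l (\<lambda>x. \<psi>1 x * k x) = - ip (\<lambda>x. \<psi>1 x * k1 x) (\<lambda>x. \<psi>1 x * k1 x)"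
proof -
  have ck: "cts k" "cts k1" by (rule DERIV_continuous_on, erule k(1)) (rule DERIV_continuous_on, erule k(2))
  have cl: "cts l" unfolding l_def by (intro continuous_intros cts_\<psi>1 cts_g ck k)
  show L: "isL0 (\<lambda>x. \<psi>1 x * k x) l"
  proof (rule isL0I[where ?w1.0 = "\<lambda>x. \<psi>1 x * k1 x - lam * g x * k x"])
    fix x assume x: "x \<in> {0..pi}"
    show "((\<lambda>x. \<psi>1 x * k x) has_real_derivative \<psi>1 x * k1 x - lam * g x * k x) (at x within {0..pi})"
      by (rule derivative_eq_intros \<psi>1_deriv[OF x] k(1)[OF x] refl)+ simp
    show "((\<lambda>x. \<psi>1 x * k1 x - lam * g x * k x) has_real_derivative l x - q x * (\<psi>1 x * k x)) (at x within {0..pi})"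
      by (rule derivative_eq_intros \<psi>1_deriv[OF x] g_deriv[OF x] k(1)[OF x] k(2)[OF x] refl)+
        (simp add: l_def q_def algebra_simps)
  qed (use k cl in auto)
  have "integral {0..pi} (\<lambda>x. l x * (\<psi>1 x * k x) + (\<psi>1 x * k1 x) * (\<psi>1 x * k1 x))
      = \<psi>1 pi * \<psi>1 pi * k1 pi * k pi - \<psi>1 0 * \<psi>1 0 * k1 0 * k 0"
  proof (rule FTC_Icc)
    fix x assume x: "x \<in> {0..pi}"
    show "((\<lambda>x. \<psi>1 x * \<psi>1 x * k1 x * k x) has_real_derivative
        l x * (\<psi>1 x * k x) + (\<psi>1 x * k1 x) * (\<psi>1 x * k1 x)) (at x within {0..pi})"
      by (rule derivative_eq_intros \<psi>1_deriv[OF x] k(1)[OF x] k(2)[OF x] refl)+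
        (simp add: l_def algebra_simps)
  qed simp
  moreover have "integral {0..pi} (\<lambda>x. l x * (\<psi>1 x * k x) + (\<psi>1 x * k1 x) * (\<psi>1 x * k1 x))
      = ip l (\<lambda>x. \<psi>1 x * k x) + ip (\<lambda>x. \<psi>1 x * k1 x) (\<lambda>x. \<psi>1 x * k1 x)"
    unfolding ip_def by (intro integral_add ip_integrable cl continuous_intros cts_\<psi>1 ck)
  ultimately show "ip l (\<lambda>x. \<psi>1 x * k x) = - ip (\<lambda>x. \<psi>1 x * k1 x) (\<lambda>x. \<psi>1 x * k1 x)"
    using k by simp
qed

text \<open>Clamping the argument makes continuity immediate. If \<psi>' vanishes at
  \<open>a\<close> and \<open>b\<close>, the result is \<psi>' truncated to [a, b].\<close>

definition W :: "real \<Rightarrow> real \<Rightarrow> real \<Rightarrow> real" where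
  "W a b x = \<psi>1 (max a (min x b))"

lemma cts_W: "0 \<le> a \<Longrightarrow> a \<le> b \<Longrightarrow> b \<le> pi \<Longrightarrow> cts (W a b)"
  unfolding W_def by (rule continuous_on_compose2[OF cts_\<psi>1]) (auto intro!: continuous_intros)

lemma W_outside:
  assumes "\<psi>1 a = 0" "\<psi>1 b = 0" "a \<le> b"
  shows "x \<le> a \<Longrightarrow> W a b x = 0" "b \<le> x \<Longrightarrow> W a b x = 0" "a \<le> x \<Longrightarrow> x \<le> b \<Longrightarrow> W a b x = \<psi>1 x"
  using assms by (auto simp: W_def max_def min_def)

context
  fixes a b :: real
  assumes ab: "0 < a" "a < b" "b < pi" and z: "\<psi>1 a = 0" "\<psi>1 b = 0"
begin

text \<open>As g = - \<psi>'' / lam, the product g W is the derivative of - W^2 / (2 lam) except at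
  the two corners, and this primitive vanishes at 0 and pi.\<close>

lemma W_ip_g: "ip g (W a b) = 0"
proof -
  note Wo = W_outside[OF z less_imp_le[OF ab(2)]]
  have cW: "cts (W a b)" using ab by (intro cts_W) auto
  have "((\<lambda>x. g x * W a b x) has_integral - (W a b pi)\<^sup>2 / (2 * lam) - (- (W a b 0)\<^sup>2 / (2 * lam))) {0..pi}"
  proof (rule fundamental_theorem_of_calculus_interior_strong[of "{a, b}"])
    show "cts (\<lambda>x. - (W a b x)\<^sup>2 / (2 * lam))" by (intro continuous_intros cW) (use lam in auto)
    fix x assume x: "x \<in> {0<..<pi} - {a, b}"
    then have x': "x \<in> {0..pi}" and at: "at x within {0..pi} = at x" by (auto intro!: at_within_Icc_at)
    have "((\<lambda>x. - (W a b x)\<^sup>2 / (2 * lam)) has_real_derivative g x * W a b x) (at x)"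
    proof (cases "a < x \<and> x < b")
      case True
      have "((\<lambda>x. - (\<psi>1 x)\<^sup>2 / (2 * lam)) has_real_derivative - (2 * \<psi>1 x * (- (lam * g x))) / (2 * lam)) (at x)"
        using \<psi>1_deriv[OF x'] unfolding at
        by (intro DERIV_cdivide DERIV_minus) (auto intro!: derivative_eq_intros)
      then have "((\<lambda>x. - (\<psi>1 x)\<^sup>2 / (2 * lam)) has_real_derivative g x * W a b x) (at x)"
        by (rule DERIV_cong) (use lam True Wo in \<open>auto simp: field_simps\<close>)
      then show ?thesis
        by (rule has_field_derivative_transform_within_open[of _ _ _ "{a<..<b}"]) (use True Wo in auto)
    next
      case False
      then have "x < a \<or> b < x" using x by auto
      then have "((\<lambda>x. 0) has_real_derivative g x * W a b x) (at x)" using Wo(1,2)[of x] by auto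
      then show ?thesis
        by (rule has_field_derivative_transform_within_open[of _ _ _ "{..<a} \<union> {b<..}"])
          (use \<open>x < a \<or> b < x\<close> Wo in auto)
    qed
    then show "((\<lambda>x. - (W a b x)\<^sup>2 / (2 * lam)) has_vector_derivative g x * W a b x) (at x)"
      by (simp add: has_real_derivative_iff_has_vector_derivative)
  qed (use ab in auto)
  moreover have "W a b pi = 0" "W a b 0 = 0" using Wo ab by auto
  ultimately show ?thesis unfolding ip_def by (simp add: integral_unique)
qed

lemma \<psi>1_ramp_limit:
  assumes "x \<in> {0..pi}"
  shows "(\<lambda>n. \<psi>1 x * ramp a b n x) \<longlonglongrightarrow> W a b x"
proof -
  note Wo = W_outside[OF z less_imp_le[OF ab(2)]]
  show ?thesis
  proof (cases "x = a \<or> x = b")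
    case True
    then have "\<psi>1 x = 0" "W a b x = 0" using z Wo(1)[of a] Wo(2)[of b] by auto
    then show ?thesis by simp
  next
    case False
    then have "(\<lambda>n. \<psi>1 x * ramp a b n x) \<longlonglongrightarrow> \<psi>1 x * ((sgn (x - a) - sgn (x - b)) / 2)"
      by (intro tendsto_intros ramp_limit ab) auto
    moreover have "\<psi>1 x * ((sgn (x - a) - sgn (x - b)) / 2) = W a b x"
      using False Wo ab by (cases "x < a"; cases "x < b") (auto simp: sgn_if)
    ultimately show ?thesis by simp
  qed
qed

lemma ip_ramp_limit:
  assumes u: "cts u"
  shows "(\<lambda>n. ip u (\<lambda>x. \<psi>1 x * ramp a b n x)) \<longlonglongrightarrow> ip u (W a b)"
proof -
  obtain B where B: "0 \<le> B" "\<And>x. x \<in> {0..pi} \<Longrightarrow> \<bar>u x * \<psi>1 x\<bar> \<le> B"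
    using continuous_on_Icc_bounded[OF continuous_on_mult[OF u cts_\<psi>1]] by metis
  show ?thesis unfolding ip_def
  proof (rule dominated_convergence(2)[where h = "\<lambda>_. B * 4"])
    fix n
    show "(\<lambda>x. u x * (\<psi>1 x * ramp a b n x)) integrable_on {0..pi}"
      by (intro integrable_continuous_real continuous_intros u cts_\<psi>1 ramp_cont)
    fix x assume x: "x \<in> {0..pi}"
    have "\<bar>u x * \<psi>1 x\<bar> * \<bar>ramp a b n x\<bar> \<le> B * 4"
      using B x ramp_bound[OF x] by (intro mult_mono) auto
    then show "norm (u x * (\<psi>1 x * ramp a b n x)) \<le> B * 4" by (simp add: abs_mult mult.assoc)
  next
    fix x assume x: "x \<in> {0..pi}"
    show "(\<lambda>n. u x * (\<psi>1 x * ramp a b n x)) \<longlonglongrightarrow> u x * W a b x"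
      by (intro tendsto_mult_left \<psi>1_ramp_limit x)
  qed auto
qed

text \<open>Dominated convergence: \<psi>' is Lipschitz and vanishes at \<open>a\<close> and
  \<open>b\<close>, so \<open>bump_bound\<close> dominates both peaks. The integrand tends to 0 at
  other points by \<open>ramp1_limit\<close>, and at \<open>a\<close> and \<open>b\<close> it is
  0.\<close>

lemma ip_ramp1_limit:
  "(\<lambda>n. ip (\<lambda>x. \<psi>1 x * ramp1 a b n x) (\<lambda>x. \<psi>1 x * ramp1 a b n x)) \<longlonglongrightarrow> 0"
proof -
  obtain B where B: "0 \<le> B" "\<And>x. x \<in> {0..pi} \<Longrightarrow> \<bar>\<psi>1 x\<bar> \<le> B"
    using continuous_on_Icc_bounded[OF cts_\<psi>1] by metis
  have "cts (\<lambda>x. - (lam * g x))" by (intro continuous_intros cts_g)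
  then obtain C where C: "0 \<le> C" "\<And>x. x \<in> {0..pi} \<Longrightarrow> \<bar>- (lam * g x)\<bar> \<le> C"
    using continuous_on_Icc_bounded by metis
  have lip: "\<bar>\<psi>1 x\<bar> \<le> C * \<bar>x - c\<bar>" if "x \<in> {0..pi}" "c \<in> {0..pi}" "\<psi>1 c = 0" for x c
  proof -
    have "norm (\<psi>1 x - \<psi>1 c) \<le> C * norm (x - c)"
      by (rule field_differentiable_bound[of "{0..pi}" \<psi>1 "\<lambda>x. - (lam * g x)"])
        (use that \<psi>1_deriv C(2) in auto)
    then show ?thesis using that by simp
  qed
  have bump: "\<bar>\<psi>1 x\<bar> * (real n / (1 + (real n * (x - c))\<^sup>2)) \<le> C" if "x \<in> {0..pi}" "c \<in> {0..pi}" "\<psi>1 c = 0" for x c n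
  proof -
    have "\<bar>\<psi>1 x\<bar> * (real n / (1 + (real n * (x - c))\<^sup>2)) \<le> (C * \<bar>x - c\<bar>) * (real n / (1 + (real n * (x - c))\<^sup>2))"
      by (rule mult_right_mono[OF lip[OF that]]) simp
    also have "\<dots> \<le> C * 1" unfolding mult.assoc by (rule mult_left_mono[OF bump_bound C(1)])
    finally show ?thesis by simp
  qed
  have bd: "\<bar>\<psi>1 x * ramp1 a b n x\<bar> \<le> 2 * C + 2 * B" if x: "x \<in> {0..pi}" for x n
  proof -
    define A1 where "A1 = real n / (1 + (real n * (x - a))\<^sup>2)"
    define A2 where "A2 = real n / (1 + (real n * (x - b))\<^sup>2)"
    define A3 where "A3 = ramp0 a b n pi - ramp0 a b n 0"
    have A: "\<bar>\<psi>1 x\<bar> * A1 \<le> C" "\<bar>\<psi>1 x\<bar> * A2 \<le> C" "0 \<le> A1" "0 \<le> A2"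
      using bump[OF x, of a n] bump[OF x, of b n] ab z by (auto simp: A1_def A2_def)
    have A3: "\<bar>A3\<bar> \<le> 2" using ramp0_bound[of a b n pi] ramp0_bound[of a b n 0] unfolding A3_def by linarith
    have "\<bar>\<psi>1 x * ramp1 a b n x\<bar> = \<bar>\<psi>1 x\<bar> * \<bar>A1 - A2 - A3\<bar> / pi"
      unfolding ramp1_def A1_def[symmetric] A2_def[symmetric] A3_def[symmetric]
      by (simp add: abs_mult diff_divide_distrib[symmetric])
    also have "\<dots> \<le> \<bar>\<psi>1 x\<bar> * \<bar>A1 - A2 - A3\<bar> / 1"
      using pi_gt3 by (intro divide_left_mono) auto
    also have "\<dots> \<le> \<bar>\<psi>1 x\<bar> * (A1 + A2 + \<bar>A3\<bar>)"
      using A by (simp, intro mult_left_mono) auto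
    also have "\<dots> = \<bar>\<psi>1 x\<bar> * A1 + \<bar>\<psi>1 x\<bar> * A2 + \<bar>\<psi>1 x\<bar> * \<bar>A3\<bar>" by (simp add: distrib_left)
    also have "\<dots> \<le> C + C + B * 2"
      using A A3 B(1) B(2)[OF x] by (intro add_mono mult_mono) auto
    finally show ?thesis by simp
  qed
  have "(\<lambda>n. integral {0..pi} (\<lambda>x. (\<psi>1 x * ramp1 a b n x) * (\<psi>1 x * ramp1 a b n x))) \<longlonglongrightarrow> integral {0..pi} (\<lambda>x. 0)"
  proof (rule dominated_convergence(2)[where h = "\<lambda>_. (2 * C + 2 * B) * (2 * C + 2 * B)"])
    fix n
    show "(\<lambda>x. (\<psi>1 x * ramp1 a b n x) * (\<psi>1 x * ramp1 a b n x)) integrable_on {0..pi}"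
      by (intro integrable_continuous_real continuous_intros cts_\<psi>1 ramp1_cont)
    fix x assume x: "x \<in> {0..pi}"
    show "norm ((\<psi>1 x * ramp1 a b n x) * (\<psi>1 x * ramp1 a b n x)) \<le> (2 * C + 2 * B) * (2 * C + 2 * B)"
    proof -
      have "\<bar>\<psi>1 x * ramp1 a b n x\<bar> * \<bar>\<psi>1 x * ramp1 a b n x\<bar> \<le> (2 * C + 2 * B) * (2 * C + 2 * B)"
        using B(1) C(1) by (intro mult_mono bd x) auto
      then show ?thesis by (simp add: abs_mult)
    qed
  next
    fix x assume x: "x \<in> {0..pi}"
    show "(\<lambda>n. (\<psi>1 x * ramp1 a b n x) * (\<psi>1 x * ramp1 a b n x)) \<longlonglongrightarrow> 0"
    proof (cases "x = a \<or> x = b")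
      case True
      then show ?thesis using z by auto
    next
      case False
      then have "(\<lambda>n. (\<psi>1 x * ramp1 a b n x) * (\<psi>1 x * ramp1 a b n x)) \<longlonglongrightarrow> (\<psi>1 x * 0) * (\<psi>1 x * 0)"
        by (intro tendsto_intros ramp1_limit ab) auto
      then show ?thesis by simp
    qed
  qed auto
  then show ?thesis by (simp add: ip_def)
qed

end

section \<open>Critical points, interior zeros and truncations of \<psi>'\<close>

definition cr :: "nat \<Rightarrow> real" where
  "cr i = (SOME x. x \<in> {0..pi} \<and> \<theta> x = (real i + 1 / 2) * pi)"
definition nd :: "nat \<Rightarrow> real" where
  "nd i = (SOME x. x \<in> {0..pi} \<and> \<theta> x = (real i + 1) * pi)"

lemma \<theta>_surj: "0 \<le> y \<Longrightarrow> y \<le> real j * pi \<Longrightarrow> \<exists>x. x \<in> {0..pi} \<and> \<theta> x = y"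
  using IVT'[of \<theta> 0 y pi] \<theta>_0 \<theta>_pi \<theta>_cont by auto

text \<open>Counted from 0: there are \<open>j\<close> critical points, at the phases (i + 1/2) pi,
  and j - 1 interior zeros, at the phases (i + 1) pi, so \<open>nd i\<close> separates
  \<open>cr i\<close> from \<open>cr (Suc i)\<close>.\<close>

lemma cr:
  assumes "i < j"
  shows "cr i \<in> {0..pi}" "\<theta> (cr i) = (real i + 1 / 2) * pi"
proof -
  have "real i + 1 / 2 \<le> real j" using assms by linarith
  then have "(real i + 1 / 2) * pi \<le> real j * pi" by (intro mult_right_mono) auto
  then have "\<exists>x. x \<in> {0..pi} \<and> \<theta> x = (real i + 1 / 2) * pi" by (intro \<theta>_surj) auto
  from someI_ex[OF this] show "cr i \<in> {0..pi}" "\<theta> (cr i) = (real i + 1 / 2) * pi"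
    unfolding cr_def by auto
qed

lemma nd:
  assumes "Suc i < j"
  shows "nd i \<in> {0..pi}" "\<theta> (nd i) = (real i + 1) * pi"
proof -
  have "real i + 1 \<le> real j" using assms by linarith
  then have "(real i + 1) * pi \<le> real j * pi" by (intro mult_right_mono) auto
  then have "\<exists>x. x \<in> {0..pi} \<and> \<theta> x = (real i + 1) * pi" by (intro \<theta>_surj) auto
  from someI_ex[OF this] show "nd i \<in> {0..pi}" "\<theta> (nd i) = (real i + 1) * pi"
    unfolding nd_def by auto
qed

lemma \<theta>_less_iff: "x \<in> {0..pi} \<Longrightarrow> y \<in> {0..pi} \<Longrightarrow> \<theta> x < \<theta> y \<longleftrightarrow> x < y"
  using \<theta>_mono[of x y] \<theta>_mono[of y x] by (cases "x = y") force+

lemma cr_interior: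
  assumes "i < j"
  shows "0 < cr i" "cr i < pi"
proof -
  have "real i + 1 / 2 < real j" using assms by linarith
  then have "(real i + 1 / 2) * pi < real j * pi" by (intro mult_strict_right_mono) auto
  then show "0 < cr i" "cr i < pi"
    using \<theta>_less_iff[of 0 "cr i"] \<theta>_less_iff[of "cr i" pi] cr[OF assms] \<theta>_0 \<theta>_pi by auto
qed

lemma cr_less: "i < i' \<Longrightarrow> i' < j \<Longrightarrow> cr i < cr i'"
proof -
  assume i: "i < i'" "i' < j"
  then have "\<theta> (cr i) < \<theta> (cr i')" unfolding cr(2)[OF i(2)] cr(2)[OF less_trans[OF i]]
    by (intro mult_strict_right_mono) auto
  then show "cr i < cr i'" using \<theta>_less_iff[of "cr i" "cr i'"] cr(1)[of i] cr(1)[of i'] i by simp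
qed

lemma \<psi>1_cr: "i < j \<Longrightarrow> \<psi>1 (cr i) = 0"
proof -
  assume "i < j"
  then have "\<theta> (cr i) = real i * pi + pi / 2" using cr(2) by (simp add: field_simps)
  then show ?thesis by (simp add: \<psi>1_def cos_add)
qed

lemma nd_between:
  assumes "Suc i < j"
  shows "cr i < nd i" "nd i < cr (Suc i)"
proof -
  have i: "i < j" using assms by simp
  have "\<theta> (cr i) < \<theta> (nd i)" "\<theta> (nd i) < \<theta> (cr (Suc i))"
    unfolding cr(2)[OF i] cr(2)[OF assms] nd(2)[OF assms] by (intro mult_strict_right_mono; simp)+
  then show "cr i < nd i" "nd i < cr (Suc i)"
    using \<theta>_less_iff cr(1)[OF i] cr(1)[OF assms] nd(1)[OF assms] by blast+
qed

lemma \<psi>1_nd: "Suc i < j \<Longrightarrow> \<psi>1 (nd i) \<noteq> 0"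
proof -
  assume i: "Suc i < j"
  have "\<theta> (nd i) = real (Suc i) * pi" using nd(2)[OF i] by (simp add: add.commute)
  then have "sin (\<theta> (nd i)) = 0" by (simp only: sin_npi)
  then show ?thesis using \<psi>1_nz_at_zero[OF nd(1)[OF i]] \<psi>_zero_iff[OF nd(1)[OF i]] by simp
qed

abbreviation "Wi i \<equiv> W (cr i) (cr (Suc i))"

lemma seg:
  assumes "Suc i < j"
  shows "0 < cr i" "cr i < cr (Suc i)" "cr (Suc i) < pi" "\<psi>1 (cr i) = 0" "\<psi>1 (cr (Suc i)) = 0"
  using cr_interior[of i] cr_interior[of "Suc i"] cr_less[of i "Suc i"] \<psi>1_cr[of i] \<psi>1_cr[of "Suc i"] assms by auto

lemma cts_Wi: "Suc i < j \<Longrightarrow> cts (Wi i)"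
  using seg[of i] by (intro cts_W) auto

text \<open>Evaluation at the interior zeros is diagonal with nonzero entries, which yields the
  linear independence of the truncations in \<open>M_positive\<close>.\<close>

lemma Wi_nd:
  assumes "Suc i < j" "Suc k < j"
  shows "Wi i (nd k) = (if i = k then \<psi>1 (nd k) else 0)"
proof -
  note o = W_outside[OF seg(4,5)[OF assms(1)] less_imp_le[OF seg(2)[OF assms(1)]]]
  consider "i = k" | "i < k" | "k < i" by linarith
  then show ?thesis
  proof cases
    case 1
    then show ?thesis using o(3)[of "nd k"] nd_between[OF assms(2)] by simp
  next
    case 2
    then have "cr (Suc i) \<le> cr k" using cr_less[of "Suc i" k] assms by (cases "Suc i = k") auto
    then show ?thesis using o(2)[of "nd k"] nd_between[OF assms(2)] 2 by simp
  next
    case 3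
    then have "cr (Suc k) \<le> cr i" using cr_less[of "Suc k" i] assms by (cases "Suc k = i") auto
    then show ?thesis using o(1)[of "nd k"] nd_between[OF assms(2)] 3 by simp
  qed
qed

lemma ip_sum_right:
  assumes "finite A" "\<And>i. i \<in> A \<Longrightarrow> cts (u i)" "cts w"
  shows "ip w (\<lambda>x. \<Sum>i\<in>A. c i * u i x) = (\<Sum>i\<in>A. c i * ip w (u i))"
  unfolding ip_commute[of w] by (rule ip_sum_left[OF assms])

text \<open>\<open>w\<close> has corners, but it is a weak limit of products \<psi>' k in the domain
  whose forms tend to 0: the diagonal terms by \<open>ip_ramp1_limit\<close>, the mixed ones by
  Cauchy-Schwarz. Convergence of inner products with continuous functions suffices for
  \<open>M_positive\<close>.\<close>

lemma test_functions:
  fixes c :: "nat \<Rightarrow> real"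
  defines "w \<equiv> \<lambda>x. \<Sum>i<j-1. c i * Wi i x"
  shows "cts w" "ip g w = 0" "\<exists>wn ln. (\<forall>n. isL0 (wn n) (ln n)) \<and> (\<lambda>n. ip (ln n) (wn n)) \<longlonglongrightarrow> 0
    \<and> (\<forall>u. cts u \<longrightarrow> (\<lambda>n. ip u (wn n)) \<longlonglongrightarrow> ip u w)"
proof -
  have ij: "Suc i < j" if "i \<in> {..<j - 1}" for i using that by auto
  show cw: "cts w" unfolding w_def by (rule cts_sum) (use cts_Wi ij in auto)
  show "ip g w = 0" unfolding w_def
    using ip_sum_right[of "{..<j-1}" Wi g c] cts_Wi ij cts_g W_ip_g[OF seg(1-5)] by simp
  let ?R = "\<lambda>i n. ramp (cr i) (cr (Suc i)) n"
  let ?R1 = "\<lambda>i n. ramp1 (cr i) (cr (Suc i)) n"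
  let ?R2 = "\<lambda>i n. ramp2 (cr i) (cr (Suc i)) n"
  define k where "k n x = (\<Sum>i<j-1. c i * ?R i n x)" for n x
  define k1 where "k1 n x = (\<Sum>i<j-1. c i * ?R1 i n x)" for n x
  define k2 where "k2 n x = (\<Sum>i<j-1. c i * ?R2 i n x)" for n x
  have dk: "(k n has_real_derivative k1 n x) (at x within {0..pi})" for n x
    unfolding k_def k1_def by (intro DERIV_sum DERIV_cmult ramp_deriv)
  have dk1: "(k1 n has_real_derivative k2 n x) (at x within {0..pi})" for n x
    unfolding k1_def k2_def by (intro DERIV_sum DERIV_cmult ramp1_deriv)
  have ck2: "cts (k2 n)" for n unfolding k2_def by (intro continuous_intros ramp2_cont)
  have k0: "k n 0 = 0" "k n pi = 0" for n by (simp_all add: k_def ramp_ends)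
  define wn where "wn n x = \<psi>1 x * k n x" for n x
  define ln where "ln n x = \<psi>1 x * k2 n x - 2 * (lam * g x) * k1 n x" for n x
  have L: "isL0 (wn n) (ln n)" "ip (ln n) (wn n) = - ip (\<lambda>x. \<psi>1 x * k1 n x) (\<lambda>x. \<psi>1 x * k1 n x)" for n
    using isL0_product[OF dk[of n] dk1[of n] ck2[of n] k0[of n]] unfolding wn_def[abs_def] ln_def[abs_def] by auto
  define x1 where "x1 i n x = \<psi>1 x * ?R1 i n x" for i n x
  have cx1: "cts (x1 i n)" for i n unfolding x1_def by (intro continuous_intros cts_\<psi>1 ramp1_cont)
  have x10: "(\<lambda>n. ip (x1 i n) (x1 i n)) \<longlonglongrightarrow> 0" if "Suc i < j" for i
    using ip_ramp1_limit[OF seg(1-5)[OF that]] unfolding x1_def .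
  have x1m: "(\<lambda>n. ip (x1 i n) (x1 i' n)) \<longlonglongrightarrow> 0" if "Suc i < j" "Suc i' < j" for i i'
  proof (rule tendsto_rabs_zero_cancel, rule tendsto_sandwich[OF always_eventually always_eventually tendsto_const])
    show "\<forall>n. \<bar>ip (x1 i n) (x1 i' n)\<bar> \<le> sqrt (ip (x1 i n) (x1 i n)) * sqrt (ip (x1 i' n) (x1 i' n))"
      using ip_bound[OF cx1 cx1] by auto
    have "(\<lambda>n. sqrt (ip (x1 i n) (x1 i n)) * sqrt (ip (x1 i' n) (x1 i' n))) \<longlonglongrightarrow> sqrt 0 * sqrt 0"
      by (intro tendsto_mult tendsto_real_sqrt x10 that)
    then show "(\<lambda>n. sqrt (ip (x1 i n) (x1 i n)) * sqrt (ip (x1 i' n) (x1 i' n))) \<longlonglongrightarrow> 0" by simp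
  qed simp
  have "ip (ln n) (wn n) = - (\<Sum>i<j-1. c i * (\<Sum>i'<j-1. c i' * ip (x1 i n) (x1 i' n)))" for n
  proof -
    have e: "(\<lambda>x. \<psi>1 x * k1 n x) = (\<lambda>x. \<Sum>i<j-1. c i * x1 i n x)"
      by (auto simp: k1_def x1_def sum_distrib_left mult_ac)
    have "ip (\<lambda>x. \<psi>1 x * k1 n x) (\<lambda>x. \<psi>1 x * k1 n x)
        = (\<Sum>i<j-1. c i * ip (x1 i n) (\<lambda>x. \<Sum>i<j-1. c i * x1 i n x))"
      unfolding e by (rule ip_sum_left) (auto intro!: cx1 cts_sum)
    also have "\<dots> = (\<Sum>i<j-1. c i * (\<Sum>i'<j-1. c i' * ip (x1 i n) (x1 i' n)))"
      by (intro sum.cong refl arg_cong2[where f = "(*)"] ip_sum_right) (auto intro!: cx1)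
    finally show ?thesis using L(2) by simp
  qed
  moreover have "(\<lambda>n. - (\<Sum>i<j-1. c i * (\<Sum>i'<j-1. c i' * ip (x1 i n) (x1 i' n))))
      \<longlonglongrightarrow> - (\<Sum>i<j-1. c i * (\<Sum>i'<j-1. c i' * 0))"
    by (intro tendsto_intros x1m) auto
  ultimately have lim0: "(\<lambda>n. ip (ln n) (wn n)) \<longlonglongrightarrow> 0" by simp
  have limu: "(\<lambda>n. ip u (wn n)) \<longlonglongrightarrow> ip u w" if u: "cts u" for u
  proof -
    have "ip u (wn n) = (\<Sum>i<j-1. c i * ip u (\<lambda>x. \<psi>1 x * ?R i n x))" for n
    proof -
      have "wn n = (\<lambda>x. \<Sum>i<j-1. c i * (\<psi>1 x * ?R i n x))"
        by (auto simp: wn_def k_def sum_distrib_left mult_ac)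
      then show ?thesis by (simp only:) (rule ip_sum_right, auto intro!: u continuous_intros cts_\<psi>1 ramp_cont)
    qed
    moreover have "(\<lambda>n. \<Sum>i<j-1. c i * ip u (\<lambda>x. \<psi>1 x * ?R i n x)) \<longlonglongrightarrow> (\<Sum>i<j-1. c i * ip u (Wi i))"
      by (intro tendsto_sum tendsto_mult_left ip_ramp_limit seg u ij)
    moreover have "ip u w = (\<Sum>i<j-1. c i * ip u (Wi i))"
      unfolding w_def by (rule ip_sum_right) (use cts_Wi ij u in auto)
    ultimately show ?thesis by simp
  qed
  show "\<exists>wn ln. (\<forall>n. isL0 (wn n) (ln n)) \<and> (\<lambda>n. ip (ln n) (wn n)) \<longlonglongrightarrow> 0
    \<and> (\<forall>u. cts u \<longrightarrow> (\<lambda>n. ip u (wn n)) \<longlonglongrightarrow> ip u w)"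
    using L(1) lim0 limu by blast
qed

end

subsection \<open>The nonlocal perturbation\<close>

locale perturbed = linearized +
  fixes \<beta> :: real
  assumes nondegenerate: "1 + \<beta> * s0 \<noteq> 0"
begin

definition "D = 1 + \<beta> * s0"

text \<open>The equation L w = l with the nonlocal term moved to the right, where it acts as a part
  of the right-hand side for L0.\<close>

definition isL :: "(real \<Rightarrow> real) \<Rightarrow> (real \<Rightarrow> real) \<Rightarrow> bool" where
  "isL w l \<longleftrightarrow> isL0 w (\<lambda>x. l x + \<beta> * ip g w * g x)"

lemma isL_cts: assumes "isL w l" shows "cts w" "cts l"
proof -
  have "cts (\<lambda>x. (l x + \<beta> * ip g w * g x) - \<beta> * ip g w * g x)"
    by (rule continuous_on_diff[OF isL0D(2)[OF assms[unfolded isL_def]]]) (intro continuous_intros cts_g)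
  then show "cts l" by simp
  show "cts w" using isL0D(1)[OF assms[unfolded isL_def]] .
qed

lemma isL_bc: "isL w l \<Longrightarrow> w 0 = 0" "isL w l \<Longrightarrow> w pi = 0"
  unfolding isL_def using isL0D(3,4) by auto

lemma isL_cong:
  assumes "isL w l" "\<And>x. x \<in> {0..pi} \<Longrightarrow> w' x = w x" "\<And>x. x \<in> {0..pi} \<Longrightarrow> l' x = l x"
  shows "isL w' l'"
proof -
  have "ip g w' = ip g w" by (rule ip_cong) (use assms in auto)
  then show ?thesis using assms unfolding isL_def by (auto intro: isL0_cong)
qed

lemma isL_lin:
  assumes "isL w l" "isL w' l'"
  shows "isL (\<lambda>x. a * w x + b * w' x) (\<lambda>x. a * l x + b * l' x)"
proof -
  have "ip g (\<lambda>x. a * w x + b * w' x) = ip g (\<lambda>x. a * w x) + ip g (\<lambda>x. b * w' x)"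
    by (intro ip_add_right continuous_intros cts_g isL_cts(1)[OF assms(1)] isL_cts(1)[OF assms(2)])
  then have e: "ip g (\<lambda>x. a * w x + b * w' x) = a * ip g w + b * ip g w'" by (simp only: ip_scale_right)
  show ?thesis unfolding isL_def e
    by (rule isL0_cong[OF isL0_lin[OF assms(1)[unfolded isL_def] assms(2)[unfolded isL_def], of a b]])
      (simp_all add: algebra_simps)
qed

lemma isL_zero: "isL (\<lambda>_. 0) (\<lambda>_. 0)"
  unfolding isL_def by (rule isL0I[where ?w1.0 = "\<lambda>_. 0"]) auto

lemma isL_sum:
  assumes "finite A" "\<And>i. i \<in> A \<Longrightarrow> isL (w i) (l i)"
  shows "isL (\<lambda>x. \<Sum>i\<in>A. c i * w i x) (\<lambda>x. \<Sum>i\<in>A. c i * l i x)"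
  using assms
proof (induction A rule: finite_induct)
  case empty
  then show ?case using isL_zero by simp
next
  case (insert i A)
  from insert have "isL (w i) (l i)" "isL (\<lambda>x. \<Sum>i\<in>A. c i * w i x) (\<lambda>x. \<Sum>i\<in>A. c i * l i x)" by auto
  from isL_lin[OF this, of "c i" 1] insert.hyps show ?case by simp
qed

lemma ip_add_scaled: "cts u \<Longrightarrow> cts u' \<Longrightarrow> cts w \<Longrightarrow> ip (\<lambda>x. u x + c * u' x) w = ip u w + c * ip u' w"
  by (subst ip_add_left) (auto intro!: continuous_intros simp: ip_scale_left)

lemma isL_sym:
  assumes "isL w l" "isL w' l'"
  shows "ip l w' = ip w l'"
proof -
  note c = isL_cts[OF assms(1)] isL_cts[OF assms(2)]
  have "ip (\<lambda>x. l x + \<beta> * ip g w * g x) w' = ip w (\<lambda>x. l' x + \<beta> * ip g w' * g x)"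
    by (rule isL0_sym[OF assms[unfolded isL_def]])
  also have "\<dots> = ip (\<lambda>x. l' x + \<beta> * ip g w' * g x) w" by (rule ip_commute)
  finally have "ip l w' + \<beta> * ip g w * ip g w' = ip l' w + \<beta> * ip g w' * ip g w"
    by (simp only: ip_add_scaled c cts_g)
  then show ?thesis by (simp add: ip_commute[of w l'])
qed

lemma isL_z: "isL z (\<lambda>x. - (D * g x))"
  unfolding isL_def by (rule isL0_cong[OF isL0_z]) (auto simp: s0_def[symmetric] D_def algebra_simps)

text \<open>If the difference d satisfies L d = 0 and c = (g, d), then d + \<beta> c z is in the
  kernel of L0 and hence 0. The inner product with \<open>g\<close> gives c (1 + \<beta> s0) =
  0.\<close>

lemma isL_inj:
  assumes "isL w l" "isL w' l'" "\<And>x. x \<in> {0..pi} \<Longrightarrow> l x = l' x" and x: "x \<in> {0..pi}"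
  shows "w x = w' x"
proof -
  let ?d = "\<lambda>x. 1 * w x + (- 1) * w' x"
  note d = isL_lin[OF assms(1,2), of 1 "-1"]
  define c where "c = ip g ?d"
  have d0: "isL0 ?d (\<lambda>x. (1 * l x + (- 1) * l' x) + \<beta> * c * g x)"
    using d unfolding isL_def c_def .
  have "isL0 (\<lambda>x. 1 * ?d x + (\<beta> * c) * z x) (\<lambda>x. 1 * ((1 * l x + (- 1) * l' x) + \<beta> * c * g x) + (\<beta> * c) * - g x)"
    by (rule isL0_lin[OF d0 isL0_z])
  then have eq: "1 * ?d x + (\<beta> * c) * z x = 0" if "x \<in> {0..pi}" for x
    by (rule isL0_unique) (use assms(3) that in auto)
  have "ip g ?d = ip g (\<lambda>x. (- \<beta> * c) * z x)"
  proof (rule ip_cong)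
    fix x assume "x \<in> {0..pi}"
    from eq[OF this] show "1 * w x + (- 1) * w' x = (- \<beta> * c) * z x" by simp
  qed simp
  then have "c = ip g (\<lambda>x. (- \<beta> * c) * z x)" by (simp only: c_def[symmetric])
  then have "c * (1 + \<beta> * s0) = 0" unfolding ip_scale_right s0_def[symmetric] by (simp add: algebra_simps)
  then have "c = 0" using nondegenerate by simp
  then show ?thesis using eq[OF x] by simp
qed

text \<open>The Sherman-Morrison formula for a rank one perturbation. \<open>D\<close> appears as
  denominator because M0 g = - z, so that 1 - \<beta> (g, M0 g) = 1 + \<beta> s0.\<close>

definition "M k x = M0 k x - (\<beta> / D * ip g (M0 k)) * z x"

lemma isL_M:
  assumes k: "cts k"
  shows "isL (M k) k"
proof -
  define c where "c = ip g (M0 k)"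
  have D: "D \<noteq> 0" using nondegenerate by (simp add: D_def)
  define \<kappa> where "\<kappa> = \<beta> / D * c"
  note L = isL0_lin[OF isL0_M0[OF k] isL0_z, of 1 "- \<kappa>"]
  have "ip g (M k) = ip g (\<lambda>x. M0 k x - \<kappa> * z x)" unfolding M_def[abs_def] c_def \<kappa>_def ..
  also have "\<dots> = ip g (M0 k) - ip g (\<lambda>x. \<kappa> * z x)"
    by (intro ip_diff_right continuous_intros cts_z cts_g isL0D(1)[OF isL0_M0[OF k]])
  also have "\<dots> = c - (\<beta> / D * c) * s0" unfolding ip_scale_right c_def[symmetric] s0_def[symmetric] \<kappa>_def ..
  also have "\<dots> = c / D" using D by (simp add: D_def field_simps)
  finally have e: "ip g (M k) = c / D" .
  show ?thesis unfolding isL_def e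
    by (rule isL0_cong[OF L]) (auto simp: M_def c_def \<kappa>_def)
qed

lemma cts_M: "cts k \<Longrightarrow> cts (M k)"
  by (rule isL_cts(1)[OF isL_M])

lemma M_bounds:
  obtains C where "0 < C" "\<And>k x. cts k \<Longrightarrow> x \<in> {0..pi} \<Longrightarrow> \<bar>M k x\<bar> \<le> C * sqrt (ip k k)"
    "\<And>k x y. cts k \<Longrightarrow> x \<in> {0..pi} \<Longrightarrow> y \<in> {0..pi} \<Longrightarrow> \<bar>M k x - M k y\<bar> \<le> C * sqrt (ip k k) * \<bar>x - y\<bar>"
proof -
  obtain C where C: "0 \<le> C" "\<And>h x. cts h \<Longrightarrow> x \<in> {0..pi} \<Longrightarrow> \<bar>M0 h x\<bar> \<le> C * sqrt (ip h h)"
    "\<And>h x y. cts h \<Longrightarrow> x \<in> {0..pi} \<Longrightarrow> y \<in> {0..pi} \<Longrightarrow> \<bar>M0 h x - M0 h y\<bar> \<le> C * sqrt (ip h h) * \<bar>x - y\<bar>"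
    using M0_bounds by metis
  obtain B where B: "0 \<le> B" "\<And>x. x \<in> {0..pi} \<Longrightarrow> \<bar>z x\<bar> \<le> B" using continuous_on_Icc_bounded[OF cts_z] by metis
  obtain z1 where z1: "has_C2_deriv z z1 (\<lambda>x. - g x - q x * z x)" using isL0_z by (auto simp: isL0_def)
  obtain B1 where B1: "0 \<le> B1" "\<And>x. x \<in> {0..pi} \<Longrightarrow> \<bar>z1 x\<bar> \<le> B1"
    using continuous_on_Icc_bounded[OF has_C2_derivD(4)[OF z1]] by metis
  have zl: "\<bar>z x - z y\<bar> \<le> B1 * \<bar>x - y\<bar>" if "x \<in> {0..pi}" "y \<in> {0..pi}" for x y
  proof -
    have "norm (z x - z y) \<le> B1 * norm (x - y)"
      by (rule field_differentiable_bound[of "{0..pi}" z z1]) (use that has_C2_derivD(1)[OF z1] B1 in auto)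
    then show ?thesis by simp
  qed
  define G where "G = \<bar>\<beta> / D\<bar> * (sqrt (ip g g) * (sqrt pi * C))"
  have G: "0 \<le> G" using C by (simp add: G_def ip_self_nonneg)
  have coeff: "\<bar>\<beta> / D * ip g (M0 k)\<bar> \<le> G * sqrt (ip k k)" if k: "cts k" for k
  proof -
    note cM = isL0D(1)[OF isL0_M0[OF k]]
    have "sqrt (ip (M0 k) (M0 k)) \<le> sqrt pi * (C * sqrt (ip k k))"
      by (rule sup_bound_imp_ip[OF cM C(2)[OF k]]) (auto simp: C ip_self_nonneg)
    then have "sqrt (ip g g) * sqrt (ip (M0 k) (M0 k)) \<le> sqrt (ip g g) * (sqrt pi * (C * sqrt (ip k k)))"
      by (intro mult_left_mono) (auto simp: ip_self_nonneg)
    with ip_bound[OF cts_g cM] have "\<bar>ip g (M0 k)\<bar> \<le> sqrt (ip g g) * (sqrt pi * (C * sqrt (ip k k)))" by linarith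
    then have "\<bar>\<beta> / D\<bar> * \<bar>ip g (M0 k)\<bar> \<le> \<bar>\<beta> / D\<bar> * (sqrt (ip g g) * (sqrt pi * (C * sqrt (ip k k))))"
      by (intro mult_left_mono) auto
    then show ?thesis unfolding abs_mult G_def by (simp add: mult.assoc)
  qed
  \<comment> \<open>The summand 1 ensures a strictly positive constant, as the lemma on compact
    operators asks for.\<close>
  define C' where "C' = C + G * B + G * B1 + 1"
  have C': "0 < C'" using C G B B1 by (auto simp: C'_def intro!: add_nonneg_pos add_nonneg_nonneg)
  have GB: "0 \<le> G * B" "0 \<le> G * B1" using G B B1 by auto
  have 1: "\<bar>M k x\<bar> \<le> C' * sqrt (ip k k)" if "cts k" "x \<in> {0..pi}" for k x
  proof -
    define n where "n = sqrt (ip k k)"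
    have n: "0 \<le> n" by (simp add: n_def ip_self_nonneg)
    have "\<bar>M k x\<bar> \<le> \<bar>M0 k x\<bar> + \<bar>(\<beta> / D * ip g (M0 k)) * z x\<bar>" unfolding M_def by (rule abs_triangle_ineq4)
    also have "\<bar>(\<beta> / D * ip g (M0 k)) * z x\<bar> = \<bar>\<beta> / D * ip g (M0 k)\<bar> * \<bar>z x\<bar>" by (rule abs_mult)
    also have "\<bar>M0 k x\<bar> + \<bar>\<beta> / D * ip g (M0 k)\<bar> * \<bar>z x\<bar> \<le> C * n + (G * n) * B"
      using C(2)[OF that] coeff[OF that(1)] B(2)[OF that(2)] G n B(1) unfolding n_def[symmetric]
      by (intro add_mono mult_mono) auto
    also have "\<dots> = (C + G * B) * n" by (simp add: algebra_simps)
    also have "\<dots> \<le> C' * n" using GB n by (intro mult_right_mono) (auto simp: C'_def)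
    finally show ?thesis unfolding n_def .
  qed
  have 2: "\<bar>M k x - M k y\<bar> \<le> C' * sqrt (ip k k) * \<bar>x - y\<bar>" if "cts k" "x \<in> {0..pi}" "y \<in> {0..pi}" for k x y
  proof -
    define n where "n = sqrt (ip k k)"
    have n: "0 \<le> n" by (simp add: n_def ip_self_nonneg)
    have "M k x - M k y = (M0 k x - M0 k y) - (\<beta> / D * ip g (M0 k)) * (z x - z y)" unfolding M_def by algebra
    then have "\<bar>M k x - M k y\<bar> \<le> \<bar>M0 k x - M0 k y\<bar> + \<bar>\<beta> / D * ip g (M0 k)\<bar> * \<bar>z x - z y\<bar>"
      unfolding abs_mult[symmetric] by (metis abs_triangle_ineq4)
    also have "\<dots> \<le> C * n * \<bar>x - y\<bar> + (G * n) * (B1 * \<bar>x - y\<bar>)"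
      using C(3)[OF that] coeff[OF that(1)] zl[OF that(2,3)] G n B1(1) unfolding n_def[symmetric]
      by (intro add_mono mult_mono) auto
    also have "\<dots> = (C + G * B1) * (n * \<bar>x - y\<bar>)" by (simp add: algebra_simps)
    also have "\<dots> \<le> C' * (n * \<bar>x - y\<bar>)" using GB n by (intro mult_right_mono) (auto simp: C'_def)
    finally show ?thesis unfolding n_def by (simp add: mult.assoc)
  qed
  from that[OF C' 1 2] show ?thesis by blast
qed

subsection \<open>Orthogonal families of eigenfunctions\<close>

text \<open>Equal eigenvalues are allowed, so the cardinality of the family counts
  multiplicities.\<close>

definition eigenfamily :: "(real \<Rightarrow> real) set \<Rightarrow> ((real \<Rightarrow> real) \<Rightarrow> real) \<Rightarrow> bool" where
  "eigenfamily E \<mu> \<longleftrightarrow> finite E \<and> (\<forall>e\<in>E. 0 < \<mu> e \<and> isL e (\<lambda>x. \<mu> e * e x) \<and> 0 < ip e e)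
     \<and> (\<forall>e\<in>E. \<forall>e'\<in>E. e \<noteq> e' \<longrightarrow> ip e e' = 0)"

lemma eigenfamilyD:
  assumes "eigenfamily E \<mu>"
  shows "finite E" "e \<in> E \<Longrightarrow> 0 < \<mu> e" "e \<in> E \<Longrightarrow> isL e (\<lambda>x. \<mu> e * e x)" "e \<in> E \<Longrightarrow> 0 < ip e e"
    "e \<in> E \<Longrightarrow> e' \<in> E \<Longrightarrow> e \<noteq> e' \<Longrightarrow> ip e e' = 0" "e \<in> E \<Longrightarrow> cts e"
  using assms isL_cts(1) unfolding eigenfamily_def by blast+

definition "index = (if 0 < D then j - 1 else j)"

lemma ip_orth_sum:
  assumes E: "finite E" "\<And>e. e \<in> E \<Longrightarrow> cts e" "\<And>e e'. e \<in> E \<Longrightarrow> e' \<in> E \<Longrightarrow> e \<noteq> e' \<Longrightarrow> ip e e' = 0" and "e' \<in> E"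
  shows "ip (\<lambda>x. \<Sum>e\<in>E. c e * e x) e' = c e' * ip e' e'"
proof -
  have "ip (\<lambda>x. \<Sum>e\<in>E. c e * e x) e' = (\<Sum>e\<in>E. c e * ip e e')"
    using ip_sum_left[of E "\<lambda>e. e"] assms by auto
  also have "\<dots> = (\<Sum>e\<in>E. if e = e' then c e' * ip e' e' else 0)"
    by (rule sum.cong) (use assms in auto)
  finally show ?thesis using assms by simp
qed

text \<open>A nontrivial combination of more than \<open>index\<close> eigenfunctions can be made to
  satisfy \<open>index\<close> linear conditions that force the form to be nonpositive on it. But on
  a combination of orthogonal eigenfunctions with positive eigenvalues the form is positive.\<close>

lemma eigenfamily_card_le:
  assumes E: "eigenfamily E \<mu>"
  shows "card E \<le> index"
proof (rule ccontr)
  assume big: "\<not> ?thesis"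
  note e = eigenfamilyD[OF E]
  define Z where "Z = {x \<in> {0<..<pi}. \<psi> x = 0}"
  have Z: "finite Z" "card Z = j - 1" using wave(4) by (auto simp: Z_def has_n_zeros_def)
  \<comment> \<open>One condition for every interior zero of \<psi>. If \<open>D\<close> is
    negative, the form is positive along \<open>z\<close>, and the extra condition
    \<open>None\<close>, orthogonality to \<open>g\<close>, excludes this direction.\<close>
  define J where "J = Some ` Z \<union> (if 0 < D then {} else {None})"
  have "card (Some ` Z) = j - 1" using Z by (simp add: card_image)
  then have J: "finite J" "card J \<le> index"
    using Z j by (auto simp: J_def index_def card_insert_if)
  \<comment> \<open>The condition \<open>Some x\<close> says that the combination, after subtraction
    of its component along \<open>z\<close>, vanishes at \<open>x\<close>. That difference is
    orthogonal to \<open>g\<close>, and \<open>form_negative\<close> applies to it.\<close>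
  define A where "A o' e = (case o' of None \<Rightarrow> ip g e | Some x \<Rightarrow> e x - ip g e / s0 * z x)" for o' and e :: "real \<Rightarrow> real"
  have "card J < card E" using J big by simp
  then obtain c where c: "\<And>o'. o' \<in> J \<Longrightarrow> (\<Sum>e\<in>E. c e * A o' e) = 0" "\<exists>e\<in>E. c e \<noteq> 0"
    using homogeneous_system_nontrivial[OF J(1) e(1), of A] by blast
  define w where "w x = (\<Sum>e\<in>E. c e * e x)" for x
  define l where "l x = (\<Sum>e\<in>E. c e * (\<mu> e * e x))" for x
  have L: "isL w l" unfolding w_def[abs_def] l_def[abs_def]
    by (rule isL_sum[OF e(1), of "\<lambda>e. e" "\<lambda>e x. \<mu> e * e x"]) (rule e(3))
  note cw = isL_cts[OF L]
  have gw: "ip g w = (\<Sum>e\<in>E. c e * ip g e)"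
    unfolding w_def[abs_def] using ip_sum_right[OF e(1), of "\<lambda>e. e" g c] e(6) cts_g by simp
  define \<alpha> where "\<alpha> = ip g w / s0"
  define w0 where "w0 x = 1 * w x + (- \<alpha>) * z x" for x
  have "isL0 w0 (\<lambda>x. 1 * (l x + \<beta> * ip g w * g x) + (- \<alpha>) * - g x)"
    unfolding w0_def[abs_def] by (rule isL0_lin[OF L[unfolded isL_def] isL0_z])
  then have L0: "isL0 w0 (\<lambda>x. l x + \<alpha> * D * g x)"
    by (rule isL0_cong) (use s0_pos in \<open>auto simp: \<alpha>_def D_def field_simps\<close>)
  have w0z: "w0 x = 0" if "x \<in> {0<..<pi}" "\<psi> x = 0" for x
  proof -
    have "Some x \<in> J" using that by (auto simp: J_def Z_def)
    from c(1)[OF this] have "0 = (\<Sum>e\<in>E. c e * (e x - ip g e / s0 * z x))" by (simp add: A_def)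
    also have "\<dots> = w x - (\<Sum>e\<in>E. c e * ip g e) / s0 * z x"
      by (simp add: w_def right_diff_distrib sum_subtractf sum_divide_distrib sum_distrib_right mult.assoc)
    finally show ?thesis unfolding gw[symmetric] w0_def \<alpha>_def by simp
  qed
  have "ip g w0 = ip g (\<lambda>x. w x + (- \<alpha>) * z x)" unfolding w0_def[abs_def] by simp
  also have "\<dots> = ip g w + (- \<alpha>) * s0"
    unfolding ip_commute[of g] s0_def by (rule ip_add_scaled[OF cw(1) cts_z cts_g])
  also have "\<dots> = 0" using s0_pos by (simp add: \<alpha>_def)
  finally have gw0: "ip g w0 = 0" .
  note cw0 = isL0D(1)[OF L0]
  have "ip (\<lambda>x. l x + \<alpha> * D * g x) w0 \<le> 0" by (rule form_negative(1)[OF L0 w0z])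
  then have neg: "ip l w0 \<le> 0" using ip_add_scaled[OF cw(2) cts_g cw0, of "\<alpha> * D"] gw0 by simp
  have "ip l z = ip w (\<lambda>x. - (D * g x))" by (rule isL_sym[OF L isL_z])
  also have "\<dots> = - D * ip w g" using ip_scale_right[of w "- D" g] by simp
  finally have lz: "ip l z = - D * (\<alpha> * s0)" using s0_pos by (simp add: \<alpha>_def ip_commute[of w])
  have "ip l w = ip l (\<lambda>x. w0 x + \<alpha> * z x)" by (rule ip_cong) (auto simp: w0_def)
  also have "\<dots> = ip l w0 + \<alpha> * ip l z"
    unfolding ip_commute[of l] by (rule ip_add_scaled[OF cw0 cts_z cw(2)])
  finally have lw: "ip l w = ip l w0 - \<alpha> * \<alpha> * s0 * D" unfolding lz by (simp add: algebra_simps)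
  have "0 \<le> \<alpha> * \<alpha> * s0 * D"
  proof (cases "0 < D")
    case True
    then show ?thesis using s0_pos by simp
  next
    case False
    then have "None \<in> J" by (simp add: J_def)
    from c(1)[OF this] have "ip g w = 0" unfolding gw by (simp add: A_def)
    then show ?thesis by (simp add: \<alpha>_def)
  qed
  with lw neg have le: "ip l w \<le> 0" by simp
  have le': "ip l e' = c e' * \<mu> e' * ip e' e'" if "e' \<in> E" for e'
  proof -
    have "ip l e' = ip (\<lambda>x. \<Sum>e\<in>E. (c e * \<mu> e) * e x) e'" unfolding l_def[abs_def] by (simp add: mult.assoc)
    also have "\<dots> = (c e' * \<mu> e') * ip e' e'" by (rule ip_orth_sum[OF e(1) e(6) e(5) that])
    finally show ?thesis .
  qed
  have "ip l w = (\<Sum>e\<in>E. c e * ip l e)"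
    unfolding w_def[abs_def] using ip_sum_right[OF e(1), of "\<lambda>e. e" l c] e(6) cw(2) by simp
  also have "\<dots> = (\<Sum>e\<in>E. (c e)\<^sup>2 * (\<mu> e * ip e e))"
    by (rule sum.cong) (auto simp: le' power2_eq_square)
  also have "\<dots> > 0"
  proof -
    obtain e' where e': "e' \<in> E" "c e' \<noteq> 0" using c(2) by blast
    show ?thesis
    proof (rule sum_pos2[OF e(1) e'(1)])
      show "0 < (c e')\<^sup>2 * (\<mu> e' * ip e' e')" using e' e(2)[OF e'(1)] e(4)[OF e'(1)] by simp
      fix i assume "i \<in> E"
      then show "0 \<le> (c i)\<^sup>2 * (\<mu> i * ip i i)" using e(2)[of i] e(4)[of i] by simp
    qed
  qed
  finally show False using le by simp
qed

text \<open>Subtract from \<open>u\<close> its projection on \<open>E\<close>. The remainder u' has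
  an image l' orthogonal to \<open>E\<close>, and its form is (M l', l'), at most 0 by assumption;
  what is left is the form of the projection.\<close>

lemma projection_bound:
  assumes E: "eigenfamily E \<mu>" and neg: "\<And>k. cts k \<Longrightarrow> (\<And>e. e \<in> E \<Longrightarrow> ip k e = 0) \<Longrightarrow> ip (M k) k \<le> 0"
    and L: "isL u l"
  shows "ip l u \<le> (\<Sum>e\<in>E. \<mu> e * (ip u e)\<^sup>2 / ip e e)"
proof -
  note e = eigenfamilyD[OF E]
  note cu = isL_cts[OF L]
  define c where "c e = ip u e / ip e e" for e
  define r where "r x = (\<Sum>e\<in>E. c e * e x)" for x
  define rl where "rl x = (\<Sum>e\<in>E. c e * (\<mu> e * e x))" for x
  have Lr: "isL r rl" unfolding r_def[abs_def] rl_def[abs_def]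
    by (rule isL_sum[OF e(1), of "\<lambda>e. e" "\<lambda>e x. \<mu> e * e x"]) (rule e(3))
  define u' where "u' x = 1 * u x + (- 1) * r x" for x
  define l' where "l' x = 1 * l x + (- 1) * rl x" for x
  have L': "isL u' l'" unfolding u'_def[abs_def] l'_def[abs_def] by (rule isL_lin[OF L Lr])
  note cr = isL_cts[OF Lr] and c' = isL_cts[OF L']
  have re: "ip r e' = ip u e'" if "e' \<in> E" for e'
  proof -
    have "ip r e' = c e' * ip e' e'" unfolding r_def[abs_def] by (rule ip_orth_sum[OF e(1) e(6) e(5) that])
    then show ?thesis using e(4)[OF that] by (simp add: c_def)
  qed
  have le: "ip l e' = \<mu> e' * ip u e'" if "e' \<in> E" for e'
    using isL_sym[OF L e(3)[OF that]] by (simp add: ip_scale_right)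
  have rle: "ip rl e' = \<mu> e' * ip u e'" if "e' \<in> E" for e'
    using isL_sym[OF Lr e(3)[OF that]] re[OF that] by (simp add: ip_scale_right)
  have l'e: "ip l' e' = 0" if "e' \<in> E" for e'
  proof -
    have "ip l' e' = ip l e' + (- 1) * ip rl e'"
      using ip_add_scaled[OF cu(2) cr(2) e(6)[OF that], of "-1"] unfolding l'_def[abs_def] by simp
    then show ?thesis using le[OF that] rle[OF that] by simp
  qed
  have "ip (M l') l' \<le> 0" by (rule neg[OF c'(2) l'e])
  moreover have "ip (M l') l' = ip u' l'"
    by (rule ip_cong) (use isL_inj[OF isL_M[OF c'(2)] L'] in auto)
  ultimately have le0: "ip l' u' \<le> 0" by (simp add: ip_commute)
  have l'r: "ip l' r = 0"
    unfolding r_def[abs_def] using ip_sum_right[OF e(1), of "\<lambda>e. e" l' c] e(6) c'(2) l'e by simp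
  have "ip u l' = ip (\<lambda>x. u' x + 1 * r x) l'" by (rule ip_cong) (auto simp: u'_def)
  also have "\<dots> = ip u' l' + 1 * ip r l'" by (rule ip_add_scaled[OF c'(1) cr(1) c'(2)])
  finally have "ip u l' \<le> 0" using le0 l'r by (simp add: ip_commute)
  moreover have "ip u l' = ip l u - ip rl u"
    using ip_add_scaled[OF cu(2) cr(2) cu(1), of "-1"] unfolding l'_def[abs_def] by (simp add: ip_commute[of u])
  moreover have "ip rl u = (\<Sum>e\<in>E. \<mu> e * (ip u e)\<^sup>2 / ip e e)"
  proof -
    have "ip rl u = (\<Sum>e\<in>E. c e * ip (\<lambda>x. \<mu> e * e x) u)"
      unfolding rl_def[abs_def] by (rule ip_sum_left[OF e(1) _ cu(1)]) (intro continuous_intros e(6))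
    also have "\<dots> = (\<Sum>e\<in>E. \<mu> e * (ip u e)\<^sup>2 / ip e e)"
    proof (rule sum.cong[OF refl])
      fix e assume "e \<in> E"
      have "ip (\<lambda>x. \<mu> e * e x) u = \<mu> e * ip u e" unfolding ip_scale_left by (simp only: ip_commute[of e u])
      then show "c e * ip (\<lambda>x. \<mu> e * e x) u = \<mu> e * (ip u e)\<^sup>2 / ip e e" by (simp add: c_def power2_eq_square)
    qed
    finally show ?thesis .
  qed
  ultimately show ?thesis by simp
qed

lemma ip_M_sym: "cts u \<Longrightarrow> cts k \<Longrightarrow> ip (M u) k = ip u (M k)"
  using isL_sym[OF isL_M isL_M, of u k] by simp

lemma M_linear:
  assumes "cts u" "cts k" "x \<in> {0..pi}"
  shows "M (\<lambda>x. a * u x + b * k x) x = a * M u x + b * M k x"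
  by (rule isL_inj[OF isL_M isL_lin[OF isL_M isL_M]]) (use assms in \<open>auto intro!: continuous_intros\<close>)

lemma M_eigen: 
  assumes "eigenfamily E \<mu>" "e \<in> E" "cts u"
  shows "ip (M u) e = ip u e / \<mu> e"
proof -
  note e = eigenfamilyD[OF assms(1)]
  have "ip u e = ip (M u) (\<lambda>x. \<mu> e * e x)" by (rule isL_sym[OF isL_M[OF assms(3)] e(3)[OF assms(2)]])
  then show ?thesis using e(2)[OF assms(2)] by (simp add: ip_scale_right)
qed

text \<open>Otherwise \<open>projection_bound\<close> would make the form nonpositive on the
  complement of \<open>E\<close>. But \<open>index\<close> independent trial functions, the
  truncations and, for negative \<open>D\<close>, also \<open>z\<close>, have a combination
  \<open>k\<close> orthogonal to \<open>E\<close> on which the form is nonnegative in the limit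
  sense. Moving from \<open>k\<close> in the direction \<open>M k\<close> increases the form to
  first order, a contradiction.\<close>

lemma M_positive:
  assumes E: "eigenfamily E \<mu>" and small: "card E < index"
  shows "\<exists>k. cts k \<and> (\<forall>e\<in>E. ip k e = 0) \<and> 0 < ip (M k) k"
proof (rule ccontr)
  assume "\<not> ?thesis"
  then have neg: "\<And>k. cts k \<Longrightarrow> (\<And>e. e \<in> E \<Longrightarrow> ip k e = 0) \<Longrightarrow> ip (M k) k \<le> 0" by force
  note e = eigenfamilyD[OF E]
  have bound: "ip l u \<le> (\<Sum>e\<in>E. \<mu> e * (ip u e)\<^sup>2 / ip e e)" if "isL u l" for u l
  proof (rule projection_bound[OF E _ that])
    fix k assume "cts k" "\<And>e. e \<in> E \<Longrightarrow> ip k e = 0"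
    then show "ip (M k) k \<le> 0" by (rule neg)
  qed
  \<comment> \<open>The trial functions mirror the conditions in \<open>eigenfamily_card_le\<close>:
    \<open>None\<close> stands for \<open>z\<close> and occurs only if \<open>D\<close> is negative,
    so there are exactly \<open>index\<close> of them.\<close>
  define I where "I = Some ` {..<j - 1} \<union> (if 0 < D then {} else {None})"
  have "card (Some ` {..<j - 1}) = j - 1" by (simp add: card_image)
  then have I: "finite I" "card I = index" using j by (auto simp: I_def index_def)
  define t where "t o' = (case o' of None \<Rightarrow> z | Some i \<Rightarrow> Wi i)" for o'
  have ct: "cts (t o')" if "o' \<in> I" for o'
    using that cts_z cts_Wi by (auto simp: I_def t_def split: if_splits)
  obtain c where c: "\<And>e. e \<in> E \<Longrightarrow> (\<Sum>o'\<in>I. c o' * ip (t o') e) = 0" "\<exists>o'\<in>I. c o' \<noteq> 0"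
    using homogeneous_system_nontrivial[OF e(1) I(1), of "\<lambda>e o'. ip (t o') e"] small I(2) by auto
  \<comment> \<open>For positive \<open>D\<close> the index \<open>None\<close> is not in
    \<open>I\<close> and its coefficient carries no information, hence the value 0.\<close>
  define \<alpha> where "\<alpha> = (if 0 < D then 0 else c None)"
  define w where "w x = (\<Sum>i<j-1. c (Some i) * Wi i x)" for x
  have cw: "cts w" and gw: "ip g w = 0" using test_functions(1,2)[of "\<lambda>i. c (Some i)"] unfolding w_def[abs_def] by auto
  obtain wn ln where wn: "\<And>n. isL0 (wn n) (ln n)" "(\<lambda>n. ip (ln n) (wn n)) \<longlonglongrightarrow> 0"
    "\<And>u. cts u \<Longrightarrow> (\<lambda>n. ip u (wn n)) \<longlonglongrightarrow> ip u w"
    using test_functions(3)[of "\<lambda>i. c (Some i)"] unfolding w_def[abs_def] by blast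
  define k where "k x = w x + \<alpha> * z x" for x
  have ck: "cts k" unfolding k_def by (intro continuous_intros cw cts_z)
  have k_sum: "k x = (\<Sum>o'\<in>I. c o' * t o' x)" for x
  proof -
    have inj: "inj_on Some {..<j-1}" by simp
    have "(\<Sum>o'\<in>Some ` {..<j-1}. c o' * t o' x) = w x"
      unfolding w_def sum.reindex[OF inj] by (simp add: t_def)
    then show ?thesis by (auto simp: I_def k_def \<alpha>_def t_def sum.insert_if)
  qed
  have ke: "ip k e = 0" if "e \<in> E" for e
  proof -
    have "ip k e = (\<Sum>o'\<in>I. c o' * ip (t o') e)"
      unfolding k_sum[abs_def] by (rule ip_sum_left[OF I(1) ct e(6)[OF that]])
    then show ?thesis using c(1)[OF that] by simp
  qed
  have gk: "ip g k = \<alpha> * s0"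
    unfolding k_def[abs_def] ip_commute[of g] using ip_add_scaled[OF cw cts_z cts_g, of \<alpha>] gw
    by (simp add: s0_def ip_commute[of _ g])
  have "0 < ip k k"
  proof (rule ccontr)
    assume "\<not> 0 < ip k k"
    then have "ip k k = 0" using ip_self_nonneg[of k] by simp
    then have k0: "\<And>x. x \<in> {0..pi} \<Longrightarrow> k x = 0" using ip_self_eq_0_iff[OF ck] by blast
    then have "ip g k = ip g (\<lambda>_. 0)" by (intro ip_cong) auto
    then have \<alpha>0: "\<alpha> = 0" using gk s0_pos by simp
    have "c (Some i) = 0" if i: "i < j - 1" for i
    proof -
      have ij: "Suc i < j" using i by simp
      have "0 = w (nd i)" using k0[OF nd(1)[OF ij]] \<alpha>0 by (simp add: k_def)
      also have "\<dots> = (\<Sum>i'<j-1. if i' = i then c (Some i) * \<psi>1 (nd i) else 0)"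
        unfolding w_def by (rule sum.cong) (use Wi_nd[OF _ ij] in auto)
      also have "\<dots> = c (Some i) * \<psi>1 (nd i)" using i by simp
      finally show ?thesis using \<psi>1_nd[OF ij] by simp
    qed
    then show False using c(2) \<alpha>0 by (auto simp: I_def \<alpha>_def split: if_splits)
  qed
  have \<alpha>D: "\<alpha> * \<alpha> * (D * s0) \<le> 0" using s0_pos by (auto simp: \<alpha>_def mult_nonneg_nonpos mult_nonpos_nonneg)
  \<comment> \<open>The trial function is k + \<epsilon> M k. As L (M k) = k, the cross term in its
    form is 2 \<epsilon> (k, k), while (k, M k) enters with \<epsilon>^2. Only the part
    \<open>w\<close> of \<open>k\<close> lies outside the domain; it is replaced by
    \<open>wn n\<close>, and the inequality is obtained in the limit.\<close>
  have key: "2 * ip k k + \<epsilon> * ip k (M k) \<le> 0" if \<epsilon>: "0 < \<epsilon>" for \<epsilon>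
  proof -
    define y where "y x = \<alpha> * z x + \<epsilon> * M k x" for x
    define ly where "ly x = \<alpha> * - (D * g x) + \<epsilon> * k x" for x
    have Ly: "isL y ly" unfolding y_def[abs_def] ly_def[abs_def] by (rule isL_lin[OF isL_z isL_M[OF ck]])
    note cy = isL_cts[OF Ly]
    define m where "m n x = ln n x - \<beta> * ip g (wn n) * g x" for n x
    have Lm: "isL (wn n) (m n)" for n
      unfolding isL_def by (rule isL0_cong[OF wn(1)[of n]]) (auto simp: m_def)
    note cm = isL_cts[OF Lm]
    define u where "u n x = 1 * wn n x + 1 * y x" for n x
    define l where "l n x = 1 * m n x + 1 * ly x" for n x
    have Lu: "isL (u n) (l n)" for n unfolding u_def[abs_def] l_def[abs_def] by (rule isL_lin[OF Lm Ly])
    note cu = isL_cts[OF Lu]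
    have lu: "ip (l n) (u n) = ip (ln n) (wn n) - \<beta> * (ip g (wn n))\<^sup>2 + 2 * ip ly (wn n) + ip ly y" for n
    proof -
      have "ip (l n) (u n) = ip (m n) (u n) + 1 * ip ly (u n)"
        using ip_add_scaled[OF cm(2) cy(2) cu(1), of n 1 n] unfolding l_def[abs_def] by simp
      moreover have "ip v' (u n) = ip v' (wn n) + 1 * ip v' y" if "cts v'" for v'
        using ip_add_scaled[OF cm(1) cy(1) that, of n 1] unfolding u_def[abs_def] ip_commute[of v'] by simp
      moreover have "ip (m n) y = ip ly (wn n)" using isL_sym[OF Lm Ly, of n] by (simp add: ip_commute)
      moreover have "ip (m n) (wn n) = ip (ln n) (wn n) - \<beta> * ip g (wn n) * ip g (wn n)"
        using ip_add_scaled[OF isL0D(2)[OF wn(1)] cts_g cm(1), of n "- (\<beta> * ip g (wn n))" n]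
        unfolding m_def[abs_def] by simp
      ultimately show ?thesis using cm(2) cy(2) by (simp add: power2_eq_square)
    qed
    have ineq: "ip (l n) (u n) \<le> (\<Sum>e\<in>E. \<mu> e * (ip (u n) e)\<^sup>2 / ip e e)" for n by (rule bound[OF Lu])
    have ye: "ip y e' = \<alpha> * ip z e'" if "e' \<in> E" for e'
    proof -
      have "ip y e' = ip (\<lambda>x. \<alpha> * z x) e' + \<epsilon> * ip (M k) e'"
        unfolding y_def[abs_def] by (rule ip_add_scaled) (intro continuous_intros cts_z cts_M ck e(6) that)+
      then show ?thesis using M_eigen[OF E that ck] ke[OF that] by (simp add: ip_scale_left)
    qed
    have lim_e: "(\<lambda>n. ip (u n) e') \<longlonglongrightarrow> 0" if "e' \<in> E" for e'
    proof -
      have "ip (u n) e' = ip e' (wn n) + ip y e'" for n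
        using ip_add_scaled[OF cm(1) cy(1) e(6)[OF that], of n 1] unfolding u_def[abs_def] by (simp add: ip_commute[of e'])
      moreover have "(\<lambda>n. ip e' (wn n) + ip y e') \<longlonglongrightarrow> ip e' w + ip y e'"
        by (intro tendsto_intros wn(3) e(6) that)
      moreover have "ip e' w + ip y e' = ip k e'"
        using ip_add_scaled[OF cw cts_z e(6)[OF that], of \<alpha>] ye[OF that] unfolding k_def[abs_def] by (simp add: ip_commute[of e'])
      ultimately show ?thesis using ke[OF that] by simp
    qed
    \<comment> \<open>Both \<open>k\<close> and \<open>M k\<close> are orthogonal to
      \<open>E\<close>, so the projections of \<open>u n\<close> on \<open>E\<close> tend to 0 and
      so does the upper bound.\<close>
    have R: "(\<lambda>n. \<Sum>e\<in>E. \<mu> e * (ip (u n) e)\<^sup>2 / ip e e) \<longlonglongrightarrow> (\<Sum>e\<in>E. \<mu> e * 0\<^sup>2 / ip e e)"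
      by (intro tendsto_intros lim_e) (use e(4) in force)+
    have Lim: "(\<lambda>n. ip (l n) (u n)) \<longlonglongrightarrow> 0 - \<beta> * (ip g w)\<^sup>2 + 2 * ip ly w + ip ly y"
      unfolding lu by (intro tendsto_intros wn cts_g cy)
    have "0 - \<beta> * (ip g w)\<^sup>2 + 2 * ip ly w + ip ly y \<le> (\<Sum>e\<in>E. \<mu> e * 0\<^sup>2 / ip e e)"
      by (rule LIMSEQ_le[OF Lim R]) (use ineq in auto)
    then have le: "2 * ip ly w + ip ly y \<le> 0" using gw by simp
    have ly: "ip ly v' = - \<alpha> * D * ip g v' + \<epsilon> * ip k v'" if "cts v'" for v'
    proof -
      have "ip ly v' = ip (\<lambda>x. (- \<alpha> * D) * g x + \<epsilon> * k x) v'" by (rule ip_cong) (auto simp: ly_def)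
      also have "\<dots> = ip (\<lambda>x. (- \<alpha> * D) * g x) v' + \<epsilon> * ip k v'"
        by (rule ip_add_scaled) (intro continuous_intros cts_g ck that)+
      finally have "ip ly v' = ip (\<lambda>x. (- \<alpha> * D) * g x) v' + \<epsilon> * ip k v'" .
      then show ?thesis by (simp only: ip_scale_left)
    qed
    have y: "ip v' y = \<alpha> * ip v' z + \<epsilon> * ip v' (M k)" if "cts v'" for v'
    proof -
      have "ip v' y = ip v' (\<lambda>x. \<alpha> * z x) + ip v' (\<lambda>x. \<epsilon> * M k x)"
        unfolding y_def[abs_def] by (intro ip_add_right continuous_intros cts_z cts_M ck that)
      then show ?thesis by (simp only: ip_scale_right)
    qed
    have gM: "- D * ip g (M k) = ip z k"
    proof -
      have "ip (\<lambda>x. - (D * g x)) (M k) = ip z k" by (rule isL_sym[OF isL_z isL_M[OF ck]])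
      moreover have "ip (\<lambda>x. - (D * g x)) (M k) = - D * ip g (M k)" using ip_scale_left[of "- D" g] by simp
      ultimately show ?thesis by simp
    qed
    have kk: "ip k k = ip k w + \<alpha> * ip k z"
    proof -
      have "ip k k = ip (\<lambda>x. w x + \<alpha> * z x) k" by (rule ip_cong) (auto simp: k_def)
      also have "\<dots> = ip w k + \<alpha> * ip z k" by (rule ip_add_scaled[OF cw cts_z ck])
      finally show ?thesis by (simp only: ip_commute[of w k] ip_commute[of z k])
    qed
    have "2 * ip ly w + ip ly y = 2 * (\<epsilon> * ip k w) + (- \<alpha> * D * (\<alpha> * s0 + \<epsilon> * ip g (M k)) + \<epsilon> * (\<alpha> * ip k z + \<epsilon> * ip k (M k)))"
      unfolding ly[OF cw] ly[OF cy(1)] y[OF cts_g] y[OF ck] gw s0_def by simp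
    also have "\<dots> = 2 * (\<epsilon> * ip k w) - \<alpha> * \<alpha> * (D * s0) + \<alpha> * \<epsilon> * (- D * ip g (M k)) + \<epsilon> * (\<alpha> * ip k z + \<epsilon> * ip k (M k))"
      by (simp add: algebra_simps)
    also have "\<dots> = \<epsilon> * (2 * ip k k + \<epsilon> * ip k (M k)) - \<alpha> * \<alpha> * (D * s0)"
      unfolding gM kk by (simp add: ip_commute[of z] algebra_simps)
    finally have "\<epsilon> * (2 * ip k k + \<epsilon> * ip k (M k)) \<le> 0" using le \<alpha>D by linarith
    then show ?thesis using \<epsilon> by (simp add: mult_le_0_iff)
  qed
  have "((\<lambda>\<epsilon>. 2 * ip k k + \<epsilon> * ip k (M k)) \<longlongrightarrow> 2 * ip k k + 0 * ip k (M k)) (at_right 0)"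
    by (intro tendsto_intros)
  then have "2 * ip k k + 0 * ip k (M k) \<le> 0"
    by (rule tendsto_upperbound) (auto simp: eventually_at_filter key)
  then show False using \<open>0 < ip k k\<close> by simp
qed

text \<open>The inverse \<open>M\<close> maps the complement of \<open>E\<close> into itself by
  \<open>M_eigen\<close>, so \<open>compact_symmetric_eigenvector\<close> gives an eigenvalue
  \<Lambda> > 0 of \<open>M\<close> there; the eigenvalue of L is 1 / \<Lambda>.\<close>

lemma eigenfamily_extend:
  assumes E: "eigenfamily E \<mu>" and small: "card E < index"
  shows "\<exists>w m. 0 < m \<and> isL w (\<lambda>x. m * w x) \<and> (\<exists>x\<in>{0..pi}. w x \<noteq> 0) \<and> (\<forall>e\<in>E. ip w e = 0)"
proof -
  note e = eigenfamilyD[OF E]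
  obtain k where k: "cts k" "\<forall>e\<in>E. ip k e = 0" "0 < ip (M k) k" using M_positive[OF E small] by blast
  obtain C where C: "0 < C" "\<And>k x. cts k \<Longrightarrow> x \<in> {0..pi} \<Longrightarrow> \<bar>M k x\<bar> \<le> C * sqrt (ip k k)"
    "\<And>k x y. cts k \<Longrightarrow> x \<in> {0..pi} \<Longrightarrow> y \<in> {0..pi} \<Longrightarrow> \<bar>M k x - M k y\<bar> \<le> C * sqrt (ip k k) * \<bar>x - y\<bar>"
    using M_bounds by metis
  have "\<exists>\<Lambda> w. 0 < \<Lambda> \<and> cts w \<and> (\<forall>e\<in>E. ip w e = 0) \<and> (\<exists>x\<in>{0..pi}. w x \<noteq> 0)
    \<and> (\<forall>x\<in>{0..pi}. M w x = \<Lambda> * w x)"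
    by (rule compact_symmetric_eigenvector[OF M_linear cts_M ip_M_sym C(2) C(3) C(1) e(6) _ k(1) _ k(3)])
      (use M_eigen[OF E] k(2) in auto)
  then obtain \<Lambda> w where w: "0 < \<Lambda>" "cts w" "\<forall>e\<in>E. ip w e = 0" "\<exists>x\<in>{0..pi}. w x \<noteq> 0"
    "\<forall>x\<in>{0..pi}. M w x = \<Lambda> * w x" by blast
  have "isL (\<lambda>x. (1 / \<Lambda>) * M w x + 0 * M w x) (\<lambda>x. (1 / \<Lambda>) * w x + 0 * w x)"
    by (rule isL_lin[OF isL_M[OF w(2)] isL_M[OF w(2)]])
  then have "isL w (\<lambda>x. (1 / \<Lambda>) * w x)" by (rule isL_cong) (use w in auto)
  then show ?thesis using w by (intro exI[of _ w] exI[of _ "1 / \<Lambda>"]) auto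
qed

end

subsection \<open>The linearization as an operator in \<open>L\<^sup>2(0, \<pi>)\<close>\<close>

lemma H2_H10_cts:
  assumes "v \<in> H2_H10"
  shows "cts v"
proof -
  obtain p where p: "has_weak_deriv v p"
    using assms by (auto simp: H2_H10_def has_weak_deriv2_def)
  have "cts (\<lambda>x. v 0 + prim p x)" by (intro continuous_intros prim_continuous has_weak_derivD(2)[OF p])
  then show ?thesis by (rule continuous_on_eq) (rule has_weak_derivD(3)[OF p, symmetric])
qed

lemma H2_H10D:
  assumes "v \<in> H2_H10"
  shows "has_weak_deriv2 v (weak_dxx v)" "v 0 = 0" "v pi = 0" "x \<notin> {0..pi} \<Longrightarrow> v x = 0"
  using assms weak_dxx_ae(1) unfolding H2_H10_def by blast+

lemma weak_deriv2_L2: "has_weak_deriv2 v w \<Longrightarrow> w \<in> L2"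
  unfolding has_weak_deriv2_def using has_weak_derivD(1) by blast

lemma L2norm_sup_bound:
  assumes "cts u" "\<And>x. x \<in> {0..pi} \<Longrightarrow> \<bar>u x\<bar> \<le> B" "0 \<le> B"
  shows "L2norm u \<le> sqrt pi * B"
  unfolding L2norm_cts[OF assms(1)] by (rule sup_bound_imp_ip[OF assms])

lemma sum_fscale: "finite A \<Longrightarrow> (\<Sum>e\<in>A. fscale (c e) e) = (\<lambda>x. \<Sum>e\<in>A. c e * e x)"
  by (induction A rule: finite_induct) (simp_all add: fscale_def fun_eq_iff)

lemma span_sum_fscale:
  assumes "finite A" "A \<subseteq> B"
  shows "(\<lambda>x. \<Sum>e\<in>A. c e * e x) \<in> fun_space.span B"
proof -
  have "(\<Sum>e\<in>A. fscale (c e) e) \<in> fun_space.span B"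
    using assms by (intro fun_space.span_sum fun_space.span_scale fun_space.span_base) auto
  then show ?thesis by (simp only: sum_fscale[OF assms(1)])
qed

context perturbed
begin

definition "Lop \<phi> x = weak_dxx \<phi> x + q x * \<phi> x - \<beta> * (\<integral>t. g t * \<phi> t \<partial>leb_I) * g x"

lemma Lop_ip: "cts \<phi> \<Longrightarrow> Lop \<phi> x = weak_dxx \<phi> x + q x * \<phi> x - \<beta> * ip g \<phi> * g x"
  by (simp add: Lop_def integral_leb_I_ip cts_g)

text \<open>With a continuous right-hand side the weak second derivative has a continuous
  representative, so the problem in \<open>H2_H10\<close> becomes classical. Injectivity and
  eigenvalue questions are thereby reduced to \<open>isL\<close>.\<close>

lemma Lop_imp_isL:
  assumes \<phi>: "\<phi> \<in> H2_H10" and l: "cts l" and eq: "eq_ae (Lop \<phi>) l"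
  shows "isL \<phi> l"
proof -
  note c = H2_H10_cts[OF \<phi>]
  let ?w = "\<lambda>x. (l x + \<beta> * ip g \<phi> * g x) - q x * \<phi> x"
  have cl: "cts (\<lambda>x. l x + \<beta> * ip g \<phi> * g x)" by (intro continuous_intros l cts_g)
  have cw: "cts ?w" by (intro continuous_intros cl cts_q c)
  have "eq_ae (weak_dxx \<phi>) ?w"
    using eq unfolding eq_ae_def by eventually_elim (simp add: Lop_ip[OF c])
  from weak_deriv2_classical[OF H2_H10D(1)[OF \<phi>] this cw]
  show ?thesis unfolding isL_def isL0_def using H2_H10D(2,3)[OF \<phi>] cl by auto
qed

lemma isL_imp_Lop:
  assumes L: "isL \<phi> l" and z: "\<And>x. x \<notin> {0..pi} \<Longrightarrow> \<phi> x = 0"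
  shows "\<phi> \<in> H2_H10" "eq_ae (Lop \<phi>) l"
proof -
  obtain v1' where v1': "has_C2_deriv \<phi> v1' (\<lambda>x. (l x + \<beta> * ip g \<phi> * g x) - q x * \<phi> x)"
    using L by (auto simp: isL_def isL0_def)
  note w = C2_imp_weak_deriv2[OF v1']
  show "\<phi> \<in> H2_H10" unfolding H2_H10_def using w isL_bc[OF L] z by auto
  show "eq_ae (Lop \<phi>) l"
    using weak_dxx_ae(2)[OF w] unfolding eq_ae_def
    by eventually_elim (simp add: Lop_ip[OF isL_cts(1)[OF L]])
qed

lemma Lop_L2:
  assumes \<phi>: "\<phi> \<in> H2_H10"
  shows "Lop \<phi> \<in> L2"
proof -
  note c = H2_H10_cts[OF \<phi>]
  have cc: "cts (\<lambda>x. q x * \<phi> x - \<beta> * ip g \<phi> * g x)" by (intro continuous_intros cts_q cts_g c)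
  have "(\<lambda>x. weak_dxx \<phi> x + (q x * \<phi> x - \<beta> * ip g \<phi> * g x)) \<in> L2"
    by (rule L2_add[OF weak_deriv2_L2[OF H2_H10D(1)[OF \<phi>]] cts_imp_L2[OF cc]])
  moreover have "Lop \<phi> = (\<lambda>x. weak_dxx \<phi> x + (q x * \<phi> x - \<beta> * ip g \<phi> * g x))"
    by (rule ext) (simp add: Lop_ip[OF c])
  ultimately show ?thesis by simp
qed

lemma Lop_inj:
  assumes u: "u \<in> H2_H10" and \<phi>: "\<phi> \<in> H2_H10" and eq: "eq_ae (Lop u) h'" "eq_ae (Lop \<phi>) h'"
  shows "u = \<phi>"
proof -
  note c = H2_H10_cts[OF u] H2_H10_cts[OF \<phi>]
  define d where "d x = u x + (- 1) * \<phi> x" for x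
  have wd: "has_weak_deriv2 d (\<lambda>x. weak_dxx u x + (- 1) * weak_dxx \<phi> x)"
    unfolding d_def by (rule weak_deriv2_add[OF H2_H10D(1)[OF u] H2_H10D(1)[OF \<phi>]])
  have dH: "d \<in> H2_H10" using wd H2_H10D(2-4)[OF u] H2_H10D(2-4)[OF \<phi>] by (auto simp: H2_H10_def d_def)
  have gd: "ip g d = ip g u + (- 1) * ip g \<phi>"
    unfolding d_def ip_commute[of g] by (rule ip_add_scaled[OF c cts_g])
  have "eq_ae (Lop d) (\<lambda>_. 0)"
    using weak_dxx_ae(2)[OF wd] eq unfolding eq_ae_def
  proof eventually_elim
    case (elim x)
    have "Lop d x = Lop u x - Lop \<phi> x"
      unfolding Lop_ip[OF H2_H10_cts[OF dH]] Lop_ip[OF c(1)] Lop_ip[OF c(2)] elim(1) gd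
      by (simp add: d_def algebra_simps)
    then show ?case using elim by simp
  qed
  from Lop_imp_isL[OF dH _ this] have "isL d (\<lambda>_. 0)" by simp
  then have "d x = 0" if "x \<in> {0..pi}" for x using isL_inj[OF _ isL_zero _ that] by auto
  then have "u x = \<phi> x" for x
    using H2_H10D(4)[OF u, of x] H2_H10D(4)[OF \<phi>, of x] by (cases "x \<in> {0..pi}") (auto simp: d_def)
  then show ?thesis by (rule ext)
qed

text \<open>A right-hand side \<open>h' \<in> L\<^sup>2\<close> is reduced to a continuous one by subtracting a second primitive of \<open>h'\<close>.\<close>

lemma Lop_solve:
  "\<exists>C. \<forall>h'\<in>L2. \<exists>\<phi>\<in>H2_H10. eq_ae (Lop \<phi>) h' \<and> L2norm \<phi> \<le> C * L2norm h'"
proof -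
  obtain C where C: "0 < C" "\<And>k x. cts k \<Longrightarrow> x \<in> {0..pi} \<Longrightarrow> \<bar>M k x\<bar> \<le> C * sqrt (ip k k)"
    using M_bounds by metis
  obtain Q where Q: "0 \<le> Q" "\<And>x. x \<in> {0..pi} \<Longrightarrow> \<bar>q x\<bar> \<le> Q" using continuous_on_Icc_bounded[OF cts_q] by metis
  obtain G where G: "0 \<le> G" "\<And>x. x \<in> {0..pi} \<Longrightarrow> \<bar>g x\<bar> \<le> G" using continuous_on_Icc_bounded[OF cts_g] by metis
  \<comment> \<open>A first primitive costs the factor 4 of \<open>L1_le_L2norm\<close>, a second
    one 4 sqrt pi, and the linear correction that enforces the boundary condition a factor
    2.\<close>
  define A where "A = 32 * sqrt pi"
  define B where "B = Q * A + \<bar>\<beta>\<bar> * (sqrt (ip g g) * (sqrt pi * A)) * G"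
  define C' where "C' = sqrt pi * (A + C * (sqrt pi * B))"
  have AB: "0 \<le> A" "0 \<le> B" using Q G by (auto simp: A_def B_def ip_self_nonneg)
  have "\<exists>\<phi>\<in>H2_H10. eq_ae (Lop \<phi>) h' \<and> L2norm \<phi> \<le> C' * L2norm h'" if h': "h' \<in> L2" for h'
  proof -
    define n where "n = L2norm h'"
    have n: "0 \<le> n" by (simp add: n_def L2norm_nonneg)
    have ih: "integrable leb_I h'" by (rule L2_imp_integrable[OF h'])
    define p1 where "p1 = prim h'"
    have cp1: "cts p1" unfolding p1_def by (rule prim_continuous[OF ih])
    have p1b: "\<bar>p1 x\<bar> \<le> 4 * n" if "x \<in> {0..pi}" for x
      using prim_bound[OF ih that] L1_le_L2norm[OF h'] unfolding p1_def n_def by linarith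
    have p2b: "\<bar>prim p1 x\<bar> \<le> 16 * sqrt pi * n" if "x \<in> {0..pi}" for x
    proof -
      have "\<bar>prim p1 x\<bar> \<le> 4 * L2norm p1"
        using prim_bound[OF cts_integrable_leb_I[OF cp1] that] L1_le_L2norm[OF cts_imp_L2[OF cp1]] by linarith
      also have "\<dots> \<le> 4 * (sqrt pi * (4 * n))"
        by (intro mult_left_mono L2norm_sup_bound cp1 p1b) (use n in auto)
      finally show ?thesis by simp
    qed
    \<comment> \<open>The linear term restores the boundary value at pi and leaves the second
      derivative unchanged.\<close>
    define c0 where "c0 = prim p1 pi / pi"
    define w where "w x = prim p1 x - c0 * x" for x
    have dw: "(w has_real_derivative p1 x - c0) (at x within {0..pi})" if "x \<in> {0..pi}" for x
      unfolding w_def using prim_has_derivative[OF cp1 that] by (auto intro!: derivative_eq_intros)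
    have cw: "cts w" by (rule DERIV_continuous_on, erule dw)
    have "has_weak_deriv w (\<lambda>x. p1 x - c0)"
      by (rule has_weak_deriv_classical[OF dw]) (auto intro!: continuous_intros cp1)
    moreover have "has_weak_deriv (\<lambda>x. p1 x - c0) h'"
      unfolding has_weak_deriv_alt using h' by (auto simp: p1_def prim_def set_lebesgue_integral_def)
    ultimately have ww: "has_weak_deriv2 w h'" by (auto simp: has_weak_deriv2_def)
    have w0: "w 0 = 0" "w pi = 0" by (auto simp: w_def c0_def prim_def set_lebesgue_integral_def)
    have wb: "\<bar>w x\<bar> \<le> A * n" if x: "x \<in> {0..pi}" for x
    proof -
      have "\<bar>c0 * x\<bar> = \<bar>prim p1 pi\<bar> * (x / pi)" using x by (simp add: c0_def abs_mult)
      also have "\<dots> \<le> (16 * sqrt pi * n) * 1" using x n by (intro mult_mono p2b) auto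
      finally show ?thesis using p2b[OF x] unfolding w_def A_def by linarith
    qed
    \<comment> \<open>This is h' - L w: since w'' = h' weakly, \<open>h'\<close> cancels and a
      continuous function remains. Then w + M k is the solution.\<close>
    define k where "k x = \<beta> * ip g w * g x - q x * w x" for x
    have ck: "cts k" unfolding k_def by (intro continuous_intros cts_g cts_q cw)
    have kb: "\<bar>k x\<bar> \<le> B * n" if x: "x \<in> {0..pi}" for x
    proof -
      have "sqrt (ip w w) \<le> sqrt pi * (A * n)" by (rule sup_bound_imp_ip[OF cw wb]) (use AB n in auto)
      then have "sqrt (ip g g) * sqrt (ip w w) \<le> sqrt (ip g g) * (sqrt pi * (A * n))"
        by (intro mult_left_mono) (auto simp: ip_self_nonneg)
      with ip_bound[OF cts_g cw] have 1: "\<bar>ip g w\<bar> \<le> sqrt (ip g g) * (sqrt pi * (A * n))" by linarith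
      have 2: "\<bar>\<beta>\<bar> * \<bar>ip g w\<bar> * \<bar>g x\<bar> \<le> \<bar>\<beta>\<bar> * (sqrt (ip g g) * (sqrt pi * (A * n))) * G"
        using 1 G(1) G(2)[OF x] AB n by (intro mult_mono) (auto simp: ip_self_nonneg)
      have 3: "\<bar>q x\<bar> * \<bar>w x\<bar> \<le> Q * (A * n)" using Q(1) Q(2)[OF x] wb[OF x] by (intro mult_mono) auto
      have "\<bar>k x\<bar> \<le> \<bar>\<beta> * ip g w * g x\<bar> + \<bar>q x * w x\<bar>" unfolding k_def by (rule abs_triangle_ineq4)
      also have "\<dots> \<le> \<bar>\<beta>\<bar> * (sqrt (ip g g) * (sqrt pi * (A * n))) * G + Q * (A * n)"
        unfolding abs_mult using 2 3 by linarith
      finally show ?thesis by (simp add: B_def algebra_simps)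
    qed
    define y where "y = M k"
    have Ly: "isL y k" unfolding y_def by (rule isL_M[OF ck])
    note cy = isL_cts(1)[OF Ly]
    have yb: "\<bar>y x\<bar> \<le> C * (sqrt pi * (B * n))" if "x \<in> {0..pi}" for x
    proof -
      have "sqrt (ip k k) \<le> sqrt pi * (B * n)" by (rule sup_bound_imp_ip[OF ck kb]) (use AB n in auto)
      then have "C * sqrt (ip k k) \<le> C * (sqrt pi * (B * n))" using C(1) by simp
      with C(2)[OF ck that] show ?thesis unfolding y_def by linarith
    qed
    obtain y1 where y1: "has_C2_deriv y y1 (\<lambda>x. (k x + \<beta> * ip g y * g x) - q x * y x)"
      using Ly by (auto simp: isL_def isL0_def)
    define v' where "v' x = (if x \<in> {0..pi} then w x + 1 * y x else 0)" for x
    have wv: "has_weak_deriv2 v' (\<lambda>x. h' x + 1 * ((k x + \<beta> * ip g y * g x) - q x * y x))"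
      by (rule weak_deriv2_cong[OF weak_deriv2_add[OF ww C2_imp_weak_deriv2[OF y1]]]) (simp add: v'_def)
    have vH: "v' \<in> H2_H10" using wv w0 isL_bc[OF Ly] by (auto simp: H2_H10_def v'_def)
    note cv = H2_H10_cts[OF vH]
    have gv: "ip g v' = ip g w + 1 * ip g y"
    proof -
      have "ip g v' = ip g (\<lambda>x. w x + 1 * y x)" by (rule ip_cong) (auto simp: v'_def)
      then show ?thesis unfolding ip_commute[of g] using ip_add_scaled[OF cw cy cts_g, of 1] by simp
    qed
    have "AE x in leb_I. x \<in> {0<..<pi}" by (rule AE_I2) (simp add: space_restrict_space)
    then have eq: "eq_ae (Lop v') h'"
      using weak_dxx_ae(2)[OF wv] unfolding eq_ae_def
    proof eventually_elim
      case (elim x)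
      then have "v' x = w x + y x" by (auto simp: v'_def)
      then show ?case unfolding Lop_ip[OF cv] elim(2) gv by (simp add: k_def algebra_simps)
    qed
    have "\<bar>v' x\<bar> \<le> (A + C * (sqrt pi * B)) * n" if "x \<in> {0..pi}" for x
    proof -
      have "\<bar>v' x\<bar> \<le> \<bar>w x\<bar> + \<bar>y x\<bar>" using that by (simp add: v'_def)
      also have "\<dots> \<le> A * n + C * (sqrt pi * (B * n))" by (intro add_mono wb yb that)
      finally show ?thesis by (simp add: algebra_simps)
    qed
    then have "L2norm v' \<le> sqrt pi * ((A + C * (sqrt pi * B)) * n)"
      by (intro L2norm_sup_bound cv) (use AB C n in auto)
    then have "L2norm v' \<le> C' * L2norm h'" by (simp add: C'_def n_def mult.assoc)
    with vH eq show ?thesis by blast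
  qed
  then show ?thesis by blast
qed

text \<open>The estimate holds for every element of the domain, not only for the constructed
  solutions: given \<open>u\<close>, solve with right-hand side \<open>Lop u\<close>, and by
  injectivity the solution with the bound is \<open>u\<close> itself.\<close>

lemma zero_not_in_spectrum: "0 \<notin> spectrum H2_H10 Lop"
proof -
  obtain C where C: "\<And>h'. h' \<in> L2 \<Longrightarrow> \<exists>\<phi>\<in>H2_H10. eq_ae (Lop \<phi>) h' \<and> L2norm \<phi> \<le> C * L2norm h'"
    using Lop_solve by blast
  have 1: "\<forall>h'\<in>L2. \<exists>!\<phi>. \<phi> \<in> H2_H10 \<and> eq_ae (Lop \<phi>) h'"
  proof
    fix h' assume "h' \<in> L2"
    then obtain v' where "v' \<in> H2_H10" "eq_ae (Lop v') h'" using C by blast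
    then show "\<exists>!\<phi>. \<phi> \<in> H2_H10 \<and> eq_ae (Lop \<phi>) h'" using Lop_inj by blast
  qed
  have 2: "L2norm u \<le> C * L2norm (Lop u)" if u: "u \<in> H2_H10" for u
  proof -
    obtain v' where v': "v' \<in> H2_H10" "eq_ae (Lop v') (Lop u)" "L2norm v' \<le> C * L2norm (Lop u)"
      using C[OF Lop_L2[OF u]] by blast
    have "eq_ae (Lop u) (Lop u)" by (simp add: eq_ae_def)
    then have "v' = u" by (rule Lop_inj[OF v'(1) u v'(2)])
    with v'(3) show ?thesis by simp
  qed
  then have "\<exists>C. \<forall>u\<in>H2_H10. L2norm u \<le> C * L2norm (Lop u)" by blast
  with 1 show ?thesis unfolding spectrum_def by simp
qed

section \<open>Eigenspaces and the count of positive eigenvalues\<close>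

lemma eigenspace_iff:
  "v' \<in> eigenspace H2_H10 Lop m \<longleftrightarrow> isL v' (\<lambda>x. m * v' x) \<and> (\<forall>x. x \<notin> {0..pi} \<longrightarrow> v' x = 0)"
proof
  assume "v' \<in> eigenspace H2_H10 Lop m"
  then have v': "v' \<in> H2_H10" "eq_ae (Lop v') (\<lambda>x. m * v' x)" by (auto simp: eigenspace_def)
  have "cts (\<lambda>x. m * v' x)" by (intro continuous_intros H2_H10_cts v')
  then show "isL v' (\<lambda>x. m * v' x) \<and> (\<forall>x. x \<notin> {0..pi} \<longrightarrow> v' x = 0)"
    using Lop_imp_isL[OF v'(1) _ v'(2)] H2_H10D(4)[OF v'(1)] by auto
next
  assume "isL v' (\<lambda>x. m * v' x) \<and> (\<forall>x. x \<notin> {0..pi} \<longrightarrow> v' x = 0)"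
  then show "v' \<in> eigenspace H2_H10 Lop m"
    using isL_imp_Lop[of v' "\<lambda>x. m * v' x"] by (auto simp: eigenspace_def)
qed

lemma eigen_orth:
  assumes "isL u (\<lambda>x. m * u x)" "isL v' (\<lambda>x. m' * v' x)" "m \<noteq> m'"
  shows "ip u v' = 0"
proof -
  have "m * ip u v' = m' * ip u v'" using isL_sym[OF assms(1,2)] by (simp add: ip_scale_left ip_scale_right)
  then show ?thesis using assms(3) by simp
qed

text \<open>Span and independence refer to functions on the whole line, and elements of
  \<open>H2_H10\<close> are extended by 0, so the values outside [0, pi] have to be fixed.\<close>

definition "supported E \<longleftrightarrow> (\<forall>e\<in>E. \<forall>x. x \<notin> {0..pi} \<longrightarrow> (e :: real \<Rightarrow> real) x = 0)"

lemma eigenfamily_insert: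
  assumes E: "eigenfamily E \<mu>" and w: "0 < m" "isL w (\<lambda>x. m * w x)" "0 < ip w w" "\<And>e. e \<in> E \<Longrightarrow> ip w e = 0"
  shows "w \<notin> E" "eigenfamily (insert w E) (\<mu>(w := m))"
proof -
  show "w \<notin> E" using w(3,4) by force
  then show "eigenfamily (insert w E) (\<mu>(w := m))"
    using E w unfolding eigenfamily_def by (auto simp: ip_commute)
qed

lemma eigenfamily_exists: "n \<le> index \<Longrightarrow> \<exists>E \<mu>. eigenfamily E \<mu> \<and> supported E \<and> card E = n"
proof (induction n)
  case 0
  show ?case by (rule exI[of _ "{}"]) (auto simp: eigenfamily_def supported_def)
next
  case (Suc n)
  then obtain E \<mu> where E: "eigenfamily E \<mu>" "supported E" "card E = n" by auto
  obtain w m where w: "0 < m" "isL w (\<lambda>x. m * w x)" "\<exists>x\<in>{0..pi}. w x \<noteq> 0" "\<forall>e\<in>E. ip w e = 0"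
    using eigenfamily_extend[OF E(1)] E(3) Suc.prems by auto
  \<comment> \<open>The eigenfunction found is determined on [0, pi] only; the extension by 0 makes
    it an element of the operator's domain.\<close>
  define w' where "w' x = (if x \<in> {0..pi} then w x else 0)" for x
  have L: "isL w' (\<lambda>x. m * w' x)" by (rule isL_cong[OF w(2)]) (auto simp: w'_def)
  have pos: "0 < ip w' w'" using w(3) ip_self_pos[OF isL_cts(1)[OF L]] by (auto simp: w'_def)
  have orth: "ip w' e = 0" if "e \<in> E" for e
  proof -
    have "ip w' e = ip w e" by (rule ip_cong) (auto simp: w'_def)
    then show ?thesis using w(4) that by simp
  qed
  note ins = eigenfamily_insert[OF E(1) w(1) L pos orth]
  have "card (insert w' E) = Suc n" using ins(1) E eigenfamilyD(1)[OF E(1)] by simp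
  moreover have "supported (insert w' E)" using E(2) by (auto simp: supported_def w'_def)
  ultimately show ?case using ins(2) by blast
qed

text \<open>Take a family of the maximal size \<open>index\<close>. By maximality its members with
  eigenvalue m > 0 span the eigenspace of m, and they are independent by orthogonality. So the
  dimensions of the eigenspaces add up to the size of the family.\<close>

lemma morse_index_Lop: "has_morse_index H2_H10 Lop index"
proof -
  obtain E \<mu> where E: "eigenfamily E \<mu>" "supported E" "card E = index" using eigenfamily_exists by blast
  note e = eigenfamilyD[OF E(1)]
  define ES where "ES m = eigenspace H2_H10 Lop m" for m
  define Em where "Em m = {e \<in> E. \<mu> e = m}" for m
  have Em_sub: "Em m \<subseteq> ES m" for m
    using e(3) E(2) by (auto simp: Em_def ES_def eigenspace_iff supported_def)
  have finEm: "finite (Em m)" for m using e(1) by (simp add: Em_def)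
  have expand: "v' = (\<lambda>x. \<Sum>e\<in>Em m. (ip v' e / ip e e) * e x)" if m: "0 < m" and v': "v' \<in> ES m" for m v'
  proof -
    have Lv: "isL v' (\<lambda>x. m * v' x)" and v0: "\<And>x. x \<notin> {0..pi} \<Longrightarrow> v' x = 0"
      using v' by (auto simp: ES_def eigenspace_iff)
    define c where "c e = ip v' e / ip e e" for e
    define r where "r x = (\<Sum>e\<in>Em m. c e * e x)" for x
    have Lr: "isL r (\<lambda>x. \<Sum>e\<in>Em m. c e * (m * e x))" unfolding r_def[abs_def]
      by (rule isL_sum[OF finEm, of m "\<lambda>e. e" "\<lambda>e x. m * e x"]) (use e(3) in \<open>auto simp: Em_def\<close>)
    define d where "d x = 1 * v' x + (- 1) * r x" for x
    have mr: "(\<Sum>e\<in>Em m. c e * (m * e x)) = m * r x" for x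
      by (simp add: r_def sum_distrib_left mult_ac)
    have Ld: "isL d (\<lambda>x. m * d x)"
      unfolding d_def[abs_def] by (rule isL_cong[OF isL_lin[OF Lv Lr, of 1 "-1"]])
        (simp_all add: mr right_diff_distrib)
    note cc = isL_cts(1)[OF Lv] isL_cts(1)[OF Lr] isL_cts(1)[OF Ld]
    have re: "ip r e' = c e' * ip e' e'" if "e' \<in> Em m" for e'
      unfolding r_def[abs_def] by (rule ip_orth_sum[OF finEm _ _ that]) (use e(5,6) in \<open>auto simp: Em_def\<close>)
    have de: "ip d e' = 0" if e': "e' \<in> E" for e'
    proof (cases "\<mu> e' = m")
      case True
      then have "ip r e' = ip v' e'" using re[of e'] e(4)[OF e'] e' by (simp add: Em_def c_def)
      moreover have "ip d e' = ip v' e' + (- 1) * ip r e'"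
        using ip_add_scaled[OF cc(1,2) e(6)[OF e'], of "-1"] unfolding d_def[abs_def] by simp
      ultimately show ?thesis by simp
    next
      case False
      then show ?thesis using eigen_orth[OF Ld e(3)[OF e']] by simp
    qed
    \<comment> \<open>The remainder \<open>d\<close> is an eigenfunction orthogonal to the whole
      family: to members with eigenvalue m by projection, to the others by symmetry. If it were not
      0, it would enlarge the family beyond the bound.\<close>
    have "ip d d = 0"
    proof (rule ccontr)
      assume "ip d d \<noteq> 0"
      then have "0 < ip d d" using ip_self_nonneg[of d] by simp
      note ins = eigenfamily_insert[OF E(1) m Ld this de]
      have "card (insert d E) \<le> index" by (rule eigenfamily_card_le[OF ins(2)])
      then show False using ins(1) E(3) e(1) by simp
    qed
    then have dz: "d x = 0" if "x \<in> {0..pi}" for x using ip_self_eq_0_iff[OF cc(3)] that by blast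
    have "v' x = r x" for x
    proof (cases "x \<in> {0..pi}")
      case True
      then show ?thesis using dz[OF True] by (simp add: d_def)
    next
      case False
      then have "r x = 0" using E(2) unfolding r_def by (intro sum.neutral) (auto simp: Em_def supported_def)
      then show ?thesis using v0[OF False] by simp
    qed
    then show ?thesis unfolding r_def c_def by (rule ext)
  qed
  have span: "ES m \<subseteq> fun_space.span (Em m)" if "0 < m" for m
  proof
    fix v' assume "v' \<in> ES m"
    from expand[OF that this] show "v' \<in> fun_space.span (Em m)"
      using span_sum_fscale[OF finEm order_refl, of "\<lambda>e. ip v' e / ip e e" m] by simp
  qed
  have indep: "fun_space.independent (Em m)" for m
  proof (rule fun_space.independent_if_scalars_zero[OF finEm])
    fix c e' assume z: "(\<Sum>e\<in>Em m. fscale (c e) e) = 0" and e': "e' \<in> Em m"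
    have zz: "(\<lambda>x. \<Sum>e\<in>Em m. c e * e x) = (\<lambda>_. 0)"
      using z unfolding sum_fscale[OF finEm] by (simp add: zero_fun_def)
    have "ip (\<lambda>x. \<Sum>e\<in>Em m. c e * e x) e' = c e' * ip e' e'"
      by (rule ip_orth_sum[OF finEm _ _ e']) (use e(5,6) in \<open>auto simp: Em_def\<close>)
    then have "c e' * ip e' e' = 0" unfolding zz by simp
    then show "c e' = 0" using e(4)[of e'] e' by (simp add: Em_def)
  qed
  define P' where "P' = {m. 0 < m \<and> (\<exists>v'\<in>ES m. v' \<noteq> (\<lambda>_. 0))}"
  have P_sub: "P' \<subseteq> \<mu> ` E"
  proof
    fix m assume "m \<in> P'"
    then obtain v' where m: "0 < m" and v': "v' \<in> ES m" "v' \<noteq> (\<lambda>_. 0)" by (auto simp: P'_def)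
    have "Em m \<noteq> {}"
    proof
      assume "Em m = {}"
      then show False using expand[OF m v'(1)] v'(2) by simp
    qed
    then show "m \<in> \<mu> ` E" by (auto simp: Em_def)
  qed
  have P_eq: "P' = \<mu> ` E"
  proof (rule antisym[OF P_sub])
    show "\<mu> ` E \<subseteq> P'"
    proof
      fix m assume "m \<in> \<mu> ` E"
      then obtain e' where e': "e' \<in> E" "m = \<mu> e'" by auto
      then have "e' \<in> ES m" using Em_sub[of m] by (auto simp: Em_def)
      moreover have "e' \<noteq> (\<lambda>_. 0)" using e(4)[OF e'(1)] by auto
      ultimately show "m \<in> P'" using e(2)[OF e'(1)] e'(2) by (auto simp: P'_def)
    qed
  qed
  have finP: "finite P'" using finite_subset[OF P_sub] e(1) by simp
  have dim: "fun_space.dim (ES m) = card (Em m)" if "m \<in> P'" for m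
    by (rule fun_space.dim_unique[OF Em_sub span indep refl]) (use that in \<open>auto simp: P'_def\<close>)
  have "(\<Sum>m\<in>P'. fun_space.dim (ES m)) = (\<Sum>m\<in>P'. card (Em m))" by (rule sum.cong) (auto simp: dim)
  also have "\<dots> = card (\<Union>m\<in>P'. Em m)"
    by (rule card_UN_disjoint[symmetric]) (use finP finEm in \<open>auto simp: Em_def\<close>)
  also have "(\<Union>m\<in>P'. Em m) = E" unfolding P_eq by (auto simp: Em_def)
  finally have "(\<Sum>m\<in>P'. fun_space.dim (ES m)) = index" using E(3) by simp
  moreover have "\<forall>m\<in>P'. \<exists>B. finite B \<and> ES m \<subseteq> fun_space.span B"
    using finEm span by (auto simp: P'_def)
  ultimately show ?thesis unfolding has_morse_index_def Let_def ES_def[symmetric] P'_def[symmetric]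
    using finP by blast
qed

end

section \<open>The equilibrium as a point of its branch\<close>

theorem theorem4p3:
  fixes f f' f'' a a' c \<psi> :: "real \<Rightarrow> real" and m M \<nu> :: real and k :: nat
  assumes f_deriv: "\<And>u. (f has_real_derivative f' u) (at u)"
    and f'_deriv: "\<And>u. (f' has_real_derivative f'' u) (at u)"
    and f''_cont: "continuous_on UNIV f''"
    and f_0: "f 0 = 0"
    and f'_0: "f' 0 = 1"
    and f''_sign: "\<And>u. u \<noteq> 0 \<Longrightarrow> f'' u * u < 0"
    and f_limsup: "Limsup at_infinity (\<lambda>u. ereal (f u / u)) < 0"
    and m_M: "0 < m" "m \<le> M"
    and a_range: "\<And>r. 0 \<le> r \<Longrightarrow> a r \<in> {m..M}"
    and a_deriv: "\<And>r. 0 \<le> r \<Longrightarrow> (a has_real_derivative a' r) (at r within {0..})"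
    and a'_cont: "continuous_on {0..} a'"
    and \<nu>_pos: "0 < \<nu>"
    and equil: "equilibrium \<nu> f a \<psi>"
    and k_pos: "1 \<le> k"
    and zeros: "has_n_zeros (k - 1) \<psi>"
    and c_pos: "dx \<psi> 0 > 0 \<Longrightarrow> c = c_plus f k"
    and c_neg: "dx \<psi> 0 < 0 \<Longrightarrow> c = c_minus f k"
  shows "(a' ((L2norm (dx \<psi>))\<^sup>2) > \<nu> * deriv c ((L2norm (dx \<psi>))\<^sup>2) \<longrightarrow>
            hyperbolic \<nu> f f' a a' \<psi> \<and> morse_index_is \<nu> f f' a a' \<psi> (k - 1))
       \<and> (a' ((L2norm (dx \<psi>))\<^sup>2) < \<nu> * deriv c ((L2norm (dx \<psi>))\<^sup>2) \<longrightarrow>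
            hyperbolic \<nu> f f' a a' \<psi> \<and> morse_index_is \<nu> f f' a a' \<psi> k)"
proof -
  define r where "r = (L2norm (dx \<psi>))\<^sup>2"
  have ar: "0 < a r" using a_range[of r] m_M by (simp add: r_def)
  define lam where "lam = \<nu> / a r"
  have lam: "0 < lam" using \<nu>_pos ar by (simp add: lam_def)
  obtain bm bp where b: "bm < 0" "f bm = 0" "0 < bp" "f bp = 0"
    by (rule sublinear_zeros[OF f_deriv f_0 f'_0 f_limsup])
  interpret N: nonlinearity f f' f'' bm bp
    by unfold_locales (use f_deriv f'_deriv f''_cont f_0 f'_0 f''_sign b in auto)
  have "(\<lambda>u. \<nu> * f u / a r) = (\<lambda>u. lam * f u)" by (auto simp: lam_def)
  then have "dirichlet_solution (\<lambda>u. lam * f u) \<psi>" using equil by (simp add: equilibrium_def r_def)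
  then obtain \<psi>1 where \<psi>1: "has_C2_deriv \<psi> \<psi>1 (\<lambda>x. - (lam * f (\<psi> x)))" "\<psi> 0 = 0" "\<psi> pi = 0"
  proof -
    have "continuous_on UNIV (\<lambda>u. lam * f u)" by (intro continuous_intros N.f_cont)
    from dirichlet_solution_iff[OF this] that show ?thesis
      using \<open>dirichlet_solution (\<lambda>u. lam * f u) \<psi>\<close> by auto
  qed
  have dx0: "dx \<psi> 0 = \<psi>1 0" by (rule has_C2_deriv_dx(1)[OF \<psi>1(1)]) simp
  \<comment> \<open>With zero initial slope uniqueness gives \<psi> = 0 on [0, pi], which has
    infinitely many zeros. So one of the two cases for \<open>c\<close> occurs.\<close>
  have "\<psi>1 0 \<noteq> 0"
  proof
    assume z: "\<psi>1 0 = 0"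
    interpret branch f f' f'' bm bp k 1 by unfold_locales (use k_pos in auto)
    have "has_C2_deriv (\<lambda>_. 0) (\<lambda>_. 0) (\<lambda>x. - (lam * f 0))" by (auto simp: has_C2_deriv_def f_0)
    then have "\<psi> x = 0" if "x \<in> {0..pi}" for x
      using wave_unique[OF \<psi>1(1), of "\<lambda>_. 0" "\<lambda>_. 0" x] that z \<psi>1(2) by simp
    then have "{x \<in> {0<..<pi}. \<psi> x = 0} = {0<..<pi}" by auto
    then show False using zeros infinite_Ioo[of 0 pi] by (simp add: has_n_zeros_def)
  qed
  define s where "s = sgn (\<psi>1 0)"
  have s: "s = 1 \<or> s = -1" "0 < s * \<psi>1 0" using \<open>\<psi>1 0 \<noteq> 0\<close> by (auto simp: s_def sgn_if)
  have c_eq: "c = (\<lambda>r. 1 / lam_of f k s r)"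
  proof (cases "0 < \<psi>1 0")
    case True
    then show ?thesis using c_pos dx0 by (auto simp: s_def c_plus_def fun_eq_iff)
  next
    case False
    then have "\<psi>1 0 < 0" using \<open>\<psi>1 0 \<noteq> 0\<close> by simp
    then show ?thesis using c_neg dx0 by (auto simp: s_def c_minus_def fun_eq_iff)
  qed
  obtain \<rho> \<theta> where w: "0 < \<rho>" "\<rho> < N.pmax k s" "N.Theta k (s * \<rho>) = pi * sqrt lam"
    "N.phase (s * \<rho>) lam pi \<theta>" "\<theta> pi = real k * pi" "\<And>x. x \<in> {0..pi} \<Longrightarrow> \<psi> x = N.h (s * \<rho> * sin (\<theta> x))"
    using N.solution_is_wave[OF lam k_pos s(1) \<psi>1 zeros s(2)] by metis
  interpret Br: branch f f' f'' bm bp k s by unfold_locales (use k_pos s in auto)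
  interpret Li: linearized f f' f'' bm bp k s \<rho> lam \<theta> \<psi>
    by unfold_locales (use w lam in \<open>auto simp: Br.Th_def\<close>)
  have r_eq: "r = Br.Rf \<rho>" unfolding r_def Br.L2norm_dx[OF Li.wave(1)] by (rule Li.ip_\<psi>1)
  have Lam: "Br.Lam \<rho> = lam" using Li.Th_eq lam by (simp add: Br.Lam_def)
  \<comment> \<open>The reciprocal of - \<nu> c' at the energy of \<psi>, written in terms of the
    amplitude. The sign of 1 + \<kappa> a' then decides between the two cases.\<close>
  define \<kappa> where "\<kappa> = lam\<^sup>2 * Br.dRf \<rho> / (\<nu> * Br.dLam \<rho>)"
  have pos: "0 < Br.dRf \<rho>" "0 < Br.dLam \<rho>" using Br.dRf_pos Br.dLam_pos w(1,2) by auto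
  have \<kappa>: "0 < \<kappa>" using pos lam \<nu>_pos by (simp add: \<kappa>_def)
  have dc: "\<nu> * deriv c r = - (1 / \<kappa>)"
    unfolding c_eq r_eq Br.deriv_c[OF w(1,2)] Lam \<kappa>_def using pos lam \<nu>_pos by (simp add: field_simps)
  \<comment> \<open>The coefficient of the nonlocal term. With \<nu> = lam a and the value of
    \<open>s0\<close> the product \<beta> s0 is \<kappa> a', so the nondegeneracy of the
    perturbation is exactly that a' differs from \<nu> c'.\<close>
  define \<beta> where "\<beta> = 2 * \<nu>\<^sup>2 * a' r / (a r) ^ 3"
  have D: "1 + \<beta> * Li.s0 = 1 + \<kappa> * a' r"
  proof -
    have "\<nu> = lam * a r" using ar by (simp add: lam_def)
    then show ?thesis unfolding \<beta>_def \<kappa>_def Li.s0_eq using pos lam ar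
      by (simp add: field_simps power2_eq_square power3_eq_cube)
  qed
  have main: "hyperbolic \<nu> f f' a a' \<psi> \<and> morse_index_is \<nu> f f' a a' \<psi> (if 0 < 1 + \<kappa> * a' r then k - 1 else k)"
    if nz: "1 + \<kappa> * a' r \<noteq> 0"
  proof -
    interpret Pe: perturbed f f' f'' bm bp k s \<rho> lam \<theta> \<psi> \<beta> by unfold_locales (use nz D in simp)
    have "linearization \<nu> f f' a a' \<psi> = Pe.Lop"
    proof (intro ext)
      fix u x
      show "linearization \<nu> f f' a a' \<psi> u x = Pe.Lop u x"
        unfolding Pe.Lop_def Li.g_def Li.q_def linearization_def Let_def r_def[symmetric]
        by (simp add: \<beta>_def lam_def)
    qed
    moreover have "Pe.index = (if 0 < 1 + \<kappa> * a' r then k - 1 else k)" by (simp add: Pe.index_def Pe.D_def D)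
    ultimately show ?thesis
      using Pe.zero_not_in_spectrum Pe.morse_index_Lop by (simp add: hyperbolic_def morse_index_is_def)
  qed
  show ?thesis unfolding r_def[symmetric] dc
  proof (intro conjI impI)
    assume "- (1 / \<kappa>) < a' r"
    then have "0 < 1 + \<kappa> * a' r" using \<kappa> by (simp add: field_simps)
    then show "hyperbolic \<nu> f f' a a' \<psi>" "morse_index_is \<nu> f f' a a' \<psi> (k - 1)" using main by auto
  next
    assume "a' r < - (1 / \<kappa>)"
    then have "1 + \<kappa> * a' r < 0" using \<kappa> by (simp add: field_simps)
    then show "hyperbolic \<nu> f f' a a' \<psi>" "morse_index_is \<nu> f f' a a' \<psi> k" using main by auto
  qed
qed

end
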